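(* Let $(H,R)$ be a finite dimensional semisimple and cosemisimple quasi-triangular Hopf algebra over a field $k$, let $\mathcal C=\mathrm{Vec}_k$, and let $D$ be a minimal $H$-adjoint-stable subcoalgebra of $H_R$. If $W$ is a finite dimensional nonzero left $D$-comodule, then $A=\operatorname{Hom}_H^D(H\otimes W,H\otimes W)$ is a semisimple $k$-algebra, and the functors $$F=\operatorname{Hom}_H^D(H\otimes W,\bullet):{}_H^D\mathcal M\to\mathcal M_A,\qquad G=\bullet\otimes_A(H\otimes W):\mathcal M_A\to{}_H^D\mathcal M$$ establish an equivalence of $\mathcal C$-module categories between ${}_H^D\mathcal M$ and $\mathcal M_A$.
   Context: $H$ has coproduct $\Delta(h)=\sum h_{(1)}\otimes h_{(2)}$, counit $\varepsilon$ and antipode $S$. Quasi-triangular: $R=\sum R^1\otimes R^2\in H\otimes H$ is invertible with $\sum R^1h_{(1)}\otimes R^2h_{(2)}=\sum h_{(2)}R^1\otimes h_{(1)}R^2$ for all $h\in H$, $(\Delta\otimes id)(R)=R^{13}R^{23}$, $(id\otimes\Delta)(R)=R^{13}R^{12}$. Left adjoint action: $h\cdot_{ad}a=\sum h_{(1)}aS(h_{(2)})$. Transmuted braided group $H_R$: the vector space $H$ with the action $\cdot_{ad}$ and the (coassociative) coproduct $\Delta_R(h)=\sum h_{(1)}S(R^2)\otimes R^1\cdot_{ad}h_{(2)}$ and counit $\varepsilon$. A minimal $H$-adjoint-stable subcoalgebra is a nonzero subcoalgebra of $(H_R,\Delta_R)$ stable under $\cdot_{ad}$ and minimal with these properties.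 ${}_H^D\mathcal M$ is the category of left $H$-modules $V$ with a left $D$-comodule structure $\rho_R(v)=\sum v^{\langle-1\rangle}\otimes v^{\langle0\rangle}$ ($D$ a coalgebra via $\Delta_R$) such that $\rho_R(hv)=\sum h_{(1)}\cdot_{ad}v^{\langle-1\rangle}\otimes h_{(2)}v^{\langle0\rangle}$; $\operatorname{Hom}_H^D$ denotes the $H$-linear $D$-colinear maps, which are its morphisms. $\mathrm{Vec}_k$ is the category of finite dimensional $k$-vector spaces, acting by $X\otimes M$ with all structure on the tensorand $M$. In this module-category setting objects are finite dimensional. $\mathcal M_A$ is the category of right $A$-modules. For a left $D$-comodule $W$, $H\otimes W\in{}_H^D\mathcal M$ with $H$ acting by left multiplication on $H$ and coaction $\rho_R(h\otimes w)=\sum h_{(1)}\cdot_{ad}w^{\langle-1\rangle}\otimes h_{(2)}\otimes w^{\langle0\rangle}$. $A$ is an algebra under composition, acts on $\operatorname{Hom}_H^D(H\otimes W,V)$ on the right by composition and on $H\otimes W$ on the left by evaluation; $U\otimes_A(H\otimes W)$ has the $H$-action and $D$-coaction induced from $H\otimes W$. *)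

theory Defs
  imports Complex_Main "HOL-Library.Nat_Bijection" "HOL-Library.Function_Algebras"
begin

section \<open>Vector spaces and tensor products\<close>

text \<open>
  Every finite dimensional vector space over \<open>k\<close> is isomorphic to a subspace of the space of all
  sequences in \<open>k\<close>.  The finite dimensional subspaces of this one ambient space therefore serve as
  the objects of all categories below, so that each category has a fixed type of objects which is
  closed under tensor products, quotients and spaces of linear maps.
\<close>

type_synonym 'k univ = "nat \<Rightarrow> 'k"

definition uscale :: "'k::field \<Rightarrow> 'k univ \<Rightarrow> 'k univ"  (infixr "*\<^sub>u" 75)
  where "c *\<^sub>u x = (\<lambda>i. c * x i)"

definition fscale :: "'k::field \<Rightarrow> ('a \<Rightarrow> 'k univ) \<Rightarrow> 'a \<Rightarrow> 'k univ"
  where "fscale c f = (\<lambda>x. c *\<^sub>u f x)"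

lemma vector_space_uscale: "vector_space uscale"
  by unfold_locales (auto simp: uscale_def fun_eq_iff algebra_simps)

lemma vector_space_fscale: "vector_space fscale"
  by unfold_locales (auto simp: fscale_def uscale_def fun_eq_iff algebra_simps)

definition fin_dim :: "('k::field \<Rightarrow> 'v::ab_group_add \<Rightarrow> 'v) \<Rightarrow> 'v set \<Rightarrow> bool"
  where "fin_dim s X \<longleftrightarrow> (\<exists>B. finite B \<and> X = module.span s B)"

definition lin_on ::
  "('k::field \<Rightarrow> 'v::ab_group_add \<Rightarrow> 'v) \<Rightarrow> ('k \<Rightarrow> 'w::ab_group_add \<Rightarrow> 'w) \<Rightarrow> 'v set \<Rightarrow> ('v \<Rightarrow> 'w) \<Rightarrow> bool"
  where "lin_on s s' X f \<longleftrightarrow>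
    (\<forall>x\<in>X. \<forall>y\<in>X. f (x + y) = f x + f y) \<and> (\<forall>c. \<forall>x\<in>X. f (s c x) = s' c (f x))"

text \<open>
  A linear map on \<open>X\<close> with kernel \<open>N\<close>; its image is a copy of the quotient \<open>X/N\<close> inside the ambient
  space.  It exists whenever \<open>X\<close> is finite dimensional and \<open>N\<close> is a subspace of \<open>X\<close>.
\<close>

definition quot_map ::
  "('k::field \<Rightarrow> 'v::ab_group_add \<Rightarrow> 'v) \<Rightarrow> 'v set \<Rightarrow> 'v set \<Rightarrow> 'v \<Rightarrow> 'k univ"
  where "quot_map s X N = (SOME q. lin_on s uscale X q \<and> {x\<in>X. q x = 0} = N)"

abbreviation embed :: "('k::field \<Rightarrow> 'v::ab_group_add \<Rightarrow> 'v) \<Rightarrow> 'v set \<Rightarrow> 'v \<Rightarrow> 'k univ"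
  where "embed s X \<equiv> quot_map s X {0}"

text \<open>
  The Kronecker product.  For subspaces \<open>X\<close> and \<open>Y\<close> of the ambient space, the canonical map
  from the tensor product of \<open>X\<close> and \<open>Y\<close> onto the span of all \<open>x \<otimes> y\<close> is an isomorphism
  (see \<open>kron_relation\<close> below), so this span is the tensor product.
\<close>

definition kron :: "'k::field univ \<Rightarrow> 'k univ \<Rightarrow> 'k univ"  (infixr "\<otimes>" 70)
  where "x \<otimes> y = (\<lambda>n. x (fst (prod_decode n)) * y (snd (prod_decode n)))"

text \<open>
  In the following, \<open>\<tau>\<close> is a pure tensor map \<open>(a, b) \<mapsto> \<iota> a \<otimes> \<kappa> b\<close> with injective linear
  \<open>\<iota>\<close> on \<open>A\<close> and \<open>\<kappa>\<close> on \<open>B\<close>.  The value of \<open>sweedler \<tau> A B t f\<close> is the sum of the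
  \<open>f a b\<close> over a representation of \<open>t\<close> as a sum of pure tensors; for bilinear \<open>f\<close> it does not depend on
  the representation, and it then renders Sweedler's sum notation.
\<close>

definition tensor_space ::
  "('a \<Rightarrow> 'b \<Rightarrow> 'k::field univ) \<Rightarrow> 'a set \<Rightarrow> 'b set \<Rightarrow> 'k univ set"
  where "tensor_space \<tau> A B = module.span uscale {\<tau> a b |a b. a \<in> A \<and> b \<in> B}"

definition sweedler ::
  "('a \<Rightarrow> 'b \<Rightarrow> 'k::field univ) \<Rightarrow> 'a set \<Rightarrow> 'b set \<Rightarrow> 'k univ \<Rightarrow> ('a \<Rightarrow> 'b \<Rightarrow> 'c::comm_monoid_add) \<Rightarrow> 'c"
  where "sweedler \<tau> A B t f =
    (\<Sum>(a, b) \<leftarrow> (SOME xs. set xs \<subseteq> A \<times> B \<and> t = (\<Sum>(a, b) \<leftarrow> xs. \<tau> a b)). f a b)"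

text \<open>The linear map on the tensor product induced by \<open>f\<close>, extended by zero.\<close>

definition tensor_lift ::
  "('a \<Rightarrow> 'b \<Rightarrow> 'k::field univ) \<Rightarrow> 'a set \<Rightarrow> 'b set \<Rightarrow> ('a \<Rightarrow> 'b \<Rightarrow> 'c::comm_monoid_add) \<Rightarrow> 'k univ \<Rightarrow> 'c"
  where "tensor_lift \<tau> A B f t = (if t \<in> tensor_space \<tau> A B then sweedler \<tau> A B t f else 0)"

text \<open>
  A linear relation between Kronecker products holds under every bilinear map; hence \<open>sweedler\<close> is
  independent of the representation, and \<open>tensor_space\<close> has the universal property of the tensor product.
\<close>

lemma sum_list_fun: "(\<Sum>x\<leftarrow>xs. g x) n = (\<Sum>x\<leftarrow>xs. g x n)"
  by (induction xs) auto

lemma lin_on_sum_list: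
  assumes "vector_space s" "module.subspace s A" "lin_on s s' A f" "vector_space s'"
    and "\<forall>x\<in>set xs. g x \<in> A"
  shows "(\<Sum>x\<leftarrow>xs. g x) \<in> A \<and> f (\<Sum>x\<leftarrow>xs. g x) = (\<Sum>x\<leftarrow>xs. f (g x))"
  using assms(5)
proof (induction xs)
  case Nil
  interpret v: vector_space s by fact
  interpret w: vector_space s' by fact
  have z: "0 \<in> A" using assms(2) by (rule v.subspace_0)
  then have "f (s 0 0) = s' 0 (f 0)" using assms(3) unfolding lin_on_def by blast
  with z show ?case by simp
next
  case (Cons x xs)
  interpret v: vector_space s by fact
  show ?case using Cons assms(2,3) by (auto simp: lin_on_def v.subspace_add)
qed

lemma kron_relation:
  assumes s: "vector_space s" "module.subspace s A" "lin_on s uscale A \<iota>" "inj_on \<iota> A"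
    and s': "vector_space s'" "module.subspace s' B" "lin_on s' uscale B \<kappa>" "inj_on \<kappa> B"
    and s3: "vector_space s3"
    and f1: "\<And>b. b \<in> B \<Longrightarrow> lin_on s s3 A (\<lambda>a. f a b)"
    and f2: "\<And>a. a \<in> A \<Longrightarrow> lin_on s' s3 B (f a)"
    and xs: "set xs \<subseteq> A \<times> B" and rel: "(\<Sum>(a, b)\<leftarrow>xs. \<iota> a \<otimes> \<kappa> b) = 0"
  shows "(\<Sum>(a, b)\<leftarrow>xs. f a b) = 0"
  using xs rel
proof (induction "length xs" arbitrary: xs)
  case 0
  then show ?case by simp
next
  case (Suc n)
  interpret v: vector_space s by fact
  interpret w: vector_space s' by fact
  interpret u: vector_space s3 by fact
  interpret k: vector_space uscale by (rule vector_space_uscale)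
  obtain a b ys where xs: "xs = (a, b) # ys" using Suc.hyps(2) by (cases xs) auto
  have n: "n = length ys" using Suc.hyps(2) xs by simp
  have a: "a \<in> A" and b: "b \<in> B" and ys: "set ys \<subseteq> A \<times> B" using Suc.prems(1) xs by auto
  have \<kappa>l: "\<kappa> (s' c x) = c *\<^sub>u \<kappa> x" "\<kappa> (x + y) = \<kappa> x + \<kappa> y" if "x \<in> B" "y \<in> B" for c x y
    using s'(3) that by (auto simp: lin_on_def)
  have rel: "\<iota> a \<otimes> \<kappa> b + (\<Sum>(a, b)\<leftarrow>ys. \<iota> a \<otimes> \<kappa> b) = 0" using Suc.prems(2) xs by simp
  show ?case
  proof (cases "\<kappa> b = 0")
    case True
    have "\<kappa> 0 = 0" using lin_on_sum_list[OF s'(1-3) vector_space_uscale, of "[]" "\<lambda>x. x"] by simp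
    then have b0: "b = 0" using True s'(4) b w.subspace_0[OF s'(2)] by (metis inj_on_def)
    have "f a 0 = 0" using lin_on_sum_list[OF s'(1,2) f2[OF a] s3, of "[]" "\<lambda>x. x"] by simp
    moreover have "(\<Sum>(a, b)\<leftarrow>ys. \<iota> a \<otimes> \<kappa> b) = 0"
      using rel True by (simp add: kron_def fun_eq_iff)
    ultimately show ?thesis using Suc.hyps(1)[OF n ys] xs b0 by simp
  next
    case False
    then obtain m where m: "\<kappa> b m \<noteq> 0" by (auto simp: fun_eq_iff)
    define c where "c y = \<kappa> y m / \<kappa> b m" for y
    have row: "\<iota> a l * \<kappa> b m + (\<Sum>(x, y)\<leftarrow>ys. \<iota> x l * \<kappa> y m) = 0" for l
    proof -
      have "(\<iota> a \<otimes> \<kappa> b + (\<Sum>(a, b)\<leftarrow>ys. \<iota> a \<otimes> \<kappa> b)) (prod_encode (l, m)) = 0" using rel by simp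
      then show ?thesis by (simp add: sum_list_fun kron_def case_prod_unfold)
    qed
    let ?A = "\<lambda>p. s (- c (snd p)) (fst p)"
    have mem: "\<forall>p\<in>set ys. ?A p \<in> A" using ys by (auto intro!: v.subspace_scale[OF s(2)] simp del: v.scale_minus_left)
    have \<iota>A: "\<iota> (?A p) = (- c (snd p)) *\<^sub>u \<iota> (fst p)" if "p \<in> set ys" for p
      using s(3) ys that by (auto simp: lin_on_def simp del: v.scale_minus_left)
    have "\<iota> (\<Sum>p\<leftarrow>ys. ?A p) = (\<Sum>p\<leftarrow>ys. (- c (snd p)) *\<^sub>u \<iota> (fst p))"
      using lin_on_sum_list[OF s(1-3) vector_space_uscale mem] \<iota>A by (simp cong: map_cong)
    also have "\<dots> = \<iota> a"
    proof
      fix l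
      have "(\<Sum>p\<leftarrow>ys. (- c (snd p)) *\<^sub>u \<iota> (fst p)) l = - (\<Sum>(x, y)\<leftarrow>ys. \<iota> x l * \<kappa> y m) / \<kappa> b m"
        unfolding sum_list_fun
        by (induction ys) (auto simp: uscale_def c_def field_simps m)
      also have "\<dots> = \<iota> a l" using row[of l] m by (simp add: field_simps add_eq_0_iff)
      finally show "(\<Sum>p\<leftarrow>ys. (- c (snd p)) *\<^sub>u \<iota> (fst p)) l = \<iota> a l" .
    qed
    finally have aeq: "a = (\<Sum>p\<leftarrow>ys. ?A p)"
      using s(4) a lin_on_sum_list[OF s(1-3) vector_space_uscale mem] by (metis inj_on_def)
    define zs where "zs = map (\<lambda>p. (fst p, snd p + s' (- c (snd p)) b)) ys"
    have zs: "set zs \<subseteq> A \<times> B" using ys b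
      by (auto simp: zs_def intro!: w.subspace_add[OF s'(2)] w.subspace_scale[OF s'(2)] simp del: w.scale_minus_left)
    have expand: "(\<Sum>(x, y)\<leftarrow>zs. g x y) = (\<Sum>(x, y)\<leftarrow>ys. g x y) + g a b"
      if add: "\<And>x y c. x \<in> A \<Longrightarrow> y \<in> B \<Longrightarrow> g x (y + s' c b) = g x y + t c (g x b)"
        and sc: "\<And>x c. x \<in> A \<Longrightarrow> g (s c x) b = t c (g x b)"
        and lin: "lin_on s t A (\<lambda>x. g x b)" and t: "vector_space t"
      for g :: "_ \<Rightarrow> _ \<Rightarrow> 'x::ab_group_add" and t
    proof -
      have "g a b = (\<Sum>p\<leftarrow>ys. g (?A p) b)"
        using lin_on_sum_list[OF s(1,2) lin t mem] aeq by simp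
      also have "\<dots> = (\<Sum>p\<leftarrow>ys. t (- c (snd p)) (g (fst p) b))"
        using ys by (intro arg_cong[where f = sum_list] map_cong refl sc) auto
      finally have "g a b = (\<Sum>p\<leftarrow>ys. t (- c (snd p)) (g (fst p) b))" .
      moreover have "(\<Sum>(x, y)\<leftarrow>zs. g x y) =
          (\<Sum>p\<leftarrow>ys. g (fst p) (snd p) + t (- c (snd p)) (g (fst p) b))"
        unfolding zs_def map_map using ys
        by (intro arg_cong[where f = sum_list] map_cong refl) (auto simp del: w.scale_minus_left intro!: add)
      ultimately show ?thesis by (simp add: sum_list_addf case_prod_unfold)
    qed
    have "(\<Sum>(x, y)\<leftarrow>zs. \<iota> x \<otimes> \<kappa> y) = (\<Sum>(x, y)\<leftarrow>ys. \<iota> x \<otimes> \<kappa> y) + \<iota> a \<otimes> \<kappa> b"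
      using s(3) s'(3) b
      by (intro expand[OF _ _ _ vector_space_uscale])
        (auto simp: lin_on_def kron_def uscale_def fun_eq_iff algebra_simps w.subspace_scale[OF s'(2)])
    then have "(\<Sum>(x, y)\<leftarrow>zs. \<iota> x \<otimes> \<kappa> y) = 0" using rel by (simp add: add.commute)
    then have "(\<Sum>(x, y)\<leftarrow>zs. f x y) = 0" using Suc.hyps(1)[of zs] n zs by (simp add: zs_def)
    moreover have "(\<Sum>(x, y)\<leftarrow>zs. f x y) = (\<Sum>(x, y)\<leftarrow>ys. f x y) + f a b"
      using f1[OF b] f2 b
      by (intro expand[OF _ _ _ s3]) (auto simp: lin_on_def w.subspace_scale[OF s'(2)])
    ultimately show ?thesis using xs by (simp add: add.commute)
  qed
qed

lemma sweedler_eq: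
  assumes s: "vector_space s" "module.subspace s A" "lin_on s uscale A \<iota>" "inj_on \<iota> A"
    and s': "vector_space s'" "module.subspace s' B" "lin_on s' uscale B \<kappa>" "inj_on \<kappa> B"
    and s3: "vector_space s3"
    and f1: "\<And>b. b \<in> B \<Longrightarrow> lin_on s s3 A (\<lambda>a. f a b)"
    and f2: "\<And>a. a \<in> A \<Longrightarrow> lin_on s' s3 B (f a)"
    and xs: "set xs \<subseteq> A \<times> B"
  shows "sweedler (\<lambda>a b. \<iota> a \<otimes> \<kappa> b) A B (\<Sum>(a, b)\<leftarrow>xs. \<iota> a \<otimes> \<kappa> b) f = (\<Sum>(a, b)\<leftarrow>xs. f a b)"
proof -
  interpret v: vector_space s by fact
  interpret u: vector_space s3 by fact
  let ?P = "\<lambda>ys. set ys \<subseteq> A \<times> B \<and>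
    (\<Sum>(a, b)\<leftarrow>xs. \<iota> a \<otimes> \<kappa> b) = (\<Sum>(a, b)\<leftarrow>ys. \<iota> a \<otimes> \<kappa> b)"
  define ys where "ys = (SOME ys. ?P ys)"
  have ys: "?P ys" unfolding ys_def by (rule someI[of ?P xs]) (use xs in simp)
  define zs where "zs = map (\<lambda>p. (s (- 1) (fst p), snd p)) ys"
  have zs: "set zs \<subseteq> A \<times> B"
    using ys by (auto simp: zs_def intro!: v.subspace_neg[OF s(2)])
  have neg: "(\<Sum>(x, y)\<leftarrow>zs. g x y) = - (\<Sum>(x, y)\<leftarrow>ys. g x y)"
    if "\<And>x y. x \<in> A \<Longrightarrow> y \<in> B \<Longrightarrow> g (s (- 1) x) y = - g x y" for g :: "_ \<Rightarrow> _ \<Rightarrow> 'x::ab_group_add"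
  proof -
    have "set ys \<subseteq> A \<times> B" using ys by simp
    then show ?thesis unfolding zs_def by (induction ys) (auto simp del: v.scale_minus_left simp: that)
  qed
  have "(\<Sum>(a, b)\<leftarrow>xs @ zs. \<iota> a \<otimes> \<kappa> b) = 0"
    using s(3) neg[of "\<lambda>a b. \<iota> a \<otimes> \<kappa> b"] ys
    by (auto simp: lin_on_def kron_def uscale_def fun_eq_iff simp del: v.scale_minus_left)
  then have "(\<Sum>(a, b)\<leftarrow>xs @ zs. f a b) = 0"
    using kron_relation[OF s s' s3 f1 f2, of "xs @ zs"] xs zs by simp
  moreover have "(\<Sum>(a, b)\<leftarrow>zs. f a b) = - (\<Sum>(a, b)\<leftarrow>ys. f a b)"
    by (intro neg) (use f1 in \<open>auto simp: lin_on_def simp del: v.scale_minus_left\<close>)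
  ultimately show ?thesis unfolding sweedler_def ys_def by simp
qed

section \<open>Algebras and Hopf algebras\<close>

record ('k, 'a) alg =
  acarrier :: "'a set"
  ascale :: "'k \<Rightarrow> 'a \<Rightarrow> 'a"
  amult :: "'a \<Rightarrow> 'a \<Rightarrow> 'a"
  aone :: 'a

definition k_algebra :: "('k::field, 'a::ab_group_add) alg \<Rightarrow> bool"
  where "k_algebra A \<longleftrightarrow>
    vector_space (ascale A) \<and> module.subspace (ascale A) (acarrier A) \<and> aone A \<in> acarrier A \<and>
    (\<forall>a\<in>acarrier A. \<forall>b\<in>acarrier A. amult A a b \<in> acarrier A) \<and>
    (\<forall>a\<in>acarrier A. lin_on (ascale A) (ascale A) (acarrier A) (amult A a)) \<and>
    (\<forall>b\<in>acarrier A. lin_on (ascale A) (ascale A) (acarrier A) (\<lambda>a. amult A a b)) \<and>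
    (\<forall>a\<in>acarrier A. \<forall>b\<in>acarrier A. \<forall>c\<in>acarrier A.
       amult A (amult A a b) c = amult A a (amult A b c)) \<and>
    (\<forall>a\<in>acarrier A. amult A (aone A) a = a \<and> amult A a (aone A) = a)"

definition left_ideal :: "('k::field, 'a::ab_group_add) alg \<Rightarrow> 'a set \<Rightarrow> bool"
  where "left_ideal A I \<longleftrightarrow> I \<subseteq> acarrier A \<and> module.subspace (ascale A) I \<and>
    (\<forall>a\<in>acarrier A. \<forall>x\<in>I. amult A a x \<in> I)"

text \<open>The left regular module is semisimple: every submodule is a direct summand.\<close>

definition semisimple_algebra :: "('k::field, 'a::ab_group_add) alg \<Rightarrow> bool"
  where "semisimple_algebra A \<longleftrightarrow> k_algebra A \<and>
    (\<forall>I. left_ideal A I \<longrightarrow>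
      (\<exists>J. left_ideal A J \<and> I \<inter> J = {0} \<and> acarrier A = {x + y |x y. x \<in> I \<and> y \<in> J}))"

record ('k, 'h) hopf =
  hscale :: "'k \<Rightarrow> 'h \<Rightarrow> 'h"
  comult :: "'h \<Rightarrow> 'k univ"
  counit :: "'h \<Rightarrow> 'k"
  antipode :: "'h \<Rightarrow> 'h"

definition hopf_alg :: "('k::field, 'h::ring_1) hopf \<Rightarrow> ('k, 'h) alg"
  where "hopf_alg H = \<lparr>acarrier = UNIV, ascale = hscale H, amult = (*), aone = 1\<rparr>"

abbreviation hemb :: "('k::field, 'h::ring_1) hopf \<Rightarrow> 'h \<Rightarrow> 'k univ"
  where "hemb H \<equiv> embed (hscale H) UNIV"

abbreviation htens :: "('k::field, 'h::ring_1) hopf \<Rightarrow> 'h \<Rightarrow> 'h \<Rightarrow> 'k univ"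
  where "htens H a b \<equiv> hemb H a \<otimes> hemb H b"

abbreviation htens3 :: "('k::field, 'h::ring_1) hopf \<Rightarrow> 'h \<Rightarrow> 'h \<Rightarrow> 'h \<Rightarrow> 'k univ"
  where "htens3 H a b c \<equiv> hemb H a \<otimes> hemb H b \<otimes> hemb H c"

abbreviation hsw ::
  "('k::field, 'h::ring_1) hopf \<Rightarrow> 'k univ \<Rightarrow> ('h \<Rightarrow> 'h \<Rightarrow> 'c::comm_monoid_add) \<Rightarrow> 'c"
  where "hsw H \<equiv> sweedler (htens H) UNIV UNIV"

definition fin_dim_hopf_algebra :: "('k::field, 'h::ring_1) hopf \<Rightarrow> bool"
  where "fin_dim_hopf_algebra H \<longleftrightarrow>
    k_algebra (hopf_alg H) \<and> fin_dim (hscale H) UNIV \<and>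
    lin_on (hscale H) uscale UNIV (comult H) \<and>
    (\<forall>h. comult H h \<in> tensor_space (htens H) UNIV UNIV) \<and>
    lin_on (hscale H) (*) UNIV (counit H) \<and>
    lin_on (hscale H) (hscale H) UNIV (antipode H) \<and>
    (\<forall>h. hsw H (comult H h) (\<lambda>x y. hsw H (comult H x) (\<lambda>x1 x2. htens3 H x1 x2 y)) =
         hsw H (comult H h) (\<lambda>x y. hsw H (comult H y) (\<lambda>y1 y2. htens3 H x y1 y2))) \<and>
    (\<forall>h. hsw H (comult H h) (\<lambda>x y. hscale H (counit H x) y) = h \<and>
         hsw H (comult H h) (\<lambda>x y. hscale H (counit H y) x) = h) \<and>
    comult H 1 = htens H 1 1 \<and> counit H 1 = 1 \<and>
    (\<forall>g h. comult H (g * h) =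
       hsw H (comult H g) (\<lambda>g1 g2. hsw H (comult H h) (\<lambda>h1 h2. htens H (g1 * h1) (g2 * h2)))) \<and>
    (\<forall>g h. counit H (g * h) = counit H g * counit H h) \<and>
    (\<forall>h. hsw H (comult H h) (\<lambda>x y. antipode H x * y) = hscale H (counit H h) 1 \<and>
         hsw H (comult H h) (\<lambda>x y. x * antipode H y) = hscale H (counit H h) 1)"

definition htens_mult ::
  "('k::field, 'h::ring_1) hopf \<Rightarrow> 'k univ \<Rightarrow> 'k univ \<Rightarrow> 'k univ"
  where "htens_mult H t u = hsw H t (\<lambda>a b. hsw H u (\<lambda>c d. htens H (a * c) (b * d)))"

definition quasitriangular :: "('k::field, 'h::ring_1) hopf \<Rightarrow> 'k univ \<Rightarrow> bool"
  where "quasitriangular H R \<longleftrightarrow>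
    R \<in> tensor_space (htens H) UNIV UNIV \<and>
    (\<exists>R'\<in>tensor_space (htens H) UNIV UNIV.
       htens_mult H R R' = htens H 1 1 \<and> htens_mult H R' R = htens H 1 1) \<and>
    (\<forall>h. hsw H R (\<lambda>r1 r2. hsw H (comult H h) (\<lambda>h1 h2. htens H (r1 * h1) (r2 * h2))) =
         hsw H R (\<lambda>r1 r2. hsw H (comult H h) (\<lambda>h1 h2. htens H (h2 * r1) (h1 * r2)))) \<and>
    hsw H R (\<lambda>r1 r2. hsw H (comult H r1) (\<lambda>a b. htens3 H a b r2)) =
      hsw H R (\<lambda>r1 r2. hsw H R (\<lambda>q1 q2. htens3 H r1 q1 (r2 * q2))) \<and>
    hsw H R (\<lambda>r1 r2. hsw H (comult H r2) (\<lambda>a b. htens3 H r1 a b)) =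
      hsw H R (\<lambda>r1 r2. hsw H R (\<lambda>q1 q2. htens3 H (r1 * q1) q2 r2))"

text \<open>Subcoalgebras of the space of \<open>H\<close> with respect to a coproduct \<open>\<delta>\<close>.\<close>

definition subcoalgebra ::
  "('k::field, 'h::ring_1) hopf \<Rightarrow> ('h \<Rightarrow> 'k univ) \<Rightarrow> 'h set \<Rightarrow> bool"
  where "subcoalgebra H \<delta> C \<longleftrightarrow>
    module.subspace (hscale H) C \<and> (\<forall>c\<in>C. \<delta> c \<in> tensor_space (htens H) C C)"

definition simple_subcoalgebra ::
  "('k::field, 'h::ring_1) hopf \<Rightarrow> ('h \<Rightarrow> 'k univ) \<Rightarrow> 'h set \<Rightarrow> bool"
  where "simple_subcoalgebra H \<delta> C \<longleftrightarrow> subcoalgebra H \<delta> C \<and> C \<noteq> {0} \<and>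
    (\<forall>C'. subcoalgebra H \<delta> C' \<and> C' \<noteq> {0} \<and> C' \<subseteq> C \<longrightarrow> C' = C)"

definition cosemisimple :: "('k::field, 'h::ring_1) hopf \<Rightarrow> bool"
  where "cosemisimple H \<longleftrightarrow>
    module.span (hscale H) (\<Union>{C. simple_subcoalgebra H (comult H) C}) = UNIV"

definition ad :: "('k::field, 'h::ring_1) hopf \<Rightarrow> 'h \<Rightarrow> 'h \<Rightarrow> 'h"
  where "ad H h a = hsw H (comult H h) (\<lambda>h1 h2. h1 * a * antipode H h2)"

definition comult_R :: "('k::field, 'h::ring_1) hopf \<Rightarrow> 'k univ \<Rightarrow> 'h \<Rightarrow> 'k univ"
  where "comult_R H R h = hsw H (comult H h) (\<lambda>h1 h2.
    hsw H R (\<lambda>r1 r2. htens H (h1 * antipode H r2) (ad H r1 h2)))"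

definition adjoint_stable_subcoalgebra ::
  "('k::field, 'h::ring_1) hopf \<Rightarrow> 'k univ \<Rightarrow> 'h set \<Rightarrow> bool"
  where "adjoint_stable_subcoalgebra H R D \<longleftrightarrow>
    subcoalgebra H (comult_R H R) D \<and> D \<noteq> {0} \<and> (\<forall>h. \<forall>d\<in>D. ad H h d \<in> D)"

definition minimal_adjoint_stable_subcoalgebra ::
  "('k::field, 'h::ring_1) hopf \<Rightarrow> 'k univ \<Rightarrow> 'h set \<Rightarrow> bool"
  where "minimal_adjoint_stable_subcoalgebra H R D \<longleftrightarrow>
    adjoint_stable_subcoalgebra H R D \<and>
    (\<forall>D'. adjoint_stable_subcoalgebra H R D' \<and> D' \<subseteq> D \<longrightarrow> D' = D)"

section \<open>Module categories\<close>

text \<open>\<open>Comp C g f\<close> is \<open>g\<close> after \<open>f\<close>.\<close>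

record ('o, 'm) cat =
  Obj :: "'o set"
  Arr :: "'m set"
  Dom :: "'m \<Rightarrow> 'o"
  Cod :: "'m \<Rightarrow> 'o"
  Id :: "'o \<Rightarrow> 'm"
  Comp :: "'m \<Rightarrow> 'm \<Rightarrow> 'm"

definition homset :: "('o, 'm, 'z) cat_scheme \<Rightarrow> 'o \<Rightarrow> 'o \<Rightarrow> 'm set"
  where "homset C x y = {f \<in> Arr C. Dom C f = x \<and> Cod C f = y}"

locale category =
  fixes C :: "('o, 'm, 'z) cat_scheme"
  assumes dom_cod: "f \<in> Arr C \<Longrightarrow> Dom C f \<in> Obj C \<and> Cod C f \<in> Obj C"
    and id_arr: "x \<in> Obj C \<Longrightarrow> Id C x \<in> homset C x x"
    and comp_arr: "\<lbrakk>f \<in> homset C x y; g \<in> homset C y z\<rbrakk> \<Longrightarrow> Comp C g f \<in> homset C x z"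
    and comp_id: "f \<in> homset C x y \<Longrightarrow> Comp C f (Id C x) = f \<and> Comp C (Id C y) f = f"
    and comp_assoc: "\<lbrakk>f \<in> homset C w x; g \<in> homset C x y; h \<in> homset C y z\<rbrakk> \<Longrightarrow>
      Comp C h (Comp C g f) = Comp C (Comp C h g) f"

definition iso_arr :: "('o, 'm, 'z) cat_scheme \<Rightarrow> 'o \<Rightarrow> 'o \<Rightarrow> 'm \<Rightarrow> bool"
  where "iso_arr C x y f \<longleftrightarrow> f \<in> homset C x y \<and>
    (\<exists>g\<in>homset C y x. Comp C g f = Id C x \<and> Comp C f g = Id C y)"

record ('o, 'm, 'p, 'n) ftor =
  fobj :: "'o \<Rightarrow> 'p"
  farr :: "'m \<Rightarrow> 'n"

definition id_ftor :: "('o, 'm, 'o, 'm) ftor"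
  where "id_ftor = \<lparr>fobj = (\<lambda>x. x), farr = (\<lambda>f. f)\<rparr>"

definition comp_ftor ::
  "('p, 'n, 'q, 'l) ftor \<Rightarrow> ('o, 'm, 'p, 'n) ftor \<Rightarrow> ('o, 'm, 'q, 'l) ftor"
  where "comp_ftor G F = \<lparr>fobj = fobj G \<circ> fobj F, farr = farr G \<circ> farr F\<rparr>"

definition is_ftor ::
  "('o, 'm, 'y) cat_scheme \<Rightarrow> ('p, 'n, 'z) cat_scheme \<Rightarrow> ('o, 'm, 'p, 'n) ftor \<Rightarrow> bool"
  where "is_ftor M N F \<longleftrightarrow>
    (\<forall>x\<in>Obj M. fobj F x \<in> Obj N) \<and>
    (\<forall>x y. \<forall>f\<in>homset M x y. farr F f \<in> homset N (fobj F x) (fobj F y)) \<and>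
    (\<forall>x\<in>Obj M. farr F (Id M x) = Id N (fobj F x)) \<and>
    (\<forall>x y z. \<forall>f\<in>homset M x y. \<forall>g\<in>homset M y z.
       farr F (Comp M g f) = Comp N (farr F g) (farr F f))"

definition natural_iso ::
  "('o, 'm, 'y) cat_scheme \<Rightarrow> ('p, 'n, 'z) cat_scheme \<Rightarrow>
   ('o, 'm, 'p, 'n) ftor \<Rightarrow> ('o, 'm, 'p, 'n) ftor \<Rightarrow> ('o \<Rightarrow> 'n) \<Rightarrow> bool"
  where "natural_iso M N F G \<eta> \<longleftrightarrow>
    (\<forall>x\<in>Obj M. iso_arr N (fobj F x) (fobj G x) (\<eta> x)) \<and>
    (\<forall>x y. \<forall>f\<in>homset M x y. Comp N (\<eta> y) (farr F f) = Comp N (farr G f) (\<eta> x))"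

record ('o, 'm) moncat = "('o, 'm) cat" +
  tob :: "'o \<Rightarrow> 'o \<Rightarrow> 'o"
  tarr :: "'m \<Rightarrow> 'm \<Rightarrow> 'm"
  tunit :: 'o
  tassoc :: "'o \<Rightarrow> 'o \<Rightarrow> 'o \<Rightarrow> 'm"
  lunit :: "'o \<Rightarrow> 'm"
  runit :: "'o \<Rightarrow> 'm"

text \<open>
  \<open>massoc X Y M : (X \<otimes> Y) \<otimes> M \<rightarrow> X \<otimes> (Y \<otimes> M)\<close> and \<open>munit M : 1 \<otimes> M \<rightarrow> M\<close>.
\<close>

record ('o, 'm, 'p, 'n) modcat = "('p, 'n) cat" +
  mob :: "'o \<Rightarrow> 'p \<Rightarrow> 'p"
  marr :: "'m \<Rightarrow> 'n \<Rightarrow> 'n"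
  massoc :: "'o \<Rightarrow> 'o \<Rightarrow> 'p \<Rightarrow> 'n"
  munit :: "'p \<Rightarrow> 'n"

locale monoidal_category = category C for C :: "('o, 'm, 'z) moncat_scheme" +
  assumes unit_obj: "tunit C \<in> Obj C"
    and tob_obj: "\<lbrakk>X \<in> Obj C; Y \<in> Obj C\<rbrakk> \<Longrightarrow> tob C X Y \<in> Obj C"
    and tarr_arr: "\<lbrakk>f \<in> homset C X X'; g \<in> homset C Y Y'\<rbrakk> \<Longrightarrow>
      tarr C f g \<in> homset C (tob C X Y) (tob C X' Y')"
    and tarr_id: "\<lbrakk>X \<in> Obj C; Y \<in> Obj C\<rbrakk> \<Longrightarrow> tarr C (Id C X) (Id C Y) = Id C (tob C X Y)"
    and tarr_comp: "\<lbrakk>f \<in> homset C X X'; f' \<in> homset C X' X''; g \<in> homset C Y Y'; g' \<in> homset C Y' Y''\<rbrakk> \<Longrightarrow>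
      tarr C (Comp C f' f) (Comp C g' g) = Comp C (tarr C f' g') (tarr C f g)"
    and tassoc_iso: "\<lbrakk>X \<in> Obj C; Y \<in> Obj C; Z \<in> Obj C\<rbrakk> \<Longrightarrow>
      iso_arr C (tob C (tob C X Y) Z) (tob C X (tob C Y Z)) (tassoc C X Y Z)"
    and tassoc_natural: "\<lbrakk>f \<in> homset C X X'; g \<in> homset C Y Y'; h \<in> homset C Z Z'\<rbrakk> \<Longrightarrow>
      Comp C (tassoc C X' Y' Z') (tarr C (tarr C f g) h) =
      Comp C (tarr C f (tarr C g h)) (tassoc C X Y Z)"
    and lunit_iso: "X \<in> Obj C \<Longrightarrow> iso_arr C (tob C (tunit C) X) X (lunit C X)"
    and runit_iso: "X \<in> Obj C \<Longrightarrow> iso_arr C (tob C X (tunit C)) X (runit C X)"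
    and lunit_natural: "f \<in> homset C X X' \<Longrightarrow>
      Comp C (lunit C X') (tarr C (Id C (tunit C)) f) = Comp C f (lunit C X)"
    and runit_natural: "f \<in> homset C X X' \<Longrightarrow>
      Comp C (runit C X') (tarr C f (Id C (tunit C))) = Comp C f (runit C X)"
    and pentagon: "\<lbrakk>W \<in> Obj C; X \<in> Obj C; Y \<in> Obj C; Z \<in> Obj C\<rbrakk> \<Longrightarrow>
      Comp C (tassoc C W X (tob C Y Z)) (tassoc C (tob C W X) Y Z) =
      Comp C (tarr C (Id C W) (tassoc C X Y Z))
        (Comp C (tassoc C W (tob C X Y) Z) (tarr C (tassoc C W X Y) (Id C Z)))"
    and triangle: "\<lbrakk>X \<in> Obj C; Y \<in> Obj C\<rbrakk> \<Longrightarrow>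
      Comp C (tarr C (Id C X) (lunit C Y)) (tassoc C X (tunit C) Y) =
      tarr C (runit C X) (Id C Y)"

locale module_category = monoidal_category C + M: category M
  for C :: "('o, 'm, 'y) moncat_scheme" and M :: "('o, 'm, 'p, 'n, 'z) modcat_scheme" +
  assumes mob_obj: "\<lbrakk>X \<in> Obj C; U \<in> Obj M\<rbrakk> \<Longrightarrow> mob M X U \<in> Obj M"
    and marr_arr: "\<lbrakk>f \<in> homset C X X'; g \<in> homset M U U'\<rbrakk> \<Longrightarrow>
      marr M f g \<in> homset M (mob M X U) (mob M X' U')"
    and marr_id: "\<lbrakk>X \<in> Obj C; U \<in> Obj M\<rbrakk> \<Longrightarrow> marr M (Id C X) (Id M U) = Id M (mob M X U)"
    and marr_comp: "\<lbrakk>f \<in> homset C X X'; f' \<in> homset C X' X''; g \<in> homset M U U'; g' \<in> homset M U' U''\<rbrakk> \<Longrightarrow>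
      marr M (Comp C f' f) (Comp M g' g) = Comp M (marr M f' g') (marr M f g)"
    and massoc_iso: "\<lbrakk>X \<in> Obj C; Y \<in> Obj C; U \<in> Obj M\<rbrakk> \<Longrightarrow>
      iso_arr M (mob M (tob C X Y) U) (mob M X (mob M Y U)) (massoc M X Y U)"
    and massoc_natural: "\<lbrakk>f \<in> homset C X X'; e \<in> homset C Y Y'; g \<in> homset M U U'\<rbrakk> \<Longrightarrow>
      Comp M (massoc M X' Y' U') (marr M (tarr C f e) g) =
      Comp M (marr M f (marr M e g)) (massoc M X Y U)"
    and munit_iso: "U \<in> Obj M \<Longrightarrow> iso_arr M (mob M (tunit C) U) U (munit M U)"
    and munit_natural: "g \<in> homset M U U' \<Longrightarrow>
      Comp M (munit M U') (marr M (Id C (tunit C)) g) = Comp M g (munit M U)"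
    and mpentagon: "\<lbrakk>X \<in> Obj C; Y \<in> Obj C; Z \<in> Obj C; U \<in> Obj M\<rbrakk> \<Longrightarrow>
      Comp M (massoc M X Y (mob M Z U)) (massoc M (tob C X Y) Z U) =
      Comp M (marr M (Id C X) (massoc M Y Z U))
        (Comp M (massoc M X (tob C Y Z) U) (marr M (tassoc C X Y Z) (Id M U)))"
    and mtriangle: "\<lbrakk>X \<in> Obj C; U \<in> Obj M\<rbrakk> \<Longrightarrow>
      Comp M (marr M (Id C X) (munit M U)) (massoc M X (tunit C) U) =
      marr M (runit C X) (Id M U)"

text \<open>\<open>s X U : F (X \<otimes> U) \<rightarrow> X \<otimes> F U\<close> is the module structure of the functor \<open>F\<close>.\<close>

definition module_ftor ::
  "('o, 'm, 'x) moncat_scheme \<Rightarrow> ('o, 'm, 'p, 'n, 'y) modcat_scheme \<Rightarrow> ('o, 'm, 'q, 'l, 'z) modcat_scheme \<Rightarrow>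
   ('p, 'n, 'q, 'l) ftor \<Rightarrow> ('o \<Rightarrow> 'p \<Rightarrow> 'l) \<Rightarrow> bool"
  where "module_ftor C M N F s \<longleftrightarrow>
    is_ftor M N F \<and>
    (\<forall>X\<in>Obj C. \<forall>U\<in>Obj M. iso_arr N (fobj F (mob M X U)) (mob N X (fobj F U)) (s X U)) \<and>
    (\<forall>X X' U U'. \<forall>f\<in>homset C X X'. \<forall>g\<in>homset M U U'.
       Comp N (s X' U') (farr F (marr M f g)) = Comp N (marr N f (farr F g)) (s X U)) \<and>
    (\<forall>X\<in>Obj C. \<forall>Y\<in>Obj C. \<forall>U\<in>Obj M.
       Comp N (marr N (Id C X) (s Y U)) (Comp N (s X (mob M Y U)) (farr F (massoc M X Y U))) =
       Comp N (massoc N X Y (fobj F U)) (s (tob C X Y) U)) \<and>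
    (\<forall>U\<in>Obj M. Comp N (munit N (fobj F U)) (s (tunit C) U) = farr F (munit M U))"

definition module_natural_iso ::
  "('o, 'm, 'x) moncat_scheme \<Rightarrow> ('o, 'm, 'p, 'n, 'y) modcat_scheme \<Rightarrow> ('o, 'm, 'q, 'l, 'z) modcat_scheme \<Rightarrow>
   ('p, 'n, 'q, 'l) ftor \<Rightarrow> ('o \<Rightarrow> 'p \<Rightarrow> 'l) \<Rightarrow>
   ('p, 'n, 'q, 'l) ftor \<Rightarrow> ('o \<Rightarrow> 'p \<Rightarrow> 'l) \<Rightarrow> ('p \<Rightarrow> 'l) \<Rightarrow> bool"
  where "module_natural_iso C M N F s G t \<eta> \<longleftrightarrow>
    natural_iso M N F G \<eta> \<and>
    (\<forall>X\<in>Obj C. \<forall>U\<in>Obj M.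
       Comp N (t X U) (\<eta> (mob M X U)) = Comp N (marr N (Id C X) (\<eta> U)) (s X U))"

definition id_struct :: "('o, 'm, 'p, 'n, 'z) modcat_scheme \<Rightarrow> 'o \<Rightarrow> 'p \<Rightarrow> 'n"
  where "id_struct M X U = Id M (mob M X U)"

text \<open>The module structure of \<open>G \<circ> F\<close>, where \<open>L\<close> is the target of \<open>G\<close>.\<close>

definition comp_struct ::
  "('q, 'l, 'z) cat_scheme \<Rightarrow> ('p, 'n, 'q, 'l) ftor \<Rightarrow> ('o \<Rightarrow> 'p \<Rightarrow> 'l) \<Rightarrow>
   ('i, 'j, 'p, 'n) ftor \<Rightarrow> ('o \<Rightarrow> 'i \<Rightarrow> 'n) \<Rightarrow> 'o \<Rightarrow> 'i \<Rightarrow> 'l"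
  where "comp_struct L G t F s X U = Comp L (t X (fobj F U)) (farr G (s X U))"

definition module_category_equivalence ::
  "('o, 'm, 'x) moncat_scheme \<Rightarrow> ('o, 'm, 'p, 'n, 'y) modcat_scheme \<Rightarrow> ('o, 'm, 'q, 'l, 'z) modcat_scheme \<Rightarrow>
   ('p, 'n, 'q, 'l) ftor \<Rightarrow> ('q, 'l, 'p, 'n) ftor \<Rightarrow> bool"
  where "module_category_equivalence C M N F G \<longleftrightarrow>
    module_category C M \<and> module_category C N \<and>
    (\<exists>s t \<eta> \<epsilon>. module_ftor C M N F s \<and> module_ftor C N M G t \<and>
       module_natural_iso C M M (comp_ftor G F) (comp_struct M G t F s) id_ftor (id_struct M) \<epsilon> \<and>
       module_natural_iso C N N id_ftor (id_struct N) (comp_ftor F G) (comp_struct N F s G t) \<eta>)"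

section \<open>Categories of vector spaces with structure\<close>

record ('k, 'o) mor =
  src :: 'o
  tgt :: 'o
  fn :: "'k univ \<Rightarrow> 'k univ"

text \<open>
  Linear maps between subspaces of the ambient space; they vanish outside their domain, so that
  equality of maps is equality of functions.
\<close>

definition lin_maps :: "'k::field univ set \<Rightarrow> 'k univ set \<Rightarrow> ('k univ \<Rightarrow> 'k univ) set"
  where "lin_maps X Y = {f. lin_on uscale uscale X f \<and> f ` X \<subseteq> Y \<and> (\<forall>x. x \<notin> X \<longrightarrow> f x = 0)}"

definition id_map :: "'k::field univ set \<Rightarrow> 'k univ \<Rightarrow> 'k univ"
  where "id_map X x = (if x \<in> X then x else 0)"

definition concrete_cat ::
  "'o set \<Rightarrow> ('o \<Rightarrow> 'k::field univ set) \<Rightarrow> ('o \<Rightarrow> 'o \<Rightarrow> ('k univ \<Rightarrow> 'k univ) set) \<Rightarrow> ('o, ('k, 'o) mor) cat"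
  where "concrete_cat Ob car hm =
    \<lparr>Obj = Ob,
     Arr = {f. src f \<in> Ob \<and> tgt f \<in> Ob \<and> fn f \<in> hm (src f) (tgt f)},
     Dom = src, Cod = tgt,
     Id = (\<lambda>x. \<lparr>src = x, tgt = x, fn = id_map (car x)\<rparr>),
     Comp = (\<lambda>g f. \<lparr>src = src f, tgt = tgt g, fn = fn g \<circ> fn f\<rparr>)\<rparr>"

abbreviation tensor_sp :: "'k::field univ set \<Rightarrow> 'k univ set \<Rightarrow> 'k univ set"
  where "tensor_sp \<equiv> tensor_space (\<otimes>)"

definition tensor_map ::
  "'k::field univ set \<Rightarrow> 'k univ set \<Rightarrow> ('k univ \<Rightarrow> 'k univ) \<Rightarrow> ('k univ \<Rightarrow> 'k univ) \<Rightarrow> 'k univ \<Rightarrow> 'k univ"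
  where "tensor_map X Y f g = tensor_lift (\<otimes>) X Y (\<lambda>x y. f x \<otimes> g y)"

definition assoc_map ::
  "'k::field univ set \<Rightarrow> 'k univ set \<Rightarrow> 'k univ set \<Rightarrow> 'k univ \<Rightarrow> 'k univ"
  where "assoc_map X Y Z =
    tensor_lift (\<otimes>) (tensor_sp X Y) Z (\<lambda>t z. sweedler (\<otimes>) X Y t (\<lambda>x y. x \<otimes> y \<otimes> z))"

text \<open>The ground field, as the subspace of sequences supported at \<open>0\<close>.\<close>

definition unit_sp :: "'k::field univ set"
  where "unit_sp = {x. \<forall>i>0. x i = 0}"

definition lunit_map :: "'k::field univ set \<Rightarrow> 'k univ \<Rightarrow> 'k univ"
  where "lunit_map X = tensor_lift (\<otimes>) unit_sp X (\<lambda>c x. c 0 *\<^sub>u x)"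

definition runit_map :: "'k::field univ set \<Rightarrow> 'k univ \<Rightarrow> 'k univ"
  where "runit_map X = tensor_lift (\<otimes>) X unit_sp (\<lambda>x c. c 0 *\<^sub>u x)"

definition Vec :: "('k::field univ set, ('k, 'k univ set) mor) moncat"
  where "Vec = cat.extend (concrete_cat {X. fin_dim uscale X} (\<lambda>X. X) lin_maps)
    (moncat.fields
      tensor_sp
      (\<lambda>f g. \<lparr>src = tensor_sp (src f) (src g), tgt = tensor_sp (tgt f) (tgt g),
              fn = tensor_map (src f) (src g) (fn f) (fn g)\<rparr>)
      unit_sp
      (\<lambda>X Y Z. \<lparr>src = tensor_sp (tensor_sp X Y) Z, tgt = tensor_sp X (tensor_sp Y Z),
                fn = assoc_map X Y Z\<rparr>)
      (\<lambda>X. \<lparr>src = tensor_sp unit_sp X, tgt = X, fn = lunit_map X\<rparr>)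
      (\<lambda>X. \<lparr>src = tensor_sp X unit_sp, tgt = X, fn = runit_map X\<rparr>))"

text \<open>
  Makes a category of vector spaces with structure into a module category over \<open>Vec\<close>, given the
  action \<open>act\<close> on objects; on arrows it is the tensor product of maps.
\<close>

definition vec_module_cat ::
  "('o, ('k::field, 'o) mor) cat \<Rightarrow> ('o \<Rightarrow> 'k univ set) \<Rightarrow> ('k univ set \<Rightarrow> 'o \<Rightarrow> 'o) \<Rightarrow>
   ('k univ set, ('k, 'k univ set) mor, 'o, ('k, 'o) mor) modcat"
  where "vec_module_cat M car act = cat.extend M
    (modcat.fields
      act
      (\<lambda>f g. \<lparr>src = act (src f) (src g), tgt = act (tgt f) (tgt g),
              fn = tensor_map (src f) (car (src g)) (fn f) (fn g)\<rparr>)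
      (\<lambda>X Y U. \<lparr>src = act (tensor_sp X Y) U, tgt = act X (act Y U), fn = assoc_map X Y (car U)\<rparr>)
      (\<lambda>U. \<lparr>src = act unit_sp U, tgt = U, fn = lunit_map (car U)\<rparr>))"

section \<open>The category of \<open>H\<close>-modules with compatible \<open>D\<close>-coaction\<close>

text \<open>
  Left comodules over \<open>D\<close> with the coproduct \<open>comult_R\<close>.  The underlying space is \<open>V\<close>, with scalar
  multiplication \<open>s\<close>, and \<open>\<kappa>\<close> embeds it into the ambient space; the coaction takes values in
  the tensor product of \<open>D\<close> and \<open>V\<close>.
\<close>

abbreviation dtens ::
  "('k::field, 'h::ring_1) hopf \<Rightarrow> ('v \<Rightarrow> 'k univ) \<Rightarrow> 'h \<Rightarrow> 'v \<Rightarrow> 'k univ"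
  where "dtens H \<kappa> d v \<equiv> hemb H d \<otimes> \<kappa> v"

definition left_comodule ::
  "('k::field, 'h::ring_1) hopf \<Rightarrow> 'k univ \<Rightarrow> 'h set \<Rightarrow>
   ('k \<Rightarrow> 'v::ab_group_add \<Rightarrow> 'v) \<Rightarrow> ('v \<Rightarrow> 'k univ) \<Rightarrow> 'v set \<Rightarrow> ('v \<Rightarrow> 'k univ) \<Rightarrow> bool"
  where "left_comodule H R D s \<kappa> V \<rho> \<longleftrightarrow>
    lin_on s uscale V \<rho> \<and> (\<forall>v\<in>V. \<rho> v \<in> tensor_space (dtens H \<kappa>) D V) \<and>
    (\<forall>v\<in>V. sweedler (dtens H \<kappa>) D V (\<rho> v) (\<lambda>d v'.
              sweedler (htens H) D D (comult_R H R d) (\<lambda>d1 d2. hemb H d1 \<otimes> hemb H d2 \<otimes> \<kappa> v')) =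
            sweedler (dtens H \<kappa>) D V (\<rho> v) (\<lambda>d v'.
              sweedler (dtens H \<kappa>) D V (\<rho> v') (\<lambda>d' v''. hemb H d \<otimes> hemb H d' \<otimes> \<kappa> v''))) \<and>
    (\<forall>v\<in>V. sweedler (dtens H \<kappa>) D V (\<rho> v) (\<lambda>d v'. s (counit H d) v') = v)"

record ('k, 'h) hdmod =
  hdcar :: "'k univ set"
  hdact :: "'h \<Rightarrow> 'k univ \<Rightarrow> 'k univ"
  hdcoact :: "'k univ \<Rightarrow> 'k univ"

abbreviation utens :: "('k::field, 'h::ring_1) hopf \<Rightarrow> 'h \<Rightarrow> 'k univ \<Rightarrow> 'k univ"
  where "utens H \<equiv> dtens H (\<lambda>v. v)"

definition left_module ::
  "('k::field, 'h::ring_1) hopf \<Rightarrow> 'k univ set \<Rightarrow> ('h \<Rightarrow> 'k univ \<Rightarrow> 'k univ) \<Rightarrow> bool"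
  where "left_module H V act \<longleftrightarrow>
    (\<forall>h. \<forall>v\<in>V. act h v \<in> V) \<and>
    (\<forall>h. lin_on uscale uscale V (act h)) \<and>
    (\<forall>v\<in>V. lin_on (hscale H) uscale UNIV (\<lambda>h. act h v)) \<and>
    (\<forall>g h. \<forall>v\<in>V. act (g * h) v = act g (act h v)) \<and> (\<forall>v\<in>V. act 1 v = v)"

definition hd_module ::
  "('k::field, 'h::ring_1) hopf \<Rightarrow> 'k univ \<Rightarrow> 'h set \<Rightarrow> ('k, 'h) hdmod \<Rightarrow> bool"
  where "hd_module H R D V \<longleftrightarrow>
    fin_dim uscale (hdcar V) \<and> left_module H (hdcar V) (hdact V) \<and>
    left_comodule H R D uscale (\<lambda>v. v) (hdcar V) (hdcoact V) \<and>
    (\<forall>h. \<forall>v\<in>hdcar V. hdcoact V (hdact V h v) =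
       hsw H (comult H h) (\<lambda>h1 h2. sweedler (utens H) D (hdcar V) (hdcoact V v) (\<lambda>d v'.
         utens H (ad H h1 d) (hdact V h2 v'))))"

definition hd_hom ::
  "('k::field, 'h::ring_1) hopf \<Rightarrow> 'h set \<Rightarrow> ('k, 'h) hdmod \<Rightarrow> ('k, 'h) hdmod \<Rightarrow> ('k univ \<Rightarrow> 'k univ) set"
  where "hd_hom H D V V' = {f \<in> lin_maps (hdcar V) (hdcar V').
    (\<forall>h. \<forall>v\<in>hdcar V. f (hdact V h v) = hdact V' h (f v)) \<and>
    (\<forall>v\<in>hdcar V. hdcoact V' (f v) =
       sweedler (utens H) D (hdcar V) (hdcoact V v) (\<lambda>d v'. utens H d (f v')))}"

definition hd_tensor ::
  "('k::field, 'h::ring_1) hopf \<Rightarrow> 'h set \<Rightarrow> 'k univ set \<Rightarrow> ('k, 'h) hdmod \<Rightarrow> ('k, 'h) hdmod"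
  where "hd_tensor H D X V =
    \<lparr>hdcar = tensor_sp X (hdcar V),
     hdact = (\<lambda>h. tensor_lift (\<otimes>) X (hdcar V) (\<lambda>x v. x \<otimes> hdact V h v)),
     hdcoact = tensor_lift (\<otimes>) X (hdcar V) (\<lambda>x v.
       sweedler (utens H) D (hdcar V) (hdcoact V v) (\<lambda>d v'. utens H d (x \<otimes> v')))\<rparr>"

definition HD_cat ::
  "('k::field, 'h::ring_1) hopf \<Rightarrow> 'k univ \<Rightarrow> 'h set \<Rightarrow>
   ('k univ set, ('k, 'k univ set) mor, ('k, 'h) hdmod, ('k, ('k, 'h) hdmod) mor) modcat"
  where "HD_cat H R D =
    vec_module_cat (concrete_cat {V. hd_module H R D V} hdcar (hd_hom H D)) hdcar (hd_tensor H D)"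

section \<open>Right modules over an algebra\<close>

record ('k, 'a) rmod =
  rcar :: "'k univ set"
  ract :: "'k univ \<Rightarrow> 'a \<Rightarrow> 'k univ"

definition right_module :: "('k::field, 'a::ab_group_add) alg \<Rightarrow> ('k, 'a) rmod \<Rightarrow> bool"
  where "right_module A U \<longleftrightarrow>
    fin_dim uscale (rcar U) \<and>
    (\<forall>u\<in>rcar U. \<forall>a\<in>acarrier A. ract U u a \<in> rcar U) \<and>
    (\<forall>a\<in>acarrier A. lin_on uscale uscale (rcar U) (\<lambda>u. ract U u a)) \<and>
    (\<forall>u\<in>rcar U. lin_on (ascale A) uscale (acarrier A) (ract U u)) \<and>
    (\<forall>u\<in>rcar U. \<forall>a\<in>acarrier A. \<forall>b\<in>acarrier A. ract U u (amult A a b) = ract U (ract U u a) b) \<and>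
    (\<forall>u\<in>rcar U. ract U u (aone A) = u)"

definition r_hom ::
  "('k::field, 'a::ab_group_add) alg \<Rightarrow> ('k, 'a) rmod \<Rightarrow> ('k, 'a) rmod \<Rightarrow> ('k univ \<Rightarrow> 'k univ) set"
  where "r_hom A U U' = {f \<in> lin_maps (rcar U) (rcar U').
    \<forall>u\<in>rcar U. \<forall>a\<in>acarrier A. f (ract U u a) = ract U' (f u) a}"

definition r_tensor :: "'k::field univ set \<Rightarrow> ('k, 'a) rmod \<Rightarrow> ('k, 'a) rmod"
  where "r_tensor X U =
    \<lparr>rcar = tensor_sp X (rcar U),
     ract = (\<lambda>t a. tensor_lift (\<otimes>) X (rcar U) (\<lambda>x u. x \<otimes> ract U u a) t)\<rparr>"

definition Mod_cat ::
  "('k::field, 'a::ab_group_add) alg \<Rightarrow>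
   ('k univ set, ('k, 'k univ set) mor, ('k, 'a) rmod, ('k, ('k, 'a) rmod) mor) modcat"
  where "Mod_cat A =
    vec_module_cat (concrete_cat {U. right_module A U} rcar (r_hom A)) rcar r_tensor"

section \<open>The object \<open>H \<otimes> W\<close> and the functors\<close>

record ('k, 'w) comod =
  wscale :: "'k \<Rightarrow> 'w \<Rightarrow> 'w"
  wcoact :: "'w \<Rightarrow> 'k univ"

abbreviation wemb :: "('k::field, 'w::ab_group_add) comod \<Rightarrow> 'w \<Rightarrow> 'k univ"
  where "wemb W \<equiv> embed (wscale W) UNIV"

definition fin_dim_left_comodule ::
  "('k::field, 'h::ring_1) hopf \<Rightarrow> 'k univ \<Rightarrow> 'h set \<Rightarrow> ('k, 'w::ab_group_add) comod \<Rightarrow> bool"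
  where "fin_dim_left_comodule H R D W \<longleftrightarrow>
    vector_space (wscale W) \<and> fin_dim (wscale W) UNIV \<and>
    left_comodule H R D (wscale W) (wemb W) UNIV (wcoact W)"

definition free_hd ::
  "('k::field, 'h::ring_1) hopf \<Rightarrow> 'h set \<Rightarrow> ('k, 'w::ab_group_add) comod \<Rightarrow> ('k, 'h) hdmod"
  where "free_hd H D W =
    (let \<tau> = dtens H (wemb W) in
     \<lparr>hdcar = tensor_space \<tau> UNIV UNIV,
      hdact = (\<lambda>g. tensor_lift \<tau> UNIV UNIV (\<lambda>h w. \<tau> (g * h) w)),
      hdcoact = tensor_lift \<tau> UNIV UNIV (\<lambda>h w.
        hsw H (comult H h) (\<lambda>h1 h2. sweedler \<tau> D UNIV (wcoact W w) (\<lambda>d w'.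
          utens H (ad H h1 d) (\<tau> h2 w'))))\<rparr>)"

definition End_alg ::
  "('k::field, 'h::ring_1) hopf \<Rightarrow> 'h set \<Rightarrow> ('k, 'h) hdmod \<Rightarrow> ('k, 'k univ \<Rightarrow> 'k univ) alg"
  where "End_alg H D P =
    \<lparr>acarrier = hd_hom H D P P, ascale = fscale, amult = (\<circ>), aone = id_map (hdcar P)\<rparr>"

text \<open>
  The functor \<open>Hom(P, -)\<close>.  Its value at \<open>V\<close> is the space \<open>hd_hom H D P V\<close> carried over to the ambient
  space by an injective linear map.
\<close>

abbreviation hom_emb ::
  "('k::field, 'h::ring_1) hopf \<Rightarrow> 'h set \<Rightarrow> ('k, 'h) hdmod \<Rightarrow> ('k, 'h) hdmod \<Rightarrow>
   ('k univ \<Rightarrow> 'k univ) \<Rightarrow> 'k univ"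
  where "hom_emb H D P V \<equiv> embed fscale (hd_hom H D P V)"

abbreviation hom_inv ::
  "('k::field, 'h::ring_1) hopf \<Rightarrow> 'h set \<Rightarrow> ('k, 'h) hdmod \<Rightarrow> ('k, 'h) hdmod \<Rightarrow>
   'k univ \<Rightarrow> 'k univ \<Rightarrow> 'k univ"
  where "hom_inv H D P V \<equiv> inv_into (hd_hom H D P V) (hom_emb H D P V)"

definition Hom_obj ::
  "('k::field, 'h::ring_1) hopf \<Rightarrow> 'h set \<Rightarrow> ('k, 'h) hdmod \<Rightarrow> ('k, 'h) hdmod \<Rightarrow>
   ('k, 'k univ \<Rightarrow> 'k univ) rmod"
  where "Hom_obj H D P V =
    \<lparr>rcar = hom_emb H D P V ` hd_hom H D P V,
     ract = (\<lambda>u a. hom_emb H D P V (hom_inv H D P V u \<circ> a))\<rparr>"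

definition Hom_ftor ::
  "('k::field, 'h::ring_1) hopf \<Rightarrow> 'h set \<Rightarrow> ('k, 'h) hdmod \<Rightarrow>
   (('k, 'h) hdmod, ('k, ('k, 'h) hdmod) mor,
    ('k, 'k univ \<Rightarrow> 'k univ) rmod, ('k, ('k, 'k univ \<Rightarrow> 'k univ) rmod) mor) ftor"
  where "Hom_ftor H D P =
    \<lparr>fobj = Hom_obj H D P,
     farr = (\<lambda>f. \<lparr>src = Hom_obj H D P (src f), tgt = Hom_obj H D P (tgt f),
       fn = (\<lambda>u. if u \<in> rcar (Hom_obj H D P (src f))
                 then hom_emb H D P (tgt f) (fn f \<circ> hom_inv H D P (src f) u) else 0)\<rparr>)\<rparr>"

text \<open>
  The functor \<open>- \<otimes>\<^sub>A P\<close>: the quotient of the tensor product of \<open>U\<close> and \<open>P\<close> over \<open>k\<close> by the span of all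
  \<open>u a \<otimes> p - u \<otimes> a p\<close>.  The structure maps are computed on arbitrary preimages under the
  quotient map.
\<close>

definition bal_rel ::
  "('k::field, 'k univ \<Rightarrow> 'k univ) alg \<Rightarrow> ('k, 'h) hdmod \<Rightarrow> ('k, 'k univ \<Rightarrow> 'k univ) rmod \<Rightarrow> 'k univ set"
  where "bal_rel A P U = module.span uscale
    {ract U u a \<otimes> p - u \<otimes> a p |u a p. u \<in> rcar U \<and> a \<in> acarrier A \<and> p \<in> hdcar P}"

abbreviation bal_map ::
  "('k::field, 'k univ \<Rightarrow> 'k univ) alg \<Rightarrow> ('k, 'h) hdmod \<Rightarrow> ('k, 'k univ \<Rightarrow> 'k univ) rmod \<Rightarrow>
   'k univ \<Rightarrow> 'k univ"
  where "bal_map A P U \<equiv> quot_map uscale (tensor_sp (rcar U) (hdcar P)) (bal_rel A P U)"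

abbreviation bal_rep ::
  "('k::field, 'k univ \<Rightarrow> 'k univ) alg \<Rightarrow> ('k, 'h) hdmod \<Rightarrow> ('k, 'k univ \<Rightarrow> 'k univ) rmod \<Rightarrow>
   'k univ \<Rightarrow> 'k univ"
  where "bal_rep A P U \<equiv> inv_into (tensor_sp (rcar U) (hdcar P)) (bal_map A P U)"

definition Tensor_obj ::
  "('k::field, 'h::ring_1) hopf \<Rightarrow> 'h set \<Rightarrow> ('k, 'k univ \<Rightarrow> 'k univ) alg \<Rightarrow> ('k, 'h) hdmod \<Rightarrow>
   ('k, 'k univ \<Rightarrow> 'k univ) rmod \<Rightarrow> ('k, 'h) hdmod"
  where "Tensor_obj H D A P U =
    \<lparr>hdcar = bal_map A P U ` tensor_sp (rcar U) (hdcar P),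
     hdact = (\<lambda>h y. bal_map A P U
       (sweedler (\<otimes>) (rcar U) (hdcar P) (bal_rep A P U y) (\<lambda>u p. u \<otimes> hdact P h p))),
     hdcoact = (\<lambda>y. sweedler (\<otimes>) (rcar U) (hdcar P) (bal_rep A P U y) (\<lambda>u p.
       sweedler (utens H) D (hdcar P) (hdcoact P p) (\<lambda>d p'. utens H d (bal_map A P U (u \<otimes> p')))))\<rparr>"

definition Tensor_ftor ::
  "('k::field, 'h::ring_1) hopf \<Rightarrow> 'h set \<Rightarrow> ('k, 'k univ \<Rightarrow> 'k univ) alg \<Rightarrow> ('k, 'h) hdmod \<Rightarrow>
   (('k, 'k univ \<Rightarrow> 'k univ) rmod, ('k, ('k, 'k univ \<Rightarrow> 'k univ) rmod) mor,
    ('k, 'h) hdmod, ('k, ('k, 'h) hdmod) mor) ftor"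
  where "Tensor_ftor H D A P =
    \<lparr>fobj = Tensor_obj H D A P,
     farr = (\<lambda>f. \<lparr>src = Tensor_obj H D A P (src f), tgt = Tensor_obj H D A P (tgt f),
       fn = (\<lambda>y. if y \<in> hdcar (Tensor_obj H D A P (src f))
                 then bal_map A P (tgt f)
                   (sweedler (\<otimes>) (rcar (src f)) (hdcar P) (bal_rep A P (src f) y) (\<lambda>u p. fn f u \<otimes> p))
                 else 0)\<rparr>)\<rparr>"

end

theory Submission
  imports Defs
begin

text \<open>
  Let \<open>P = H \<otimes> W\<close>.  The functor \<open>Hom(P, _)\<close> is an equivalence onto the right modules over \<open>A = End(P)\<close> because \<open>P\<close> is a
  projective generator, and both properties come from one averaging operator.

  Semisimplicity of \<open>H\<close> gives a two-sided integral \<open>Lam\<close> with \<open>\<epsilon> Lam = 1\<close>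
  (\<open>integral_exists\<close>), and cosemisimplicity an invariant functional \<open>lam\<close> with \<open>lam 1 = 1\<close>
  (\<open>cointegral_exists\<close>).  The integral makes linear maps \<open>H\<close>-linear.  For colinearity, put
  \<open>theta a b = lam (a sigma b)\<close>, where \<open>sigma\<close> is the antipode of the transmuted braided group.  This form is
  normalised by the counit, invariant under the adjoint action and bicolinear (\<open>theta_counit\<close>, \<open>theta_invariant\<close>,
  \<open>theta_bicolinear\<close>), so it makes the transmuted coalgebra coseparable in a way that respects \<open>H\<close>.  Invariance
  and bicolinearity rest on \<open>lam (x y) = lam (y S\<^sup>2 x)\<close> (\<open>lam_nakayama\<close>).  Averaging with \<open>Lam\<close> and then with \<open>theta\<close>
  projects all linear maps between two objects onto the morphisms, naturally in both objects (\<open>avg_hom\<close>,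
  \<open>avg_id\<close>, \<open>avg_post\<close>, \<open>avg_pre\<close>).

  Minimality of \<open>D\<close> enters once: the coefficients of a nonzero object span \<open>D\<close>
  (\<open>coefficients_span\<close>).  If all morphisms from \<open>P\<close> to a nonzero object vanished, so would the averages of the rank
  one maps on \<open>W\<close>; then \<open>theta\<close> would vanish on the coefficients of \<open>W\<close>, against its normalisation
  (\<open>nonzero_hom\<close>).  Hence every object is a summand of a power of \<open>P\<close>, with an explicit dual basis
  (\<open>dual_basis\<close>).

  The dual basis inverts the evaluation \<open>Hom(P, V) \<otimes>\<^sub>A P \<rightarrow> V\<close>.  Every morphism out
  of \<open>P\<close> is the average of a sum of rank one maps, which inverts the unit \<open>U \<rightarrow> Hom(P, U \<otimes>\<^sub>A P)\<close>.
  The averages of quasi-inverses make \<open>A\<close> von Neumann regular, and a finite dimensional regular algebra is semisimple.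
  The module structures are the evident maps, and all coherence conditions are equations between linear maps that are
  compared on generators.
\<close>

section \<open>Finite dimensional spaces and their dual systems\<close>

lemmas vs_u = vector_space_uscale and vs_f = vector_space_fscale

interpretation uv: vector_space "uscale :: 'k::field \<Rightarrow> 'k univ \<Rightarrow> 'k univ"
  by (rule vs_u)

lemma vs_k: "vector_space ((*) :: 'k::field \<Rightarrow> 'k \<Rightarrow> 'k)"
  by unfold_locales (auto simp: algebra_simps)

abbreviation lin where "lin s s' f \<equiv> lin_on s s' UNIV f"

abbreviation "ulin \<equiv> lin_on uscale uscale"

abbreviation "fd \<equiv> fin_dim uscale"

abbreviation usub :: "'k::field univ set \<Rightarrow> bool"
  where "usub \<equiv> module.subspace uscale"

lemma uscale_apply [simp]: "(c *\<^sub>u x) i = c * x i"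
  by (simp add: uscale_def)

lemma sum_list_apply: "(\<Sum>(a, b)\<leftarrow>xs. f a b) n = (\<Sum>(a, b)\<leftarrow>xs. f a b n)"
  by (induction xs) auto

lemma sum_pairs_cong: "(\<And>a b. (a, b) \<in> set xs \<Longrightarrow> f a b = g a b) \<Longrightarrow> (\<Sum>(a, b)\<leftarrow>xs. f a b) = (\<Sum>(a, b)\<leftarrow>xs. g a b)"
  by (induction xs) auto

lemma lin_onD:
  assumes "lin_on s s' X f"
  shows "x \<in> X \<Longrightarrow> y \<in> X \<Longrightarrow> f (x + y) = f x + f y" "x \<in> X \<Longrightarrow> f (s c x) = s' c (f x)"
  using assms by (auto simp: lin_on_def)

lemma lin_onI:
  assumes "\<And>x y. x \<in> X \<Longrightarrow> y \<in> X \<Longrightarrow> f (x + y) = f x + f y"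
    and "\<And>c x. x \<in> X \<Longrightarrow> f (s c x) = s' c (f x)"
  shows "lin_on s s' X f"
  using assms by (auto simp: lin_on_def)

lemma lin_on_subset: "lin_on s s' X f \<Longrightarrow> Y \<subseteq> X \<Longrightarrow> lin_on s s' Y f"
  unfolding lin_on_def by (meson subsetD)

lemma lin_on_zero:
  assumes "vector_space s" "vector_space s'" "module.subspace s X" "lin_on s s' X f"
  shows "f 0 = 0"
proof -
  interpret v: vector_space s by fact
  interpret w: vector_space s' by fact
  have "0 \<in> X" using assms(3) by (rule v.subspace_0)
  then have "f (s 0 0) = s' 0 (f 0)" using assms(4) by (intro lin_onD)
  then show ?thesis by simp
qed

lemma lin_on_diff:
  assumes "vector_space s" "vector_space s'" "module.subspace s X" "lin_on s s' X f" "x \<in> X" "y \<in> X"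
  shows "f (x - y) = f x - f y"
proof -
  interpret v: vector_space s by fact
  have "x - y \<in> X" using assms by (intro v.subspace_diff)
  then have "f (x - y + y) = f (x - y) + f y" using assms by (intro lin_onD)
  then show ?thesis by (simp add: eq_diff_eq)
qed

lemma lin_on_sum_pairs:
  assumes "vector_space s" "vector_space s'" "module.subspace s X" "lin_on s s' X f"
    and "\<And>a b. (a, b) \<in> set xs \<Longrightarrow> g a b \<in> X"
  shows "f (\<Sum>(a, b)\<leftarrow>xs. g a b) = (\<Sum>(a, b)\<leftarrow>xs. f (g a b))"
  using lin_on_sum_list[OF assms(1,3,4,2), of xs "\<lambda>(a, b). g a b"] assms(5)
  by (auto simp: case_prod_unfold)

lemma subspace_UNIV:
  assumes "vector_space s"
  shows "module.subspace s UNIV"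
proof -
  interpret v: vector_space s by fact
  show ?thesis by simp
qed

lemma lin_zero:
  assumes "vector_space s" "vector_space s'" "lin s s' f"
  shows "f 0 = 0"
  by (rule lin_on_zero[OF assms(1,2) subspace_UNIV[OF assms(1)] assms(3)])

lemma lin_sum_pairs:
  assumes "vector_space s" "vector_space s'" "lin s s' f"
  shows "f (\<Sum>(a, b)\<leftarrow>xs. g a b) = (\<Sum>(a, b)\<leftarrow>xs. f (g a b))"
  by (rule lin_on_sum_pairs[OF assms(1,2) subspace_UNIV[OF assms(1)] assms(3)]) simp

lemma subspace_sum_pairs:
  assumes "vector_space s" "module.subspace s X" "\<And>a b. (a, b) \<in> set xs \<Longrightarrow> g a b \<in> X"
  shows "(\<Sum>(a, b)\<leftarrow>xs. g a b) \<in> X"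
proof -
  interpret v: vector_space s by fact
  show ?thesis using assms(3) by (induction xs) (auto intro!: v.subspace_0[OF assms(2)] v.subspace_add[OF assms(2)])
qed

lemma lin_sum_list:
  assumes "vector_space s'" "\<And>p. p \<in> set xs \<Longrightarrow> lin_on s s' X (\<lambda>x. f x p)"
  shows "lin_on s s' X (\<lambda>x. \<Sum>p\<leftarrow>xs. f x p)"
proof -
  interpret w: vector_space s' by fact
  show ?thesis using assms(2)
    by (induction xs) (auto simp: lin_on_def w.scale_right_distrib algebra_simps)
qed

lemma fin_dim_subspace:
  assumes "vector_space s" "fin_dim s X"
  shows "module.subspace s X"
proof -
  interpret v: vector_space s by fact
  show ?thesis using assms(2) by (auto simp: fin_dim_def)
qed

text \<open>
  Finite dual systems are used instead of bases throughout: an expansion \<open>x = \<Sum> \<xi> x b\<close> with linear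
  functionals defined on the whole ambient space is all that finite dimensionality is needed for,
  and it survives taking subspaces and images.
\<close>

definition dual_sys :: "('k::field \<Rightarrow> 'v::ab_group_add \<Rightarrow> 'v) \<Rightarrow> 'v set \<Rightarrow> ('v \<times> ('v \<Rightarrow> 'k)) list \<Rightarrow> bool"
  where "dual_sys s X xs \<longleftrightarrow> (\<forall>(b, \<xi>)\<in>set xs. b \<in> X \<and> lin s (*) \<xi>) \<and> (\<forall>x\<in>X. x = (\<Sum>(b, \<xi>)\<leftarrow>xs. s (\<xi> x) b))"

lemma dual_sysD:
  assumes "dual_sys s X xs"
  shows "(b, \<xi>) \<in> set xs \<Longrightarrow> b \<in> X \<and> lin s (*) \<xi>" "x \<in> X \<Longrightarrow> x = (\<Sum>(b, \<xi>)\<leftarrow>xs. s (\<xi> x) b)"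
  using assms unfolding dual_sys_def by blast+

lemma dual_system:
  fixes s :: "'k::field \<Rightarrow> 'v::ab_group_add \<Rightarrow> 'v"
  assumes "vector_space s" "fin_dim s X"
  obtains xs where "dual_sys s X xs"
proof -
  interpret v: vector_space s by fact
  obtain B0 where B0: "finite B0" "X = v.span B0" using assms(2) by (auto simp: fin_dim_def)
  obtain B where B: "B \<subseteq> X" "v.independent B" "X \<subseteq> v.span B" using v.basis_exists by metis
  have fB: "finite B" using v.independent_span_bound[of B0 B] B B0 by auto
  have spB: "X = v.span B"
    using B B0 v.span_minimal[OF B(1)] by (simp add: subset_antisym)
  define E where "E = v.extend_basis B"
  have E: "v.independent E" "B \<subseteq> E" "v.span E = UNIV"
    using B by (auto simp: E_def v.independent_extend_basis v.extend_basis_superset)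
  obtain bs where bs: "distinct bs" "set bs = B" using fB finite_distinct_list by blast
  define xs where "xs = map (\<lambda>b. (b, \<lambda>x. v.representation E x b)) bs"
  show thesis
  proof (rule that[unfolded dual_sys_def], intro conjI ballI, clarify)
    fix b \<xi> assume "(b, \<xi>) \<in> set xs"
    then have "b \<in> B" "\<xi> = (\<lambda>x. v.representation E x b)" using bs by (auto simp: xs_def)
    then show "b \<in> X \<and> lin s (*) \<xi>"
      using B E by (auto simp: lin_on_def v.representation_add v.representation_scale)
  next
    fix x assume x: "x \<in> X"
    have "(\<Sum>(b, \<xi>)\<leftarrow>xs. s (\<xi> x) b) = (\<Sum>b\<in>B. s (v.representation E x b) b)"
      using bs by (simp add: xs_def o_def sum_list_distinct_conv_sum_set)
    also have "\<dots> = (\<Sum>b\<in>B. s (v.representation B x b) b)"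
      using v.representation_extend[OF E(1) _ E(2), of x] x spB by simp
    also have "\<dots> = x" using v.sum_representation_eq[OF B(2) _ fB] x spB by simp
    finally show "x = (\<Sum>(b, \<xi>)\<leftarrow>xs. s (\<xi> x) b)" by simp
  qed
qed

lemma fin_dim_mono:
  assumes "vector_space s" "fin_dim s X" "module.subspace s N" "N \<subseteq> X"
  shows "fin_dim s N"
proof -
  interpret v: vector_space s by fact
  obtain B0 where B0: "finite B0" "X = v.span B0" using assms(2) by (auto simp: fin_dim_def)
  obtain B where B: "B \<subseteq> N" "v.independent B" "N \<subseteq> v.span B" using v.basis_exists by metis
  have "finite B" using v.independent_span_bound[of B0 B] B B0 assms(4) by auto
  moreover have "N = v.span B" using B assms(3) v.span_minimal by blast
  ultimately show ?thesis unfolding fin_dim_def by blast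
qed

lemma fin_dimI:
  assumes "vector_space s" "module.subspace s X" "finite B" "X \<subseteq> module.span s B"
  shows "fin_dim s X"
  using fin_dim_mono[OF assms(1) _ assms(2,4)] assms(3) by (auto simp: fin_dim_def)

lemma subspace_image:
  assumes "vector_space s" "vector_space s'" "module.subspace s X" "lin_on s s' X f"
  shows "module.subspace s' (f ` X)"
proof -
  interpret v: vector_space s by fact
  interpret w: vector_space s' by fact
  show ?thesis
  proof (rule w.subspaceI)
    show "0 \<in> f ` X" using lin_on_zero[OF assms] v.subspace_0[OF assms(3)] by force
  next
    fix x y assume "x \<in> f ` X" "y \<in> f ` X"
    then show "x + y \<in> f ` X"
      using lin_onD(1)[OF assms(4)] v.subspace_add[OF assms(3)] by (metis (no_types, lifting) image_iff)
  next
    fix c x assume "x \<in> f ` X"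
    then show "s' c x \<in> f ` X"
      using lin_onD(2)[OF assms(4)] v.subspace_scale[OF assms(3)] by (metis (no_types, lifting) image_iff)
  qed
qed

lemma fin_dim_image:
  assumes "vector_space s" "vector_space s'" "fin_dim s X" "lin_on s s' X f"
  shows "fin_dim s' (f ` X)"
proof -
  interpret v: vector_space s by fact
  interpret w: vector_space s' by fact
  have X: "v.subspace X" using assms(1,3) by (rule fin_dim_subspace)
  obtain xs where "dual_sys s X xs" by (rule dual_system[OF assms(1,3)])
  note xs = dual_sysD[OF this]
  have "f ` X \<subseteq> w.span (f ` fst ` set xs)"
  proof
    fix y assume "y \<in> f ` X"
    then obtain x where x: "x \<in> X" "y = f x" by blast
    have "f x = f (\<Sum>(b, \<xi>)\<leftarrow>xs. s (\<xi> x) b)" by (rule arg_cong[OF xs(2)[OF x(1)]])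
    also have "\<dots> = (\<Sum>(b, \<xi>)\<leftarrow>xs. f (s (\<xi> x) b))"
      by (rule lin_on_sum_pairs[OF assms(1,2) X assms(4)]) (use xs(1) v.subspace_scale[OF X] in blast)
    also have "\<dots> = (\<Sum>(b, \<xi>)\<leftarrow>xs. s' (\<xi> x) (f b))"
      by (rule sum_pairs_cong) (use lin_onD(2)[OF assms(4)] xs(1) in force)
    also have "\<dots> \<in> w.span (f ` fst ` set xs)"
      by (intro subspace_sum_pairs[OF assms(2) w.subspace_span] w.span_scale w.span_base) force
    finally show "y \<in> w.span (f ` fst ` set xs)" using x by simp
  qed
  then show ?thesis using subspace_image[OF assms(1,2) X assms(4)] by (intro fin_dimI[OF assms(2)]) auto
qed

lemma linear_separates:
  assumes "vector_space s" "fin_dim s X" "x \<in> X"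
    and "\<And>\<xi>. lin s (*) \<xi> \<Longrightarrow> \<xi> x = 0"
  shows "x = 0"
proof -
  interpret v: vector_space s by fact
  obtain xs where "dual_sys s X xs" by (rule dual_system[OF assms(1,2)])
  note xs = dual_sysD[OF this]
  have "x = (\<Sum>(b, \<xi>)\<leftarrow>xs. s (\<xi> x) b)" by (rule xs(2)) fact
  also have "\<dots> = (\<Sum>(b, \<xi>)\<leftarrow>xs. 0)"
    by (rule sum_pairs_cong) (use xs(1) assms(4) in auto)
  also have "\<dots> = 0" by (induction xs) auto
  finally show ?thesis .
qed

text \<open>
  The quotient map: subtract the projection onto \<open>N\<close> given by a dual system of \<open>N\<close>, and write
  the result in the coordinates given by a dual system of \<open>X\<close>.
\<close>

lemma quot_map_exists:
  fixes s :: "'k::field \<Rightarrow> 'v::ab_group_add \<Rightarrow> 'v"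
  assumes "vector_space s" "fin_dim s X" "module.subspace s N" "N \<subseteq> X"
  shows "\<exists>q. lin_on s uscale X q \<and> {x\<in>X. q x = 0} = N"
proof -
  interpret v: vector_space s by fact
  have X: "v.subspace X" using assms(1,2) by (rule fin_dim_subspace)
  obtain xs where "dual_sys s X xs" by (rule dual_system[OF assms(1,2)])
  note xs = dual_sysD[OF this]
  obtain ns where "dual_sys s N ns" by (rule dual_system[OF assms(1) fin_dim_mono[OF assms]])
  note ns = dual_sysD[OF this]
  define e where "e x = (\<Sum>(b, \<xi>)\<leftarrow>ns. s (\<xi> x) b)" for x
  have "lin s s (\<lambda>x. case p of (b, \<xi>) \<Rightarrow> s (\<xi> x) b)" if "p \<in> set ns" for p
  proof -
    have "lin s (*) (snd p)" using ns(1)[of "fst p" "snd p"] that by simp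
    then show ?thesis by (auto simp: lin_on_def case_prod_unfold v.scale_left_distrib)
  qed
  then have "lin s s e" unfolding e_def by (intro lin_sum_list[OF assms(1)])
  then have e_lin: "e (x + y) = e x + e y" "e (s c x) = s c (e x)" for x y c
    by (auto simp: lin_on_def)
  have eN: "e x \<in> N" for x unfolding e_def
    by (intro subspace_sum_pairs[OF assms(1,3)]) (use ns(1) v.subspace_scale[OF assms(3)] in blast)
  have eid: "e x = x" if "x \<in> N" for x unfolding e_def by (rule ns(2)[OF that, symmetric])
  define q :: "'v \<Rightarrow> 'k univ" where "q x = (\<lambda>i. if i < length xs then snd (xs ! i) (x - e x) else 0)" for x
  have nth: "lin s (*) (snd (xs ! i))" if "i < length xs" for i
    using xs(1)[of "fst (xs ! i)" "snd (xs ! i)"] nth_mem[OF that] by simp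
  have lq: "lin_on s uscale X q"
  proof (rule lin_onI)
    fix x y
    have eq: "x + y - e (x + y) = (x - e x) + (y - e y)" by (simp add: e_lin)
    have "snd (xs ! i) (x + y - e (x + y)) = snd (xs ! i) (x - e x) + snd (xs ! i) (y - e y)"
      if "i < length xs" for i
      unfolding eq by (rule lin_onD(1)[OF nth[OF that]]) simp_all
    then show "q (x + y) = q x + q y" by (simp add: q_def fun_eq_iff)
  next
    fix c x
    have eq: "s c x - e (s c x) = s c (x - e x)" by (simp add: e_lin v.scale_right_diff_distrib)
    have "snd (xs ! i) (s c x - e (s c x)) = c * snd (xs ! i) (x - e x)" if "i < length xs" for i
      unfolding eq by (rule lin_onD(2)[OF nth[OF that]]) simp_all
    then show "q (s c x) = c *\<^sub>u q x" by (simp add: q_def fun_eq_iff)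
  qed
  have "x \<in> N" if "x \<in> X" "q x = 0" for x
  proof -
    have mem: "x - e x \<in> X" using that(1) eN[of x] assms(4) v.subspace_diff[OF X] by blast
    have z: "\<xi> (x - e x) = 0" if m: "(b, \<xi>) \<in> set xs" for b \<xi>
    proof -
      obtain i where "i < length xs" "xs ! i = (b, \<xi>)" using m by (metis in_set_conv_nth)
      then show ?thesis using fun_cong[OF \<open>q x = 0\<close>, of i] by (simp add: q_def)
    qed
    have "x - e x = (\<Sum>(b, \<xi>)\<leftarrow>xs. s (\<xi> (x - e x)) b)" by (rule xs(2)) fact
    also have "\<dots> = (\<Sum>(b, \<xi>)\<leftarrow>xs. 0)"
      by (rule sum_pairs_cong) (auto simp: z)
    also have "\<dots> = 0" by (induction xs) auto
    finally have "x = e x" by (simp only: right_minus_eq)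
    then have ex: "e x = x" by (rule sym)
    show ?thesis using eN[of x] unfolding ex .
  qed
  moreover have "q x = 0" if "x \<in> N" for x
    unfolding q_def eid[OF that] diff_self
    by (simp add: fun_eq_iff lin_zero[OF assms(1) vs_k nth])
  ultimately have "{x\<in>X. q x = 0} = N" using assms(4) by blast
  with lq show ?thesis by blast
qed

lemma quot_map_spec:
  assumes "vector_space s" "fin_dim s X" "module.subspace s N" "N \<subseteq> X"
  shows "lin_on s uscale X (quot_map s X N)" "x \<in> X \<Longrightarrow> quot_map s X N x = 0 \<longleftrightarrow> x \<in> N"
proof -
  have *: "lin_on s uscale X (quot_map s X N) \<and> {x\<in>X. quot_map s X N x = 0} = N"
    unfolding quot_map_def by (rule someI_ex[OF quot_map_exists[OF assms]])
  show "lin_on s uscale X (quot_map s X N)" using * by (rule conjunct1)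
  show "quot_map s X N x = 0 \<longleftrightarrow> x \<in> N" if "x \<in> X" using conjunct2[OF *] that by blast
qed

lemma embed_spec:
  assumes "vector_space s" "fin_dim s X"
  shows "lin_on s uscale X (embed s X)" "inj_on (embed s X) X"
proof -
  interpret v: vector_space s by fact
  have X: "v.subspace X" using assms by (rule fin_dim_subspace)
  have N: "v.subspace {0}" "{0} \<subseteq> X" using v.subspace_0[OF X] by (simp_all add: v.subspace_single_0)
  note q = quot_map_spec[OF assms N]
  show "lin_on s uscale X (embed s X)" by (rule q)
  show "inj_on (embed s X) X"
  proof (rule inj_onI)
    fix x y assume xy: "x \<in> X" "y \<in> X" "embed s X x = embed s X y"
    then have "embed s X (x - y) = 0"
      using lin_on_diff[OF assms(1) vs_u X q(1) xy(1,2)] by simp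
    then have "x - y \<in> {0}" using q(2)[OF v.subspace_diff[OF X xy(1,2)]] by blast
    then show "x = y" by simp
  qed
qed

section \<open>Tensor products inside the ambient space\<close>

text \<open>
  A sequence is read as a matrix through \<open>prod_encode\<close>.  Rows and columns are linear on the whole ambient
  space, so elements of a tensor product are compared and located by them, without any
  choice of a representation.
\<close>

definition row :: "nat \<Rightarrow> 'k::field univ \<Rightarrow> 'k univ" where "row i t = (\<lambda>j. t (prod_encode (i, j)))"

definition col :: "nat \<Rightarrow> 'k::field univ \<Rightarrow> 'k univ" where "col j t = (\<lambda>i. t (prod_encode (i, j)))"

definition contr :: "('k::field univ \<Rightarrow> 'k) \<Rightarrow> 'k univ \<Rightarrow> 'k univ" where "contr \<xi> t = (\<lambda>j. \<xi> (col j t))"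

lemma row_kron [simp]: "row i (x \<otimes> y) = x i *\<^sub>u y"
  by (simp add: row_def kron_def fun_eq_iff)

lemma col_kron [simp]: "col j (x \<otimes> y) = y j *\<^sub>u x"
  by (simp add: col_def kron_def fun_eq_iff mult.commute)

lemma contr_kron [simp]: "lin uscale (*) \<xi> \<Longrightarrow> contr \<xi> (x \<otimes> y) = \<xi> x *\<^sub>u y"
  by (auto simp: contr_def fun_eq_iff lin_on_def mult.commute)

lemma lin_row: "lin uscale uscale (row i)" and lin_col: "lin uscale uscale (col i)"
  by (auto simp: row_def col_def lin_on_def fun_eq_iff)

lemma lin_contr: "lin uscale (*) \<xi> \<Longrightarrow> lin uscale uscale (contr \<xi>)"
  unfolding contr_def lin_on_def lin_onD(1)[OF lin_col UNIV_I UNIV_I] lin_onD(2)[OF lin_col UNIV_I]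
  by (auto simp: fun_eq_iff)

lemma row_eqI: "(\<And>i. row i t = row i u) \<Longrightarrow> t = u"
  unfolding row_def fun_eq_iff by (metis prod.collapse prod_decode_inverse)

lemma kron_left: "(x + y) \<otimes> z = x \<otimes> z + y \<otimes> z" "(c *\<^sub>u x) \<otimes> z = c *\<^sub>u (x \<otimes> z)" "0 \<otimes> z = 0"
  and kron_right: "z \<otimes> (x + y) = z \<otimes> x + z \<otimes> y" "z \<otimes> (c *\<^sub>u x) = c *\<^sub>u (z \<otimes> x)" "z \<otimes> 0 = 0"
  by (auto simp: kron_def fun_eq_iff algebra_simps)

lemma lin_kron: "lin uscale uscale (\<lambda>x. x \<otimes> y)" "lin uscale uscale (\<lambda>y. x \<otimes> y)"
  by (auto simp: lin_on_def kron_left kron_right)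

definition emb :: "('k::field \<Rightarrow> 'v::ab_group_add \<Rightarrow> 'v) \<Rightarrow> 'v set \<Rightarrow> ('v \<Rightarrow> 'k univ) \<Rightarrow> bool"
  where "emb s A \<iota> \<longleftrightarrow> vector_space s \<and> fin_dim s A \<and> lin_on s uscale A \<iota> \<and> inj_on \<iota> A"

lemma embD:
  assumes "emb s A \<iota>"
  shows "vector_space s" "fin_dim s A" "module.subspace s A" "lin_on s uscale A \<iota>" "inj_on \<iota> A"
  using assms fin_dim_subspace by (auto simp: emb_def)

lemma emb_id: "fd X \<Longrightarrow> emb uscale X (\<lambda>x. x)"
  by (auto simp: emb_def vs_u lin_on_def)

lemma emb_subspace: "emb s A \<iota> \<Longrightarrow> module.subspace s B \<Longrightarrow> B \<subseteq> A \<Longrightarrow> emb s B \<iota>"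
  unfolding emb_def by (auto intro: fin_dim_mono lin_on_subset inj_on_subset)

lemma emb_embed: "vector_space s \<Longrightarrow> fin_dim s X \<Longrightarrow> emb s X (embed s X)"
  by (simp add: emb_def embed_spec)

text \<open>The functionals live on the ambient space rather than on \<open>A\<close>, so that they apply to rows and columns of tensors.\<close>

lemma emb_dual_system:
  assumes "emb s A \<iota>"
  obtains xs where "\<And>b \<xi>. (b, \<xi>) \<in> set xs \<Longrightarrow> b \<in> A \<and> lin uscale (*) \<xi>"
    and "\<And>a. a \<in> A \<Longrightarrow> a = (\<Sum>(b, \<xi>)\<leftarrow>xs. s (\<xi> (\<iota> a)) b)"
proof -
  note e = embD[OF assms]
  interpret v: vector_space s by (rule e)
  have fd: "fd (\<iota> ` A)" by (rule fin_dim_image[OF e(1) vs_u e(2,4)])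
  obtain xs where "dual_sys uscale (\<iota> ` A) xs" by (rule dual_system[OF vs_u fd])
  note xs = dual_sysD[OF this]
  let ?j = "inv_into A \<iota>"
  let ?xs = "map (\<lambda>(b, \<xi>). (?j b, \<xi>)) xs"
  have mem: "?j b \<in> A \<and> lin uscale (*) \<xi> \<and> \<iota> (?j b) = b" if "(b, \<xi>) \<in> set xs" for b \<xi>
    using xs(1)[OF that] by (auto simp: inv_into_into f_inv_into_f)
  show thesis
  proof (rule that)
    show "b \<in> A \<and> lin uscale (*) \<xi>" if "(b, \<xi>) \<in> set ?xs" for b \<xi> using that mem by auto
  next
    fix a assume a: "a \<in> A"
    have m: "s (\<xi> (\<iota> a)) (?j b) \<in> A" if "(b, \<xi>) \<in> set xs" for b \<xi>
      using mem[OF that] v.subspace_scale[OF e(3)] by blast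
    have "\<iota> (\<Sum>(b, \<xi>)\<leftarrow>xs. s (\<xi> (\<iota> a)) (?j b)) = (\<Sum>(b, \<xi>)\<leftarrow>xs. \<iota> (s (\<xi> (\<iota> a)) (?j b)))"
      by (rule lin_on_sum_pairs[OF e(1) vs_u e(3,4)]) (rule m)
    also have "\<dots> = (\<Sum>(b, \<xi>)\<leftarrow>xs. \<xi> (\<iota> a) *\<^sub>u b)"
      by (rule sum_pairs_cong) (use mem lin_onD(2)[OF e(4)] in auto)
    also have "\<dots> = \<iota> a" by (rule xs(2)[symmetric]) (use a in simp)
    finally have eq: "\<iota> (\<Sum>(b, \<xi>)\<leftarrow>xs. s (\<xi> (\<iota> a)) (?j b)) = \<iota> a" .
    have 1: "(\<Sum>(b, \<xi>)\<leftarrow>xs. s (\<xi> (\<iota> a)) (?j b)) = a"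
      by (rule inj_onD[OF e(5) eq subspace_sum_pairs[OF e(1,3)] a]) (rule m)
    have 2: "(\<Sum>(b, \<xi>)\<leftarrow>?xs. s (\<xi> (\<iota> a)) b) = (\<Sum>(b, \<xi>)\<leftarrow>xs. s (\<xi> (\<iota> a)) (?j b))"
      by (simp add: case_prod_unfold o_def)
    show "a = (\<Sum>(b, \<xi>)\<leftarrow>?xs. s (\<xi> (\<iota> a)) b)" by (rule sym[OF trans[OF 2 1]])
  qed
qed

definition bilin ::
  "('k::field \<Rightarrow> 'a::ab_group_add \<Rightarrow> 'a) \<Rightarrow> 'a set \<Rightarrow> ('k \<Rightarrow> 'b::ab_group_add \<Rightarrow> 'b) \<Rightarrow> 'b set \<Rightarrow>
   ('k \<Rightarrow> 'c::ab_group_add \<Rightarrow> 'c) \<Rightarrow> ('a \<Rightarrow> 'b \<Rightarrow> 'c) \<Rightarrow> bool"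
  where "bilin s A s' B t f \<longleftrightarrow> (\<forall>b\<in>B. lin_on s t A (\<lambda>a. f a b)) \<and> (\<forall>a\<in>A. lin_on s' t B (f a))"

abbreviation "ubilin X Y \<equiv> bilin uscale X uscale Y uscale"

lemma bilinI:
  "(\<And>b. b \<in> B \<Longrightarrow> lin_on s t A (\<lambda>a. f a b)) \<Longrightarrow> (\<And>a. a \<in> A \<Longrightarrow> lin_on s' t B (\<lambda>b. f a b)) \<Longrightarrow>
   bilin s A s' B t f"
  by (simp add: bilin_def)

lemma lin_comp: "lin_on s s' X f \<Longrightarrow> lin_on s' s'' Y g \<Longrightarrow> f ` X \<subseteq> Y \<Longrightarrow> lin_on s s'' X (\<lambda>x. g (f x))"
  unfolding lin_on_def by (auto simp: image_subset_iff)

text \<open>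
  The universal property of the tensor product, in a strong form: a bilinear map is the restriction of a
  linear map defined on the whole ambient space.  All well-definedness questions about Sweedler sums
  are settled by applying this one map.
\<close>

lemma bilin_extends:
  fixes t :: "'k::field \<Rightarrow> 'c::ab_group_add \<Rightarrow> 'c"
  assumes "emb s A \<iota>" "emb s' B \<kappa>" "vector_space t" "bilin s A s' B t f"
  obtains F where "lin uscale t F" "\<And>a b. a \<in> A \<Longrightarrow> b \<in> B \<Longrightarrow> F (\<iota> a \<otimes> \<kappa> b) = f a b"
proof -
  note e = embD[OF assms(1)] and e' = embD[OF assms(2)]
  interpret v: vector_space s by (rule e)
  interpret v': vector_space s' by (rule e')
  interpret w: vector_space t by fact
  obtain xs where xs: "\<And>b \<xi>. (b, \<xi>) \<in> set xs \<Longrightarrow> b \<in> A \<and> lin uscale (*) \<xi>"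
    "\<And>a. a \<in> A \<Longrightarrow> a = (\<Sum>(b, \<xi>)\<leftarrow>xs. s (\<xi> (\<iota> a)) b)"
    using emb_dual_system[OF assms(1)] by blast
  obtain ys where ys: "\<And>b \<xi>. (b, \<xi>) \<in> set ys \<Longrightarrow> b \<in> B \<and> lin uscale (*) \<xi>"
    "\<And>a. a \<in> B \<Longrightarrow> a = (\<Sum>(b, \<xi>)\<leftarrow>ys. s' (\<xi> (\<kappa> a)) b)"
    using emb_dual_system[OF assms(2)] by blast
  define F where "F u = (\<Sum>p\<leftarrow>xs. \<Sum>q\<leftarrow>ys. t (snd q (contr (snd p) u)) (f (fst p) (fst q)))" for u
  have lin1: "lin uscale t (\<lambda>u. t (\<eta> (contr \<xi> u)) y)" if "lin uscale (*) \<xi>" "lin uscale (*) \<eta>" for \<xi> \<eta> y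
    using lin_onD[OF lin_contr[OF that(1)]] lin_onD[OF that(2)]
    by (auto simp: lin_on_def w.scale_left_distrib)
  have "lin uscale t F" unfolding F_def
    by (intro lin_sum_list[OF assms(3)] lin1) (use xs(1) ys(1) in auto)
  moreover have "F (\<iota> a \<otimes> \<kappa> b) = f a b" if ab: "a \<in> A" "b \<in> B" for a b
  proof -
    have fa: "f a' b = (\<Sum>(c, \<eta>)\<leftarrow>ys. t (\<eta> (\<kappa> b)) (f a' c))" if a': "a' \<in> A" for a'
    proof -
      have l: "lin_on s' t B (f a')" using assms(4) a' by (simp add: bilin_def)
      have "f a' b = f a' (\<Sum>(c, \<eta>)\<leftarrow>ys. s' (\<eta> (\<kappa> b)) c)" by (rule arg_cong[OF ys(2)[OF ab(2)]])
      also have "\<dots> = (\<Sum>(c, \<eta>)\<leftarrow>ys. f a' (s' (\<eta> (\<kappa> b)) c))"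
        by (rule lin_on_sum_pairs[OF e'(1) assms(3) e'(3) l]) (use ys(1) v'.subspace_scale[OF e'(3)] in blast)
      also have "\<dots> = (\<Sum>(c, \<eta>)\<leftarrow>ys. t (\<eta> (\<kappa> b)) (f a' c))"
        by (rule sum_pairs_cong) (use lin_onD(2)[OF l] ys(1) in force)
      finally show ?thesis .
    qed
    have l: "lin_on s t A (\<lambda>a. f a b)" using assms(4) ab by (simp add: bilin_def)
    have "f a b = f (\<Sum>(c, \<xi>)\<leftarrow>xs. s (\<xi> (\<iota> a)) c) b"
      by (rule arg_cong[OF xs(2)[OF ab(1)]])
    also have "\<dots> = (\<Sum>(c, \<xi>)\<leftarrow>xs. f (s (\<xi> (\<iota> a)) c) b)"
      by (rule lin_on_sum_pairs[OF e(1) assms(3) e(3) l]) (use xs(1) v.subspace_scale[OF e(3)] in blast)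
    also have "\<dots> = (\<Sum>p\<leftarrow>xs. \<Sum>q\<leftarrow>ys. t (snd q (contr (snd p) (\<iota> a \<otimes> \<kappa> b))) (f (fst p) (fst q)))"
    proof (intro arg_cong[where f = sum_list] map_cong refl)
      fix p assume p: "p \<in> set xs"
      obtain c \<xi> where [simp]: "p = (c, \<xi>)" by (cases p)
      have c: "c \<in> A" "lin uscale (*) \<xi>" using xs(1) p by auto
      have "f (s (\<xi> (\<iota> a)) c) b = t (\<xi> (\<iota> a)) (f c b)" using lin_onD(2)[OF l] c by simp
      also have "\<dots> = t (\<xi> (\<iota> a)) (\<Sum>q\<leftarrow>ys. t (snd q (\<kappa> b)) (f c (fst q)))"
        using fa[OF c(1)] by (simp add: case_prod_unfold)
      also have "\<dots> = (\<Sum>q\<leftarrow>ys. t (\<xi> (\<iota> a)) (t (snd q (\<kappa> b)) (f c (fst q))))"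
        by (induction ys) (auto simp: w.scale_right_distrib)
      also have "\<dots> = (\<Sum>q\<leftarrow>ys. t (snd q (contr \<xi> (\<iota> a \<otimes> \<kappa> b))) (f c (fst q)))"
      proof (intro arg_cong[where f = sum_list] map_cong refl)
        fix q assume "q \<in> set ys"
        then have "lin uscale (*) (snd q)" using ys(1)[of "fst q" "snd q"] by simp
        then show "t (\<xi> (\<iota> a)) (t (snd q (\<kappa> b)) (f c (fst q))) = t (snd q (contr \<xi> (\<iota> a \<otimes> \<kappa> b))) (f c (fst q))"
          using c(2) lin_onD(2)[of uscale "(*)" UNIV "snd q"] by simp
      qed
      finally show "(case p of (c, \<xi>) \<Rightarrow> f (s (\<xi> (\<iota> a)) c) b)
        = (\<Sum>q\<leftarrow>ys. t (snd q (contr (snd p) (\<iota> a \<otimes> \<kappa> b))) (f (fst p) (fst q)))" by simp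
    qed
    finally show ?thesis by (simp add: F_def)
  qed
  ultimately show thesis using that by blast
qed

subsection \<open>Sweedler sums\<close>

definition trep :: "('a \<Rightarrow> 'b \<Rightarrow> 'k::field univ) \<Rightarrow> 'a set \<Rightarrow> 'b set \<Rightarrow> 'k univ \<Rightarrow> ('a \<times> 'b) list"
  where "trep \<tau> A B t = (SOME xs. set xs \<subseteq> A \<times> B \<and> t = (\<Sum>(a, b)\<leftarrow>xs. \<tau> a b))"

lemma sweedler_trep: "sweedler \<tau> A B t f = (\<Sum>(a, b)\<leftarrow>trep \<tau> A B t. f a b)"
  by (simp add: sweedler_def trep_def)

lemma sweedler_additive:
  assumes "g 0 = 0" "\<And>x y. g (x + y) = g x + g y"
  shows "g (sweedler \<tau> A B t f) = sweedler \<tau> A B t (\<lambda>a b. g (f a b))"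
proof -
  have "g (\<Sum>(a, b)\<leftarrow>xs. f a b) = (\<Sum>(a, b)\<leftarrow>xs. g (f a b))" for xs
    using assms by (induction xs) auto
  then show ?thesis by (simp add: sweedler_trep)
qed

lemma sweedler_lin:
  assumes "vector_space s" "vector_space s'" "lin s s' g"
  shows "g (sweedler \<tau> A B t f) = sweedler \<tau> A B t (\<lambda>a b. g (f a b))"
  using lin_zero[OF assms] lin_onD(1)[OF assms(3)] by (intro sweedler_additive) auto

lemma sweedler_swap:
  "sweedler \<tau> A B t (\<lambda>a b. sweedler \<tau>' A' B' t' (\<lambda>c d. f a b c d :: 'c::comm_monoid_add)) =
   sweedler \<tau>' A' B' t' (\<lambda>c d. sweedler \<tau> A B t (\<lambda>a b. f a b c d))"
proof -
  have "(\<Sum>(a, b)\<leftarrow>xs. \<Sum>(c, d)\<leftarrow>ys. f a b c d) = (\<Sum>(c, d)\<leftarrow>ys. \<Sum>(a, b)\<leftarrow>xs. f a b c d)" for xs ys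
  proof (induction xs)
    case Nil show ?case by (induction ys) auto
  next
    case (Cons p xs)
    then show ?case by (cases p) (simp add: case_prod_unfold sum_list_addf)
  qed
  then show ?thesis by (simp add: sweedler_trep)
qed

lemma sweedler_ext: "(\<And>a b. f a b = g a b) \<Longrightarrow> sweedler \<tau> A B t f = sweedler \<tau> A B t g"
  by (rule arg_cong[where f = "sweedler \<tau> A B t"]) (intro ext)

lemma sweedler_add:
  "sweedler \<tau> A B t (\<lambda>a b. f a b + g a b :: 'c::comm_monoid_add) = sweedler \<tau> A B t f + sweedler \<tau> A B t g"
  by (simp add: sweedler_trep case_prod_unfold sum_list_addf)

lemma sweedler_zero: "sweedler \<tau> A B t (\<lambda>a b. 0 :: 'c::comm_monoid_add) = 0"
  by (simp add: sweedler_trep case_prod_unfold)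

lemma lin_on_sweedler:
  assumes "vector_space s'" "\<And>a b. lin_on s s' X (\<lambda>x. f x a b)"
  shows "lin_on s s' X (\<lambda>x. sweedler \<tau> A B t (f x))"
  unfolding sweedler_trep using assms(2)
  by (intro lin_sum_list[OF assms(1)]) (auto simp: case_prod_unfold)

context
  fixes s :: "'k::field \<Rightarrow> 'a::ab_group_add \<Rightarrow> 'a" and A \<iota>
    and s' :: "'k \<Rightarrow> 'b::ab_group_add \<Rightarrow> 'b" and B \<kappa>
  assumes eA: "emb s A \<iota>" and eB: "emb s' B \<kappa>"
begin

abbreviation (input) "T \<equiv> tensor_space (\<lambda>a b. \<iota> a \<otimes> \<kappa> b) A B"
abbreviation (input) "sw \<equiv> sweedler (\<lambda>a b. \<iota> a \<otimes> \<kappa> b) A B"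

lemma tensor_space_subspace: "usub T"
  by (simp add: tensor_space_def)

lemma tensor_space_pure: "a \<in> A \<Longrightarrow> b \<in> B \<Longrightarrow> \<iota> a \<otimes> \<kappa> b \<in> T"
  unfolding tensor_space_def by (rule uv.span_base) auto

lemma tensor_space_list: "t \<in> T \<longleftrightarrow> (\<exists>xs. set xs \<subseteq> A \<times> B \<and> t = (\<Sum>(a, b)\<leftarrow>xs. \<iota> a \<otimes> \<kappa> b))"
proof
  interpret v: vector_space s by (rule embD[OF eA])
  assume "t \<in> T"
  then have "t \<in> uv.span {\<iota> a \<otimes> \<kappa> b |a b. a \<in> A \<and> b \<in> B}" by (simp add: tensor_space_def)
  then show "\<exists>xs. set xs \<subseteq> A \<times> B \<and> t = (\<Sum>(a, b)\<leftarrow>xs. \<iota> a \<otimes> \<kappa> b)"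
  proof (induction rule: uv.span_induct_alt)
    case base show ?case by (rule exI[of _ "[]"]) simp
  next
    case (step c x y)
    then obtain a b xs where *: "a \<in> A" "b \<in> B" "x = \<iota> a \<otimes> \<kappa> b" "set xs \<subseteq> A \<times> B"
      "y = (\<Sum>(a, b)\<leftarrow>xs. \<iota> a \<otimes> \<kappa> b)" by blast
    have "s c a \<in> A" using v.subspace_scale[OF embD(3)[OF eA]] * by blast
    moreover have "\<iota> (s c a) = c *\<^sub>u \<iota> a" using lin_onD(2)[OF embD(4)[OF eA]] * by blast
    ultimately show ?case using * by (intro exI[of _ "(s c a, b) # xs"]) (simp add: kron_left)
  qed
next
  assume "\<exists>xs. set xs \<subseteq> A \<times> B \<and> t = (\<Sum>(a, b)\<leftarrow>xs. \<iota> a \<otimes> \<kappa> b)"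
  then obtain xs where "set xs \<subseteq> A \<times> B" "t = (\<Sum>(a, b)\<leftarrow>xs. \<iota> a \<otimes> \<kappa> b)" by blast
  then show "t \<in> T"
    using subspace_sum_pairs[OF vs_u tensor_space_subspace, of xs "\<lambda>a b. \<iota> a \<otimes> \<kappa> b"]
    by (auto intro: tensor_space_pure)
qed

lemma trep_spec:
  assumes "t \<in> T"
  shows "set (trep (\<lambda>a b. \<iota> a \<otimes> \<kappa> b) A B t) \<subseteq> A \<times> B"
    and "t = (\<Sum>(a, b)\<leftarrow>trep (\<lambda>a b. \<iota> a \<otimes> \<kappa> b) A B t. \<iota> a \<otimes> \<kappa> b)"
  using someI_ex[OF assms[unfolded tensor_space_list]] unfolding trep_def by blast+

lemma sweedler_extends:
  fixes r :: "'k \<Rightarrow> 'c::ab_group_add \<Rightarrow> 'c"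
  assumes "vector_space r" "bilin s A s' B r f"
  obtains F where "lin uscale r F" "\<And>a b. a \<in> A \<Longrightarrow> b \<in> B \<Longrightarrow> F (\<iota> a \<otimes> \<kappa> b) = f a b"
    "\<And>t. t \<in> T \<Longrightarrow> sw t f = F t"
proof -
  obtain F where F: "lin uscale r F" "\<And>a b. a \<in> A \<Longrightarrow> b \<in> B \<Longrightarrow> F (\<iota> a \<otimes> \<kappa> b) = f a b"
    using bilin_extends[OF eA eB assms] by blast
  have "sw t f = F t" if t: "t \<in> T" for t
  proof -
    let ?xs = "trep (\<lambda>a b. \<iota> a \<otimes> \<kappa> b) A B t"
    have "F t = F (\<Sum>(a, b)\<leftarrow>?xs. \<iota> a \<otimes> \<kappa> b)" by (rule arg_cong[OF trep_spec(2)[OF t]])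
    also have "\<dots> = (\<Sum>(a, b)\<leftarrow>?xs. F (\<iota> a \<otimes> \<kappa> b))"
      by (rule lin_sum_pairs[OF vs_u assms(1) F(1)])
    also have "\<dots> = (\<Sum>(a, b)\<leftarrow>?xs. f a b)"
      by (rule sum_pairs_cong) (use trep_spec(1)[OF t] F(2) in auto)
    finally show ?thesis by (simp add: sweedler_trep)
  qed
  with F show thesis using that by blast
qed

lemma lin_sweedler_arg:
  assumes "vector_space r" "bilin s A s' B r f"
  shows "lin_on uscale r T (\<lambda>t. sw t f)"
proof (rule sweedler_extends[OF assms])
  fix F assume F: "lin uscale r F" "\<And>t. t \<in> T \<Longrightarrow> sw t f = F t"
  show ?thesis
  proof (rule lin_onI)
    fix x y assume "x \<in> T" "y \<in> T"
    then show "sw (x + y) f = sw x f + sw y f"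
      using F(2) uv.subspace_add[OF tensor_space_subspace] lin_onD(1)[OF F(1) UNIV_I UNIV_I] by metis
  next
    fix c x assume "x \<in> T"
    then show "sw (c *\<^sub>u x) f = r c (sw x f)"
      using F(2) uv.subspace_scale[OF tensor_space_subspace] lin_onD(2)[OF F(1) UNIV_I] by metis
  qed
qed

lemma sweedler_pure:
  assumes "vector_space r" "bilin s A s' B r f" "a \<in> A" "b \<in> B"
  shows "sw (\<iota> a \<otimes> \<kappa> b) f = f a b"
proof (rule sweedler_extends[OF assms(1,2)])
  fix F assume F: "\<And>a b. a \<in> A \<Longrightarrow> b \<in> B \<Longrightarrow> F (\<iota> a \<otimes> \<kappa> b) = f a b" "\<And>t. t \<in> T \<Longrightarrow> sw t f = F t"
  show ?thesis unfolding F(2)[OF tensor_space_pure[OF assms(3,4)]] by (rule F(1)[OF assms(3,4)])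
qed

lemma sweedler_cong:
  assumes "t \<in> T" "\<And>a b. a \<in> A \<Longrightarrow> b \<in> B \<Longrightarrow> f a b = g a b"
  shows "sw t f = sw t g"
  unfolding sweedler_trep
  by (rule sum_pairs_cong) (use trep_spec(1)[OF assms(1)] assms(2) in auto)

lemma sweedler_self: "t \<in> T \<Longrightarrow> sw t (\<lambda>a b. \<iota> a \<otimes> \<kappa> b) = t"
  unfolding sweedler_trep by (rule trep_spec(2)[symmetric])

lemma sweedler_in:
  assumes "vector_space r" "module.subspace r Y" "t \<in> T" "\<And>a b. a \<in> A \<Longrightarrow> b \<in> B \<Longrightarrow> f a b \<in> Y"
  shows "sw t f \<in> Y"
  unfolding sweedler_trep
  by (rule subspace_sum_pairs[OF assms(1,2)]) (use trep_spec(1)[OF assms(3)] assms(4) in auto)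

lemma sweedler_lin_on:
  assumes "vector_space r" "vector_space r'" "module.subspace r Y" "lin_on r r' Y g" "t \<in> T"
    and "\<And>a b. a \<in> A \<Longrightarrow> b \<in> B \<Longrightarrow> f a b \<in> Y"
  shows "g (sw t f) = sw t (\<lambda>a b. g (f a b))"
  unfolding sweedler_trep
  by (rule lin_on_sum_pairs[OF assms(1-4)]) (use trep_spec(1)[OF assms(5)] assms(6) in auto)

lemma lin_on_sweedler_in:
  assumes "vector_space r'" "t \<in> T" "\<And>a b. a \<in> A \<Longrightarrow> b \<in> B \<Longrightarrow> lin_on r r' X (\<lambda>x. f x a b)"
  shows "lin_on r r' X (\<lambda>x. sw t (f x))"
  unfolding sweedler_trep
  by (rule lin_sum_list[OF assms(1)]) (use trep_spec(1)[OF assms(2)] assms(3) in \<open>auto simp: case_prod_unfold\<close>)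

end

lemma row_sum_pairs: "row i (\<Sum>(a, b)\<leftarrow>xs. f a b) = (\<Sum>(a, b)\<leftarrow>xs. row i (f a b))"
  by (rule lin_sum_pairs[OF vs_u vs_u lin_row])

lemma kron_expansion:
  assumes "\<And>b \<xi>. (b, \<xi>) \<in> set xs \<Longrightarrow> lin uscale (*) \<xi>"
    and "\<And>x. x \<in> X \<Longrightarrow> x = (\<Sum>(b, \<xi>)\<leftarrow>xs. \<xi> x *\<^sub>u b)" and "\<And>j. col j t \<in> X"
  shows "t = (\<Sum>(b, \<xi>)\<leftarrow>xs. b \<otimes> contr \<xi> t)"
proof (rule row_eqI)
  fix i
  have "row i t j = row i (\<Sum>(b, \<xi>)\<leftarrow>xs. b \<otimes> contr \<xi> t) j" for j
  proof -
    have "row i t j = col j t i" by (simp add: row_def col_def)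
    also have "\<dots> = (\<Sum>(b, \<xi>)\<leftarrow>xs. \<xi> (col j t) *\<^sub>u b) i" by (rule fun_cong[OF assms(2)[OF assms(3)]])
    also have "\<dots> = row i (\<Sum>(b, \<xi>)\<leftarrow>xs. b \<otimes> contr \<xi> t) j"
      unfolding row_sum_pairs by (simp add: sum_list_apply contr_def mult.commute)
    finally show ?thesis .
  qed
  then show "row i t = row i (\<Sum>(b, \<xi>)\<leftarrow>xs. b \<otimes> contr \<xi> t)" by (rule ext)
qed

text \<open>
  Expanding the columns in a dual system of \<open>X\<close> writes \<open>t\<close> as a sum of \<open>b \<otimes> contr \<xi> t\<close>; each contraction is a
  combination of rows, hence lies in \<open>Y\<close>.
\<close>

lemma tensor_sp_rows_cols:
  assumes X: "fd X" and Y: "fd Y"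
    and c: "\<And>j. col j t \<in> X" and r: "\<And>i. row i t \<in> Y"
  shows "t \<in> tensor_sp X Y"
proof -
  obtain xs where "dual_sys uscale X xs" by (rule dual_system[OF vs_u X])
  note xs = dual_sysD[OF this]
  obtain ys where "dual_sys uscale Y ys" by (rule dual_system[OF vs_u Y])
  note ys = dual_sysD[OF this]
  have uY: "usub Y" by (rule fin_dim_subspace[OF vs_u Y])
  have row: "contr \<xi> t \<in> Y" if "(b, \<xi>) \<in> set xs" for b \<xi>
  proof -
    have \<xi>: "lin uscale (*) \<xi>" using xs(1)[OF that] ..
    have "col j t = (\<Sum>(y, \<eta>)\<leftarrow>ys. y j *\<^sub>u (\<lambda>i. \<eta> (row i t)))" for j
    proof
      fix i
      have "col j t i = row i t j" by (simp add: row_def col_def)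
      also have "\<dots> = (\<Sum>(y, \<eta>)\<leftarrow>ys. \<eta> (row i t) *\<^sub>u y) j" by (rule fun_cong[OF ys(2)[OF r]])
      finally show "col j t i = (\<Sum>(y, \<eta>)\<leftarrow>ys. y j *\<^sub>u (\<lambda>i. \<eta> (row i t))) i"
        by (simp add: sum_list_apply mult.commute)
    qed
    then have "contr \<xi> t = (\<lambda>j. \<Sum>(y, \<eta>)\<leftarrow>ys. y j * \<xi> (\<lambda>i. \<eta> (row i t)))"
      unfolding contr_def
      by (simp add: lin_sum_pairs[OF vs_u vs_k \<xi>] lin_onD(2)[OF \<xi>])
    also have "\<dots> = (\<Sum>(y, \<eta>)\<leftarrow>ys. \<xi> (\<lambda>i. \<eta> (row i t)) *\<^sub>u y)"
      by (simp add: fun_eq_iff sum_list_apply mult.commute)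
    also have "\<dots> \<in> Y"
      by (rule subspace_sum_pairs[OF vs_u uY]) (use ys(1) uv.subspace_scale[OF uY] in blast)
    finally show ?thesis .
  qed
  have "t = (\<Sum>(b, \<xi>)\<leftarrow>xs. b \<otimes> contr \<xi> t)" by (rule kron_expansion[of xs X]) (use xs c in blast)+
  also have "\<dots> \<in> tensor_sp X Y" unfolding tensor_space_def
    by (intro subspace_sum_pairs[OF vs_u uv.subspace_span] uv.span_base) (use xs(1) row in blast)
  finally show ?thesis .
qed

section \<open>Tensor products of linear maps\<close>

lemma pure_in [simp, intro]: "x \<in> X \<Longrightarrow> y \<in> Y \<Longrightarrow> x \<otimes> y \<in> tensor_sp X Y"
  unfolding tensor_space_def by (rule uv.span_base) blast

lemma lin_on_eq_on_span:
  assumes "vector_space s" "vector_space s'" "lin_on s s' (module.span s S) f" "lin_on s s' (module.span s S) g"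
    and "\<And>x. x \<in> S \<Longrightarrow> f x = g x" and x: "x \<in> module.span s S"
  shows "f x = g x"
proof -
  interpret v: vector_space s by fact
  interpret w: vector_space s' by fact
  note 0 = lin_on_zero[OF assms(1,2) v.subspace_span]
  have "x \<in> v.span S \<and> f x = g x" using x
  proof (induction rule: v.span_induct_alt)
    case base show ?case using 0[OF assms(3)] 0[OF assms(4)] v.span_zero by simp
  next
    case (step c x y)
    then have "x \<in> v.span S" "y \<in> v.span S" by (auto intro: v.span_base)
    moreover from this have "s c x \<in> v.span S" by (intro v.span_scale)
    ultimately show ?case
      using step assms(5)[of x] lin_onD[OF assms(3)] lin_onD[OF assms(4)] by (simp add: v.span_add)
  qed
  then show ?thesis ..
qed

lemma lin_mapsD:
  assumes "f \<in> lin_maps X Y"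
  shows "ulin X f" "x \<in> X \<Longrightarrow> f x \<in> Y" "x \<notin> X \<Longrightarrow> f x = 0"
  using assms by (auto simp: lin_maps_def)

lemma lin_maps_eqI:
  assumes "f \<in> lin_maps X Y" "g \<in> lin_maps X Y'" "X = uv.span S" "\<And>x. x \<in> S \<Longrightarrow> f x = g x"
  shows "f = g"
proof
  fix x
  show "f x = g x"
  proof (cases "x \<in> X")
    case True
    then show ?thesis
      using lin_on_eq_on_span[OF vs_u vs_u, of S f g x] assms lin_mapsD(1) by blast
  qed (use assms lin_mapsD(3) in metis)
qed

lemma lin_maps_comp: "f \<in> lin_maps X Y \<Longrightarrow> g \<in> lin_maps Y Z \<Longrightarrow> usub Y \<Longrightarrow> g \<circ> f \<in> lin_maps X Z"
  unfolding lin_maps_def lin_on_def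
  using lin_on_zero[OF vs_u vs_u, of Y g]
  by (auto simp: image_subset_iff lin_on_def)

lemma id_map_lin_maps: "usub X \<Longrightarrow> id_map X \<in> lin_maps X X"
  by (auto simp: lin_maps_def lin_on_def id_map_def uv.subspace_add uv.subspace_scale)

lemma id_map_apply [simp]: "x \<in> X \<Longrightarrow> id_map X x = x"
  by (simp add: id_map_def)

lemma tensor_sp_subspace [simp]: "usub (tensor_sp X Y)"
  by (simp add: tensor_space_def)

lemma tensor_sp_span: "tensor_sp X Y = uv.span {x \<otimes> y |x y. x \<in> X \<and> y \<in> Y}"
  by (simp add: tensor_space_def)

lemma tensor_sp_span_gen:
  assumes "X = uv.span S" "Y = uv.span Z"
  shows "tensor_sp X Y = uv.span {x \<otimes> y |x y. x \<in> S \<and> y \<in> Z}"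
proof
  let ?S = "{x \<otimes> y |x y. x \<in> S \<and> y \<in> Z}"
  have "x \<otimes> y \<in> uv.span ?S" if "x \<in> uv.span S" "y \<in> uv.span Z" for x y
    using that(1)
  proof (induction rule: uv.span_induct_alt)
    case base show ?case unfolding kron_left by (rule uv.span_zero)
  next
    case (step c x z)
    have "x \<otimes> y \<in> uv.span ?S" using that(2)
    proof (induction rule: uv.span_induct_alt)
      case base show ?case unfolding kron_right by (rule uv.span_zero)
    next
      case (step d w z)
      then have "x \<otimes> w \<in> ?S" using \<open>x \<in> S\<close> by blast
      then show ?case unfolding kron_right by (intro uv.span_add uv.span_scale uv.span_base step(2))
    qed
    then show ?case unfolding kron_left by (intro uv.span_add uv.span_scale step(2))
  qed
  then show "tensor_sp X Y \<subseteq> uv.span ?S"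
    unfolding tensor_space_def by (intro uv.span_minimal) (use assms in auto)
  show "uv.span ?S \<subseteq> tensor_sp X Y"
    unfolding tensor_space_def by (intro uv.span_mono) (use assms uv.span_base in blast)
qed

lemma fin_dim_tensor_sp:
  assumes "fd X" "fd Y"
  shows "fd (tensor_sp X Y)"
proof -
  obtain S Z where S: "finite S" "X = uv.span S" "finite Z" "Y = uv.span Z" using assms by (auto simp: fin_dim_def)
  have "finite {x \<otimes> y |x y. x \<in> S \<and> y \<in> Z}" using S by (intro finite_image_set2) auto
  then show ?thesis unfolding fin_dim_def tensor_sp_span_gen[OF S(2,4)] by blast
qed

lemma fin_dim_tensor_space:
  assumes A: "emb s A \<iota>" and B: "emb s' B \<kappa>"
  shows "fd (tensor_space (\<lambda>a b. \<iota> a \<otimes> \<kappa> b) A B)"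
proof -
  have "tensor_space (\<lambda>a b. \<iota> a \<otimes> \<kappa> b) A B = tensor_sp (\<iota> ` A) (\<kappa> ` B)"
    unfolding tensor_space_def by (rule arg_cong[where f = uv.span]) blast
  then show ?thesis
    using fin_dim_tensor_sp[OF fin_dim_image[OF embD(1)[OF A] vs_u embD(2,4)[OF A]] fin_dim_image[OF embD(1)[OF B] vs_u embD(2,4)[OF B]]]
    by simp
qed

lemma subspace_span_self: "usub X \<Longrightarrow> X = uv.span X"
  by (rule uv.span_eq_iff[THEN iffD2, symmetric])

lemma tensor_sp_span_left:
  assumes "usub Z"
  shows "tensor_sp (tensor_sp X Y) Z = uv.span {(x \<otimes> y) \<otimes> z |x y z. x \<in> X \<and> y \<in> Y \<and> z \<in> Z}"
  unfolding tensor_sp_span_gen[OF tensor_sp_span subspace_span_self[OF assms]]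
  by (rule arg_cong[where f = uv.span]) blast

lemma tensor_sp_span_right:
  assumes "usub X"
  shows "tensor_sp X (tensor_sp Y Z) = uv.span {x \<otimes> (y \<otimes> z) |x y z. x \<in> X \<and> y \<in> Y \<and> z \<in> Z}"
  unfolding tensor_sp_span_gen[OF subspace_span_self[OF assms] tensor_sp_span]
  by (rule arg_cong[where f = uv.span]) blast

lemma tensor_sp_span_left4:
  assumes "usub Z" "usub U"
  shows "tensor_sp (tensor_sp (tensor_sp X Y) Z) U =
    uv.span {((x \<otimes> y) \<otimes> z) \<otimes> u |x y z u. x \<in> X \<and> y \<in> Y \<and> z \<in> Z \<and> u \<in> U}"
  unfolding tensor_sp_span_gen[OF tensor_sp_span_left[OF assms(1)] subspace_span_self[OF assms(2)]]
  by (rule arg_cong[where f = uv.span]) blast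

lemma tensor_lift_pure:
  assumes "fd X" "fd Y" "ubilin X Y f" "x \<in> X" "y \<in> Y"
  shows "tensor_lift (\<otimes>) X Y f (x \<otimes> y) = f x y"
  using sweedler_pure[OF emb_id[OF assms(1)] emb_id[OF assms(2)] vs_u assms(3-5)] assms(4,5)
  by (simp add: tensor_lift_def)

lemma tensor_lift_lin_maps:
  assumes "fd X" "fd Y" "ubilin X Y f"
    and "usub Z" "\<And>x y. x \<in> X \<Longrightarrow> y \<in> Y \<Longrightarrow> f x y \<in> Z"
  shows "tensor_lift (\<otimes>) X Y f \<in> lin_maps (tensor_sp X Y) Z"
proof -
  note e = emb_id[OF assms(1)] emb_id[OF assms(2)]
  have "ulin (tensor_sp X Y) (tensor_lift (\<otimes>) X Y f)"
    using lin_sweedler_arg[OF e vs_u assms(3)]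
    by (simp add: tensor_lift_def lin_on_def uv.subspace_add uv.subspace_scale)
  moreover have "tensor_lift (\<otimes>) X Y f t \<in> Z" if "t \<in> tensor_sp X Y" for t
    using sweedler_in[OF e vs_u assms(4) _ assms(5), of t] that by (simp add: tensor_lift_def)
  ultimately show ?thesis by (auto simp: lin_maps_def tensor_lift_def)
qed

lemma bilin_kron_maps:
  assumes "ulin X f" "ulin Y g"
  shows "ubilin X Y (\<lambda>x y. f x \<otimes> g y)"
  using assms by (auto simp: bilin_def lin_on_def kron_left kron_right)

lemma tensor_map_lin_maps:
  assumes "fd X" "fd Y" "f \<in> lin_maps X X'" "g \<in> lin_maps Y Y'"
  shows "tensor_map X Y f g \<in> lin_maps (tensor_sp X Y) (tensor_sp X' Y')"
  unfolding tensor_map_def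
  by (intro tensor_lift_lin_maps bilin_kron_maps assms tensor_sp_subspace pure_in
      lin_mapsD(1)[OF assms(3)] lin_mapsD(1)[OF assms(4)] lin_mapsD(2)[OF assms(3)] lin_mapsD(2)[OF assms(4)])

lemma tensor_map_pure:
  assumes "fd X" "fd Y" "f \<in> lin_maps X X'" "g \<in> lin_maps Y Y'" "x \<in> X" "y \<in> Y"
  shows "tensor_map X Y f g (x \<otimes> y) = f x \<otimes> g y"
  unfolding tensor_map_def
  by (intro tensor_lift_pure bilin_kron_maps assms lin_mapsD(1)[OF assms(3)] lin_mapsD(1)[OF assms(4)])

lemma sweedler_kron_bilin:
  assumes X: "fd X" and Y: "fd Y"
    and f: "\<And>z. z \<in> Z \<Longrightarrow> ubilin X Y (\<lambda>x y. f x y z)"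
    and g: "\<And>x y. x \<in> X \<Longrightarrow> y \<in> Y \<Longrightarrow> ulin Z (f x y)"
  shows "ubilin (tensor_sp X Y) Z (\<lambda>t z. sweedler (\<otimes>) X Y t (\<lambda>x y. f x y z))"
proof (rule bilinI)
  note e = emb_id[OF X] emb_id[OF Y]
  show "ulin (tensor_sp X Y) (\<lambda>t. sweedler (\<otimes>) X Y t (\<lambda>x y. f x y z))" if "z \<in> Z" for z
    using lin_sweedler_arg[OF e vs_u f[OF that]] .
  show "ulin Z (\<lambda>z. sweedler (\<otimes>) X Y t (\<lambda>x y. f x y z))" if "t \<in> tensor_sp X Y" for t
    using lin_on_sweedler_in[OF e vs_u that, of uscale Z "\<lambda>z x y. f x y z"] g by blast
qed

lemma assoc_bilin: "ubilin X Y (\<lambda>x y. x \<otimes> y \<otimes> z)" "ulin Z (\<lambda>z. x \<otimes> y \<otimes> z)"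
  by (auto simp: bilin_def lin_on_def kron_left kron_right)

lemma assoc_map_pure:
  assumes "fd X" "fd Y" "fd Z" "x \<in> X" "y \<in> Y" "z \<in> Z"
  shows "assoc_map X Y Z ((x \<otimes> y) \<otimes> z) = x \<otimes> (y \<otimes> z)"
proof -
  have "assoc_map X Y Z ((x \<otimes> y) \<otimes> z) = sweedler (\<otimes>) X Y (x \<otimes> y) (\<lambda>x y. x \<otimes> y \<otimes> z)"
    unfolding assoc_map_def
    by (intro tensor_lift_pure fin_dim_tensor_sp sweedler_kron_bilin assoc_bilin assms pure_in)
  also have "\<dots> = x \<otimes> y \<otimes> z"
    using sweedler_pure[OF emb_id[OF assms(1)] emb_id[OF assms(2)] vs_u assoc_bilin(1) assms(4,5)] .
  finally show ?thesis .
qed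

lemma assoc_map_lin_maps:
  assumes "fd X" "fd Y" "fd Z"
  shows "assoc_map X Y Z \<in> lin_maps (tensor_sp (tensor_sp X Y) Z) (tensor_sp X (tensor_sp Y Z))"
  unfolding assoc_map_def
proof (intro tensor_lift_lin_maps fin_dim_tensor_sp sweedler_kron_bilin assoc_bilin assms tensor_sp_subspace)
  fix t z assume "t \<in> tensor_sp X Y" "z \<in> Z"
  then show "sweedler (\<otimes>) X Y t (\<lambda>x y. x \<otimes> y \<otimes> z) \<in> tensor_sp X (tensor_sp Y Z)"
    using sweedler_in[OF emb_id[OF assms(1)] emb_id[OF assms(2)] vs_u tensor_sp_subspace, of t "\<lambda>x y. x \<otimes> y \<otimes> z" X "tensor_sp Y Z"]
    by auto
qed

definition assoc_inv :: "'k::field univ set \<Rightarrow> 'k univ set \<Rightarrow> 'k univ set \<Rightarrow> 'k univ \<Rightarrow> 'k univ"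
  where "assoc_inv X Y Z = tensor_lift (\<otimes>) X (tensor_sp Y Z) (\<lambda>x t. sweedler (\<otimes>) Y Z t (\<lambda>y z. (x \<otimes> y) \<otimes> z))"

lemma assoc_inv_bilin:
  assumes "fd Y" "fd Z"
  shows "ubilin X (tensor_sp Y Z) (\<lambda>x t. sweedler (\<otimes>) Y Z t (\<lambda>y z. (x \<otimes> y) \<otimes> z))"
proof (rule bilinI)
  note e = emb_id[OF assms(1)] emb_id[OF assms(2)]
  show "ulin X (\<lambda>x. sweedler (\<otimes>) Y Z t (\<lambda>y z. (x \<otimes> y) \<otimes> z))" for t
    by (intro lin_on_sweedler vs_u) (auto simp: lin_on_def kron_left)
  show "ulin (tensor_sp Y Z) (\<lambda>t. sweedler (\<otimes>) Y Z t (\<lambda>y z. (x \<otimes> y) \<otimes> z))" for x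
    by (rule lin_sweedler_arg[OF e vs_u]) (auto simp: bilin_def lin_on_def kron_left kron_right)
qed

lemma assoc_inv_pure:
  assumes "fd X" "fd Y" "fd Z" "x \<in> X" "y \<in> Y" "z \<in> Z"
  shows "assoc_inv X Y Z (x \<otimes> (y \<otimes> z)) = (x \<otimes> y) \<otimes> z"
proof -
  have "assoc_inv X Y Z (x \<otimes> (y \<otimes> z)) = sweedler (\<otimes>) Y Z (y \<otimes> z) (\<lambda>y z. (x \<otimes> y) \<otimes> z)"
    unfolding assoc_inv_def
    by (intro tensor_lift_pure fin_dim_tensor_sp assoc_inv_bilin assms pure_in)
  also have "\<dots> = (x \<otimes> y) \<otimes> z"
    by (rule sweedler_pure[OF emb_id[OF assms(2)] emb_id[OF assms(3)] vs_u _ assms(5,6)])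
      (auto simp: bilin_def lin_on_def kron_left kron_right)
  finally show ?thesis .
qed

lemma assoc_inv_lin_maps:
  assumes "fd X" "fd Y" "fd Z"
  shows "assoc_inv X Y Z \<in> lin_maps (tensor_sp X (tensor_sp Y Z)) (tensor_sp (tensor_sp X Y) Z)"
  unfolding assoc_inv_def
proof (intro tensor_lift_lin_maps fin_dim_tensor_sp assoc_inv_bilin assms tensor_sp_subspace)
  fix x t assume "t \<in> tensor_sp Y Z" "x \<in> X"
  then show "sweedler (\<otimes>) Y Z t (\<lambda>y z. (x \<otimes> y) \<otimes> z) \<in> tensor_sp (tensor_sp X Y) Z"
    using sweedler_in[OF emb_id[OF assms(2)] emb_id[OF assms(3)] vs_u tensor_sp_subspace, of t "\<lambda>y z. (x \<otimes> y) \<otimes> z" "tensor_sp X Y" Z]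
    by auto
qed

definition unit_vec :: "'k::field univ" where "unit_vec i = (if i = 0 then 1 else 0)"

lemma unit_vec_0 [simp]: "unit_vec 0 = 1"
  by (simp add: unit_vec_def)

lemma unit_sp_span: "unit_sp = uv.span {unit_vec :: 'k::field univ}"
proof
  show "unit_sp \<subseteq> uv.span {unit_vec :: 'k univ}"
  proof
    fix x :: "'k univ" assume "x \<in> unit_sp"
    then have "x = x 0 *\<^sub>u unit_vec" by (auto simp: unit_sp_def unit_vec_def fun_eq_iff)
    then show "x \<in> uv.span {unit_vec}" by (metis uv.span_base uv.span_scale singletonI)
  qed
  show "uv.span {unit_vec :: 'k univ} \<subseteq> unit_sp"
    by (rule uv.span_minimal) (auto simp: unit_sp_def unit_vec_def uv.subspace_def)
qed

lemma fin_dim_unit_sp: "fd (unit_sp :: 'k::field univ set)"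
  unfolding fin_dim_def unit_sp_span by blast

lemma unit_vec_in [simp]: "unit_vec \<in> unit_sp"
  by (simp add: unit_sp_span uv.span_base)

lemma unit_bilin: "ubilin X Y (\<lambda>c x. c 0 *\<^sub>u x)" "ubilin X Y (\<lambda>x c. c 0 *\<^sub>u x)"
  by (auto simp: bilin_def lin_on_def fun_eq_iff algebra_simps)

lemma lunit_map_pure: "fd X \<Longrightarrow> c \<in> unit_sp \<Longrightarrow> x \<in> X \<Longrightarrow> lunit_map X (c \<otimes> x) = c 0 *\<^sub>u x"
  unfolding lunit_map_def by (intro tensor_lift_pure fin_dim_unit_sp unit_bilin)

lemma runit_map_pure: "fd X \<Longrightarrow> c \<in> unit_sp \<Longrightarrow> x \<in> X \<Longrightarrow> runit_map X (x \<otimes> c) = c 0 *\<^sub>u x"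
  unfolding runit_map_def by (intro tensor_lift_pure fin_dim_unit_sp unit_bilin)

lemma lunit_map_lin_maps: "fd X \<Longrightarrow> lunit_map X \<in> lin_maps (tensor_sp unit_sp X) X"
  unfolding lunit_map_def
  by (intro tensor_lift_lin_maps fin_dim_unit_sp unit_bilin fin_dim_subspace[OF vs_u])
    (auto intro: uv.subspace_scale fin_dim_subspace[OF vs_u])

lemma runit_map_lin_maps: "fd X \<Longrightarrow> runit_map X \<in> lin_maps (tensor_sp X unit_sp) X"
  unfolding runit_map_def
  by (intro tensor_lift_lin_maps fin_dim_unit_sp unit_bilin fin_dim_subspace[OF vs_u])
    (auto intro: uv.subspace_scale fin_dim_subspace[OF vs_u])

definition unit_inv :: "bool \<Rightarrow> 'k::field univ set \<Rightarrow> 'k univ \<Rightarrow> 'k univ"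
  where "unit_inv left X x = (if x \<in> X then if left then unit_vec \<otimes> x else x \<otimes> unit_vec else 0)"

lemma unit_inv_lin_maps:
  assumes "fd X"
  shows "unit_inv True X \<in> lin_maps X (tensor_sp unit_sp X)" "unit_inv False X \<in> lin_maps X (tensor_sp X unit_sp)"
  using fin_dim_subspace[OF vs_u assms]
  by (auto simp: lin_maps_def lin_on_def unit_inv_def uv.subspace_add uv.subspace_scale kron_left kron_right)

section \<open>Module categories of spaces with operators\<close>

abbreviation marr_of :: "'o \<Rightarrow> 'o \<Rightarrow> ('k univ \<Rightarrow> 'k univ) \<Rightarrow> ('k, 'o) mor"
  where "marr_of U V \<phi> \<equiv> \<lparr>src = U, tgt = V, fn = \<phi>\<rparr>"

lemmas vmc_simps = vec_module_cat_def concrete_cat_def cat.extend_def modcat.fields_def moncat.fields_def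

lemma homset_vmc:
  "f \<in> homset (vec_module_cat (concrete_cat Ob car hm) c a) U V \<longleftrightarrow>
    U \<in> Ob \<and> V \<in> Ob \<and> (\<exists>\<phi>\<in>hm U V. f = marr_of U V \<phi>)"
  by (cases f) (auto simp: homset_def vmc_simps)

lemma homset_Vec:
  "f \<in> homset Vec X Y \<longleftrightarrow>
    fd X \<and> fd Y \<and> (\<exists>\<phi>\<in>lin_maps X Y. f = marr_of X Y \<phi>)"
  by (cases f) (auto simp: homset_def Vec_def vmc_simps)

lemma Vec_sel [simp]:
  "Obj Vec = {X. fd X}" "Id Vec X = marr_of X X (id_map X)"
  "Comp Vec g f = marr_of (src f) (tgt g) (fn g \<circ> fn f)"
  "tob Vec X Y = tensor_sp X Y"
  "tarr Vec f g = marr_of (tensor_sp (src f) (src g)) (tensor_sp (tgt f) (tgt g)) (tensor_map (src f) (src g) (fn f) (fn g))"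
  "tunit Vec = unit_sp"
  "tassoc Vec X Y Z = marr_of (tensor_sp (tensor_sp X Y) Z) (tensor_sp X (tensor_sp Y Z)) (assoc_map X Y Z)"
  "lunit Vec X = marr_of (tensor_sp unit_sp X) X (lunit_map X)"
  "runit Vec X = marr_of (tensor_sp X unit_sp) X (runit_map X)"
  by (auto simp: Vec_def vmc_simps)

lemma vmc_sel [simp]:
  "Obj (vec_module_cat (concrete_cat Ob car hm) c a) = Ob"
  "Id (vec_module_cat (concrete_cat Ob car hm) c a) U = marr_of U U (id_map (car U))"
  "Comp (vec_module_cat (concrete_cat Ob car hm) c a) g f = marr_of (src f) (tgt g) (fn g \<circ> fn f)"
  "mob (vec_module_cat (concrete_cat Ob car hm) c a) = a"
  "marr (vec_module_cat (concrete_cat Ob car hm) c a) k l =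
    marr_of (a (src k) (src l)) (a (tgt k) (tgt l)) (tensor_map (src k) (c (src l)) (fn k) (fn l))"
  "massoc (vec_module_cat (concrete_cat Ob car hm) c a) X Y U =
    marr_of (a (tensor_sp X Y) U) (a X (a Y U)) (assoc_map X Y (c U))"
  "munit (vec_module_cat (concrete_cat Ob car hm) c a) U = marr_of (a unit_sp U) U (lunit_map (c U))"
  by (auto simp: vmc_simps)

subsection \<open>Identities between tensor products of maps\<close>

lemma fd_usub [simp]: "fd X \<Longrightarrow> usub X"
  by (rule fin_dim_subspace[OF vs_u])

lemma usub_span: "usub X \<Longrightarrow> X = uv.span X"
  by (rule subspace_span_self)

lemmas fd_intros = fin_dim_tensor_sp fin_dim_unit_sp

lemmas lmaps = tensor_map_lin_maps assoc_map_lin_maps lunit_map_lin_maps runit_map_lin_maps id_map_lin_maps fd_intros tensor_sp_subspace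

lemma tensor_map_id:
  assumes "fd X" "fd U"
  shows "tensor_map X U (id_map X) (id_map U) = id_map (tensor_sp X U)"
proof -
  note i = id_map_lin_maps[OF fd_usub[OF assms(1)]] id_map_lin_maps[OF fd_usub[OF assms(2)]]
  show ?thesis
    by (rule lin_maps_eqI[OF tensor_map_lin_maps[OF assms i] id_map_lin_maps tensor_sp_span])
      (auto simp: tensor_map_pure[OF assms i])
qed

lemma tensor_map_comp:
  assumes "fd X" "fd U" "fd X'" "fd U'"
    and "f \<in> lin_maps X X'" "f' \<in> lin_maps X' X''" "g \<in> lin_maps U U'" "g' \<in> lin_maps U' U''"
  shows "tensor_map X U (f' \<circ> f) (g' \<circ> g) = tensor_map X' U' f' g' \<circ> tensor_map X U f g"
proof (rule lin_maps_eqI[OF _ _ tensor_sp_span])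
  have c: "f' \<circ> f \<in> lin_maps X X''" "g' \<circ> g \<in> lin_maps U U''" using assms by (auto intro: lin_maps_comp)
  then show "tensor_map X U (f' \<circ> f) (g' \<circ> g) \<in> lin_maps (tensor_sp X U) (tensor_sp X'' U'')"
    using assms by (auto intro: tensor_map_lin_maps)
  show "tensor_map X' U' f' g' \<circ> tensor_map X U f g \<in> lin_maps (tensor_sp X U) (tensor_sp X'' U'')"
    using assms by (auto intro!: lin_maps_comp tensor_map_lin_maps)
  fix t assume "t \<in> {x \<otimes> y |x y. x \<in> X \<and> y \<in> U}"
  then show "tensor_map X U (f' \<circ> f) (g' \<circ> g) t = (tensor_map X' U' f' g' \<circ> tensor_map X U f g) t"
    using assms lin_mapsD(2)[OF assms(5)] lin_mapsD(2)[OF assms(7)]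
    by (auto simp: tensor_map_pure[OF assms(1,2) c] tensor_map_pure[OF assms(1,2,5,7)]
        tensor_map_pure[OF assms(3,4,6,8)])
qed

lemma assoc_natural:
  assumes fd: "fd X" "fd Y" "fd U" "fd X'" "fd Y'" "fd U'"
    and f: "f \<in> lin_maps X X'" "e \<in> lin_maps Y Y'" "g \<in> lin_maps U U'"
  shows "assoc_map X' Y' U' \<circ> tensor_map (tensor_sp X Y) U (tensor_map X Y f e) g =
    tensor_map X (tensor_sp Y U) f (tensor_map Y U e g) \<circ> assoc_map X Y U"
proof (rule lin_maps_eqI[OF lin_maps_comp lin_maps_comp tensor_sp_span_left])
  note t = tensor_map_lin_maps[OF fd(1,2) f(1,2)] tensor_map_lin_maps[OF fd(2,3) f(2,3)]
  fix z assume "z \<in> {(x \<otimes> y) \<otimes> u |x y u. x \<in> X \<and> y \<in> Y \<and> u \<in> U}"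
  then obtain x y u where z: "z = (x \<otimes> y) \<otimes> u" and m: "x \<in> X" "y \<in> Y" "u \<in> U" by blast
  show "(assoc_map X' Y' U' \<circ> tensor_map (tensor_sp X Y) U (tensor_map X Y f e) g) z =
    (tensor_map X (tensor_sp Y U) f (tensor_map Y U e g) \<circ> assoc_map X Y U) z"
    using m lin_mapsD(2)[OF f(1)] lin_mapsD(2)[OF f(2)] lin_mapsD(2)[OF f(3)]
    by (simp add: z tensor_map_pure[OF fin_dim_tensor_sp[OF fd(1,2)] fd(3) t(1) f(3)]
        tensor_map_pure[OF fd(1,2) f(1,2)] tensor_map_pure[OF fd(2,3) f(2,3)] assoc_map_pure fd
        tensor_map_pure[OF fd(1) fin_dim_tensor_sp[OF fd(2,3)] f(1) t(2)])
qed (rule fd_usub lmaps assms)+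

lemma lunit_natural:
  assumes fd: "fd U" "fd U'" and g: "g \<in> lin_maps U U'"
  shows "lunit_map U' \<circ> tensor_map unit_sp U (id_map unit_sp) g = g \<circ> lunit_map U"
proof (rule lin_maps_eqI[OF lin_maps_comp lin_maps_comp tensor_sp_span])
  note i = id_map_lin_maps[OF fd_usub[OF fin_dim_unit_sp]]
  fix z assume "z \<in> {x \<otimes> y |x y. x \<in> unit_sp \<and> y \<in> U}"
  then show "(lunit_map U' \<circ> tensor_map unit_sp U (id_map unit_sp) g) z = (g \<circ> lunit_map U) z"
    using lin_mapsD[OF g] fd lin_onD(2)[OF lin_mapsD(1)[OF g]]
    by (auto simp: tensor_map_pure[OF fin_dim_unit_sp fd(1) i g] lunit_map_pure)
qed (rule fd_usub lmaps assms)+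

lemma runit_natural:
  assumes fd: "fd U" "fd U'" and g: "g \<in> lin_maps U U'"
  shows "runit_map U' \<circ> tensor_map U unit_sp g (id_map unit_sp) = g \<circ> runit_map U"
proof (rule lin_maps_eqI[OF lin_maps_comp lin_maps_comp tensor_sp_span])
  note i = id_map_lin_maps[OF fd_usub[OF fin_dim_unit_sp]]
  fix z assume "z \<in> {x \<otimes> y |x y. x \<in> U \<and> y \<in> unit_sp}"
  then show "(runit_map U' \<circ> tensor_map U unit_sp g (id_map unit_sp)) z = (g \<circ> runit_map U) z"
    using lin_mapsD[OF g] fd lin_onD(2)[OF lin_mapsD(1)[OF g]]
    by (auto simp: tensor_map_pure[OF fd(1) fin_dim_unit_sp g i] runit_map_pure)
qed (rule fd_usub lmaps assms)+

lemma pentagon_maps: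
  assumes fd: "fd W" "fd X" "fd Y" "fd Z"
  shows "assoc_map W X (tensor_sp Y Z) \<circ> assoc_map (tensor_sp W X) Y Z =
    tensor_map W (tensor_sp (tensor_sp X Y) Z) (id_map W) (assoc_map X Y Z) \<circ>
      (assoc_map W (tensor_sp X Y) Z \<circ> tensor_map (tensor_sp (tensor_sp W X) Y) Z (assoc_map W X Y) (id_map Z))"
proof (rule lin_maps_eqI[OF lin_maps_comp lin_maps_comp[OF lin_maps_comp] tensor_sp_span_left4])
  note i = id_map_lin_maps[OF fd_usub[OF fd(1)]] id_map_lin_maps[OF fd_usub[OF fd(4)]]
  note a = assoc_map_lin_maps[OF fd(2-4)] assoc_map_lin_maps[OF fd(1-3)]
  fix t assume "t \<in> {((w \<otimes> x) \<otimes> y) \<otimes> z |w x y z. w \<in> W \<and> x \<in> X \<and> y \<in> Y \<and> z \<in> Z}"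
  then obtain w x y z where t: "t = ((w \<otimes> x) \<otimes> y) \<otimes> z" and m: "w \<in> W" "x \<in> X" "y \<in> Y" "z \<in> Z" by blast
  show "(assoc_map W X (tensor_sp Y Z) \<circ> assoc_map (tensor_sp W X) Y Z) t =
    (tensor_map W (tensor_sp (tensor_sp X Y) Z) (id_map W) (assoc_map X Y Z) \<circ>
      (assoc_map W (tensor_sp X Y) Z \<circ> tensor_map (tensor_sp (tensor_sp W X) Y) Z (assoc_map W X Y) (id_map Z))) t"
    using m by (simp add: t assoc_map_pure fd fd_intros
        tensor_map_pure[OF fin_dim_tensor_sp[OF fin_dim_tensor_sp[OF fd(1,2)] fd(3)] fd(4) a(2) i(2)]
        tensor_map_pure[OF fd(1) fin_dim_tensor_sp[OF fin_dim_tensor_sp[OF fd(2,3)] fd(4)] i(1) a(1)])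
qed (rule fd_usub lmaps assms)+

lemma triangle_maps:
  assumes fd: "fd X" "fd Y"
  shows "tensor_map X (tensor_sp unit_sp Y) (id_map X) (lunit_map Y) \<circ> assoc_map X unit_sp Y =
    tensor_map (tensor_sp X unit_sp) Y (runit_map X) (id_map Y)"
proof (rule lin_maps_eqI[OF lin_maps_comp tensor_map_lin_maps tensor_sp_span_left])
  note i = id_map_lin_maps[OF fd_usub[OF fd(1)]] id_map_lin_maps[OF fd_usub[OF fd(2)]]
  note l = lunit_map_lin_maps[OF fd(2)] runit_map_lin_maps[OF fd(1)]
  fix t assume "t \<in> {(x \<otimes> c) \<otimes> y |x c y. x \<in> X \<and> c \<in> unit_sp \<and> y \<in> Y}"
  then show "(tensor_map X (tensor_sp unit_sp Y) (id_map X) (lunit_map Y) \<circ> assoc_map X unit_sp Y) t =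
    tensor_map (tensor_sp X unit_sp) Y (runit_map X) (id_map Y) t"
    by (auto simp: assoc_map_pure lunit_map_pure runit_map_pure fd fd_intros kron_left kron_right
        tensor_map_pure[OF fd(1) fin_dim_tensor_sp[OF fin_dim_unit_sp fd(2)] i(1) l(1)]
        tensor_map_pure[OF fin_dim_tensor_sp[OF fd(1) fin_dim_unit_sp] fd(2) l(2) i(2)])
qed (rule fd_usub lmaps assms)+

lemma assoc_map_inverse:
  assumes fd: "fd X" "fd Y" "fd Z"
  shows "assoc_inv X Y Z \<circ> assoc_map X Y Z = id_map (tensor_sp (tensor_sp X Y) Z)"
    and "assoc_map X Y Z \<circ> assoc_inv X Y Z = id_map (tensor_sp X (tensor_sp Y Z))"
proof -
  note a = assoc_map_lin_maps[OF fd] assoc_inv_lin_maps[OF fd]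
  show "assoc_inv X Y Z \<circ> assoc_map X Y Z = id_map (tensor_sp (tensor_sp X Y) Z)"
    by (rule lin_maps_eqI[OF lin_maps_comp[OF a] id_map_lin_maps tensor_sp_span_left])
      (use fd in \<open>auto simp: assoc_map_pure assoc_inv_pure\<close>)
  show "assoc_map X Y Z \<circ> assoc_inv X Y Z = id_map (tensor_sp X (tensor_sp Y Z))"
    by (rule lin_maps_eqI[OF lin_maps_comp[OF a(2,1)] id_map_lin_maps tensor_sp_span_right])
      (use fd in \<open>auto simp: assoc_map_pure assoc_inv_pure\<close>)
qed

lemma unit_move: "c \<in> unit_sp \<Longrightarrow> c 0 *\<^sub>u unit_vec = c"
  by (auto simp: unit_sp_def unit_vec_def fun_eq_iff)

lemma unit_map_inverse:
  assumes fd: "fd X"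
  shows "unit_inv True X \<circ> lunit_map X = id_map (tensor_sp unit_sp X)" "lunit_map X \<circ> unit_inv True X = id_map X"
    and "unit_inv False X \<circ> runit_map X = id_map (tensor_sp X unit_sp)" "runit_map X \<circ> unit_inv False X = id_map X"
proof -
  note u = unit_inv_lin_maps[OF fd] and l = lunit_map_lin_maps[OF fd] and r = runit_map_lin_maps[OF fd]
  have sc: "c *\<^sub>u x \<in> X" if "x \<in> X" for c x using that uv.subspace_scale[OF fd_usub[OF fd]] by blast
  have e: "unit_vec \<otimes> (c 0 *\<^sub>u x) = c \<otimes> x" "(c 0 *\<^sub>u x) \<otimes> unit_vec = x \<otimes> c" if "c \<in> unit_sp" for c x :: "'a univ"
    using unit_move[OF that] by (metis kron_left(2) kron_right(2))+
  show "unit_inv True X \<circ> lunit_map X = id_map (tensor_sp unit_sp X)"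
    by (rule lin_maps_eqI[OF lin_maps_comp[OF l u(1)] id_map_lin_maps tensor_sp_span])
      (use fd in \<open>auto simp: lunit_map_pure unit_inv_def sc e\<close>)
  show "unit_inv False X \<circ> runit_map X = id_map (tensor_sp X unit_sp)"
    by (rule lin_maps_eqI[OF lin_maps_comp[OF r u(2)] id_map_lin_maps tensor_sp_span])
      (use fd in \<open>auto simp: runit_map_pure unit_inv_def sc e\<close>)
  show "lunit_map X \<circ> unit_inv True X = id_map X"
    by (rule lin_maps_eqI[OF lin_maps_comp[OF u(1) l] id_map_lin_maps usub_span])
      (use fd in \<open>auto simp: lunit_map_pure unit_inv_def\<close>)
  show "runit_map X \<circ> unit_inv False X = id_map X"
    by (rule lin_maps_eqI[OF lin_maps_comp[OF u(2) r] id_map_lin_maps usub_span])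
      (use fd in \<open>auto simp: runit_map_pure unit_inv_def\<close>)
qed

lemma iso_arr_Vec:
  assumes "fd X" "fd Y" "f \<in> lin_maps X Y" "g \<in> lin_maps Y X"
    and "g \<circ> f = id_map X" "f \<circ> g = id_map Y"
  shows "iso_arr Vec X Y (marr_of X Y f)"
  unfolding iso_arr_def homset_Vec using assms by (auto intro!: bexI[of _ "marr_of Y X g"] simp: homset_Vec)

lemma lin_maps_0:
  assumes "f \<in> lin_maps X Y"
  shows "f 0 = 0"
proof (cases "0 \<in> X")
  case True
  then have "f (0 *\<^sub>u 0) = 0 *\<^sub>u f 0" by (rule lin_onD(2)[OF lin_mapsD(1)[OF assms]])
  then show ?thesis unfolding uv.scale_zero_left .
qed (rule lin_mapsD(3)[OF assms])

lemma lin_maps_id: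
  assumes "f \<in> lin_maps X Y"
  shows "f \<circ> id_map X = f" "id_map Y \<circ> f = f"
proof -
  show "f \<circ> id_map X = f"
  proof
    fix x show "(f \<circ> id_map X) x = f x"
      by (cases "x \<in> X") (simp_all add: id_map_def lin_maps_0[OF assms] lin_mapsD(3)[OF assms])
  qed
  show "id_map Y \<circ> f = f"
  proof
    fix x show "(id_map Y \<circ> f) x = f x"
      by (cases "x \<in> X") (simp_all add: id_map_def lin_mapsD(2)[OF assms] lin_mapsD(3)[OF assms])
  qed
qed

lemma category_Vec: "category (Vec :: ('k::field univ set, ('k, 'k univ set) mor) moncat)"
proof
  fix f :: "('k, 'k univ set) mor" assume "f \<in> Arr Vec"
  then show "Dom Vec f \<in> Obj Vec \<and> Cod Vec f \<in> Obj Vec" by (auto simp: Vec_def vmc_simps)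
qed (auto simp: homset_Vec lin_maps_id comp_assoc intro: id_map_lin_maps lin_maps_comp)

lemma monoidal_category_Vec: "monoidal_category (Vec :: ('k::field univ set, ('k, 'k univ set) mor) moncat)"
proof (intro monoidal_category.intro category_Vec monoidal_category_axioms.intro)
  fix X Y Z :: "'k univ set"
  assume "X \<in> Obj Vec" "Y \<in> Obj Vec" "Z \<in> Obj Vec"
  then show "iso_arr Vec (tob Vec (tob Vec X Y) Z) (tob Vec X (tob Vec Y Z)) (tassoc Vec X Y Z)"
    by (auto intro!: iso_arr_Vec fd_intros assoc_map_lin_maps assoc_inv_lin_maps assoc_map_inverse)
next
  fix X :: "'k univ set"
  assume "X \<in> Obj Vec"
  then show "iso_arr Vec (tob Vec (tunit Vec) X) X (lunit Vec X)"
    by (auto intro!: iso_arr_Vec[where g = "unit_inv True X"] fd_intros lunit_map_lin_maps unit_inv_lin_maps unit_map_inverse)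
next
  fix X :: "'k univ set"
  assume "X \<in> Obj Vec"
  then show "iso_arr Vec (tob Vec X (tunit Vec)) X (runit Vec X)"
    by (auto intro!: iso_arr_Vec[where g = "unit_inv False X"] fd_intros runit_map_lin_maps unit_inv_lin_maps unit_map_inverse)
qed (auto simp: homset_Vec tensor_map_id tensor_map_comp assoc_natural lunit_natural runit_natural pentagon_maps triangle_maps
      intro!: fd_intros tensor_map_lin_maps)

text \<open>
  Both module categories of the theorem consist of finite dimensional spaces with a family of linear operators,
  the morphisms being the linear maps that commute with them, and \<open>X \<otimes> U\<close> carries the operators of \<open>U\<close>.
  These facts alone make such a category a module category.
\<close>

locale op_category =
  fixes Ob :: "'o set" and car :: "'o \<Rightarrow> 'k::field univ set" and J :: "'j set"
    and op :: "'o \<Rightarrow> 'j \<Rightarrow> 'k univ \<Rightarrow> 'k univ" and hm :: "'o \<Rightarrow> 'o \<Rightarrow> ('k univ \<Rightarrow> 'k univ) set"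
    and act :: "'k univ set \<Rightarrow> 'o \<Rightarrow> 'o"
  assumes car_fd: "U \<in> Ob \<Longrightarrow> fd (car U)"
    and op_car: "\<lbrakk>U \<in> Ob; j \<in> J; u \<in> car U\<rbrakk> \<Longrightarrow> op U j u \<in> car U"
    and op_lin: "\<lbrakk>U \<in> Ob; j \<in> J\<rbrakk> \<Longrightarrow> ulin (car U) (op U j)"
    and hm_eq: "\<lbrakk>U \<in> Ob; V \<in> Ob\<rbrakk> \<Longrightarrow>
      hm U V = {f \<in> lin_maps (car U) (car V). \<forall>j\<in>J. \<forall>u\<in>car U. f (op U j u) = op V j (f u)}"
    and act_obj: "\<lbrakk>fd X; U \<in> Ob\<rbrakk> \<Longrightarrow> act X U \<in> Ob"
    and act_car: "car (act X U) = tensor_sp X (car U)"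
    and act_op: "\<lbrakk>fd X; U \<in> Ob; j \<in> J; x \<in> X; u \<in> car U\<rbrakk> \<Longrightarrow> op (act X U) j (x \<otimes> u) = x \<otimes> op U j u"
begin

abbreviation "Cat \<equiv> vec_module_cat (concrete_cat Ob car hm) car act"

lemma hm_lin_maps: "\<lbrakk>U \<in> Ob; V \<in> Ob; f \<in> hm U V\<rbrakk> \<Longrightarrow> f \<in> lin_maps (car U) (car V)"
  by (simp add: hm_eq)

lemma car_usub: "U \<in> Ob \<Longrightarrow> usub (car U)"
  using car_fd by simp

lemma hm_genI:
  assumes "U \<in> Ob" "V \<in> Ob" "f \<in> lin_maps (car U) (car V)" "car U = uv.span S"
    and "\<And>j u. j \<in> J \<Longrightarrow> u \<in> S \<Longrightarrow> f (op U j u) = op V j (f u)"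
  shows "f \<in> hm U V"
proof -
  have "f (op U j u) = op V j (f u)" if "j \<in> J" "u \<in> car U" for j u
  proof (rule lin_on_eq_on_span[OF vs_u vs_u,
        where S = S and f = "\<lambda>u. f (op U j u)" and g = "\<lambda>u. op V j (f u)"])
    note l = lin_mapsD[OF assms(3)]
    show "ulin (uv.span S) (\<lambda>u. f (op U j u))"
      using lin_comp[OF op_lin[OF assms(1) that(1)] l(1)] op_car[OF assms(1) that(1)] assms(4) by auto
    show "ulin (uv.span S) (\<lambda>u. op V j (f u))"
      using lin_comp[OF l(1) op_lin[OF assms(2) that(1)]] l(2) assms(4) by auto
    show "u \<in> uv.span S" using that assms(4) by simp
  qed (use assms(5) that in auto)
  then show ?thesis using assms(1-3) by (simp add: hm_eq)
qed

lemma hm_comp: "\<lbrakk>U \<in> Ob; V \<in> Ob; W \<in> Ob; f \<in> hm U V; g \<in> hm V W\<rbrakk> \<Longrightarrow> g \<circ> f \<in> hm U W"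
  by (auto simp: hm_eq lin_mapsD car_usub intro: lin_maps_comp)

lemma hm_id: "U \<in> Ob \<Longrightarrow> id_map (car U) \<in> hm U U"
  by (auto simp: hm_eq op_car id_map_lin_maps car_usub)

lemma hm_inverse:
  assumes "U \<in> Ob" "V \<in> Ob" "f \<in> hm U V" "g \<in> lin_maps (car V) (car U)"
    and "g \<circ> f = id_map (car U)" "f \<circ> g = id_map (car V)"
  shows "g \<in> hm V U"
proof -
  have gf: "g (f u) = u" if "u \<in> car U" for u using fun_cong[OF assms(5), of u] that by simp
  have fg: "f (g v) = v" if "v \<in> car V" for v using fun_cong[OF assms(6), of v] that by simp
  have "g (op V j v) = op U j (g v)" if "j \<in> J" "v \<in> car V" for j v
  proof -
    have m: "g v \<in> car U" by (rule lin_mapsD(2)[OF assms(4) that(2)])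
    have "op V j v = f (op U j (g v))"
      using assms(1-3) m that fg by (simp add: hm_eq)
    then show ?thesis using gf[OF op_car[OF assms(1) that(1) m]] by simp
  qed
  then show ?thesis using assms by (simp add: hm_eq)
qed

lemma iso_arrI:
  assumes "U \<in> Ob" "V \<in> Ob" "f \<in> hm U V" "g \<in> lin_maps (car V) (car U)"
    and "g \<circ> f = id_map (car U)" "f \<circ> g = id_map (car V)"
  shows "iso_arr Cat U V (marr_of U V f)"
  unfolding iso_arr_def
  using assms hm_inverse[OF assms] by (auto intro!: bexI[of _ "marr_of V U g"] simp: homset_vmc)

lemma iso_arr_genI:
  assumes "U \<in> Ob" "V \<in> Ob" "f \<in> hm U V" "g \<in> lin_maps (car V) (car U)"
    and "car U = uv.span S" "car V = uv.span S'"
    and "\<And>x. x \<in> S \<Longrightarrow> g (f x) = x" "\<And>y. y \<in> S' \<Longrightarrow> f (g y) = y"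
  shows "iso_arr Cat U V (marr_of U V f)"
proof (rule iso_arrI[OF assms(1-4)])
  note f = hm_lin_maps[OF assms(1-3)]
  have S: "S \<subseteq> car U" "S' \<subseteq> car V" using assms(5,6) uv.span_superset by auto
  show "g \<circ> f = id_map (car U)"
    by (rule lin_maps_eqI[OF lin_maps_comp[OF f assms(4)] id_map_lin_maps assms(5)])
      (use assms S car_usub in auto)
  show "f \<circ> g = id_map (car V)"
    by (rule lin_maps_eqI[OF lin_maps_comp[OF assms(4) f] id_map_lin_maps assms(6)])
      (use assms S car_usub in auto)
qed

lemma tensor_map_hm:
  assumes "fd X" "fd X'" "U \<in> Ob" "U' \<in> Ob" "f \<in> lin_maps X X'" "g \<in> hm U U'"
  shows "tensor_map X (car U) f g \<in> hm (act X U) (act X' U')"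
proof (rule hm_genI)
  note g = hm_lin_maps[OF assms(3,4,6)]
  show "car (act X U) = uv.span {x \<otimes> u |x u. x \<in> X \<and> u \<in> car U}"
    unfolding act_car by (rule tensor_sp_span)
  show "tensor_map X (car U) f g \<in> lin_maps (car (act X U)) (car (act X' U'))"
    unfolding act_car by (intro tensor_map_lin_maps assms g car_fd)
  fix j t assume j: "j \<in> J" and "t \<in> {x \<otimes> u |x u. x \<in> X \<and> u \<in> car U}"
  then obtain x u where t: "t = x \<otimes> u" "x \<in> X" "u \<in> car U" by blast
  show "tensor_map X (car U) f g (op (act X U) j t) = op (act X' U') j (tensor_map X (car U) f g t)"
    using t j assms lin_mapsD(2)[OF assms(5)] lin_mapsD(2)[OF g]
    by (simp add: act_op tensor_map_pure[OF assms(1) car_fd assms(5) g] op_car) (simp add: hm_eq)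
qed (use assms act_obj in auto)

lemma assoc_map_hm:
  assumes "fd X" "fd Y" "U \<in> Ob"
  shows "assoc_map X Y (car U) \<in> hm (act (tensor_sp X Y) U) (act X (act Y U))"
proof (rule hm_genI)
  show "car (act (tensor_sp X Y) U) = uv.span {(x \<otimes> y) \<otimes> u |x y u. x \<in> X \<and> y \<in> Y \<and> u \<in> car U}"
    unfolding act_car by (rule tensor_sp_span_left[OF car_usub[OF assms(3)]])
  fix j t assume j: "j \<in> J" and "t \<in> {(x \<otimes> y) \<otimes> u |x y u. x \<in> X \<and> y \<in> Y \<and> u \<in> car U}"
  then obtain x y u where t: "t = (x \<otimes> y) \<otimes> u" "x \<in> X" "y \<in> Y" "u \<in> car U" by blast
  show "assoc_map X Y (car U) (op (act (tensor_sp X Y) U) j t) = op (act X (act Y U)) j (assoc_map X Y (car U) t)"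
    using t j assms by (simp add: act_op act_car act_obj assoc_map_pure car_fd op_car fd_intros)
qed (use assms in \<open>auto simp: act_car intro!: act_obj fd_intros assoc_map_lin_maps car_fd\<close>)

lemma lunit_map_hm:
  assumes "U \<in> Ob"
  shows "lunit_map (car U) \<in> hm (act unit_sp U) U"
proof (rule hm_genI)
  show "car (act unit_sp U) = uv.span {x \<otimes> u |x u. x \<in> unit_sp \<and> u \<in> car U}"
    unfolding act_car by (rule tensor_sp_span)
  fix j t assume j: "j \<in> J" and "t \<in> {x \<otimes> u |x u. x \<in> unit_sp \<and> u \<in> car U}"
  then obtain x u where t: "t = x \<otimes> u" "x \<in> unit_sp" "u \<in> car U" by blast
  show "lunit_map (car U) (op (act unit_sp U) j t) = op U j (lunit_map (car U) t)"
    using t j assms lin_onD(2)[OF op_lin[OF assms j]]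
    by (simp add: act_op lunit_map_pure car_fd op_car fd_intros)
qed (use assms in \<open>auto simp: act_car intro!: act_obj fd_intros lunit_map_lin_maps car_fd\<close>)

lemma tensor_map_comp_hm:
  assumes "fd X" "fd X'" "U \<in> Ob" "U' \<in> Ob" "U'' \<in> Ob"
    and "f \<in> lin_maps X X'" "f' \<in> lin_maps X' X''" "g \<in> hm U U'" "g' \<in> hm U' U''"
  shows "tensor_map X (car U) (f' \<circ> f) (g' \<circ> g) = tensor_map X' (car U') f' g' \<circ> tensor_map X (car U) f g"
  by (rule tensor_map_comp[OF assms(1) car_fd[OF assms(3)] assms(2) car_fd[OF assms(4)] assms(6,7)
        hm_lin_maps[OF assms(3,4,8)] hm_lin_maps[OF assms(4,5,9)]])

lemma category_Cat: "category Cat"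
proof
  fix f assume "f \<in> Arr Cat"
  then show "Dom Cat f \<in> Obj Cat \<and> Cod Cat f \<in> Obj Cat" by (auto simp: vmc_simps)
qed (auto simp: homset_vmc lin_maps_id[OF hm_lin_maps] car_usub comp_assoc intro: hm_id hm_comp)

lemma module_category_Cat: "module_category Vec Cat"
proof (intro module_category.intro monoidal_category_Vec category_Cat module_category_axioms.intro)
  fix X Y :: "'k univ set" and U :: 'o
  assume *: "X \<in> Obj Vec" "Y \<in> Obj Vec" "U \<in> Obj Cat"
  then show "iso_arr Cat (mob Cat (tob Vec X Y) U) (mob Cat X (mob Cat Y U)) (massoc Cat X Y U)"
    by (auto intro!: iso_arrI[where g = "assoc_inv X Y (car U)"] act_obj fd_intros assoc_map_hm assoc_inv_lin_maps
        simp: act_car assoc_map_inverse car_fd)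
next
  fix U :: 'o
  assume "U \<in> Obj Cat"
  then show "iso_arr Cat (mob Cat (tunit Vec) U) U (munit Cat U)"
    by (auto intro!: iso_arrI[where g = "unit_inv True (car U)"] act_obj fd_intros lunit_map_hm unit_inv_lin_maps
        simp: act_car unit_map_inverse car_fd)
qed (auto simp: homset_vmc homset_Vec act_car tensor_map_id tensor_map_comp_hm assoc_natural lunit_natural
      pentagon_maps triangle_maps car_fd hm_lin_maps intro!: act_obj fd_intros tensor_map_hm)

end

section \<open>Sweedler calculus in a finite dimensional Hopf algebra\<close>

lemma trilin_extends:
  fixes r :: "'k::field \<Rightarrow> 'd::ab_group_add \<Rightarrow> 'd"
  assumes "emb s A \<iota>" "emb s' B \<kappa>" "emb s'' C \<mu>" "vector_space r"
    and f1: "\<And>b c. b \<in> B \<Longrightarrow> c \<in> C \<Longrightarrow> lin_on s r A (\<lambda>a. f a b c)"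
    and f2: "\<And>a. a \<in> A \<Longrightarrow> bilin s' B s'' C r (f a)"
  obtains F where "lin uscale r F"
    "\<And>a b c. a \<in> A \<Longrightarrow> b \<in> B \<Longrightarrow> c \<in> C \<Longrightarrow> F (\<iota> a \<otimes> \<kappa> b \<otimes> \<mu> c) = f a b c"
proof -
  note eB = assms(2) and eC = assms(3) and r = assms(4)
  let ?T = "tensor_space (\<lambda>b c. \<kappa> b \<otimes> \<mu> c) B C" and ?sw = "sweedler (\<lambda>b c. \<kappa> b \<otimes> \<mu> c) B C"
  have "bilin s A uscale ?T r (\<lambda>a t. ?sw t (f a))"
  proof (rule bilinI)
    show "lin_on s r A (\<lambda>a. ?sw t (f a))" if "t \<in> ?T" for t by (rule lin_on_sweedler_in[OF eB eC r that f1])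
    show "lin_on uscale r ?T (\<lambda>t. ?sw t (f a))" if "a \<in> A" for a by (rule lin_sweedler_arg[OF eB eC r f2[OF that]])
  qed
  then obtain F where F: "lin uscale r F" "\<And>a t. a \<in> A \<Longrightarrow> t \<in> ?T \<Longrightarrow> F (\<iota> a \<otimes> t) = ?sw t (f a)"
    by (rule bilin_extends[OF assms(1) emb_id[OF fin_dim_tensor_space[OF eB eC]] r]) blast
  show thesis by (rule that[OF F(1)]) (simp add: F(2) tensor_space_pure[OF eB eC] sweedler_pure[OF eB eC r f2])
qed

locale fd_hopf =
  fixes H :: "('k::field, 'h::ring_1) hopf"
  assumes hopf: "fin_dim_hopf_algebra H"
begin

abbreviation "hs \<equiv> hscale H"
abbreviation "S \<equiv> antipode H"
abbreviation "\<epsilon> \<equiv> counit H"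
abbreviation cop :: "'h \<Rightarrow> ('h \<Rightarrow> 'h \<Rightarrow> 'c::comm_monoid_add) \<Rightarrow> 'c" where "cop h f \<equiv> hsw H (comult H h) f"
abbreviation hlin :: "('k \<Rightarrow> 'c::ab_group_add \<Rightarrow> 'c) \<Rightarrow> ('h \<Rightarrow> 'c) \<Rightarrow> bool" where "hlin s f \<equiv> lin_on hs s UNIV f"
abbreviation hbil :: "('k \<Rightarrow> 'c::ab_group_add \<Rightarrow> 'c) \<Rightarrow> ('h \<Rightarrow> 'h \<Rightarrow> 'c) \<Rightarrow> bool"
  where "hbil s f \<equiv> bilin hs UNIV hs UNIV s f"

lemma hopf_unfold:
  "k_algebra (hopf_alg H)" "fin_dim hs UNIV" "hlin uscale (comult H)"
  "comult H h \<in> tensor_space (htens H) UNIV UNIV" "hlin (*) \<epsilon>" "hlin hs S"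
  "cop h (\<lambda>x y. cop x (\<lambda>x1 x2. htens3 H x1 x2 y)) = cop h (\<lambda>x y. cop y (\<lambda>y1 y2. htens3 H x y1 y2))"
  "cop h (\<lambda>x y. hs (\<epsilon> x) y) = h" "cop h (\<lambda>x y. hs (\<epsilon> y) x) = h"
  "comult H 1 = htens H 1 1" "\<epsilon> 1 = 1"
  "comult H (g * h) = cop g (\<lambda>g1 g2. cop h (\<lambda>h1 h2. htens H (g1 * h1) (g2 * h2)))"
  "\<epsilon> (g * h) = \<epsilon> g * \<epsilon> h"
  "cop h (\<lambda>x y. S x * y) = hs (\<epsilon> h) 1" "cop h (\<lambda>x y. x * S y) = hs (\<epsilon> h) 1"
  using hopf unfolding fin_dim_hopf_algebra_def by blast+

lemma vs: "vector_space hs"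
  using hopf_unfold(1) by (simp add: k_algebra_def hopf_alg_def)

lemma mult_scale: "hs c a * b = hs c (a * b)" "a * hs c b = hs c (a * b)"
  using hopf_unfold(1) by (simp_all add: k_algebra_def hopf_alg_def lin_on_def)

sublocale hv: vector_space hs by (rule vs)

lemma embH: "emb hs UNIV (hemb H)"
  by (rule emb_embed[OF vs hopf_unfold(2)])

lemmas vss = vs vs_k vs_u

subsection \<open>Linearity rules\<close>

lemma hl_id: "hlin hs (\<lambda>a. a)"
  by (simp add: lin_on_def)

lemma hl_comp: "hlin s f \<Longrightarrow> hlin hs g \<Longrightarrow> hlin s (\<lambda>a. f (g a))"
  by (simp add: lin_on_def)

lemma hl_mult: "hlin hs f \<Longrightarrow> hlin hs (\<lambda>a. f a * c)" "hlin hs f \<Longrightarrow> hlin hs (\<lambda>a. c * f a)"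
  by (auto simp: lin_on_def mult_scale algebra_simps)

lemma hl_kmult: "hlin (*) f \<Longrightarrow> hlin (*) (\<lambda>a. f a * (c::'k))" "hlin (*) f \<Longrightarrow> hlin (*) (\<lambda>a. (c::'k) * f a)"
  by (auto simp: lin_on_def algebra_simps)

lemma hl_scale:
  assumes "vector_space s"
  shows "hlin (*) f \<Longrightarrow> hlin s (\<lambda>a. s (f a) c)" "hlin s g \<Longrightarrow> hlin s (\<lambda>a. s d (g a))"
proof -
  interpret w: vector_space s by fact
  show "hlin (*) f \<Longrightarrow> hlin s (\<lambda>a. s (f a) c)" "hlin s g \<Longrightarrow> hlin s (\<lambda>a. s d (g a))"
    by (auto simp: lin_on_def w.scale_left_distrib w.scale_right_distrib mult.commute)
qed

lemma hl_kron: "hlin uscale f \<Longrightarrow> hlin uscale (\<lambda>a. f a \<otimes> c)" "hlin uscale f \<Longrightarrow> hlin uscale (\<lambda>a. c \<otimes> f a)"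
  by (auto simp: lin_on_def kron_left kron_right)

lemma hl_sweedler: "vector_space s \<Longrightarrow> (\<And>x y. hlin s (\<lambda>a. f a x y)) \<Longrightarrow> hlin s (\<lambda>a. sweedler \<tau> A B t (f a))"
  by (rule lin_on_sweedler)

lemma hbilI: "(\<And>b. hlin s (\<lambda>a. f a b)) \<Longrightarrow> (\<And>a. hlin s (\<lambda>b. f a b)) \<Longrightarrow> hbil s f"
  by (simp add: bilin_def)

lemma hbilD: "hbil s f \<Longrightarrow> hlin s (\<lambda>a. f a b)" "hbil s f \<Longrightarrow> hlin s (\<lambda>b. f a b)"
  by (simp_all add: bilin_def)

lemma hl_cop:
  assumes "vector_space s" "hlin hs g" "hbil s f"
  shows "hlin s (\<lambda>a. cop (g a) f)"
proof -
  have "hlin s (\<lambda>a. cop a f)"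
    by (rule lin_comp[OF hopf_unfold(3) lin_sweedler_arg[OF embH embH assms(1,3)]]) (use hopf_unfold(4) in blast)
  then show ?thesis using assms(2) by (rule hl_comp)
qed

lemmas hl_S = hl_comp[OF hopf_unfold(6)] and hl_eps = hl_comp[OF hopf_unfold(5)]
  and hl_emb = hl_comp[OF embD(4)[OF embH]]

lemmas hl = hl_id hl_mult hl_kmult hl_scale hl_kron hl_sweedler hbilI hl_cop hl_S hl_eps hl_emb vss

lemma hadd: "hlin s f \<Longrightarrow> f (x + y) = f x + f y" and hscl: "hlin s f \<Longrightarrow> f (hs c x) = s c (f x)"
  by (simp_all add: lin_on_def)

lemma cop_lin: "vector_space s \<Longrightarrow> hlin s g \<Longrightarrow> g (sweedler \<tau> A B t f) = sweedler \<tau> A B t (\<lambda>a b. g (f a b))"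
  by (rule sweedler_lin[OF vs])

lemma cop_lin_s: "vector_space s \<Longrightarrow> s c (sweedler \<tau> A B t f) = sweedler \<tau> A B t (\<lambda>a b. s c (f a b))"
proof -
  assume "vector_space s"
  then interpret w: vector_space s .
  show ?thesis by (rule sweedler_additive) (auto simp: w.scale_right_distrib)
qed

subsection \<open>The axioms in Sweedler form\<close>

lemma cop_coassoc:
  assumes "vector_space s" and f: "\<And>b c. hlin s (\<lambda>a. f a b c)" "\<And>a c. hlin s (\<lambda>b. f a b c)" "\<And>a b. hlin s (\<lambda>c. f a b c)"
  shows "cop h (\<lambda>x y. cop x (\<lambda>a b. f a b y)) = cop h (\<lambda>x y. cop y (\<lambda>a b. f x a b))"
proof -
  obtain F where F: "lin uscale s F" "\<And>a b c. F (htens3 H a b c) = f a b c"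
    by (rule trilin_extends[OF embH embH embH assms(1), of f]) (auto intro: hbilI f)
  note l = sweedler_lin[OF vs_u assms(1) F(1)]
  show ?thesis using arg_cong[OF hopf_unfold(7)[of h], of F] by (simp add: l F(2))
qed

lemma cop_counit:
  assumes "vector_space s" "hlin s f"
  shows "cop h (\<lambda>x y. s (\<epsilon> x) (f y)) = f h" "cop h (\<lambda>x y. s (\<epsilon> y) (f x)) = f h"
  by (simp_all only: hscl[OF assms(2), symmetric] cop_lin[OF assms, symmetric] hopf_unfold(8,9))

lemma cop_S:
  assumes "vector_space s" "hlin s f"
  shows "cop h (\<lambda>x y. f (S x * y)) = s (\<epsilon> h) (f 1)" "cop h (\<lambda>x y. f (x * S y)) = s (\<epsilon> h) (f 1)"
  by (simp_all only: cop_lin[OF assms, symmetric] hopf_unfold(14,15) hscl[OF assms(2)])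

lemma hsw_htens:
  assumes "vector_space s" "hbil s f"
  shows "hsw H (sweedler \<tau> A B t (\<lambda>a b. htens H (p a b) (q a b))) f = sweedler \<tau> A B t (\<lambda>a b. f (p a b) (q a b))"
    and "hsw H (htens H x y) f = f x y"
proof -
  obtain F where F: "lin uscale s F" "\<And>a b. a \<in> UNIV \<Longrightarrow> b \<in> UNIV \<Longrightarrow> F (htens H a b) = f a b"
    "\<And>t. t \<in> tensor_space (htens H) UNIV UNIV \<Longrightarrow> hsw H t f = F t"
    by (rule sweedler_extends[OF embH embH assms]) blast
  have "sweedler \<tau> A B t (\<lambda>a b. htens H (p a b) (q a b)) \<in> tensor_space (htens H) UNIV UNIV"
    unfolding sweedler_trep
    by (rule subspace_sum_pairs[OF vs_u tensor_space_subspace[OF embH embH]])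
      (auto intro: tensor_space_pure[OF embH embH])
  then show "hsw H (sweedler \<tau> A B t (\<lambda>a b. htens H (p a b) (q a b))) f = sweedler \<tau> A B t (\<lambda>a b. f (p a b) (q a b))"
    by (simp add: F(2,3) sweedler_lin[OF vs_u assms(1) F(1)])
  show "hsw H (htens H x y) f = f x y"
    using sweedler_pure[OF embH embH assms] by simp
qed

lemma hsw_htens2:
  assumes "vector_space s" "hbil s f"
  shows "hsw H (sweedler \<tau> A B t (\<lambda>a b. sweedler \<tau>' A' B' (t' a b) (\<lambda>c d. htens H (p a b c d) (q a b c d)))) f =
    sweedler \<tau> A B t (\<lambda>a b. sweedler \<tau>' A' B' (t' a b) (\<lambda>c d. f (p a b c d) (q a b c d)))"
    "sweedler \<tau> A B t (\<lambda>a b. sweedler \<tau>' A' B' (t' a b) (\<lambda>c d. htens H (p a b c d) (q a b c d))) \<in> tensor_space (htens H) UNIV UNIV"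
proof -
  obtain F where F: "lin uscale s F" "\<And>a b. a \<in> UNIV \<Longrightarrow> b \<in> UNIV \<Longrightarrow> F (htens H a b) = f a b"
    "\<And>t. t \<in> tensor_space (htens H) UNIV UNIV \<Longrightarrow> hsw H t f = F t"
    by (rule sweedler_extends[OF embH embH assms]) blast
  show 1: "sweedler \<tau> A B t (\<lambda>a b. sweedler \<tau>' A' B' (t' a b) (\<lambda>c d. htens H (p a b c d) (q a b c d))) \<in> tensor_space (htens H) UNIV UNIV"
    unfolding sweedler_trep
    by (intro subspace_sum_pairs[OF vs_u tensor_space_subspace[OF embH embH]]
        tensor_space_pure[OF embH embH] UNIV_I)
  show "hsw H (sweedler \<tau> A B t (\<lambda>a b. sweedler \<tau>' A' B' (t' a b) (\<lambda>c d. htens H (p a b c d) (q a b c d)))) f =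
    sweedler \<tau> A B t (\<lambda>a b. sweedler \<tau>' A' B' (t' a b) (\<lambda>c d. f (p a b c d) (q a b c d)))"
    unfolding F(3)[OF 1] by (simp add: F(2) sweedler_lin[OF vs_u assms(1) F(1)])
qed

lemma cop_mult:
  assumes "vector_space s" "hbil s f"
  shows "cop (g * h) f = cop g (\<lambda>a b. cop h (\<lambda>c d. f (a * c) (b * d)))"
  unfolding hopf_unfold(12) by (rule hsw_htens2[OF assms])

lemma cop_1: "vector_space s \<Longrightarrow> hbil s f \<Longrightarrow> cop 1 f = f 1 1"
  unfolding hopf_unfold(10) by (rule hsw_htens)

lemma regroup3:
  assumes "vector_space s" and f: "\<And>b c d. hlin s (\<lambda>a. f a b c d)" "\<And>a c d. hlin s (\<lambda>b. f a b c d)"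
    "\<And>a b d. hlin s (\<lambda>c. f a b c d)" "\<And>a b c. hlin s (\<lambda>d. f a b c d)"
  shows "cop h (\<lambda>a u. cop u (\<lambda>b v. cop v (\<lambda>c d. f a b c d))) = cop h (\<lambda>x d. cop x (\<lambda>a y. cop y (\<lambda>b c. f a b c d)))"
proof -
  have "cop h (\<lambda>a u. cop u (\<lambda>b v. cop v (\<lambda>c d. f a b c d))) = cop h (\<lambda>a u. cop u (\<lambda>y d. cop y (\<lambda>b c. f a b c d)))"
    by (simp only: cop_coassoc[OF assms(1) f(2,3,4)])
  also have "\<dots> = cop h (\<lambda>x d. cop x (\<lambda>a y. cop y (\<lambda>b c. f a b c d)))"
    by (rule cop_coassoc[OF assms(1), symmetric]) (intro hl f assms(1))+
  finally show ?thesis .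
qed

lemma regroup22:
  assumes "vector_space s" and f: "\<And>b c d. hlin s (\<lambda>a. f a b c d)" "\<And>a c d. hlin s (\<lambda>b. f a b c d)"
    "\<And>a b d. hlin s (\<lambda>c. f a b c d)" "\<And>a b c. hlin s (\<lambda>d. f a b c d)"
  shows "cop h (\<lambda>x y. cop x (\<lambda>a b. cop y (\<lambda>c d. f a b c d))) = cop h (\<lambda>a u. cop u (\<lambda>v d. cop v (\<lambda>b c. f a b c d)))"
proof -
  have "cop h (\<lambda>x y. cop x (\<lambda>a b. cop y (\<lambda>c d. f a b c d))) = cop h (\<lambda>a u. cop u (\<lambda>b y. cop y (\<lambda>c d. f a b c d)))"
    by (rule cop_coassoc[OF assms(1)]) (intro hl f assms(1))+
  also have "\<dots> = cop h (\<lambda>a u. cop u (\<lambda>v d. cop v (\<lambda>b c. f a b c d)))"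
    by (simp only: cop_coassoc[OF assms(1) f(2,3,4)])
  finally show ?thesis .
qed

subsection \<open>The antipode and the adjoint action\<close>

lemma eps_mult: "\<epsilon> (g * h) = \<epsilon> g * \<epsilon> h" and eps_1: "\<epsilon> 1 = 1"
  by (rule hopf_unfold)+

lemma S_1: "S 1 = 1"
proof -
  have "cop 1 (\<lambda>x y. S x * y) = S 1 * 1" by (rule cop_1[OF vs]) (intro hl)+
  then show ?thesis using cop_S(1)[OF vs hl_id, of 1] by (simp add: eps_1)
qed

lemma eps_S: "\<epsilon> (S h) = \<epsilon> h"
proof -
  have "\<epsilon> (S h) = cop h (\<lambda>x y. \<epsilon> y * \<epsilon> (S x))"
    by (rule cop_counit(2)[OF vs_k, symmetric]) (intro hl)+
  also have "\<dots> = cop h (\<lambda>x y. \<epsilon> (S x * y))" by (simp add: eps_mult mult.commute)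
  also have "\<dots> = \<epsilon> h * \<epsilon> 1" by (rule cop_S(1)[OF vs_k]) (intro hl hopf_unfold)+
  finally show ?thesis by (simp add: eps_1)
qed

text \<open>
  The antipode is anti-multiplicative because both sides are convolution inverse to multiplication: the sum
  of the \<open>S (g\<^sub>1 h\<^sub>1) g\<^sub>2 h\<^sub>2 S h\<^sub>3 S g\<^sub>3\<close> is evaluated from both ends.
\<close>

lemma S_mult: "S (g * h) = S h * S g"
proof -
  let ?F = "\<lambda>g1 g2 g3 h1 h2 h3. S (g1 * h1) * (g2 * h2) * (S h3 * S g3)"
  have A: "cop h (\<lambda>h1 h'. cop h' (\<lambda>h2 h3. ?F g1 g2 g3 h1 h2 h3)) = S (g1 * h) * (g2 * S g3)" for g1 g2 g3
  proof -
    have "cop h' (\<lambda>h2 h3. ?F g1 g2 g3 h1 h2 h3) = hs (\<epsilon> h') (S (g1 * h1) * (g2 * S g3))" for h1 h'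
      using cop_S(2)[OF vs, of "\<lambda>z. S (g1 * h1) * (g2 * z * S g3)" h'] by (simp add: mult.assoc hl)
    then show ?thesis using cop_counit(2)[OF vs, of "\<lambda>x. S (g1 * x) * (g2 * S g3)" h] by (simp add: hl)
  qed
  have B: "cop h (\<lambda>h1 h'. cop h' (\<lambda>h2 h3. ?F g1 g2 g3 h1 h2 h3)) =
      cop h (\<lambda>y h3. cop y (\<lambda>h1 h2. ?F g1 g2 g3 h1 h2 h3))" for g1 g2 g3
    by (rule cop_coassoc[OF vs, symmetric]) (intro hl)+
  have "S (g * h) = cop g (\<lambda>g1 g'. cop g' (\<lambda>g2 g3. S (g1 * h) * (g2 * S g3)))"
  proof -
    have "cop g' (\<lambda>g2 g3. S (g1 * h) * (g2 * S g3)) = hs (\<epsilon> g') (S (g1 * h))" for g1 g'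
      using cop_S(2)[OF vs, of "\<lambda>z. S (g1 * h) * z" g'] by (simp add: hl)
    then show ?thesis using cop_counit(2)[OF vs, of "\<lambda>x. S (x * h)" g] by (simp add: hl)
  qed
  also have "\<dots> = cop g (\<lambda>g1 g'. cop g' (\<lambda>g2 g3. cop h (\<lambda>y h3. cop y (\<lambda>h1 h2. ?F g1 g2 g3 h1 h2 h3))))"
    by (simp only: A[symmetric] B)
  also have "\<dots> = cop g (\<lambda>x g3. cop x (\<lambda>g1 g2. cop h (\<lambda>y h3. cop y (\<lambda>h1 h2. ?F g1 g2 g3 h1 h2 h3))))"
    by (rule cop_coassoc[OF vs, symmetric]) (intro hl)+
  also have "\<dots> = cop g (\<lambda>x g3. cop h (\<lambda>y h3. cop x (\<lambda>g1 g2. cop y (\<lambda>h1 h2. ?F g1 g2 g3 h1 h2 h3))))"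
    by (intro arg_cong[where f = "cop g"] ext sweedler_swap)
  also have "\<dots> = cop g (\<lambda>x g3. cop h (\<lambda>y h3. cop (x * y) (\<lambda>a b. (S a * b) * (S h3 * S g3))))"
    by (subst cop_mult[OF vs]) (intro hl | simp)+
  also have "\<dots> = cop g (\<lambda>x g3. cop h (\<lambda>y h3. hs (\<epsilon> x) (hs (\<epsilon> y) (S h3 * S g3))))"
    by (subst cop_S(1)[OF vs]) (intro hl | simp add: eps_mult)+
  also have "\<dots> = cop g (\<lambda>x g3. hs (\<epsilon> x) (S h * S g3))"
  proof -
    have "cop h (\<lambda>y h3. hs (\<epsilon> y) (S h3 * w)) = S h * w" for w
      by (rule cop_counit(1)[OF vs]) (intro hl)
    then show ?thesis by (simp only: cop_lin_s[OF vs, symmetric])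
  qed
  also have "\<dots> = S h * S g" by (rule cop_counit(1)[OF vs]) (intro hl)+
  finally show ?thesis .
qed

lemma cop_antipode:
  assumes s: "vector_space s" and f: "hbil s f"
  shows "cop (S h) f = cop h (\<lambda>x y. f (S y) (S x))"
proof -
  interpret w: vector_space s by fact
  note fl = hl_comp[OF hbilD(1)[OF f]] hl_comp[OF hbilD(2)[OF f]]
  let ?F = "\<lambda>p q h2 h3 h4 h5. f (p * h2 * S h5) (q * h3 * S h4)"
  have "cop v (\<lambda>h3 z. cop z (\<lambda>h4 h5. ?F p q h2 h3 h4 h5)) = f (p * (h2 * S v)) q" for p q h2 v
  proof -
    have "cop v (\<lambda>h3 z. cop z (\<lambda>h4 h5. ?F p q h2 h3 h4 h5)) =
        cop v (\<lambda>z h5. cop z (\<lambda>h3 h4. f (p * h2 * S h5) (q * (h3 * S h4))))"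
      unfolding mult.assoc by (rule cop_coassoc[OF s, symmetric]) (intro hl fl s)+
    also have "\<dots> = cop v (\<lambda>z h5. s (\<epsilon> z) (f (p * h2 * S h5) (q * 1)))"
      by (subst cop_S(2)[OF s]) (intro hl fl | simp)+
    also have "\<dots> = f (p * h2 * S v) (q * 1)" by (rule cop_counit[OF s]) (intro hl fl s)+
    finally show ?thesis by (simp add: mult.assoc)
  qed
  note 1 = this
  have 2: "cop u (\<lambda>h2 v. f (p * (h2 * S v)) q) = s (\<epsilon> u) (f p q)" for p q u
    using cop_S(2)[OF s, of "\<lambda>z. f (p * z) q" u] by (simp add: hl fl)
  have 3: "cop x (\<lambda>h1 y. cop (S h1) (\<lambda>p q. cop y (\<lambda>h2 h3. cop w (\<lambda>h4 h5. ?F p q h2 h3 h4 h5)))) =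
      s (\<epsilon> x) (cop w (\<lambda>h4 h5. f (S h5) (S h4)))" for x w
  proof -
    let ?g = "\<lambda>a b. cop w (\<lambda>h4 h5. f (a * S h5) (b * S h4))"
    have g: "hbil s ?g" by (intro hl fl s)
    have "cop x (\<lambda>h1 y. cop (S h1) (\<lambda>p q. cop y (\<lambda>h2 h3. ?g (p * h2) (q * h3)))) = cop x (\<lambda>h1 y. cop (S h1 * y) ?g)"
      by (simp only: cop_mult[OF s g])
    also have "\<dots> = s (\<epsilon> x) (cop 1 ?g)" by (rule cop_S(1)[OF s]) (intro hl_cop[OF s] hl g)
    also have "cop 1 ?g = ?g 1 1" by (rule cop_1[OF s g])
    finally show ?thesis by simp
  qed
  have "cop (S h) f = cop h (\<lambda>h1 u. s (\<epsilon> u) (cop (S h1) f))"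
    by (rule cop_counit(2)[OF s, symmetric]) (intro hl_cop[OF s] hl s f)+
  also have "\<dots> = cop h (\<lambda>h1 u. cop (S h1) (\<lambda>p q. cop u (\<lambda>h2 v. cop v (\<lambda>h3 z. cop z (\<lambda>h4 h5. ?F p q h2 h3 h4 h5)))))"
    by (simp only: 1 2 cop_lin_s[OF s])
  also have "\<dots> = cop h (\<lambda>h1 u. cop u (\<lambda>h2 v. cop v (\<lambda>h3 z. cop (S h1) (\<lambda>p q. cop z (\<lambda>h4 h5. ?F p q h2 h3 h4 h5)))))"
    by (simp only: sweedler_swap[of "htens H" UNIV UNIV "comult H (S _)"])
  also have "\<dots> = cop h (\<lambda>x z. cop x (\<lambda>h1 y. cop y (\<lambda>h2 h3. cop (S h1) (\<lambda>p q. cop z (\<lambda>h4 h5. ?F p q h2 h3 h4 h5)))))"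
    by (rule regroup3[OF s]) (intro hl fl s)+
  also have "\<dots> = cop h (\<lambda>x z. cop x (\<lambda>h1 y. cop (S h1) (\<lambda>p q. cop y (\<lambda>h2 h3. cop z (\<lambda>h4 h5. ?F p q h2 h3 h4 h5)))))"
    by (intro arg_cong[where f = "cop _"] ext sweedler_swap)
  also have "\<dots> = cop h (\<lambda>x z. s (\<epsilon> x) (cop z (\<lambda>h4 h5. f (S h5) (S h4))))"
    by (simp only: 3)
  also have "\<dots> = cop h (\<lambda>h4 h5. f (S h5) (S h4))" by (rule cop_counit(1)[OF s]) (intro hl_cop[OF s] hl fl s)+
  finally show ?thesis .
qed

abbreviation "adj \<equiv> ad H"

lemma hl_ad: "hlin hs f \<Longrightarrow> hlin hs (\<lambda>x. adj (f x) a)" "hlin hs f \<Longrightarrow> hlin hs (\<lambda>x. adj h (f x))"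
  unfolding ad_def by (intro hl; assumption)+

lemma ad_mult: "adj (g * h) a = adj g (adj h a)"
proof -
  have "adj (g * h) a = cop g (\<lambda>g1 g2. cop h (\<lambda>h1 h2. g1 * h1 * a * S (g2 * h2)))"
    unfolding ad_def by (rule cop_mult[OF vs]) (intro hl)+
  also have "\<dots> = cop g (\<lambda>g1 g2. g1 * adj h a * S g2)"
    unfolding ad_def
    by (subst cop_lin[OF vs, where g = "\<lambda>z. g1 * z * S g2" for g1 g2]) (intro hl | simp add: S_mult mult.assoc)+
  finally show ?thesis by (simp add: ad_def)
qed

lemma ad_1: "adj 1 a = a"
proof -
  have "adj 1 a = 1 * a * S 1" unfolding ad_def by (rule cop_1[OF vs]) (intro hl)+
  then show ?thesis by (simp add: S_1)
qed

lemma eps_ad: "\<epsilon> (adj h a) = \<epsilon> h * \<epsilon> a"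
proof -
  have "\<epsilon> (adj h a) = cop h (\<lambda>x y. \<epsilon> (x * a * S y))"
    unfolding ad_def by (rule cop_lin[OF vs_k]) (intro hl hopf_unfold)+
  also have "\<dots> = cop h (\<lambda>x y. \<epsilon> y * (\<epsilon> x * \<epsilon> a))" by (simp add: eps_mult eps_S mult_ac)
  also have "\<dots> = \<epsilon> h * \<epsilon> a" by (rule cop_counit[OF vs_k]) (intro hl)+
  finally show ?thesis .
qed

lemma ad_prod: "cop h (\<lambda>x y. adj x a * adj y b) = adj h (a * b)"
proof -
  have 1: "z * adj y b = cop y (\<lambda>y1 y2. z * (y1 * b * S y2))" for y z
    unfolding ad_def by (rule cop_lin[OF vs, where g = "\<lambda>w. z * w"]) (intro hl)
  have "adj x a * adj y b = cop x (\<lambda>x1 x2. (x1 * a * S x2) * adj y b)" for x y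
    unfolding ad_def[of H x] by (rule cop_lin[OF vs, where g = "\<lambda>w. w * adj y b"]) (intro hl)
  then have "cop h (\<lambda>x y. adj x a * adj y b) =
      cop h (\<lambda>x y. cop x (\<lambda>x1 x2. cop y (\<lambda>y1 y2. (x1 * a * S x2) * (y1 * b * S y2))))"
    by (simp only: 1)
  also have "\<dots> = cop h (\<lambda>x y. cop x (\<lambda>x1 x2. cop y (\<lambda>y1 y2. x1 * a * (S x2 * y1) * (b * S y2))))"
    by (simp only: mult.assoc)
  also have "\<dots> = cop h (\<lambda>x1 u. cop u (\<lambda>v y2. cop v (\<lambda>x2 y1. x1 * a * (S x2 * y1) * (b * S y2))))"
    by (rule regroup22[OF vs]) (intro hl)+
  also have "\<dots> = cop h (\<lambda>x1 u. cop u (\<lambda>v y2. hs (\<epsilon> v) (x1 * a * 1 * (b * S y2))))"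
    by (subst cop_S(1)[OF vs, where f = "\<lambda>z. x1 * a * z * (b * S y2)" for x1 y2]) (intro hl | simp)+
  also have "\<dots> = cop h (\<lambda>x1 u. x1 * a * 1 * (b * S u))"
    by (subst cop_counit(1)[OF vs]) (intro hl | simp)+
  finally show ?thesis by (simp add: ad_def mult.assoc)
qed

lemma cop_ad:
  assumes s: "vector_space s" and f: "hbil s f"
  shows "cop (adj h d) f = cop h (\<lambda>h1 u. cop u (\<lambda>v h4. cop d (\<lambda>d1 d2. f (h1 * d1 * S h4) (adj v d2))))"
proof -
  note fl = hl_comp[OF hbilD(1)[OF f]] hl_comp[OF hbilD(2)[OF f]]
  have "cop (adj h d) f = cop h (\<lambda>x y. cop (x * d * S y) f)"
    unfolding ad_def by (rule cop_lin[OF s]) (intro hl_cop[OF s hl_id f])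
  also have "\<dots> = cop h (\<lambda>x y. cop x (\<lambda>x1 x2. cop d (\<lambda>d1 d2. cop y (\<lambda>y1 y2. f (x1 * d1 * S y2) (x2 * d2 * S y1)))))"
    by (subst cop_mult[OF s f], subst cop_mult[OF s], intro hl fl s, subst cop_antipode[OF s], intro hl fl, rule refl)
  also have "\<dots> = cop h (\<lambda>x y. cop x (\<lambda>x1 x2. cop y (\<lambda>y1 y2. cop d (\<lambda>d1 d2. f (x1 * d1 * S y2) (x2 * d2 * S y1)))))"
    by (intro arg_cong[where f = "cop _"] ext sweedler_swap)
  also have "\<dots> = cop h (\<lambda>x1 u. cop u (\<lambda>v y2. cop v (\<lambda>x2 y1. cop d (\<lambda>d1 d2. f (x1 * d1 * S y2) (x2 * d2 * S y1)))))"
    by (rule regroup22[OF s]) (intro hl fl s)+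
  also have "\<dots> = cop h (\<lambda>x1 u. cop u (\<lambda>v y2. cop d (\<lambda>d1 d2. cop v (\<lambda>x2 y1. f (x1 * d1 * S y2) (x2 * d2 * S y1)))))"
    by (intro arg_cong[where f = "cop _"] ext sweedler_swap)
  also have "\<dots> = cop h (\<lambda>x1 u. cop u (\<lambda>v y2. cop d (\<lambda>d1 d2. f (x1 * d1 * S y2) (adj v d2))))"
    unfolding ad_def by (subst cop_lin[OF s hbilD(2)[OF f]]) (rule refl)
  finally show ?thesis .
qed

lemma ad_mult_move: "cop u (\<lambda>x y. adj x c * y) = u * c"
proof -
  have "adj x c * z = cop x (\<lambda>x1 x2. (x1 * c * S x2) * z)" for x z
    unfolding ad_def by (rule cop_lin[OF vs, where g = "\<lambda>w. w * z"]) (intro hl)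
  then have "cop u (\<lambda>x y. adj x c * y) = cop u (\<lambda>x y. cop x (\<lambda>x1 x2. x1 * c * (S x2 * y)))"
    by (simp only: mult.assoc)
  also have "\<dots> = cop u (\<lambda>x1 z. cop z (\<lambda>x2 y. x1 * c * (S x2 * y)))"
    by (rule cop_coassoc[OF vs]) (intro hl)+
  also have "\<dots> = cop u (\<lambda>x1 z. hs (\<epsilon> z) (x1 * c * 1))"
    by (subst cop_S(1)[OF vs]) (intro hl | simp)+
  also have "\<dots> = u * c * 1" by (rule cop_counit[OF vs]) (intro hl)+
  finally show ?thesis by simp
qed

end

section \<open>Quasi-triangular structures\<close>

locale qt_hopf = fd_hopf H for H :: "('k::field, 'h::ring_1) hopf" +
  fixes R :: "'k univ"
  assumes qt: "quasitriangular H R"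
begin

abbreviation RR :: "('h \<Rightarrow> 'h \<Rightarrow> 'c::comm_monoid_add) \<Rightarrow> 'c" where "RR f \<equiv> hsw H R f"

lemma R_in: "R \<in> tensor_space (htens H) UNIV UNIV"
  using qt by (simp add: quasitriangular_def)

lemma R_move:
  assumes "vector_space s" "hbil s f"
  shows "RR (\<lambda>r1 r2. cop h (\<lambda>h1 h2. f (r1 * h1) (r2 * h2))) = RR (\<lambda>r1 r2. cop h (\<lambda>h1 h2. f (h2 * r1) (h1 * r2)))"
proof -
  have "RR (\<lambda>r1 r2. cop h (\<lambda>h1 h2. htens H (r1 * h1) (r2 * h2))) = RR (\<lambda>r1 r2. cop h (\<lambda>h1 h2. htens H (h2 * r1) (h1 * r2)))"
    using qt unfolding quasitriangular_def by blast
  from arg_cong[OF this, of "\<lambda>t. hsw H t f"] show ?thesis by (simp only: hsw_htens2(1)[OF assms])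
qed

lemma R_comult:
  assumes "vector_space s" and f: "\<And>b c. hlin s (\<lambda>a. f a b c)" "\<And>a c. hlin s (\<lambda>b. f a b c)" "\<And>a b. hlin s (\<lambda>c. f a b c)"
  shows "RR (\<lambda>r1 r2. cop r1 (\<lambda>a b. f a b r2)) = RR (\<lambda>r1 r2. RR (\<lambda>q1 q2. f r1 q1 (r2 * q2)))"
    and "RR (\<lambda>r1 r2. cop r2 (\<lambda>a b. f r1 a b)) = RR (\<lambda>r1 r2. RR (\<lambda>q1 q2. f (r1 * q1) q2 r2))"
proof -
  obtain F where F: "lin uscale s F" "\<And>a b c. a \<in> UNIV \<Longrightarrow> b \<in> UNIV \<Longrightarrow> c \<in> UNIV \<Longrightarrow> F (htens3 H a b c) = f a b c"
    by (rule trilin_extends[OF embH embH embH assms(1), of f]) (auto intro: hbilI f)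
  note l = sweedler_lin[OF vs_u assms(1) F(1)]
  have 1: "RR (\<lambda>r1 r2. cop r1 (\<lambda>a b. htens3 H a b r2)) = RR (\<lambda>r1 r2. RR (\<lambda>q1 q2. htens3 H r1 q1 (r2 * q2)))"
    and 2: "RR (\<lambda>r1 r2. cop r2 (\<lambda>a b. htens3 H r1 a b)) = RR (\<lambda>r1 r2. RR (\<lambda>q1 q2. htens3 H (r1 * q1) q2 r2))"
    using qt unfolding quasitriangular_def by blast+
  show "RR (\<lambda>r1 r2. cop r1 (\<lambda>a b. f a b r2)) = RR (\<lambda>r1 r2. RR (\<lambda>q1 q2. f r1 q1 (r2 * q2)))"
    using arg_cong[OF 1, of F] by (simp add: l F(2))
  show "RR (\<lambda>r1 r2. cop r2 (\<lambda>a b. f r1 a b)) = RR (\<lambda>r1 r2. RR (\<lambda>q1 q2. f (r1 * q1) q2 r2))"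
    using arg_cong[OF 2, of F] by (simp add: l F(2))
qed

lemma R_self: "RR (\<lambda>a b. htens H a b) = R"
  by (rule sweedler_self[OF embH embH R_in])

text \<open>
  The maps \<open>p\<close> and \<open>q\<close> are the left multiplications by \<open>p 1\<close> and \<open>q 1\<close>, so the first premise reads
  \<open>(p 1 \<otimes> q 1) R = R\<close>, and \<open>R\<close> is invertible.
\<close>

lemma R_unit_left:
  assumes "RR (\<lambda>a b. htens H (p a) (q b)) = R" "hlin hs p" "hlin hs q" "\<And>a b. p (a * b) = p a * b" "\<And>a b. q (a * b) = q a * b"
    and "vector_space s" "hbil s f"
  shows "f (p 1) (q 1) = f 1 1"
proof -
  obtain R' where R': "R' \<in> tensor_space (htens H) UNIV UNIV"
    "RR (\<lambda>a b. hsw H R' (\<lambda>c d. htens H (a * c) (b * d))) = htens H 1 1"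
    using qt unfolding quasitriangular_def htens_mult_def by blast
  have inv: "RR (\<lambda>a b. hsw H R' (\<lambda>c d. g (a * c) (b * d))) = g 1 1" if g: "hbil s g" for g
    using arg_cong[OF R'(2), of "\<lambda>t. hsw H t g"] by (simp only: hsw_htens2(1)[OF assms(6) g] hsw_htens(2)[OF assms(6) g])
  note fl = hl_comp[OF hbilD(1)[OF assms(7)]] hl_comp[OF hbilD(2)[OF assms(7)]]
  have R1: "RR (\<lambda>a b. g (p a) (q b)) = RR g" if g: "hbil s g" for g
    using arg_cong[OF assms(1), of "\<lambda>t. hsw H t g"] by (simp only: hsw_htens(1)[OF assms(6) g])
  have "f (p 1) (q 1) = RR (\<lambda>a b. hsw H R' (\<lambda>c d. f (p (a * c)) (q (b * d))))"
    by (rule inv[symmetric]) (intro hl fl assms(2,3))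
  also have "\<dots> = RR (\<lambda>a b. hsw H R' (\<lambda>c d. f (p a * c) (q b * d)))" by (simp only: assms(4,5))
  also have "\<dots> = RR (\<lambda>a b. hsw H R' (\<lambda>c d. f (a * c) (b * d)))"
    by (rule R1) (intro hl fl assms(6))
  also have "\<dots> = f 1 1" by (rule inv[OF assms(7)])
  finally show ?thesis .
qed

lemma R_eps:
  assumes s: "vector_space s" and f: "hlin s f"
  shows "RR (\<lambda>a b. s (\<epsilon> a) (f b)) = f 1" "RR (\<lambda>a b. s (\<epsilon> b) (f a)) = f 1"
proof -
  define e where "e = RR (\<lambda>a b. hs (\<epsilon> a) b)"
  have "RR (\<lambda>r1 r2. cop r1 (\<lambda>a b. \<epsilon> a *\<^sub>u htens H b r2)) =
      RR (\<lambda>r1 r2. RR (\<lambda>q1 q2. \<epsilon> r1 *\<^sub>u htens H q1 (r2 * q2)))"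
    by (rule R_comult(1)[OF vs_u]) (intro hl)+
  also have "\<dots> = RR (\<lambda>q1 q2. RR (\<lambda>r1 r2. \<epsilon> r1 *\<^sub>u htens H q1 (r2 * q2)))" by (rule sweedler_swap)
  also have "\<dots> = RR (\<lambda>q1 q2. htens H q1 (e * q2))"
  proof -
    have "htens H q1 (e * q2) = RR (\<lambda>r1 r2. htens H q1 (hs (\<epsilon> r1) r2 * q2))" for q1 q2
      unfolding e_def by (rule cop_lin[OF vs_u, where g = "\<lambda>z. htens H q1 (z * q2)"]) (intro hl)
    moreover have "htens H q1 (hs (\<epsilon> r1) r2 * q2) = \<epsilon> r1 *\<^sub>u htens H q1 (r2 * q2)" for q1 q2 r1 r2
      by (rule hscl[where f = "\<lambda>z. htens H q1 (z * q2)"]) (intro hl)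
    ultimately show ?thesis by simp
  qed
  also have "RR (\<lambda>r1 r2. cop r1 (\<lambda>a b. \<epsilon> a *\<^sub>u htens H b r2)) = RR (\<lambda>r1 r2. htens H r1 r2)"
    by (subst cop_counit(1)[OF vs_u, where f = "\<lambda>b. htens H b r" for r]) (intro hl | simp)+
  finally have 1: "RR (\<lambda>q1 q2. htens H q1 (e * q2)) = R" by (simp add: R_self)
  have "s (\<epsilon> 1) (f (e * 1)) = s (\<epsilon> 1) (f 1)"
    by (rule R_unit_left[OF 1, where s = s and f = "\<lambda>a b. s (\<epsilon> a) (f b)"])
      (intro hl s hl_comp[OF f] | simp add: mult.assoc)+
  then have "f e = f 1" using vector_space.vector_space_assms(4)[OF s] by (simp add: eps_1)
  moreover have "f e = RR (\<lambda>a b. s (\<epsilon> a) (f b))"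
    unfolding e_def by (simp only: cop_lin[OF s f] hscl[OF f])
  ultimately show "RR (\<lambda>a b. s (\<epsilon> a) (f b)) = f 1" by simp
next
  define e where "e = RR (\<lambda>a b. hs (\<epsilon> b) a)"
  have "RR (\<lambda>r1 r2. cop r2 (\<lambda>a b. \<epsilon> b *\<^sub>u htens H r1 a)) =
      RR (\<lambda>r1 r2. RR (\<lambda>q1 q2. \<epsilon> r2 *\<^sub>u htens H (r1 * q1) q2))"
    by (rule R_comult(2)[OF vs_u]) (intro hl)+
  also have "\<dots> = RR (\<lambda>q1 q2. RR (\<lambda>r1 r2. \<epsilon> r2 *\<^sub>u htens H (r1 * q1) q2))" by (rule sweedler_swap)
  also have "\<dots> = RR (\<lambda>q1 q2. htens H (e * q1) q2)"
  proof -
    have "htens H (e * q1) q2 = RR (\<lambda>r1 r2. htens H (hs (\<epsilon> r2) r1 * q1) q2)" for q1 q2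
      unfolding e_def by (rule cop_lin[OF vs_u, where g = "\<lambda>z. htens H (z * q1) q2"]) (intro hl)
    moreover have "htens H (hs (\<epsilon> r2) r1 * q1) q2 = \<epsilon> r2 *\<^sub>u htens H (r1 * q1) q2" for q1 q2 r1 r2
      by (rule hscl[where f = "\<lambda>z. htens H (z * q1) q2"]) (intro hl)
    ultimately show ?thesis by simp
  qed
  also have "RR (\<lambda>r1 r2. cop r2 (\<lambda>a b. \<epsilon> b *\<^sub>u htens H r1 a)) = RR (\<lambda>r1 r2. htens H r1 r2)"
    by (subst cop_counit(2)[OF vs_u, where f = "\<lambda>b. htens H r b" for r]) (intro hl | simp)+
  finally have 1: "RR (\<lambda>q1 q2. htens H (e * q1) q2) = R" by (simp add: R_self)
  have "s (\<epsilon> 1) (f (e * 1)) = s (\<epsilon> 1) (f 1)"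
    by (rule R_unit_left[OF 1, where s = s and f = "\<lambda>a b. s (\<epsilon> b) (f a)"])
      (intro hl s hl_comp[OF f] | simp add: mult.assoc)+
  then have "f e = f 1" using vector_space.vector_space_assms(4)[OF s] by (simp add: eps_1)
  moreover have "f e = RR (\<lambda>a b. s (\<epsilon> b) (f a))"
    unfolding e_def by (simp only: cop_lin[OF s f] hscl[OF f])
  ultimately show "RR (\<lambda>a b. s (\<epsilon> b) (f a)) = f 1" by simp
qed

text \<open>
  The inverses of \<open>R\<close> in \<open>H \<otimes> H\<close> and in \<open>H \<otimes> H\<^sup>o\<^sup>p\<close>, obtained by applying the antipode to the two hexagon axioms.
\<close>

lemma R_inverse:
  assumes s: "vector_space s" and f: "hbil s f"
  shows "RR (\<lambda>r1 r2. RR (\<lambda>q1 q2. f (r1 * S q1) (r2 * q2))) = f 1 1"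
    and "RR (\<lambda>r1 r2. RR (\<lambda>q1 q2. f (r1 * q1) (q2 * S r2))) = f 1 1"
    and "RR (\<lambda>r1 r2. RR (\<lambda>q1 q2. f (r1 * q1) (S q2 * r2))) = f 1 1"
proof -
  note fl = hl_comp[OF hbilD(1)[OF f]] hl_comp[OF hbilD(2)[OF f]]
  have "RR (\<lambda>r1 r2. RR (\<lambda>q1 q2. f (r1 * S q1) (r2 * q2))) = RR (\<lambda>r1 r2. cop r1 (\<lambda>a b. f (a * S b) r2))"
    by (rule R_comult(1)[OF s, symmetric]) (intro hl fl)+
  also have "\<dots> = RR (\<lambda>r1 r2. s (\<epsilon> r1) (f 1 r2))"
    by (simp only: cop_S(2)[OF s hbilD(1)[OF f]])
  also have "\<dots> = f 1 1" by (rule R_eps(1)[OF s]) (intro fl hl)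
  finally show "RR (\<lambda>r1 r2. RR (\<lambda>q1 q2. f (r1 * S q1) (r2 * q2))) = f 1 1" .
  have "RR (\<lambda>r1 r2. RR (\<lambda>q1 q2. f (r1 * q1) (q2 * S r2))) = RR (\<lambda>r1 r2. cop r2 (\<lambda>a b. f r1 (a * S b)))"
    by (rule R_comult(2)[OF s, symmetric]) (intro hl fl)+
  also have "\<dots> = RR (\<lambda>r1 r2. s (\<epsilon> r2) (f r1 1))"
    by (simp only: cop_S(2)[OF s hbilD(2)[OF f]])
  also have "\<dots> = f 1 1" by (rule R_eps(2)[OF s]) (intro fl hl)
  finally show "RR (\<lambda>r1 r2. RR (\<lambda>q1 q2. f (r1 * q1) (q2 * S r2))) = f 1 1" .
  have "RR (\<lambda>r1 r2. RR (\<lambda>q1 q2. f (r1 * q1) (S q2 * r2))) = RR (\<lambda>r1 r2. cop r2 (\<lambda>a b. f r1 (S a * b)))"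
    by (rule R_comult(2)[OF s, symmetric]) (intro hl fl)+
  also have "\<dots> = RR (\<lambda>r1 r2. s (\<epsilon> r2) (f r1 1))"
    by (simp only: cop_S(1)[OF s hbilD(2)[OF f]])
  also have "\<dots> = f 1 1" by (rule R_eps(2)[OF s]) (intro fl hl)
  finally show "RR (\<lambda>r1 r2. RR (\<lambda>q1 q2. f (r1 * q1) (S q2 * r2))) = f 1 1" .
qed

lemma R_antipode:
  assumes s: "vector_space s" and f: "hbil s f"
  shows "RR (\<lambda>r1 r2. f (S r1) (S r2)) = RR f"
proof -
  note fl = hl_comp[OF hbilD(1)[OF f]] hl_comp[OF hbilD(2)[OF f]]
  let ?X = "\<lambda>p1 p2 q1 q2 s1 s2. f (p1 * S q1 * S s1) (p2 * q2 * S s2)"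
  have 1: "RR (\<lambda>p1 p2. RR (\<lambda>q1 q2. ?X p1 p2 q1 q2 s1 s2)) = f (S s1) (S s2)" for s1 s2
    using R_inverse(1)[OF s, of "\<lambda>a b. f (a * S s1) (b * S s2)"] by (simp add: hl fl)
  have 2: "RR (\<lambda>s1 s2. RR (\<lambda>q1 q2. ?X p1 p2 q1 q2 s1 s2)) = f p1 p2" for p1 p2
    using R_inverse(2)[OF s, of "\<lambda>a b. f (p1 * S a) (p2 * b)"] by (simp add: hl fl S_mult S_1 mult.assoc)
  have "RR (\<lambda>r1 r2. f (S r1) (S r2)) = RR (\<lambda>s1 s2. RR (\<lambda>p1 p2. RR (\<lambda>q1 q2. ?X p1 p2 q1 q2 s1 s2)))"
    by (simp only: 1)
  also have "\<dots> = RR (\<lambda>p1 p2. RR (\<lambda>s1 s2. RR (\<lambda>q1 q2. ?X p1 p2 q1 q2 s1 s2)))" by (rule sweedler_swap)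
  also have "\<dots> = RR f" by (simp only: 2)
  finally show ?thesis .
qed

subsection \<open>The transmuted coproduct\<close>

abbreviation copR :: "'h \<Rightarrow> ('h \<Rightarrow> 'h \<Rightarrow> 'c::comm_monoid_add) \<Rightarrow> 'c"
  where "copR d f \<equiv> cop d (\<lambda>d1 d2. RR (\<lambda>r1 r2. f (d1 * S r2) (adj r1 d2)))"

lemma comult_R_in: "comult_R H R d \<in> tensor_space (htens H) UNIV UNIV"
  unfolding comult_R_def by (rule hsw_htens2(2)[OF vs_u, of "htens H"]) (intro hl)

lemma hsw_comult_R:
  assumes "vector_space s" "hbil s f"
  shows "hsw H (comult_R H R d) f = copR d f"
  unfolding comult_R_def by (rule hsw_htens2(1)[OF assms])

lemma hl_copR:
  assumes s: "vector_space s" and g: "hlin hs g" and f: "hbil s f"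
  shows "hlin s (\<lambda>a. copR (g a) f)"
  by (intro hl_cop[OF s g] hl hl_ad s hl_comp[OF hbilD(1)[OF f]] hl_comp[OF hbilD(2)[OF f]])

text \<open>The adjoint action makes \<open>H\<close> with the transmuted coproduct a coalgebra in the category of \<open>H\<close>-modules.\<close>

lemma copR_ad:
  assumes s: "vector_space s" and f: "hbil s f"
  shows "copR (adj h d) f = cop h (\<lambda>x y. copR d (\<lambda>a b. f (adj x a) (adj y b)))"
proof -
  note fl = hl_comp[OF hbilD(1)[OF f]] hl_comp[OF hbilD(2)[OF f]]
  let ?M = "\<lambda>h1 p q. cop d (\<lambda>d1 d2. f (h1 * d1 * S q) (adj p d2))"
  have "copR (adj h d) f = cop h (\<lambda>h1 u. cop u (\<lambda>v h4. cop d (\<lambda>d1 d2. RR (\<lambda>r1 r2. f (h1 * d1 * S h4 * S r2) (adj r1 (adj v d2))))))"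
    by (rule cop_ad[OF s]) (intro hl hl_ad fl s)
  also have "\<dots> = cop h (\<lambda>h1 u. cop u (\<lambda>v h4. cop d (\<lambda>d1 d2. RR (\<lambda>r1 r2. f (h1 * d1 * S (r2 * h4)) (adj (r1 * v) d2)))))"
    by (simp only: ad_mult S_mult mult.assoc)
  also have "\<dots> = cop h (\<lambda>h1 u. cop u (\<lambda>v h4. RR (\<lambda>r1 r2. ?M h1 (r1 * v) (r2 * h4))))"
    by (intro arg_cong[where f = "cop _"] ext sweedler_swap)
  also have "\<dots> = cop h (\<lambda>h1 u. RR (\<lambda>r1 r2. cop u (\<lambda>v h4. ?M h1 (r1 * v) (r2 * h4))))"
    by (intro arg_cong[where f = "cop _"] ext sweedler_swap)
  also have "\<dots> = cop h (\<lambda>h1 u. RR (\<lambda>r1 r2. cop u (\<lambda>v h4. ?M h1 (h4 * r1) (v * r2))))"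
    by (subst R_move[OF s]) (intro hl hl_ad fl s | rule refl)+
  also have "\<dots> = cop h (\<lambda>h1 u. cop u (\<lambda>v h4. RR (\<lambda>r1 r2. ?M h1 (h4 * r1) (v * r2))))"
    by (intro arg_cong[where f = "cop _"] ext sweedler_swap)
  also have "\<dots> = cop h (\<lambda>x h4. cop x (\<lambda>h1 v. RR (\<lambda>r1 r2. ?M h1 (h4 * r1) (v * r2))))"
    by (rule cop_coassoc[OF s, symmetric]) (intro hl hl_ad fl s)+
  also have "\<dots> = cop h (\<lambda>x h4. RR (\<lambda>r1 r2. cop d (\<lambda>d1 d2. cop x (\<lambda>h1 v. f (h1 * (d1 * S r2) * S v) (adj h4 (adj r1 d2))))))"
    by (simp only: ad_mult S_mult mult.assoc sweedler_swap[of "htens H" UNIV UNIV "comult H _" "htens H" UNIV UNIV R]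
        sweedler_swap[of "htens H" UNIV UNIV "comult H d"])
  also have "\<dots> = cop h (\<lambda>x h4. RR (\<lambda>r1 r2. cop d (\<lambda>d1 d2. f (adj x (d1 * S r2)) (adj h4 (adj r1 d2)))))"
    unfolding ad_def[of H _ "_ * S _"] by (simp only: cop_lin[OF s hbilD(1)[OF f]])
  also have "\<dots> = cop h (\<lambda>x y. copR d (\<lambda>a b. f (adj x a) (adj y b)))"
    by (intro arg_cong[where f = "cop _"] ext sweedler_swap)
  finally show ?thesis .
qed

lemma copR_inverse:
  assumes s: "vector_space s" and f: "hbil s f"
  shows "copR d (\<lambda>a b. RR (\<lambda>p1 p2. f (a * p2) (adj p1 b))) = cop d f"
proof -
  note fl = hl_comp[OF hbilD(1)[OF f]] hl_comp[OF hbilD(2)[OF f]]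
  have "RR (\<lambda>r1 r2. RR (\<lambda>p1 p2. f (d1 * S r2 * p2) (adj p1 (adj r1 d2)))) = f d1 d2" for d1 d2
  proof -
    have "RR (\<lambda>r1 r2. RR (\<lambda>p1 p2. f (d1 * S r2 * p2) (adj p1 (adj r1 d2)))) =
        RR (\<lambda>p1 p2. RR (\<lambda>r1 r2. f (d1 * (S r2 * p2)) (adj (p1 * r1) d2)))"
      unfolding ad_mult mult.assoc by (rule sweedler_swap)
    also have "\<dots> = f (d1 * 1) (adj 1 d2)" by (rule R_inverse(3)[OF s]) (intro hl hl_ad fl)
    finally show ?thesis by (simp add: ad_1)
  qed
  then show ?thesis by simp
qed

text \<open>
  \<open>sigma\<close> is the antipode of the transmuted braided group; it commutes with the adjoint action.
\<close>

definition sigma :: "'h \<Rightarrow> 'h" where "sigma b = RR (\<lambda>r1 r2. r2 * S (adj r1 b))"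

lemma hl_sigma: "hlin hs f \<Longrightarrow> hlin hs (\<lambda>x. sigma (f x))"
  unfolding sigma_def by (intro hl hl_ad)

lemma sigma_ad: "sigma (adj h b) = adj h (sigma b)"
proof -
  have e: "r2 * S (adj (r1 * h) b) = cop h (\<lambda>x h3. cop x (\<lambda>h1 h2. r2 * h2 * S h3 * S (adj (r1 * h1) b)))" for r1 r2
  proof -
    have "cop h (\<lambda>x h3. cop x (\<lambda>h1 h2. r2 * h2 * S h3 * S (adj (r1 * h1) b))) =
        cop h (\<lambda>h1 u. cop u (\<lambda>h2 h3. r2 * (h2 * S h3) * S (adj (r1 * h1) b)))"
      unfolding mult.assoc by (rule cop_coassoc[OF vs]) (intro hl hl_ad)+
    also have "\<dots> = cop h (\<lambda>h1 u. hs (\<epsilon> u) (r2 * 1 * S (adj (r1 * h1) b)))"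
      by (subst cop_S(2)[OF vs]) (intro hl | rule refl)+
    also have "\<dots> = r2 * 1 * S (adj (r1 * h) b)" by (rule cop_counit[OF vs]) (intro hl hl_ad)
    finally show ?thesis by simp
  qed
  let ?N = "\<lambda>h3 p q. q * S h3 * S (adj p b)"
  have S: "cop u (\<lambda>h2 h3. S h3 * S (adj h2 c)) = S c * S u" for u c
  proof -
    have "cop u (\<lambda>h2 h3. S h3 * S (adj h2 c)) = S (cop u (\<lambda>x y. adj x c * y))"
      by (simp only: cop_lin[OF vs hopf_unfold(6)] S_mult)
    then show ?thesis by (simp add: ad_mult_move S_mult)
  qed
  have "sigma (adj h b) = RR (\<lambda>r1 r2. cop h (\<lambda>x h3. cop x (\<lambda>h1 h2. ?N h3 (r1 * h1) (r2 * h2))))"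
    unfolding sigma_def ad_mult[symmetric] e ..
  also have "\<dots> = cop h (\<lambda>x h3. RR (\<lambda>r1 r2. cop x (\<lambda>h1 h2. ?N h3 (r1 * h1) (r2 * h2))))"
    by (rule sweedler_swap)
  also have "\<dots> = cop h (\<lambda>x h3. RR (\<lambda>r1 r2. cop x (\<lambda>h1 h2. ?N h3 (h2 * r1) (h1 * r2))))"
    by (subst R_move[OF vs]) (intro hl hl_ad | rule refl)+
  also have "\<dots> = RR (\<lambda>r1 r2. cop h (\<lambda>x h3. cop x (\<lambda>h1 h2. ?N h3 (h2 * r1) (h1 * r2))))"
    by (rule sweedler_swap)
  also have "\<dots> = RR (\<lambda>r1 r2. cop h (\<lambda>h1 u. cop u (\<lambda>h2 h3. ?N h3 (h2 * r1) (h1 * r2))))"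
    by (subst cop_coassoc[OF vs]) (intro hl hl_ad | rule refl)+
  also have "\<dots> = RR (\<lambda>r1 r2. cop h (\<lambda>h1 u. h1 * r2 * (S (adj r1 b) * S u)))"
  proof -
    have "cop u (\<lambda>h2 h3. ?N h3 (h2 * r1) (h1 * r2)) = h1 * r2 * cop u (\<lambda>h2 h3. S h3 * S (adj h2 (adj r1 b)))" for h1 u r1 r2
    proof -
      have "h1 * r2 * cop u (\<lambda>h2 h3. S h3 * S (adj h2 (adj r1 b))) = cop u (\<lambda>h2 h3. h1 * r2 * (S h3 * S (adj h2 (adj r1 b))))"
        by (rule cop_lin[OF vs, where g = "\<lambda>z. h1 * r2 * z"]) (intro hl)
      then show ?thesis by (simp only: ad_mult mult.assoc)
    qed
    then show ?thesis by (simp only: S)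
  qed
  also have "\<dots> = cop h (\<lambda>h1 u. RR (\<lambda>r1 r2. h1 * r2 * (S (adj r1 b) * S u)))" by (rule sweedler_swap)
  also have "\<dots> = adj h (sigma b)"
  proof -
    have "h1 * sigma b * S u = RR (\<lambda>r1 r2. h1 * (r2 * S (adj r1 b)) * S u)" for h1 u
      unfolding sigma_def by (rule cop_lin[OF vs, where g = "\<lambda>z. h1 * z * S u"]) (intro hl)
    then show ?thesis by (simp only: ad_def[of H h] mult.assoc)
  qed
  finally show ?thesis .
qed

end

section \<open>Integrals\<close>

context fd_hopf
begin

text \<open>
  A complement of the augmentation ideal consists of left integrals.  Left integrals of augmentation zero
  vanish, as they span nilpotent left ideals; hence the integral is two-sided.
\<close>

lemma integral_exists:
  assumes "semisimple_algebra (hopf_alg H)"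
  shows "\<exists>L. (\<forall>h. h * L = hs (\<epsilon> h) L) \<and> (\<forall>h. L * h = hs (\<epsilon> h) L) \<and> \<epsilon> L = 1"
proof -
  have compl: "\<exists>J. hv.subspace J \<and> (\<forall>a. \<forall>x\<in>J. a * x \<in> J) \<and> I \<inter> J = {0} \<and> (\<forall>h. \<exists>x\<in>I. \<exists>y\<in>J. h = x + y)"
    if I: "hv.subspace I" "\<And>a x. x \<in> I \<Longrightarrow> a * x \<in> I" for I
  proof -
    have "left_ideal (hopf_alg H) I" using I by (auto simp: left_ideal_def hopf_alg_def)
    then obtain J where J: "left_ideal (hopf_alg H) J" "I \<inter> J = {0}" "UNIV = {x + y |x y. x \<in> I \<and> y \<in> J}"
      using assms unfolding semisimple_algebra_def by (auto simp: hopf_alg_def)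
    have "\<exists>x\<in>I. \<exists>y\<in>J. h = x + y" for h using UNIV_I[of h] unfolding J(3) by blast
    then show ?thesis using J(1,2) by (intro exI[of _ J]) (auto simp: left_ideal_def hopf_alg_def)
  qed
  have el: "\<epsilon> (x + y) = \<epsilon> x + \<epsilon> y" "\<epsilon> (hs c x) = c * \<epsilon> x" for x y c
    using hopf_unfold(5) by (auto simp: lin_on_def)
  have e0: "\<epsilon> 0 = 0" using el(2)[of 0 0] by simp
  have "hv.subspace {h. \<epsilon> h = 0}" by (rule hv.subspaceI) (auto simp: el e0)
  then obtain J where J: "hv.subspace J" "\<And>a x. x \<in> J \<Longrightarrow> a * x \<in> J" "{h. \<epsilon> h = 0} \<inter> J = {0}"
    "\<And>h. \<exists>x\<in>{h. \<epsilon> h = 0}. \<exists>y\<in>J. h = x + y"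
    using compl[of "{h. \<epsilon> h = 0}"] by (auto simp: eps_mult)
  obtain i j where ij: "\<epsilon> i = 0" "j \<in> J" "1 = i + j" using J(4)[of 1] by auto
  have "\<epsilon> (i + j) = 1" unfolding ij(3)[symmetric] by (rule eps_1)
  then have ej: "\<epsilon> j = 1" using ij(1) by (simp add: el)
  have left: "h * j = hs (\<epsilon> h) j" for h
  proof -
    have "h * j - hs (\<epsilon> h) j \<in> J"
      by (intro hv.subspace_diff[OF J(1)] hv.subspace_scale[OF J(1)] J(2) ij(2))
    moreover have "\<epsilon> (h * j - hs (\<epsilon> h) j) = 0"
      using el(1)[of "h * j - hs (\<epsilon> h) j" "hs (\<epsilon> h) j"] by (simp add: eps_mult el(2) ej)
    ultimately have "h * j - hs (\<epsilon> h) j \<in> {0}" using J(3) by blast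
    then show ?thesis by simp
  qed
  have zero: "t = 0" if t: "\<And>g. g * t = hs (\<epsilon> g) t" "\<epsilon> t = 0" for t
  proof -
    have "hv.subspace (range (\<lambda>c. hs c t))"
      using subspace_image[OF vs_k vs subspace_UNIV[OF vs_k], of "\<lambda>c. hs c t"]
      by (simp add: lin_on_def hv.scale_left_distrib)
    moreover have "a * x \<in> range (\<lambda>c. hs c t)" if "x \<in> range (\<lambda>c. hs c t)" for a x
      using that by (auto simp: mult_scale t(1))
    ultimately have "\<exists>J. hv.subspace J \<and> (\<forall>a. \<forall>x\<in>J. a * x \<in> J) \<and> range (\<lambda>c. hs c t) \<inter> J = {0} \<and>
        (\<forall>h. \<exists>x\<in>range (\<lambda>c. hs c t). \<exists>y\<in>J. h = x + y)"
      by (rule compl)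
    then obtain K where K0: "hv.subspace K \<and> (\<forall>a. \<forall>x\<in>K. a * x \<in> K) \<and> range (\<lambda>c. hs c t) \<inter> K = {0} \<and>
        (\<forall>h. \<exists>x\<in>range (\<lambda>c. hs c t). \<exists>y\<in>K. h = x + y)" ..
    then have K: "\<And>a x. x \<in> K \<Longrightarrow> a * x \<in> K" "range (\<lambda>c. hs c t) \<inter> K = {0}"
      "\<And>h. \<exists>x\<in>range (\<lambda>c. hs c t). \<exists>y\<in>K. h = x + y" by simp_all
    obtain c k where ck: "k \<in> K" "1 = hs c t + k" using K(3)[of 1] by blast
    have "t = t * (hs c t + k)" unfolding ck(2)[symmetric] by simp
    also have "\<dots> = t * k" by (simp add: distrib_left mult_scale t)
    finally have "t \<in> K" using K(1)[OF ck(1), of t] by simp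
    moreover have "t = hs 1 t" by simp
    then have "t \<in> range (\<lambda>c. hs c t)" by blast
    ultimately show ?thesis using K(2) by blast
  qed
  have "j * h = hs (\<epsilon> h) j" for h
  proof -
    have "j * h - hs (\<epsilon> h) j = 0"
    proof (rule zero)
      show "g * (j * h - hs (\<epsilon> h) j) = hs (\<epsilon> g) (j * h - hs (\<epsilon> h) j)" for g
        by (simp add: right_diff_distrib mult.assoc[symmetric] left mult_scale hv.scale_right_diff_distrib mult.commute)
      show "\<epsilon> (j * h - hs (\<epsilon> h) j) = 0"
        using el(1)[of "j * h - hs (\<epsilon> h) j" "hs (\<epsilon> h) j"] by (simp add: eps_mult el(2) ej)
    qed
    then show ?thesis by simp
  qed
  then show ?thesis using left ej by blast
qed

lemma tensor_space_emb: "tensor_space (htens H) A B = tensor_sp (hemb H ` A) (hemb H ` B)"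
  unfolding tensor_space_def by (rule arg_cong[where f = "uv.span"]) blast

lemma hemb_inj: "hemb H x = hemb H y \<Longrightarrow> x = y"
  using embD(5)[OF embH] by (simp add: inj_on_def)

lemma emb_sub: "hv.subspace C \<Longrightarrow> emb hs C (hemb H)"
  by (rule emb_subspace[OF embH]) auto

lemma fd_emb: "hv.subspace C \<Longrightarrow> fd (hemb H ` C)"
  by (rule fin_dim_image[OF vs vs_u embD(2,4)[OF emb_sub]])

lemma tensor_sp_row_col:
  fixes X :: "'x::field univ set"
  assumes "usub X" "usub Y" "t \<in> tensor_sp X Y"
  shows "row i t \<in> Y" "col j t \<in> X"
proof -
  have "t \<in> uv.span {x \<otimes> y |x y. x \<in> X \<and> y \<in> Y}" using assms(3) by (simp add: tensor_space_def)
  then have "row i t \<in> Y \<and> col j t \<in> X"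
  proof (induction rule: uv.span_induct_alt)
    case base
    have e: "row i 0 = (0 :: 'x univ)" "col j 0 = (0 :: 'x univ)" by (simp_all add: row_def col_def fun_eq_iff)
    show ?case unfolding e by (intro conjI uv.subspace_0 assms(1,2))
  next
    case (step c x y)
    then have "row i x \<in> Y \<and> col j x \<in> X" using assms(1,2) by (auto intro: uv.subspace_scale)
    then show ?case
      unfolding lin_onD(1)[OF lin_row UNIV_I UNIV_I] lin_onD(2)[OF lin_row UNIV_I]
        lin_onD(1)[OF lin_col UNIV_I UNIV_I] lin_onD(2)[OF lin_col UNIV_I]
      using step assms(1,2) by (intro conjI uv.subspace_add uv.subspace_scale) blast+
  qed
  then show "row i t \<in> Y" "col j t \<in> X" by auto
qed

lemma subcoalgebra_Int:
  assumes A: "subcoalgebra H \<delta> A" and B: "subcoalgebra H \<delta> B"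
  shows "subcoalgebra H \<delta> (A \<inter> B)"
proof -
  have sA: "hv.subspace A" and sB: "hv.subspace B" using A B by (auto simp: subcoalgebra_def)
  have s: "hv.subspace (A \<inter> B)" using sA sB by (rule hv.subspace_inter)
  have im: "hemb H ` (A \<inter> B) = hemb H ` A \<inter> hemb H ` B" using hemb_inj by blast
  have "\<delta> c \<in> tensor_space (htens H) (A \<inter> B) (A \<inter> B)" if c: "c \<in> A \<inter> B" for c
    unfolding tensor_space_emb
  proof (rule tensor_sp_rows_cols)
    have "\<delta> c \<in> tensor_sp (hemb H ` A) (hemb H ` A)" "\<delta> c \<in> tensor_sp (hemb H ` B) (hemb H ` B)"
      using A B c by (auto simp: subcoalgebra_def tensor_space_emb)
    note rc = tensor_sp_row_col[OF fd_usub fd_usub this(1)] tensor_sp_row_col[OF fd_usub fd_usub this(2)]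
    show "col j (\<delta> c) \<in> hemb H ` (A \<inter> B)" "row j (\<delta> c) \<in> hemb H ` (A \<inter> B)" for j
      unfolding im using rc fd_emb[OF sA] fd_emb[OF sB] by blast+
  qed (rule fd_emb[OF s])+
  with s show ?thesis by (simp add: subcoalgebra_def)
qed

lemma sums_left: "hv.subspace B \<Longrightarrow> A \<subseteq> {a + b |a b. a \<in> A \<and> b \<in> B}"
  using hv.subspace_0 by (metis (mono_tags, lifting) add.right_neutral mem_Collect_eq subsetI)

lemma sums_right: "hv.subspace A \<Longrightarrow> B \<subseteq> {a + b |a b. a \<in> A \<and> b \<in> B}"
  using hv.subspace_0 by (metis (mono_tags, lifting) add.left_neutral mem_Collect_eq subsetI)

lemma sums_mono: "A \<subseteq> A' \<Longrightarrow> {a + b |a b. a \<in> A \<and> b \<in> B} \<subseteq> {a + b |a b. a \<in> A' \<and> b \<in> B}"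
  by blast

lemma subcoalgebra_sum:
  assumes A: "subcoalgebra H \<delta> A" and B: "subcoalgebra H \<delta> B" and \<delta>: "hlin uscale \<delta>"
  shows "subcoalgebra H \<delta> {a + b |a b. a \<in> A \<and> b \<in> B}" (is "subcoalgebra H \<delta> ?C")
proof -
  have sA: "hv.subspace A" and sB: "hv.subspace B" using A B by (auto simp: subcoalgebra_def)
  have sub: "A \<subseteq> ?C" "B \<subseteq> ?C" using sums_left[OF sB] sums_right[OF sA] by blast+
  have mono: "tensor_space (htens H) X X \<subseteq> tensor_space (htens H) Y Y" if "X \<subseteq> Y" for X Y
    unfolding tensor_space_def by (rule uv.span_mono) (use that in blast)
  have "\<delta> c \<in> tensor_space (htens H) ?C ?C" if m: "c \<in> ?C" for c
  proof -
    obtain a b where c: "c = a + b" "a \<in> A" "b \<in> B" using m by blast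
    have "\<delta> a \<in> tensor_space (htens H) ?C ?C" "\<delta> b \<in> tensor_space (htens H) ?C ?C"
      using A B c mono[OF sub(1)] mono[OF sub(2)] by (auto simp: subcoalgebra_def)
    then show ?thesis unfolding c(1) hadd[OF \<delta>] tensor_space_def by (rule uv.span_add)
  qed
  then show ?thesis using hv.subspace_sums[OF sA sB] by (simp add: subcoalgebra_def)
qed

lemma unit_subcoalgebra: "subcoalgebra H (comult H) (range (\<lambda>c. hs c 1))"
proof -
  have "hv.subspace (range (\<lambda>c. hs c 1))"
    using subspace_image[OF vs_k vs subspace_UNIV[OF vs_k], of "\<lambda>c. hs c 1"]
    by (simp add: lin_on_def hv.scale_left_distrib)
  moreover have "comult H (hs c 1) \<in> tensor_space (htens H) (range (\<lambda>c. hs c 1)) (range (\<lambda>c. hs c 1))" for c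
  proof -
    have "1 = hs 1 1" by simp
    then have "1 \<in> range (\<lambda>c. hs c 1)" by blast
    then show ?thesis
      unfolding hscl[OF hopf_unfold(3)] hopf_unfold(10) tensor_space_def
      by (intro uv.span_scale uv.span_base) blast
  qed
  ultimately show ?thesis by (auto simp: subcoalgebra_def)
qed

text \<open>
  If \<open>1 = m + e\<close> with \<open>m\<close> and \<open>e\<close> in subcoalgebras \<open>M\<close> and \<open>E\<close> that meet in \<open>0\<close>, then \<open>m = 0\<close> or
  \<open>1 \<in> M\<close>: the component of \<open>\<Delta>(1) = 1 \<otimes> 1\<close> in \<open>M \<otimes> M\<close> is \<open>1 \<otimes> m\<close>.
\<close>

lemma unit_in_sum:
  assumes M: "subcoalgebra H (comult H) M" and E: "subcoalgebra H (comult H) E" and ME: "M \<inter> E = {0}"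
    and me: "m \<in> M" "e \<in> E" "1 = m + e" and 1: "1 \<notin> M"
  shows "m = 0"
proof (rule ccontr)
  assume "m \<noteq> 0"
  let ?u = "hemb H"
  have sM: "hv.subspace M" and sE: "hv.subspace E" using M E by (auto simp: subcoalgebra_def)
  note fM = fd_usub[OF fd_emb[OF sM]] and fE = fd_usub[OF fd_emb[OF sE]]
  have ul: "?u (x + y) = ?u x + ?u y" "?u (hs c x) = c *\<^sub>u ?u x" for x y c
    using lin_onD[OF embD(4)[OF embH]] by auto
  have tm: "comult H m \<in> tensor_sp (?u ` M) (?u ` M)" and te: "comult H e \<in> tensor_sp (?u ` E) (?u ` E)"
    using M E me by (auto simp: subcoalgebra_def tensor_space_emb)
  have sum: "?u 1 \<otimes> ?u 1 = comult H m + comult H e"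
    using hopf_unfold(10) hadd[OF hopf_unfold(3), of m e] by (simp add: me(3)[symmetric])
  have "row i (comult H m) = row i (?u 1 \<otimes> ?u m)" for i
  proof -
    obtain m' where m': "m' \<in> M" "row i (comult H m) = ?u m'" using tensor_sp_row_col(1)[OF fM fM tm] by blast
    obtain e' where e': "e' \<in> E" "row i (comult H e) = ?u e'" using tensor_sp_row_col(1)[OF fE fE te] by blast
    have "?u (hs (?u 1 i) 1) = ?u (m' + e')"
      using arg_cong[OF sum, of "row i"] by (simp add: lin_onD(1)[OF lin_row] m' e' ul)
    then have "hs (?u 1 i) (m + e) = m' + e'" unfolding me(3)[symmetric] by (rule hemb_inj)
    then have eq: "hs (?u 1 i) m - m' = e' - hs (?u 1 i) e" by (simp add: hv.scale_right_distrib algebra_simps)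
    have "hs (?u 1 i) m - m' \<in> M" "e' - hs (?u 1 i) e \<in> E"
      using sM sE me m' e' by (auto intro: hv.subspace_diff hv.subspace_scale)
    then have "hs (?u 1 i) m - m' \<in> M \<inter> E" by (simp add: eq)
    then have "m' = hs (?u 1 i) m" using ME by auto
    then show ?thesis by (simp add: m'(2) ul)
  qed
  then have c: "comult H m = ?u 1 \<otimes> ?u m" by (rule row_eqI)
  have "?u m \<noteq> 0" using \<open>m \<noteq> 0\<close> hemb_inj[of m 0] lin_zero[OF vs vs_u embD(4)[OF embH]] by auto
  then obtain j where j: "?u m j \<noteq> 0" by (auto simp: fun_eq_iff)
  have "?u m j *\<^sub>u ?u 1 \<in> ?u ` M" using tensor_sp_row_col(2)[OF fM fM tm, of j] by (simp add: c)
  then have "inverse (?u m j) *\<^sub>u (?u m j *\<^sub>u ?u 1) \<in> ?u ` M" using fM by (rule uv.subspace_scale[rotated])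
  then have "?u 1 \<in> ?u ` M" using j by simp
  then show False using 1 hemb_inj by blast
qed

lemma finite_simples:
  assumes "x \<in> hv.span (\<Union>{C. simple_subcoalgebra H \<delta> C})"
  shows "\<exists>Es. (\<forall>E\<in>set Es. simple_subcoalgebra H \<delta> E) \<and> x \<in> hv.span (\<Union>(set Es))"
  using assms
proof (induction rule: hv.span_induct_alt)
  case base show ?case by (rule exI[of _ "[]"]) (simp add: hv.span_zero)
next
  case (step c x y)
  then obtain Es E where *: "\<forall>E\<in>set Es. simple_subcoalgebra H \<delta> E" "y \<in> hv.span (\<Union>(set Es))"
    "simple_subcoalgebra H \<delta> E" "x \<in> E" by blast
  have "hs c x + y \<in> hv.span (\<Union>(set (E # Es)))"
    using *(2,4) hv.span_mono[of "\<Union>(set Es)" "\<Union>(set (E # Es))"]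
    by (intro hv.span_add hv.span_scale) (auto intro: hv.span_base)
  then show ?case using * by (intro exI[of _ "E # Es"]) auto
qed

text \<open>
  The line spanned by \<open>1\<close> has a complement that is a subcoalgebra, built up along finitely many simple subcoalgebras;
  the projection onto that line is the Haar integral.
\<close>

lemma cointegral_exists:
  assumes "cosemisimple H"
  shows "\<exists>l. hlin (*) l \<and> l 1 = 1 \<and> (\<forall>h. cop h (\<lambda>x y. hs (l y) x) = hs (l h) 1) \<and>
    (\<forall>h. cop h (\<lambda>x y. hs (l x) y) = hs (l h) 1)"
proof -
  let ?\<Delta> = "comult H" and ?K = "range (\<lambda>c. hs c (1::'h))"
  note sK = unit_subcoalgebra
  then have kK: "hv.subspace ?K" by (simp add: subcoalgebra_def)
  have 1: "(1::'h) \<noteq> 0" using eps_1 hscl[OF hopf_unfold(5), of 0 0] by auto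
  have step: "\<exists>M. subcoalgebra H ?\<Delta> M \<and> 1 \<notin> M \<and> (\<forall>E\<in>set Es. E \<subseteq> {a + b |a b. a \<in> M \<and> b \<in> ?K})"
    if "\<forall>E\<in>set Es. simple_subcoalgebra H ?\<Delta> E" for Es
    using that
  proof (induction Es)
    case Nil
    have "subcoalgebra H ?\<Delta> {0}"
      using lin_zero[OF vs vs_u hopf_unfold(3)] uv.span_zero
      by (auto simp: subcoalgebra_def hv.subspace_single_0 tensor_space_def)
    then show ?case using 1 by (intro exI[of _ "{0}"]) auto
  next
    case (Cons E Es)
    then obtain M where M: "subcoalgebra H ?\<Delta> M" "1 \<notin> M" "\<forall>E\<in>set Es. E \<subseteq> {a + b |a b. a \<in> M \<and> b \<in> ?K}"
      by auto
    have E: "simple_subcoalgebra H ?\<Delta> E" using Cons.prems by simp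
    then have cE: "subcoalgebra H ?\<Delta> E" by (simp add: simple_subcoalgebra_def)
    have sM: "hv.subspace M" and sE: "hv.subspace E" using M cE by (auto simp: subcoalgebra_def)
    show ?case
    proof (cases "E \<subseteq> {a + b |a b. a \<in> M \<and> b \<in> ?K}")
      case True
      then show ?thesis using M by (intro exI[of _ M]) auto
    next
      case False
      let ?N = "{a + b |a b. a \<in> M \<and> b \<in> E}"
      have "M \<inter> E = {0}"
      proof (rule ccontr)
        assume "M \<inter> E \<noteq> {0}"
        then have "M \<inter> E = E"
          using E subcoalgebra_Int[OF M(1) cE] unfolding simple_subcoalgebra_def by blast
        then have "E \<subseteq> M" by blast
        then show False using False sums_left[OF kK, of M] by blast
      qed
      note ME = this
      have "1 \<notin> ?N"
      proof
        assume "1 \<in> ?N"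
        then obtain m e where me: "m \<in> M" "e \<in> E" "1 = m + e" by blast
        then have "m = 0" using unit_in_sum[OF M(1) cE ME] M(2) by blast
        then have "1 \<in> E" using me by simp
        then have "?K \<subseteq> E" using hv.subspace_scale[OF sE] by blast
        moreover have "?K \<noteq> {0}" using 1 by (metis hv.scale_one rangeI singletonD)
        ultimately have "?K = E" using E sK unfolding simple_subcoalgebra_def by blast
        then show False using False sums_right[OF sM, of ?K] by blast
      qed
      moreover have "subcoalgebra H ?\<Delta> ?N" by (rule subcoalgebra_sum[OF M(1) cE hopf_unfold(3)])
      moreover have "E' \<subseteq> {a + b |a b. a \<in> ?N \<and> b \<in> ?K}" if "E' \<in> set (E # Es)" for E'
      proof (cases "E' = E")
        case True
        show ?thesis unfolding True by (rule subset_trans[OF sums_right[OF sM] sums_left[OF kK]])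
      next
        case False
        then have "E' \<subseteq> {a + b |a b. a \<in> M \<and> b \<in> ?K}" using M(3) that by auto
        also have "\<dots> \<subseteq> {a + b |a b. a \<in> ?N \<and> b \<in> ?K}" by (rule sums_mono[OF sums_left[OF sE]])
        finally show ?thesis .
      qed
      ultimately show ?thesis by (intro exI[of _ ?N] conjI ballI)
    qed
  qed
  obtain B where B: "finite B" "UNIV = hv.span B" using hopf_unfold(2) by (auto simp: fin_dim_def)
  have "\<exists>Es. (\<forall>E\<in>set Es. simple_subcoalgebra H ?\<Delta> E) \<and> B' \<subseteq> hv.span (\<Union>(set Es))" if "finite B'" for B'
    using that
  proof (induction B' rule: finite_induct)
    case empty show ?case by (rule exI[of _ "[]"]) simp
  next
    case (insert b B')
    obtain Es where Es: "\<forall>E\<in>set Es. simple_subcoalgebra H ?\<Delta> E" "B' \<subseteq> hv.span (\<Union>(set Es))"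
      using insert.IH by blast
    obtain Fs where Fs: "\<forall>E\<in>set Fs. simple_subcoalgebra H ?\<Delta> E" "b \<in> hv.span (\<Union>(set Fs))"
      using finite_simples[of b ?\<Delta>] assms unfolding cosemisimple_def by blast
    have "hv.span (\<Union>(set Es)) \<subseteq> hv.span (\<Union>(set (Es @ Fs)))" "hv.span (\<Union>(set Fs)) \<subseteq> hv.span (\<Union>(set (Es @ Fs)))"
      by (auto intro!: hv.span_mono)
    then show ?case using Es Fs by (intro exI[of _ "Es @ Fs"]) auto
  qed
  then obtain Es where Es: "\<forall>E\<in>set Es. simple_subcoalgebra H ?\<Delta> E" "B \<subseteq> hv.span (\<Union>(set Es))"
    using B(1) by blast
  obtain M where M: "subcoalgebra H ?\<Delta> M" "1 \<notin> M" "\<forall>E\<in>set Es. E \<subseteq> {a + b |a b. a \<in> M \<and> b \<in> ?K}"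
    using step[OF Es(1)] by blast
  have sM: "hv.subspace M" using M(1) by (simp add: subcoalgebra_def)
  have "hv.span (\<Union>(set Es)) \<subseteq> {a + b |a b. a \<in> M \<and> b \<in> ?K}"
    by (rule hv.span_minimal[OF _ hv.subspace_sums[OF sM kK]]) (use M(3) in blast)
  then have "B \<subseteq> {a + b |a b. a \<in> M \<and> b \<in> ?K}" using Es(2) by blast
  then have "hv.span B \<subseteq> {a + b |a b. a \<in> M \<and> b \<in> ?K}"
    by (rule hv.span_minimal[OF _ hv.subspace_sums[OF sM kK]])
  then have dec: "\<exists>m\<in>M. \<exists>c. h = m + hs c 1" for h using B(2) UNIV_I[of h] by blast
  have uniq: "c = d" if "m + hs c 1 = n + hs d 1" "m \<in> M" "n \<in> M" for m n c d
  proof (rule ccontr)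
    assume "c \<noteq> d"
    have "hs (c - d) 1 = n - m" using that(1) by (simp add: hv.scale_left_diff_distrib algebra_simps)
    then have "hs (c - d) 1 \<in> M" using sM that by (simp add: hv.subspace_diff)
    then have "hs (inverse (c - d)) (hs (c - d) 1) \<in> M" by (rule hv.subspace_scale[OF sM])
    then show False using M(2) \<open>c \<noteq> d\<close> by simp
  qed
  define l where "l h = (THE c. \<exists>m\<in>M. h = m + hs c 1)" for h
  have l: "l (m + hs c 1) = c" if "m \<in> M" for m c
    unfolding l_def using that uniq by (intro the_equality) blast+
  have lM: "l m = 0" if "m \<in> M" for m using l[OF that, of 0] by simp
  have l1: "l (hs c 1) = c" for c using l[OF hv.subspace_0[OF sM], of c] by simp
  have lin: "hlin (*) l"
  proof (rule lin_onI)
    fix x y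
    obtain m c n d where x: "x = m + hs c 1" "m \<in> M" and y: "y = n + hs d 1" "n \<in> M"
      using dec[of x] dec[of y] by blast
    have "x + y = (m + n) + hs (c + d) 1" using x y by (simp add: hv.scale_left_distrib)
    then show "l (x + y) = l x + l y" using l x y hv.subspace_add[OF sM] by metis
  next
    fix a x
    obtain m c where x: "x = m + hs c 1" "m \<in> M" using dec[of x] by blast
    have "hs a x = hs a m + hs (a * c) 1" using x by (simp add: hv.scale_right_distrib)
    then show "l (hs a x) = a * l x" using l x hv.subspace_scale[OF sM] by metis
  qed
  have van: "cop m f = 0" if m: "m \<in> M" and f: "hbil hs f" "\<And>a b. a \<in> M \<Longrightarrow> b \<in> M \<Longrightarrow> f a b = 0" for m and f :: "'h \<Rightarrow> 'h \<Rightarrow> 'h"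
  proof -
    obtain F where F: "lin uscale hs F" "\<And>a b. a \<in> UNIV \<Longrightarrow> b \<in> UNIV \<Longrightarrow> F (htens H a b) = f a b"
      "\<And>t. t \<in> tensor_space (htens H) UNIV UNIV \<Longrightarrow> hsw H t f = F t"
      by (rule sweedler_extends[OF embH embH vs f(1)]) blast
    have "comult H m \<in> tensor_space (htens H) M M" using M(1) m by (simp add: subcoalgebra_def)
    then have t: "comult H m \<in> uv.span {htens H a b |a b. a \<in> M \<and> b \<in> M}" by (simp add: tensor_space_def)
    have "F (comult H m) = (\<lambda>_. 0) (comult H m)"
      by (rule lin_on_eq_on_span[OF vs_u vs _ _ _ t])
        (use F f(2) in \<open>auto intro: lin_on_subset simp: lin_on_def\<close>)
    then show ?thesis using F(3) hopf_unfold(4) by simp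
  qed
  have i: "cop h f = hs (l h) 1"
    if f: "hbil hs f" "\<And>a b. a \<in> M \<Longrightarrow> b \<in> M \<Longrightarrow> f a b = 0" "f 1 1 = 1" for h and f :: "'h \<Rightarrow> 'h \<Rightarrow> 'h"
  proof -
    obtain m c where x: "h = m + hs c 1" "m \<in> M" using dec[of h] by blast
    have cl: "hlin hs (\<lambda>h. cop h f)" by (rule hl_cop[OF vs hl_id f(1)])
    show ?thesis using l[OF x(2)] cop_1[OF vs f(1)]
      by (simp add: x(1) hadd[OF cl] hscl[OF cl] van[OF x(2) f(1,2)] f(3))
  qed
  note ll = hl_comp[OF lin]
  have "l 1 = 1" using l1[of 1] by simp
  moreover have "cop h (\<lambda>x y. hs (l y) x) = hs (l h) 1" for h
    by (rule i) (use \<open>l 1 = 1\<close> lM in \<open>auto intro!: hl ll\<close>)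
  moreover have "cop h (\<lambda>x y. hs (l x) y) = hs (l h) 1" for h
    by (rule i) (use \<open>l 1 = 1\<close> lM in \<open>auto intro!: hl ll\<close>)
  ultimately show ?thesis using lin by blast
qed

end

text \<open>The integrals of \<open>H\<close> and of its dual, as provided by semisimplicity and cosemisimplicity.\<close>

locale integral_hopf = qt_hopf H R for H :: "('k::field, 'h::ring_1) hopf" and R +
  fixes lam :: "'h \<Rightarrow> 'k" and Lam :: 'h
  assumes lam_lin: "hlin (*) lam" and lam_1: "lam 1 = 1"
    and lam_left: "cop h (\<lambda>x y. hs (lam y) x) = hs (lam h) 1"
    and lam_right: "cop h (\<lambda>x y. hs (lam x) y) = hs (lam h) 1"
    and Lam_left: "h * Lam = hs (\<epsilon> h) Lam" and Lam_right: "Lam * h = hs (\<epsilon> h) Lam"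
    and eps_Lam: "\<epsilon> Lam = 1"
begin

lemmas hll = hl hl_comp[OF lam_lin] hl_ad hl_sigma

lemma cop_lam:
  assumes s: "vector_space s" and f: "hlin s f"
  shows "cop h (\<lambda>x y. s (lam y) (f x)) = s (lam h) (f 1)" "cop h (\<lambda>x y. s (lam x) (f y)) = s (lam h) (f 1)"
  by (simp_all only: hscl[OF f, symmetric] cop_lin[OF s f, symmetric] lam_left lam_right)

text \<open>
  Three forms of the invariance of \<open>lam\<close>.  In each, a factor \<open>S(y\<^sub>1) y\<^sub>2 = \<epsilon>\<close>
  (or its mirror image) is inserted so that \<open>z\<close> and \<open>y\<close> are multiplied in both tensor factors.
\<close>

lemma lam_shift:
  assumes s: "vector_space s" and f: "hlin s f"
  shows "cop z (\<lambda>a b. s (lam (y * b)) (f a)) = cop y (\<lambda>y1 w. s (lam (w * z)) (f (S y1)))"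
proof -
  let ?K = "\<lambda>p q. cop z (\<lambda>a b. s (lam (q * b)) (f (p * a)))"
  note fl = hl_comp[OF f]
  have "?K 1 y = cop y (\<lambda>z y3. s (\<epsilon> z) (?K 1 y3))"
    by (rule cop_counit(1)[OF s, symmetric]) (intro hll fl s)
  also have "\<dots> = cop y (\<lambda>z y3. cop z (\<lambda>y1 y2. ?K (S y1 * y2) y3))"
    by (subst cop_S(1)[OF s]) (intro hll fl s | rule refl)+
  also have "\<dots> = cop y (\<lambda>y1 w. cop w (\<lambda>y2 y3. ?K (S y1 * y2) y3))"
    by (rule cop_coassoc[OF s]) (intro hll fl s)+
  also have "\<dots> = cop y (\<lambda>y1 w. cop (w * z) (\<lambda>p q. s (lam q) (f (S y1 * p))))"
    by (subst cop_mult[OF s]) (intro hll fl s | simp only: mult.assoc)+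
  also have "\<dots> = cop y (\<lambda>y1 w. s (lam (w * z)) (f (S y1 * 1)))"
    by (subst cop_lam(1)[OF s]) (intro hll fl | rule refl)+
  finally show ?thesis by simp
qed

lemma lam_shift_right:
  assumes s: "vector_space s" and f: "hlin s f"
  shows "cop z (\<lambda>a b. s (lam (a * y)) (f b)) = cop y (\<lambda>w y3. s (lam (z * w)) (f (S y3)))"
proof -
  let ?K = "\<lambda>p q. cop z (\<lambda>a b. s (lam (a * p)) (f (b * q)))"
  note fl = hl_comp[OF f]
  have "?K y 1 = cop y (\<lambda>y1 u. s (\<epsilon> u) (?K y1 1))"
    by (rule cop_counit(2)[OF s, symmetric]) (intro hll fl s)
  also have "\<dots> = cop y (\<lambda>y1 u. cop u (\<lambda>y2 y3. ?K y1 (y2 * S y3)))"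
    by (subst cop_S(2)[OF s]) (intro hll fl s | rule refl)+
  also have "\<dots> = cop y (\<lambda>w y3. cop w (\<lambda>y1 y2. ?K y1 (y2 * S y3)))"
    by (rule cop_coassoc[OF s, symmetric]) (intro hll fl s)+
  also have "\<dots> = cop y (\<lambda>w y3. cop w (\<lambda>y1 y2. cop z (\<lambda>a b. s (lam (a * y1)) (f (b * y2 * S y3)))))"
    by (simp only: mult.assoc)
  also have "\<dots> = cop y (\<lambda>w y3. cop (z * w) (\<lambda>p q. s (lam p) (f (q * S y3))))"
    by (subst cop_mult[OF s], intro hll fl s, subst sweedler_swap, rule refl)
  also have "\<dots> = cop y (\<lambda>w y3. s (lam (z * w)) (f (1 * S y3)))"
    by (subst cop_lam(2)[OF s]) (intro hll fl | rule refl)+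
  finally show ?thesis by simp
qed

text \<open>The form \<open>lam (y x)\<close> is nondegenerate, since its radical is a left ideal and a left coideal.\<close>

lemma lam_nondegenerate:
  assumes "\<And>y. lam (y * x) = 0"
  shows "x = 0"
proof -
  have rad: "cop x (\<lambda>a b. hs (lam (y * b)) a) = 0" if "\<And>y. lam (y * x) = 0" for x y
    using lam_shift[OF vs hl_id, of x y] that by (simp add: sweedler_zero)
  have eps0: "\<epsilon> x = 0" if x: "\<And>y. lam (y * x) = 0" for x
  proof -
    obtain xs where "dual_sys hs UNIV xs" by (rule dual_system[OF vs hopf_unfold(2)])
    note xs = dual_sysD[OF this]
    have "lam (z * b) = (\<Sum>(c, \<xi>)\<leftarrow>xs. \<xi> z * lam (c * b))" for z b
    proof -
      have "lam (z * b) = lam ((\<Sum>(c, \<xi>)\<leftarrow>xs. hs (\<xi> z) c) * b)"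
        by (rule arg_cong[OF xs(2)[OF UNIV_I], where f = "\<lambda>w. lam (w * b)"])
      also have "\<dots> = (\<Sum>(c, \<xi>)\<leftarrow>xs. lam (hs (\<xi> z) c * b))"
        by (rule lin_sum_pairs[OF vs vs_k, where f = "\<lambda>w. lam (w * b)"]) (intro hll)
      finally show ?thesis by (simp add: mult_scale hscl[OF lam_lin])
    qed
    then have "cop x (\<lambda>a b. lam (S a * b)) = cop x (\<lambda>a b. \<Sum>(c, \<xi>)\<leftarrow>xs. \<xi> (S a) * lam (c * b))"
      by (intro arg_cong[where f = "cop x"] ext)
    also have "\<dots> = (\<Sum>(c, \<xi>)\<leftarrow>xs. cop x (\<lambda>a b. \<xi> (S a) * lam (c * b)))"
      by (induction xs) (auto simp: sweedler_zero sweedler_add)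
    also have "\<dots> = (\<Sum>(c, \<xi>)\<leftarrow>xs. 0)"
    proof (intro arg_cong[where f = sum_list] map_cong refl, clarify)
      fix c \<xi> assume "(c, \<xi>) \<in> set xs"
      then have \<xi>: "hlin (*) (\<lambda>a. \<xi> (S a))" using xs(1) hl_comp hopf_unfold(6) by blast
      have "cop x (\<lambda>a b. \<xi> (S a) * lam (c * b)) = \<xi> (S (cop x (\<lambda>a b. hs (lam (c * b)) a)))"
        unfolding cop_lin[OF vs_k \<xi>] hscl[OF \<xi>] by (simp add: mult.commute)
      then show "cop x (\<lambda>a b. \<xi> (S a) * lam (c * b)) = 0"
        using rad[OF x, of c] lin_zero[OF vs vs_k \<xi>] by simp
    qed
    also have "\<dots> = 0" by (induction xs) auto
    finally show ?thesis using cop_S(1)[OF vs_k lam_lin, of x] by (simp add: lam_1)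
  qed
  show ?thesis
  proof (rule linear_separates[OF vs hopf_unfold(2) UNIV_I])
    fix \<phi> assume \<phi>: "hlin (*) \<phi>"
    let ?b = "cop x (\<lambda>a b. hs (\<phi> a) b)"
    have "lam (y * ?b) = 0" for y
    proof -
      have l: "hlin (*) (\<lambda>b. lam (y * b))" by (intro hll)
      have "lam (y * ?b) = \<phi> (cop x (\<lambda>a b. hs (lam (y * b)) a))"
        unfolding cop_lin[OF vs_k l] hscl[OF l] cop_lin[OF vs_k \<phi>] hscl[OF \<phi>]
        by (simp add: mult.commute)
      then show ?thesis using rad[OF assms, of y] lin_zero[OF vs vs_k \<phi>] by simp
    qed
    then have "\<epsilon> ?b = 0" by (rule eps0)
    moreover have "\<epsilon> ?b = cop x (\<lambda>a b. \<epsilon> b * \<phi> a)"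
      unfolding cop_lin[OF vs_k hopf_unfold(5)] hscl[OF hopf_unfold(5)] by (simp add: mult.commute)
    ultimately show "\<phi> x = 0" using cop_counit(2)[OF vs_k \<phi>, of x] by simp
  qed
qed

lemma lam_Lam: "lam Lam \<noteq> 0"
proof
  assume "lam Lam = 0"
  then have "Lam = 0" by (intro lam_nondegenerate) (simp add: Lam_left hscl[OF lam_lin])
  then show False using eps_Lam lin_zero[OF vs vs_k hopf_unfold(5)] by simp
qed

text \<open>
  The inverse of the antipode: applying \<open>lam\<close> to the first factor of \<open>\<Delta> (x Lam) = \<epsilon> x \<Delta> Lam\<close> shows
  \<open>\<Sum> x\<^sub>2 S' x\<^sub>1 = \<epsilon> x\<close>, which characterises it.
\<close>

definition S' :: "'h \<Rightarrow> 'h" where "S' x = hs (inverse (lam Lam)) (cop Lam (\<lambda>a b. hs (lam (x * a)) b))"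

lemma hl_S': "hlin hs f \<Longrightarrow> hlin hs (\<lambda>x. S' (f x))"
  unfolding S'_def by (intro hll)

lemma cop_S'_1: "cop x (\<lambda>a b. b * S' a) = hs (\<epsilon> x) 1"
proof -
  have "b * S' a = hs (inverse (lam Lam)) (cop Lam (\<lambda>p q. hs (lam (a * p)) (b * q)))" for a b
    unfolding S'_def mult_scale by (simp add: cop_lin[OF vs, where g = "\<lambda>z. b * z"] hl mult_scale)
  then have "cop x (\<lambda>a b. b * S' a) = hs (inverse (lam Lam)) (cop x (\<lambda>a b. cop Lam (\<lambda>p q. hs (lam (a * p)) (b * q))))"
    by (simp only: cop_lin_s[OF vs, symmetric])
  also have "cop x (\<lambda>a b. cop Lam (\<lambda>p q. hs (lam (a * p)) (b * q))) = cop (x * Lam) (\<lambda>u v. hs (lam u) v)"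
    by (rule cop_mult[OF vs, symmetric]) (intro hll)
  also have "\<dots> = hs (\<epsilon> x * lam Lam) 1" by (simp add: lam_right Lam_left hscl[OF lam_lin])
  finally show ?thesis using lam_Lam by simp
qed

lemma S_S': "S (S' x) = x"
proof -
  have e: "cop z (\<lambda>a b. S (S' a) * S b) = hs (\<epsilon> z) 1" for z
  proof -
    have "S (cop z (\<lambda>a b. b * S' a)) = cop z (\<lambda>a b. S (S' a) * S b)"
      by (simp only: cop_lin[OF vs hopf_unfold(6)] S_mult)
    then show ?thesis by (simp add: cop_S'_1 hscl[OF hopf_unfold(6)] S_1)
  qed
  have "cop x (\<lambda>a u. cop u (\<lambda>b c. S (S' a) * (S b * c))) = cop x (\<lambda>z c. cop z (\<lambda>a b. S (S' a) * (S b * c)))"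
    by (rule cop_coassoc[OF vs, symmetric]) (intro hll hl_S')+
  also have "\<dots> = cop x (\<lambda>z c. hs (\<epsilon> z) c)"
  proof -
    have "cop z (\<lambda>a b. S (S' a) * (S b * c)) = cop z (\<lambda>a b. S (S' a) * S b) * c" for z c
      by (simp add: cop_lin[OF vs, where g = "\<lambda>w. w * c"] hl mult.assoc)
    then show ?thesis by (simp add: e mult_scale)
  qed
  also have "\<dots> = x" by (rule cop_counit(1)[OF vs hl_id])
  finally have "cop x (\<lambda>a u. cop u (\<lambda>b c. S (S' a) * (S b * c))) = x" .
  moreover have "cop u (\<lambda>b c. S (S' a) * (S b * c)) = hs (\<epsilon> u) (S (S' a) * 1)" for a u
    by (rule cop_S(1)[OF vs]) (intro hl)
  moreover have "cop x (\<lambda>a u. hs (\<epsilon> u) (S (S' a) * 1)) = S (S' x) * 1"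
    by (rule cop_counit(2)[OF vs]) (intro hll hl_S')
  ultimately show ?thesis by simp
qed

lemma S'_S: "S' (S x) = x"
proof -
  obtain B0 where B0: "finite B0" "UNIV = hv.span B0" using hopf_unfold(2) by (auto simp: fin_dim_def)
  obtain B where B: "hv.independent B" "UNIV \<subseteq> hv.span B" using hv.basis_exists[of UNIV] by metis
  have "finite B" using hv.independent_span_bound[OF B0(1) B(1)] B0(2) by auto
  then interpret f: finite_dimensional_vector_space hs B
    using B by unfold_locales auto
  have "Vector_Spaces.linear hs hs S'"
    using hl_S'[OF hl_id] vs by (intro Vector_Spaces.linear_iff[THEN iffD2]) (auto simp: lin_on_def)
  moreover have "inj S'" by (rule inj_on_inverseI[of _ S]) (rule S_S')
  ultimately have "surj S'" by (rule f.linear_inj_imp_surj)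
  then obtain z where "x = S' z" by (metis surjD)
  then show ?thesis by (simp add: S_S')
qed

lemma S'_mult: "S' (x * y) = S' y * S' x"
proof -
  have "S' (x * y) = S' (S (S' y * S' x))" by (simp add: S_mult S_S')
  then show ?thesis by (simp add: S'_S)
qed

lemma S'_1: "S' 1 = 1"
  using S'_S[of 1] by (simp add: S_1)

lemma cop_S':
  assumes s: "vector_space s" and f: "hlin s f"
  shows "cop x (\<lambda>a b. f (b * S' a)) = s (\<epsilon> x) (f 1)" "cop x (\<lambda>a b. f (S' b * a)) = s (\<epsilon> x) (f 1)"
proof -
  show "cop x (\<lambda>a b. f (b * S' a)) = s (\<epsilon> x) (f 1)"
    by (simp only: cop_lin[OF s f, symmetric] cop_S'_1 hscl[OF f])
  have l: "hlin s (\<lambda>z. f (S' z))" by (intro hl_comp[OF f] hl_S' hl_id)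
  have "cop x (\<lambda>a b. f (S' b * a)) = cop x (\<lambda>a b. f (S' (S a * b)))" by (simp add: S'_mult S'_S)
  also have "\<dots> = s (\<epsilon> x) (f (S' 1))" by (rule cop_S(1)[OF s l])
  finally show "cop x (\<lambda>a b. f (S' b * a)) = s (\<epsilon> x) (f 1)" by (simp add: S'_1)
qed

lemma lam_shift_inverse:
  assumes s: "vector_space s" and f: "hlin s f"
  shows "cop z (\<lambda>a b. s (lam (b * y)) (f a)) = cop y (\<lambda>y1 w. s (lam (z * w)) (f (S' y1)))"
proof -
  let ?K = "\<lambda>p q. cop z (\<lambda>a b. s (lam (b * q)) (f (a * p)))"
  note fl = hl_comp[OF f]
  have "?K 1 y = cop y (\<lambda>z y3. s (\<epsilon> z) (?K 1 y3))"
    by (rule cop_counit(1)[OF s, symmetric]) (intro hll fl s)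
  also have "\<dots> = cop y (\<lambda>z y3. cop z (\<lambda>y1 y2. ?K (y2 * S' y1) y3))"
    by (subst cop_S'(1)[OF s]) (intro hll fl s | rule refl)+
  also have "\<dots> = cop y (\<lambda>y1 w. cop w (\<lambda>y2 y3. ?K (y2 * S' y1) y3))"
    by (rule cop_coassoc[OF s]) (intro hll hl_S' fl s)+
  also have "\<dots> = cop y (\<lambda>y1 w. cop w (\<lambda>y2 y3. cop z (\<lambda>a b. s (lam (b * y3)) (f (a * y2 * S' y1)))))"
    by (simp only: mult.assoc)
  also have "\<dots> = cop y (\<lambda>y1 w. cop (z * w) (\<lambda>p q. s (lam q) (f (p * S' y1))))"
    by (subst cop_mult[OF s], intro hll fl s, subst sweedler_swap, rule refl)
  also have "\<dots> = cop y (\<lambda>y1 w. s (lam (z * w)) (f (1 * S' y1)))"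
    by (subst cop_lam(1)[OF s]) (intro hll fl | rule refl)+
  finally show ?thesis by simp
qed

text \<open>
  The Nakayama automorphism of \<open>lam\<close> is the square of the antipode: evaluated on the integral \<open>Lam\<close>, the
  shift formulas give \<open>\<Sum> lam (x Lam\<^sub>2) Lam\<^sub>1 = lam Lam S x = \<Sum> lam (Lam\<^sub>2 S\<^sup>2 x) Lam\<^sub>1\<close>,
  and every element is of the form \<open>\<Sum> lam (Lam\<^sub>1 y) Lam\<^sub>2\<close>.
\<close>

lemma lam_nakayama: "lam (x * y) = lam (y * S (S x))"
proof -
  let ?L = "lam Lam"
  have A: "cop Lam (\<lambda>a b. s (lam (x * b)) (f a)) = s ?L (f (S x))" if s: "vector_space s" and f: "hlin s f"
    for s :: "'k \<Rightarrow> 'k \<Rightarrow> 'k" and f x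
  proof -
    have "cop Lam (\<lambda>a b. s (lam (x * b)) (f a)) = cop x (\<lambda>y1 w. s (lam (w * Lam)) (f (S y1)))"
      by (rule lam_shift[OF s f])
    also have "\<dots> = cop x (\<lambda>y1 w. s (\<epsilon> w) (s ?L (f (S y1))))"
      using vector_space.vector_space_assms(3)[OF s] by (simp add: Lam_left hscl[OF lam_lin])
    also have "\<dots> = s ?L (f (S x))" by (rule cop_counit(2)[OF s]) (intro hll hl_comp[OF f] s)
    finally show ?thesis .
  qed
  have B: "cop Lam (\<lambda>a b. s (lam (b * x)) (f a)) = s ?L (f (S' x))" if s: "vector_space s" and f: "hlin s f"
    for s :: "'k \<Rightarrow> 'k \<Rightarrow> 'k" and f x
  proof -
    have "cop Lam (\<lambda>a b. s (lam (b * x)) (f a)) = cop x (\<lambda>y1 w. s (lam (Lam * w)) (f (S' y1)))"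
      by (rule lam_shift_inverse[OF s f])
    also have "\<dots> = cop x (\<lambda>y1 w. s (\<epsilon> w) (s ?L (f (S' y1))))"
      using vector_space.vector_space_assms(3)[OF s] by (simp add: Lam_right hscl[OF lam_lin])
    also have "\<dots> = s ?L (f (S' x))" by (rule cop_counit(2)[OF s]) (intro hll hl_S' hl_comp[OF f] s)
    finally show ?thesis .
  qed
  have C: "cop Lam (\<lambda>a b. lam (a * z) * f b) = ?L * f (S z)" if f: "hlin (*) f" for f z
  proof -
    have "cop Lam (\<lambda>a b. lam (a * z) * f b) = cop z (\<lambda>w y3. lam (Lam * w) * f (S y3))"
      by (rule lam_shift_right[OF vs_k f])
    also have "\<dots> = cop z (\<lambda>w y3. \<epsilon> w * (?L * f (S y3)))"
      by (simp only: Lam_right hscl[OF lam_lin] mult.assoc)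
    also have "\<dots> = ?L * f (S z)" by (rule cop_counit(1)[OF vs_k]) (intro hll hl_comp[OF f])
    finally show ?thesis .
  qed
  have "hlin (*) (\<lambda>a. lam (a * S' y))" by (intro hll)
  note l = A[OF vs_k this, of x] B[OF vs_k this, of "S (S x)"]
  have "cop Lam (\<lambda>a b. lam (a * S' y) * lam (x * b)) = cop Lam (\<lambda>a b. lam (a * S' y) * lam (b * S (S x)))"
    using l by (simp add: S'_S mult.commute)
  moreover have "cop Lam (\<lambda>a b. lam (a * S' y) * lam (x * b)) = ?L * lam (x * S (S' y))"
    by (rule C) (intro hll)
  moreover have "cop Lam (\<lambda>a b. lam (a * S' y) * lam (b * S (S x))) = ?L * lam (S (S' y) * S (S x))"
    by (rule C) (intro hll)
  ultimately show ?thesis using lam_Lam by (simp add: S_S')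
qed

lemma lam_ad: "lam (adj h x) = \<epsilon> h * lam x"
proof -
  have "lam (adj h x) = cop h (\<lambda>a b. lam (a * x * S b))"
    unfolding ad_def by (rule cop_lin[OF vs_k lam_lin])
  also have "\<dots> = cop h (\<lambda>a b. lam (x * S (S a * b)))"
  proof -
    have "lam (a * x * S b) = lam (x * S (S a * b))" for a b
      using lam_nakayama[of a "x * S b"] by (simp only: mult.assoc S_mult)
    then show ?thesis by simp
  qed
  also have "\<dots> = \<epsilon> h * lam (x * S 1)" by (rule cop_S(1)[OF vs_k]) (intro hll)
  finally show ?thesis by (simp add: S_1)
qed

lemma lam_ad_move: "lam (adj h x * y) = lam (x * adj (S h) y)"
proof -
  note s = vs_k
  have "lam (adj h x * y) = cop h (\<lambda>h1 u. \<epsilon> u * lam (adj h1 x * y))"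
    by (rule cop_counit(2)[OF s, symmetric]) (intro hll)
  also have "\<dots> = cop h (\<lambda>h1 u. cop u (\<lambda>h2 h3. lam (adj h1 x * adj (h2 * S h3) y)))"
    by (subst cop_S(2)[OF s]) (intro hll | simp add: ad_1)+
  also have "\<dots> = cop h (\<lambda>w h3. cop w (\<lambda>h1 h2. lam (adj h1 x * adj (h2 * S h3) y)))"
    by (rule cop_coassoc[OF s, symmetric]) (intro hll)+
  also have "\<dots> = cop h (\<lambda>w h3. lam (adj w (x * adj (S h3) y)))"
    unfolding ad_prod[symmetric] by (simp only: cop_lin[OF s lam_lin] ad_mult)
  also have "\<dots> = cop h (\<lambda>w h3. \<epsilon> w * lam (x * adj (S h3) y))" by (simp only: lam_ad)
  also have "\<dots> = lam (x * adj (S h) y)" by (rule cop_counit(1)[OF s]) (intro hll)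
  finally show ?thesis .
qed

section \<open>An invariant coseparability form on the transmuted coalgebra\<close>

text \<open>
  The form \<open>lam (a S b)\<close> exhibits a cosemisimple Hopf algebra as a coseparable coalgebra.  For the transmuted coproduct
  the antipode is replaced by the braided antipode \<open>sigma\<close>.
\<close>

definition theta :: "'h \<Rightarrow> 'h \<Rightarrow> 'k" where "theta a b = lam (a * sigma b)"

lemma hl_theta: "hlin hs f \<Longrightarrow> hlin (*) (\<lambda>x. theta (f x) b)" "hlin hs f \<Longrightarrow> hlin (*) (\<lambda>x. theta a (f x))"
  unfolding theta_def by (intro hll; assumption)+

text \<open>The copies of \<open>R\<close> in the coproduct and in \<open>sigma\<close> are inverse to each other, which leaves \<open>lam (d\<^sub>1 S d\<^sub>2)\<close>.\<close>

lemma theta_counit: "copR d (\<lambda>a b. theta a b) = \<epsilon> d"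
proof -
  have "RR (\<lambda>r1 r2. theta (d1 * S r2) (adj r1 d2)) = lam (d1 * S d2)" for d1 d2
  proof -
    have "d1 * S r2 * sigma (adj r1 d2) = RR (\<lambda>q1 q2. d1 * (S r2 * q2) * S (adj (q1 * r1) d2))" for r1 r2
    proof -
      have "d1 * S r2 * sigma (adj r1 d2) = RR (\<lambda>q1 q2. d1 * S r2 * (q2 * S (adj q1 (adj r1 d2))))"
        unfolding sigma_def by (rule cop_lin[OF vs, where g = "\<lambda>z. d1 * S r2 * z"]) (intro hl)
      then show ?thesis by (simp only: ad_mult mult.assoc)
    qed
    then have "RR (\<lambda>r1 r2. theta (d1 * S r2) (adj r1 d2)) =
        RR (\<lambda>r1 r2. RR (\<lambda>q1 q2. lam (d1 * (S r2 * q2) * S (adj (q1 * r1) d2))))"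
      by (simp add: theta_def cop_lin[OF vs_k lam_lin])
    also have "\<dots> = RR (\<lambda>q1 q2. RR (\<lambda>r1 r2. lam (d1 * (S r2 * q2) * S (adj (q1 * r1) d2))))"
      by (rule sweedler_swap)
    also have "\<dots> = lam (d1 * 1 * S (adj 1 d2))" by (rule R_inverse(3)[OF vs_k]) (intro hll)
    finally show ?thesis by (simp add: ad_1)
  qed
  then have "copR d (\<lambda>a b. theta a b) = cop d (\<lambda>d1 d2. lam (d1 * S d2))" by simp
  also have "\<dots> = \<epsilon> d * lam 1" by (rule cop_S(2)[OF vs_k lam_lin])
  finally show ?thesis by (simp add: lam_1)
qed

lemma theta_invariant: "cop h (\<lambda>x y. theta (adj x a) (adj y b)) = \<epsilon> h * theta a b"
proof -
  have "cop h (\<lambda>x y. theta (adj x a) (adj y b)) = lam (cop h (\<lambda>x y. adj x a * adj y (sigma b)))"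
    by (simp only: theta_def sigma_ad cop_lin[OF vs_k lam_lin])
  then show ?thesis by (simp add: ad_prod lam_ad theta_def)
qed

text \<open>
  Bicolinearity.  Moving \<open>R\<^sup>1\<close> to the other side by invariance turns the left-hand side into a shift of \<open>lam\<close>;
  the four copies of \<open>R\<close> that arise then cancel in pairs.
\<close>

lemma theta_bicolinear:
  assumes s: "vector_space s" and f: "hlin s f"
  shows "copR d (\<lambda>a b. s (theta b e) (f a)) = copR e (\<lambda>a b. s (theta d a) (f b))"
proof -
  note fl = hl_comp[OF f]
  define G where "G p q = s (lam (d * q)) (f p)" for p q
  have G: "hlin hs g \<Longrightarrow> hlin s (\<lambda>x. G (g x) q)" "hlin hs g \<Longrightarrow> hlin s (\<lambda>x. G p (g x))" for p q g
    unfolding G_def by (intro hll fl s; assumption)+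
  note hg = hll hl_S' G s
  have "copR d (\<lambda>a b. s (theta b e) (f a)) = cop d (\<lambda>d1 d2. RR (\<lambda>r1 r2. s (lam (d2 * adj (S r1) (sigma e))) (f (d1 * S r2))))"
    by (simp only: theta_def lam_ad_move)
  also have "\<dots> = cop d (\<lambda>d1 d2. RR (\<lambda>r1 r2. s (lam (d2 * adj r1 (sigma e))) (f (d1 * r2))))"
    by (subst R_antipode[OF s, where f = "\<lambda>a b. s (lam (d2 * adj a (sigma e))) (f (d1 * b))" for d1 d2])
      (intro hll fl s | rule refl)+
  also have "\<dots> = RR (\<lambda>t1 t2. cop d (\<lambda>d1 d2. s (lam (d2 * sigma (adj t1 e))) (f (d1 * t2))))"
    unfolding sigma_ad by (rule sweedler_swap)
  also have "\<dots> = RR (\<lambda>t1 t2. cop (sigma (adj t1 e)) (\<lambda>z1 z2. G (S' z1 * t2) z2))"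
    unfolding G_def by (subst lam_shift_inverse[OF s]) (intro fl hll | rule refl)+
  also have "\<dots> = RR (\<lambda>t1 t2. RR (\<lambda>r1 r2. RR (\<lambda>p1 p2. cop (adj (r1 * p1 * t1) e) (\<lambda>x1 x2. G (x2 * S' p2 * t2) (r2 * S x1)))))"
  proof -
    have "cop (sigma b) g = RR (\<lambda>r1 r2. RR (\<lambda>p1 p2. cop (adj (r1 * p1) b) (\<lambda>x1 x2. g (p2 * S x2) (r2 * S x1))))"
      if g: "hbil s g" for b g
    proof -
      note gl = hl_comp[OF hbilD(1)[OF g]] hl_comp[OF hbilD(2)[OF g]]
      have "cop (sigma b) g = RR (\<lambda>q1 q2. cop (q2 * S (adj q1 b)) g)"
        unfolding sigma_def by (rule cop_lin[OF s]) (intro hl_cop[OF s hl_id g])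
      also have "\<dots> = RR (\<lambda>q1 q2. cop q2 (\<lambda>a a'. cop (adj q1 b) (\<lambda>x1 x2. g (a * S x2) (a' * S x1))))"
        by (subst cop_mult[OF s g], subst cop_antipode[OF s]) (intro hll gl | rule refl)+
      also have "\<dots> = RR (\<lambda>r1 r2. RR (\<lambda>p1 p2. cop (adj (r1 * p1) b) (\<lambda>x1 x2. g (p2 * S x2) (r2 * S x1))))"
        by (rule R_comult(2)[OF s]) (intro hll hl_cop[OF s] gl s)+
      finally show ?thesis .
    qed
    note 1 = this
    have "cop (sigma (adj t1 e)) (\<lambda>z1 z2. G (S' z1 * t2) z2) =
        RR (\<lambda>r1 r2. RR (\<lambda>p1 p2. cop (adj (r1 * p1 * t1) e) (\<lambda>x1 x2. G (x2 * S' p2 * t2) (r2 * S x1))))" for t1 t2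
    proof -
      have g: "hbil s (\<lambda>z1 z2. G (S' z1 * t2) z2)" by (intro hg)
      show ?thesis by (simp only: 1[OF g] S'_mult S'_S ad_mult)
    qed
    then show ?thesis by simp
  qed
  also have "\<dots> = RR (\<lambda>r1 r2. RR (\<lambda>t1 t2. RR (\<lambda>p1 p2. cop (adj (r1 * p1 * t1) e) (\<lambda>x1 x2. G (x2 * S' p2 * t2) (r2 * S x1)))))"
    by (rule sweedler_swap)
  also have "\<dots> = RR (\<lambda>r1 r2. cop (adj r1 e) (\<lambda>x1 x2. G x2 (r2 * S x1)))"
  proof -
    have "RR (\<lambda>t1 t2. RR (\<lambda>p1 p2. cop (adj (r1 * p1 * t1) e) (\<lambda>x1 x2. G (x2 * S' p2 * t2) (r2 * S x1)))) =
        cop (adj (r1 * 1) e) (\<lambda>x1 x2. G (x2 * S' 1) (r2 * S x1))" for r1 r2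
    proof -
      let ?g = "\<lambda>a b. cop (adj (r1 * a) e) (\<lambda>x1 x2. G (x2 * S' b) (r2 * S x1))"
      have "RR (\<lambda>t1 t2. RR (\<lambda>p1 p2. cop (adj (r1 * p1 * t1) e) (\<lambda>x1 x2. G (x2 * S' p2 * t2) (r2 * S x1)))) =
          RR (\<lambda>p1 p2. RR (\<lambda>t1 t2. ?g (p1 * t1) (S t2 * p2)))"
        by (subst sweedler_swap) (simp only: S'_mult S'_S mult.assoc)
      also have "\<dots> = ?g 1 1" by (rule R_inverse(3)[OF s]) (intro hl_cop[OF s] hg)
      finally show ?thesis .
    qed
    then show ?thesis by (simp add: S'_1)
  qed
  also have "\<dots> = RR (\<lambda>r1 r2. cop r1 (\<lambda>x y. copR e (\<lambda>a b. RR (\<lambda>p1 p2. G (adj p1 (adj y b)) (r2 * S (adj x a * p2))))))"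
  proof -
    have "cop (adj r1 e) (\<lambda>x1 x2. G x2 (r2 * S x1)) =
        cop r1 (\<lambda>x y. copR e (\<lambda>a b. RR (\<lambda>p1 p2. G (adj p1 (adj y b)) (r2 * S (adj x a * p2)))))" for r1 r2
    proof -
      have "cop (adj r1 e) (\<lambda>x1 x2. G x2 (r2 * S x1)) = copR (adj r1 e) (\<lambda>a b. RR (\<lambda>p1 p2. G (adj p1 b) (r2 * S (a * p2))))"
        by (rule copR_inverse[OF s, symmetric]) (intro hg)
      also have "\<dots> = cop r1 (\<lambda>x y. copR e (\<lambda>a b. RR (\<lambda>p1 p2. G (adj p1 (adj y b)) (r2 * S (adj x a * p2)))))"
        by (rule copR_ad[OF s]) (intro hg)
      finally show ?thesis .
    qed
    then show ?thesis by simp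
  qed
  also have "\<dots> = RR (\<lambda>r1 r2. RR (\<lambda>q1 q2. copR e (\<lambda>a b. RR (\<lambda>p1 p2. G (adj p1 (adj q1 b)) (r2 * q2 * S (adj r1 a * p2))))))"
    by (rule R_comult(1)[OF s]) (intro hg)+
  also have "\<dots> = copR e (\<lambda>a b. RR (\<lambda>r1 r2. RR (\<lambda>q1 q2. RR (\<lambda>p1 p2. G (adj p1 (adj q1 b)) (r2 * q2 * S (adj r1 a * p2))))))"
    (is "RR (\<lambda>r1 r2. RR (\<lambda>q1 q2. cop e (\<lambda>d1 d2. RR (\<lambda>t1 t2. ?K r1 r2 q1 q2 d1 d2 t1 t2)))) = _")
  proof -
    have "RR (\<lambda>r1 r2. RR (\<lambda>q1 q2. cop e (\<lambda>d1 d2. RR (\<lambda>t1 t2. ?K r1 r2 q1 q2 d1 d2 t1 t2)))) =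
        RR (\<lambda>r1 r2. cop e (\<lambda>d1 d2. RR (\<lambda>q1 q2. RR (\<lambda>t1 t2. ?K r1 r2 q1 q2 d1 d2 t1 t2))))"
      by (rule sweedler_ext, rule sweedler_swap)
    also have "\<dots> = cop e (\<lambda>d1 d2. RR (\<lambda>r1 r2. RR (\<lambda>q1 q2. RR (\<lambda>t1 t2. ?K r1 r2 q1 q2 d1 d2 t1 t2))))"
      by (rule sweedler_swap)
    also have "\<dots> = cop e (\<lambda>d1 d2. RR (\<lambda>r1 r2. RR (\<lambda>t1 t2. RR (\<lambda>q1 q2. ?K r1 r2 q1 q2 d1 d2 t1 t2))))"
      by (rule sweedler_ext, rule sweedler_ext, rule sweedler_swap)
    also have "\<dots> = cop e (\<lambda>d1 d2. RR (\<lambda>t1 t2. RR (\<lambda>r1 r2. RR (\<lambda>q1 q2. ?K r1 r2 q1 q2 d1 d2 t1 t2))))"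
      by (rule sweedler_ext, rule sweedler_swap)
    finally show ?thesis .
  qed
  also have "\<dots> = copR e (\<lambda>a b. RR (\<lambda>r1 r2. G b (r2 * S (adj r1 a))))"
  proof -
    have "RR (\<lambda>q1 q2. RR (\<lambda>p1 p2. G (adj p1 (adj q1 b)) (r2 * q2 * S (adj r1 a * p2)))) = G b (r2 * S (adj r1 a))" for r1 r2 a b
    proof -
      have "RR (\<lambda>q1 q2. RR (\<lambda>p1 p2. G (adj p1 (adj q1 b)) (r2 * q2 * S (adj r1 a * p2)))) =
          RR (\<lambda>p1 p2. RR (\<lambda>q1 q2. G (adj (p1 * q1) b) (r2 * (q2 * S p2) * S (adj r1 a))))"
        by (subst sweedler_swap) (simp only: ad_mult S_mult mult.assoc)
      also have "\<dots> = G (adj 1 b) (r2 * 1 * S (adj r1 a))" by (rule R_inverse(2)[OF s]) (intro hg)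
      finally show ?thesis by (simp add: ad_1)
    qed
    then show ?thesis by simp
  qed
  also have "\<dots> = copR e (\<lambda>a b. s (theta d a) (f b))"
  proof -
    have "RR (\<lambda>r1 r2. G b (r2 * S (adj r1 a))) = G b (sigma a)" for a b
      unfolding sigma_def by (rule cop_lin[OF s, symmetric]) (intro G hl)
    then show ?thesis by (simp only: G_def theta_def)
  qed
  finally show ?thesis .
qed

end

section \<open>Comodules over the transmuted coalgebra\<close>

lemma gl_id: "lin_on s s X (\<lambda>x. x)"
  by (simp add: lin_on_def)

lemma gl_kron:
  "lin_on s uscale X f \<Longrightarrow> lin_on s uscale X (\<lambda>x. f x \<otimes> c)"
  "lin_on s uscale X f \<Longrightarrow> lin_on s uscale X (\<lambda>x. c \<otimes> f x)"
  by (auto simp: lin_on_def kron_left kron_right)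

lemma gl_scale:
  assumes "vector_space r"
  shows "lin_on s (*) X f \<Longrightarrow> lin_on s r X (\<lambda>x. r (f x) c)" "lin_on s r X g \<Longrightarrow> lin_on s r X (\<lambda>x. r d (g x))"
proof -
  interpret w: vector_space r by fact
  show "lin_on s (*) X f \<Longrightarrow> lin_on s r X (\<lambda>x. r (f x) c)" "lin_on s r X g \<Longrightarrow> lin_on s r X (\<lambda>x. r d (g x))"
    by (auto simp: lin_on_def w.scale_left_distrib w.scale_right_distrib mult.commute)
qed

lemma gl_kmult: "lin_on s (*) X f \<Longrightarrow> lin_on s (*) X (\<lambda>a. f a * (c::'k::field))" "lin_on s (*) X f \<Longrightarrow> lin_on s (*) X (\<lambda>a. c * f a)"
  by (auto simp: lin_on_def algebra_simps)

lemma gl_comp: "lin r t g \<Longrightarrow> lin_on s r X f \<Longrightarrow> lin_on s t X (\<lambda>x. g (f x))"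
  by (auto simp: lin_on_def)

lemmas gl = gl_id gl_kron gl_scale gl_kmult

locale hd_setting = integral_hopf H R lam Lam for H :: "('k::field, 'h::ring_1) hopf" and R lam Lam +
  fixes D :: "'h set"
  assumes D: "minimal_adjoint_stable_subcoalgebra H R D"
begin

lemma D_facts:
  "hv.subspace D" "d \<in> D \<Longrightarrow> comult_R H R d \<in> tensor_space (htens H) D D" "d \<in> D \<Longrightarrow> adj h d \<in> D"
  "D \<noteq> {0}" "adjoint_stable_subcoalgebra H R C \<Longrightarrow> C \<subseteq> D \<Longrightarrow> C = D"
  using D by (auto simp: minimal_adjoint_stable_subcoalgebra_def adjoint_stable_subcoalgebra_def subcoalgebra_def)

lemma eD: "emb hs D (hemb H)"
  by (rule emb_sub[OF D_facts(1)])

lemma sweedler_DD: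
  assumes s: "vector_space s" and f: "hbil s f" and d: "d \<in> D"
  shows "sweedler (htens H) D D (comult_R H R d) f = copR d f"
proof -
  obtain F where F: "lin uscale s F" "\<And>a b. a \<in> UNIV \<Longrightarrow> b \<in> UNIV \<Longrightarrow> F (htens H a b) = f a b"
    "\<And>t. t \<in> tensor_space (htens H) UNIV UNIV \<Longrightarrow> hsw H t f = F t"
    by (rule sweedler_extends[OF embH embH s f]) blast
  have "sweedler (htens H) D D (comult_R H R d) f = sweedler (htens H) D D (comult_R H R d) (\<lambda>a b. F (htens H a b))"
    by (simp add: F(2))
  also have "\<dots> = F (sweedler (htens H) D D (comult_R H R d) (\<lambda>a b. htens H a b))"
    by (rule sweedler_lin[OF vs_u s F(1), symmetric])
  also have "\<dots> = F (comult_R H R d)" by (simp add: sweedler_self[OF eD eD D_facts(2)[OF d]])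
  also have "\<dots> = copR d f" using F(3)[OF comult_R_in] hsw_comult_R[OF s f, of d] by simp
  finally show ?thesis .
qed

definition comod ::
  "('k \<Rightarrow> 'v::ab_group_add \<Rightarrow> 'v) \<Rightarrow> 'v set \<Rightarrow> ('v \<Rightarrow> 'k univ) \<Rightarrow> ('v \<Rightarrow> 'k univ) \<Rightarrow> bool"
  where "comod s X \<kappa> \<rho> \<longleftrightarrow> emb s X \<kappa> \<and> left_comodule H R D s \<kappa> X \<rho>"

abbreviation co :: "('v::ab_group_add \<Rightarrow> 'k univ) \<Rightarrow> 'v set \<Rightarrow> ('v \<Rightarrow> 'k univ) \<Rightarrow> 'v \<Rightarrow> ('h \<Rightarrow> 'v \<Rightarrow> 'c::comm_monoid_add) \<Rightarrow> 'c"
  where "co \<kappa> X \<rho> x f \<equiv> sweedler (dtens H \<kappa>) D X (\<rho> x) f"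

text \<open>
  Coactions take values in \<open>D \<otimes> X\<close>, but all maps applied to them are defined and linear on \<open>H\<close>; asking for
  linearity there keeps the side conditions free of membership in \<open>D\<close>.
\<close>

definition cbil :: "('k \<Rightarrow> 'v::ab_group_add \<Rightarrow> 'v) \<Rightarrow> 'v set \<Rightarrow> ('k \<Rightarrow> 'c::ab_group_add \<Rightarrow> 'c) \<Rightarrow> ('h \<Rightarrow> 'v \<Rightarrow> 'c) \<Rightarrow> bool"
  where "cbil s X r f \<longleftrightarrow> (\<forall>x\<in>X. hlin r (\<lambda>h. f h x)) \<and> (\<forall>h. lin_on s r X (f h))"

lemma cbilI: "(\<And>x. x \<in> X \<Longrightarrow> hlin r (\<lambda>h. f h x)) \<Longrightarrow> (\<And>h. lin_on s r X (\<lambda>x. f h x)) \<Longrightarrow> cbil s X r f"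
  by (simp add: cbil_def)

lemma cbil_bilin: "cbil s X r f \<Longrightarrow> bilin hs D s X r f"
  by (auto simp: cbil_def bilin_def intro: lin_on_subset)

context
  fixes s :: "'k \<Rightarrow> 'v::ab_group_add \<Rightarrow> 'v" and X \<kappa> \<rho>
  assumes C: "comod s X \<kappa> \<rho>"
begin

lemma co_emb: "emb s X \<kappa>"
  using C by (simp add: comod_def)

lemma co_facts:
  "lin_on s uscale X \<rho>" "x \<in> X \<Longrightarrow> \<rho> x \<in> tensor_space (dtens H \<kappa>) D X"
  using C by (auto simp: comod_def left_comodule_def)

lemma co_lin: "vector_space r \<Longrightarrow> cbil s X r f \<Longrightarrow> lin_on s r X (\<lambda>x. co \<kappa> X \<rho> x f)"
  by (rule lin_comp[OF co_facts(1) lin_sweedler_arg[OF eD co_emb _ cbil_bilin]]) (assumption | rule image_subsetI co_facts(2))+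

lemma co_cong: "x \<in> X \<Longrightarrow> (\<And>d y. d \<in> D \<Longrightarrow> y \<in> X \<Longrightarrow> f d y = g d y) \<Longrightarrow> co \<kappa> X \<rho> x f = co \<kappa> X \<rho> x g"
  by (rule sweedler_cong[OF eD co_emb co_facts(2)])

lemma co_in: "\<lbrakk>vector_space r; module.subspace r Y; x \<in> X; \<And>d y. d \<in> D \<Longrightarrow> y \<in> X \<Longrightarrow> f d y \<in> Y\<rbrakk> \<Longrightarrow> co \<kappa> X \<rho> x f \<in> Y"
  by (rule sweedler_in[OF eD co_emb _ _ co_facts(2)])

lemma co_lin_on:
  "\<lbrakk>vector_space r; vector_space r'; module.subspace r Y; lin_on r r' Y g; x \<in> X; \<And>d y. d \<in> D \<Longrightarrow> y \<in> X \<Longrightarrow> f d y \<in> Y\<rbrakk> \<Longrightarrow>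
   g (co \<kappa> X \<rho> x f) = co \<kappa> X \<rho> x (\<lambda>d y. g (f d y))"
  by (rule sweedler_lin_on[OF eD co_emb _ _ _ _ co_facts(2)])

lemma co_self: "x \<in> X \<Longrightarrow> co \<kappa> X \<rho> x (\<lambda>d y. dtens H \<kappa> d y) = \<rho> x"
  by (rule sweedler_self[OF eD co_emb co_facts(2)])

lemma co_coassoc:
  assumes r: "vector_space r" and x: "x \<in> X"
    and f: "\<And>b y. y \<in> X \<Longrightarrow> hlin r (\<lambda>a. f a b y)" "\<And>a y. y \<in> X \<Longrightarrow> hlin r (\<lambda>b. f a b y)" "\<And>a b. lin_on s r X (f a b)"
  shows "co \<kappa> X \<rho> x (\<lambda>d y. copR d (\<lambda>a b. f a b y)) = co \<kappa> X \<rho> x (\<lambda>d y. co \<kappa> X \<rho> y (\<lambda>e z. f d e z))"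
proof -
  obtain F where F: "lin uscale r F"
    "\<And>a b c. a \<in> UNIV \<Longrightarrow> b \<in> UNIV \<Longrightarrow> c \<in> X \<Longrightarrow> F (hemb H a \<otimes> hemb H b \<otimes> \<kappa> c) = f a b c"
    by (rule trilin_extends[OF embH embH co_emb r, of f]) (use f in \<open>auto simp: bilin_def\<close>)
  note l = sweedler_lin[OF vs_u r F(1)]
  have ax: "co \<kappa> X \<rho> x (\<lambda>d y. sweedler (htens H) D D (comult_R H R d) (\<lambda>a b. hemb H a \<otimes> hemb H b \<otimes> \<kappa> y)) =
      co \<kappa> X \<rho> x (\<lambda>d y. co \<kappa> X \<rho> y (\<lambda>e z. hemb H d \<otimes> hemb H e \<otimes> \<kappa> z))"
    using C x by (simp add: comod_def left_comodule_def)
  have "co \<kappa> X \<rho> x (\<lambda>d y. copR d (\<lambda>a b. f a b y)) =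
      co \<kappa> X \<rho> x (\<lambda>d y. sweedler (htens H) D D (comult_R H R d) (\<lambda>a b. F (hemb H a \<otimes> hemb H b \<otimes> \<kappa> y)))"
  proof (rule co_cong[OF x])
    fix d y assume d: "d \<in> D" and y: "y \<in> X"
    have "hbil r (\<lambda>a b. f a b y)" by (intro hbilI f y)
    then show "copR d (\<lambda>a b. f a b y) = sweedler (htens H) D D (comult_R H R d) (\<lambda>a b. F (hemb H a \<otimes> hemb H b \<otimes> \<kappa> y))"
      using sweedler_DD[OF r _ d, of "\<lambda>a b. f a b y"] y by (simp add: F(2))
  qed
  also have "\<dots> = F (co \<kappa> X \<rho> x (\<lambda>d y. co \<kappa> X \<rho> y (\<lambda>e z. hemb H d \<otimes> hemb H e \<otimes> \<kappa> z)))"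
    unfolding ax[symmetric] by (simp only: l)
  also have "\<dots> = co \<kappa> X \<rho> x (\<lambda>d y. co \<kappa> X \<rho> y (\<lambda>e z. f d e z))"
    unfolding l by (intro co_cong x F(2) UNIV_I)
  finally show ?thesis .
qed

lemma co_counit:
  assumes r: "vector_space r" and x: "x \<in> X" and f: "lin_on s r X f"
  shows "co \<kappa> X \<rho> x (\<lambda>d y. r (\<epsilon> d) (f y)) = f x"
proof -
  note e = embD[OF co_emb]
  interpret v: vector_space s by (rule e)
  have "co \<kappa> X \<rho> x (\<lambda>d y. s (\<epsilon> d) y) = x" using C x by (simp add: comod_def left_comodule_def)
  then have "f x = f (co \<kappa> X \<rho> x (\<lambda>d y. s (\<epsilon> d) y))" by simp
  also have "\<dots> = co \<kappa> X \<rho> x (\<lambda>d y. f (s (\<epsilon> d) y))"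
    by (rule co_lin_on[OF e(1) r e(3) f x]) (rule v.subspace_scale[OF e(3)])
  also have "\<dots> = co \<kappa> X \<rho> x (\<lambda>d y. r (\<epsilon> d) (f y))"
    by (rule co_cong[OF x]) (rule lin_onD(2)[OF f])
  finally show ?thesis ..
qed

end

text \<open>
  The coaction of an image is known only as an element of \<open>D \<otimes> Y\<close>, given by a sum over some other tensor.
  Applying a linear extension of \<open>K\<close> to it transfers Sweedler sums from \<open>Y\<close> to that tensor.
\<close>

lemma sweedler_transport:
  assumes r: "vector_space r" and Y: "emb s' Y \<mu>" and K: "bilin hs D s' Y r K"
    and t: "t = sweedler \<tau> A B u (\<lambda>a b. dtens H \<mu> (p a b) (q a b))"
    and u: "\<And>f g :: 'x \<Rightarrow> 'y \<Rightarrow> 'c. (\<And>a b. a \<in> A \<Longrightarrow> b \<in> B \<Longrightarrow> f a b = g a b) \<Longrightarrow> sweedler \<tau> A B u f = sweedler \<tau> A B u g"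
    and in_T: "t \<in> tensor_space (dtens H \<mu>) D Y"
    and m: "\<And>a b. a \<in> A \<Longrightarrow> b \<in> B \<Longrightarrow> p a b \<in> D \<and> q a b \<in> Y"
  shows "sweedler (dtens H \<mu>) D Y t K = sweedler \<tau> A B u (\<lambda>a b. K (p a b) (q a b) :: 'c::ab_group_add)"
proof -
  obtain F where F: "lin uscale r F" "\<And>a b. a \<in> D \<Longrightarrow> b \<in> Y \<Longrightarrow> F (dtens H \<mu> a b) = K a b"
    "\<And>t. t \<in> tensor_space (dtens H \<mu>) D Y \<Longrightarrow> sweedler (dtens H \<mu>) D Y t K = F t"
    by (rule sweedler_extends[OF eD Y r K]) blast
  have "sweedler (dtens H \<mu>) D Y t K = F t" by (rule F(3)[OF in_T])
  also have "\<dots> = sweedler \<tau> A B u (\<lambda>a b. F (dtens H \<mu> (p a b) (q a b)))"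
    unfolding t by (rule sweedler_lin[OF vs_u r F(1)])
  also have "\<dots> = sweedler \<tau> A B u (\<lambda>a b. K (p a b) (q a b))"
    by (rule u) (use m F(2) in blast)
  finally show ?thesis .
qed

lemma co_transport:
  assumes C: "comod s X \<kappa> \<rho>" and x: "x \<in> X" and r: "vector_space r" and Y: "emb s' Y \<mu>" and K: "bilin hs D s' Y r K"
    and t: "t = co \<kappa> X \<rho> x (\<lambda>d y. dtens H \<mu> d (g y))" and g: "\<And>y. y \<in> X \<Longrightarrow> g y \<in> Y"
  shows "sweedler (dtens H \<mu>) D Y t K = co \<kappa> X \<rho> x (\<lambda>d y. K d (g y))"
    and "t \<in> tensor_space (dtens H \<mu>) D Y"
proof -
  show *: "t \<in> tensor_space (dtens H \<mu>) D Y"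
    unfolding t by (rule co_in[OF C vs_u tensor_space_subspace[OF eD Y] x])
      (rule tensor_space_pure[OF eD Y], auto simp: g)
  show "sweedler (dtens H \<mu>) D Y t K = co \<kappa> X \<rho> x (\<lambda>d y. K d (g y))"
    by (rule sweedler_transport[OF r Y K t _ *]) (use co_cong[OF C x] g in auto)
qed

section \<open>Averaging\<close>

text \<open>
  Averaging a linear map over the coseparability form makes it colinear, as in the proof of Maschke's theorem.
\<close>

definition avg_co :: "('v::ab_group_add \<Rightarrow> 'k univ) \<Rightarrow> 'v set \<Rightarrow> ('v \<Rightarrow> 'k univ) \<Rightarrow> 'k univ set \<Rightarrow> ('k univ \<Rightarrow> 'k univ) \<Rightarrow>
    ('v \<Rightarrow> 'k univ) \<Rightarrow> 'v \<Rightarrow> 'k univ"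
  where "avg_co \<kappa> X \<rho> V \<sigma> f x = co \<kappa> X \<rho> x (\<lambda>d y. co (\<lambda>v. v) V \<sigma> (f y) (\<lambda>e w. theta d e *\<^sub>u w))"

lemma tw_cbil: "cbil uscale V uscale (\<lambda>e w. theta d e *\<^sub>u w)"
  by (intro cbilI gl hl_scale hl_theta hl_id vs_u)

context
  fixes s :: "'k \<Rightarrow> 'v::ab_group_add \<Rightarrow> 'v" and X \<kappa> \<rho> and V :: "'k univ set" and \<sigma> f
  assumes C: "comod s X \<kappa> \<rho>" and CV: "comod uscale V (\<lambda>v. v) \<sigma>"
    and f: "lin_on s uscale X f" "\<And>x. x \<in> X \<Longrightarrow> f x \<in> V"
begin

lemma avg_co_arg: "cbil s X uscale (\<lambda>d y. co (\<lambda>v. v) V \<sigma> (f y) (\<lambda>e w. theta d e *\<^sub>u w))"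
proof (rule cbilI)
  show "hlin uscale (\<lambda>d. co (\<lambda>v. v) V \<sigma> (f y) (\<lambda>e w. theta d e *\<^sub>u w))" for y
    by (intro hl_sweedler hl_scale hl_theta hl_id vs_u)
  show "lin_on s uscale X (\<lambda>y. co (\<lambda>v. v) V \<sigma> (f y) (\<lambda>e w. theta d e *\<^sub>u w))" for d
    by (rule lin_comp[OF f(1) co_lin[OF CV vs_u tw_cbil]]) (use f(2) in blast)
qed

lemma avg_co_lin: "lin_on s uscale X (avg_co \<kappa> X \<rho> V \<sigma> f)"
  unfolding avg_co_def by (rule co_lin[OF C vs_u avg_co_arg])

lemma tw_in: "y \<in> X \<Longrightarrow> co (\<lambda>v. v) V \<sigma> (f y) (\<lambda>e w. theta d e *\<^sub>u w) \<in> V"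
  using embD(3)[OF co_emb[OF CV]]
  by (intro co_in[OF CV vs_u]) (auto intro: f(2) uv.subspace_scale)

lemma avg_co_in: "x \<in> X \<Longrightarrow> avg_co \<kappa> X \<rho> V \<sigma> f x \<in> V"
  unfolding avg_co_def using embD(3)[OF co_emb[OF CV]] by (intro co_in[OF C vs_u]) (auto intro: tw_in)

lemma avg_co_colinear:
  assumes x: "x \<in> X"
  shows "\<sigma> (avg_co \<kappa> X \<rho> V \<sigma> f x) = co \<kappa> X \<rho> x (\<lambda>d y. utens H d (avg_co \<kappa> X \<rho> V \<sigma> f y))"
proof -
  note u = vs_u and sV = embD(3)[OF co_emb[OF CV]]
  have "\<sigma> (avg_co \<kappa> X \<rho> V \<sigma> f x) = co \<kappa> X \<rho> x (\<lambda>d y. \<sigma> (co (\<lambda>v. v) V \<sigma> (f y) (\<lambda>e w. theta d e *\<^sub>u w)))"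
    unfolding avg_co_def by (rule co_lin_on[OF C u u sV co_facts(1)[OF CV] x tw_in])
  also have "\<dots> = co \<kappa> X \<rho> x (\<lambda>d y. copR d (\<lambda>a b. co (\<lambda>v. v) V \<sigma> (f y) (\<lambda>e w. theta b e *\<^sub>u utens H a w)))"
  proof (rule co_cong[OF C x])
    fix d y assume y: "y \<in> X"
    have "\<sigma> (co (\<lambda>v. v) V \<sigma> (f y) (\<lambda>e w. theta d e *\<^sub>u w)) = co (\<lambda>v. v) V \<sigma> (f y) (\<lambda>e w. \<sigma> (theta d e *\<^sub>u w))"
      by (rule co_lin_on[OF CV u u sV co_facts(1)[OF CV] f(2)[OF y]]) (rule uv.subspace_scale[OF sV])
    also have "\<dots> = co (\<lambda>v. v) V \<sigma> (f y) (\<lambda>e w. co (\<lambda>v. v) V \<sigma> w (\<lambda>e' w'. theta d e *\<^sub>u utens H e' w'))"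
    proof (rule co_cong[OF CV f(2)[OF y]])
      fix e w assume w: "w \<in> V"
      have "\<sigma> (theta d e *\<^sub>u w) = theta d e *\<^sub>u \<sigma> w" by (rule lin_onD(2)[OF co_facts(1)[OF CV] w])
      also have "\<dots> = theta d e *\<^sub>u co (\<lambda>v. v) V \<sigma> w (utens H)" using co_self[OF CV w] by simp
      finally show "\<sigma> (theta d e *\<^sub>u w) = co (\<lambda>v. v) V \<sigma> w (\<lambda>e' w'. theta d e *\<^sub>u utens H e' w')"
        by (simp only: cop_lin_s[OF u])
    qed
    also have "\<dots> = co (\<lambda>v. v) V \<sigma> (f y) (\<lambda>e w. copR e (\<lambda>a b. theta d a *\<^sub>u utens H b w))"
      by (rule co_coassoc[OF CV u f(2)[OF y], symmetric]) (intro hl_scale hl_theta hl gl hl_emb u)+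
    also have "\<dots> = co (\<lambda>v. v) V \<sigma> (f y) (\<lambda>e w. copR d (\<lambda>a b. theta b e *\<^sub>u utens H a w))"
      by (rule sweedler_ext, rule theta_bicolinear[OF u, symmetric]) (intro hl)
    also have "\<dots> = copR d (\<lambda>a b. co (\<lambda>v. v) V \<sigma> (f y) (\<lambda>e w. theta b e *\<^sub>u utens H a w))"
      by (subst sweedler_swap, rule sweedler_ext, rule sweedler_swap)
    finally show "\<sigma> (co (\<lambda>v. v) V \<sigma> (f y) (\<lambda>e w. theta d e *\<^sub>u w)) =
      copR d (\<lambda>a b. co (\<lambda>v. v) V \<sigma> (f y) (\<lambda>e w. theta b e *\<^sub>u utens H a w))" .
  qed
  also have "\<dots> = co \<kappa> X \<rho> x (\<lambda>d y. co \<kappa> X \<rho> y (\<lambda>d' y'. co (\<lambda>v. v) V \<sigma> (f y') (\<lambda>e w. theta d' e *\<^sub>u utens H d w)))"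
  proof (rule co_coassoc[OF C u x])
    show "hlin uscale (\<lambda>a. co (\<lambda>v. v) V \<sigma> (f y) (\<lambda>e w. theta b e *\<^sub>u utens H a w))" for b y by (intro hl)
    show "hlin uscale (\<lambda>b. co (\<lambda>v. v) V \<sigma> (f y) (\<lambda>e w. theta b e *\<^sub>u utens H a w))" for a y
      by (intro hl hl_theta)
    have "cbil uscale V uscale (\<lambda>e w. theta b e *\<^sub>u utens H a w)" for a b
      by (intro cbilI gl hl hl_theta u)
    then show "lin_on s uscale X (\<lambda>y. co (\<lambda>v. v) V \<sigma> (f y) (\<lambda>e w. theta b e *\<^sub>u utens H a w))" for a b
      by (intro lin_comp[OF f(1) co_lin[OF CV u]]) (use f(2) in auto)
  qed
  also have "\<dots> = co \<kappa> X \<rho> x (\<lambda>d y. utens H d (avg_co \<kappa> X \<rho> V \<sigma> f y))"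
    unfolding avg_co_def by (simp only: sweedler_lin[OF u u lin_kron(2)] kron_right(2))
  finally show ?thesis .
qed

lemma avg_co_id:
  assumes x: "x \<in> X" and fc: "\<And>y. y \<in> X \<Longrightarrow> \<sigma> (f y) = co \<kappa> X \<rho> y (\<lambda>d z. utens H d (f z))"
  shows "avg_co \<kappa> X \<rho> V \<sigma> f x = f x"
proof -
  note u = vs_u
  have "avg_co \<kappa> X \<rho> V \<sigma> f x = co \<kappa> X \<rho> x (\<lambda>d y. co \<kappa> X \<rho> y (\<lambda>e z. theta d e *\<^sub>u f z))"
    unfolding avg_co_def
    by (rule co_cong[OF C x], rule co_transport(1)[OF C _ u co_emb[OF CV] cbil_bilin[OF tw_cbil] fc f(2)])
  also have "\<dots> = co \<kappa> X \<rho> x (\<lambda>d y. copR d (\<lambda>a b. theta a b *\<^sub>u f y))"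
    by (rule co_coassoc[OF C u x, symmetric]) (intro hl hl_theta gl_scale u f(1))+
  also have "\<dots> = co \<kappa> X \<rho> x (\<lambda>d y. \<epsilon> d *\<^sub>u f y)"
  proof (rule sweedler_ext)
    fix d y
    have l: "lin (*) uscale (\<lambda>c. c *\<^sub>u f y)" by (simp add: lin_on_def uv.scale_left_distrib)
    have "copR d (\<lambda>a b. theta a b *\<^sub>u f y) = copR d (\<lambda>a b. theta a b) *\<^sub>u f y"
      by (simp only: sweedler_lin[OF vs_k u l])
    then show "copR d (\<lambda>a b. theta a b *\<^sub>u f y) = \<epsilon> d *\<^sub>u f y" by (simp only: theta_counit)
  qed
  also have "\<dots> = f x" by (rule co_counit[OF C u x f(1)])
  finally show ?thesis .
qed

end

text \<open>
  The Casimir property of the integral, which makes averages over it linear.  Inserting \<open>S h\<^sub>2 h\<^sub>3\<close> on the left-hand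
  side turns its tensor into \<open>\<Delta> (h\<^sub>1 Lam) = \<epsilon> h\<^sub>1 \<Delta> Lam\<close>.
\<close>

lemma Lam_casimir:
  assumes s: "vector_space s" and K: "hbil s K"
  shows "cop Lam (\<lambda>a b. K (h * a) (S b)) = cop Lam (\<lambda>a b. K a (S b * h))"
proof -
  note fl = hl_comp[OF hbilD(1)[OF K]] hl_comp[OF hbilD(2)[OF K]]
  let ?G = "\<lambda>h1 z. cop Lam (\<lambda>a b. K (h1 * a) (S b * z))"
  have "?G h 1 = cop h (\<lambda>h1 u. s (\<epsilon> u) (?G h1 1))"
    by (rule cop_counit(2)[OF s, symmetric]) (intro hl fl s)
  also have "\<dots> = cop h (\<lambda>h1 u. cop u (\<lambda>h2 h3. ?G h1 (S h2 * h3)))"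
    by (subst cop_S(1)[OF s]) (intro hl fl s | rule refl)+
  also have "\<dots> = cop h (\<lambda>x h3. cop x (\<lambda>h1 h2. ?G h1 (S h2 * h3)))"
    by (rule cop_coassoc[OF s, symmetric]) (intro hl fl s)+
  also have "\<dots> = cop h (\<lambda>x h3. cop (x * Lam) (\<lambda>a b. K a (S b * h3)))"
    by (subst cop_mult[OF s], intro hl fl s) (simp only: S_mult mult.assoc)
  also have "\<dots> = cop h (\<lambda>x h3. s (\<epsilon> x) (cop Lam (\<lambda>a b. K a (S b * h3))))"
  proof -
    have "hbil s (\<lambda>a b. K a (S b * h3))" for h3 by (intro hl fl)
    then show ?thesis by (simp only: Lam_left hscl[OF hl_cop[OF s hl_id]])
  qed
  also have "\<dots> = cop Lam (\<lambda>a b. K a (S b * h))" by (rule cop_counit(1)[OF s]) (intro hl fl s)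
  finally show ?thesis by simp
qed

end

section \<open>Modules with compatible coaction\<close>

context hd_setting
begin

abbreviation hdm :: "('k, 'h) hdmod \<Rightarrow> bool" where "hdm V \<equiv> hd_module H R D V"
abbreviation coV :: "('k, 'h) hdmod \<Rightarrow> 'k univ \<Rightarrow> ('h \<Rightarrow> 'k univ \<Rightarrow> 'c::comm_monoid_add) \<Rightarrow> 'c"
  where "coV V v f \<equiv> co (\<lambda>v. v) (hdcar V) (hdcoact V) v f"
abbreviation hom :: "('k, 'h) hdmod \<Rightarrow> ('k, 'h) hdmod \<Rightarrow> ('k univ \<Rightarrow> 'k univ) set" where "hom V V' \<equiv> hd_hom H D V V'"

lemma hdm_facts:
  assumes "hdm V"
  shows "fd (hdcar V)" "usub (hdcar V)" "v \<in> hdcar V \<Longrightarrow> hdact V h v \<in> hdcar V"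
    "ulin (hdcar V) (hdact V h)" "v \<in> hdcar V \<Longrightarrow> hlin uscale (\<lambda>h. hdact V h v)"
    "v \<in> hdcar V \<Longrightarrow> hdact V (g * h) v = hdact V g (hdact V h v)" "v \<in> hdcar V \<Longrightarrow> hdact V 1 v = v"
    "comod uscale (hdcar V) (\<lambda>v. v) (hdcoact V)"
    "v \<in> hdcar V \<Longrightarrow> hdcoact V (hdact V h v) = cop h (\<lambda>h1 h2. coV V v (\<lambda>d v'. utens H (adj h1 d) (hdact V h2 v')))"
  using assms emb_id by (auto simp: hd_module_def left_module_def comod_def)

lemma hl_act: "hdm V \<Longrightarrow> v \<in> hdcar V \<Longrightarrow> hlin hs f \<Longrightarrow> hlin uscale (\<lambda>x. hdact V (f x) v)"
  using hl_comp[OF hdm_facts(5)] .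

lemma gl_act: "hdm V \<Longrightarrow> lin_on s uscale X f \<Longrightarrow> (\<And>x. x \<in> X \<Longrightarrow> f x \<in> hdcar V) \<Longrightarrow> lin_on s uscale X (\<lambda>x. hdact V h (f x))"
  by (rule lin_comp[OF _ hdm_facts(4)]) auto

lemma co_act:
  assumes V: "hdm V" and r: "vector_space r" and f: "cbil uscale (hdcar V) r f" and v: "v \<in> hdcar V"
  shows "coV V (hdact V h v) f = cop h (\<lambda>h1 h2. coV V v (\<lambda>d v'. f (adj h1 d) (hdact V h2 v')))"
proof -
  note C = hdm_facts(8)[OF V]
  obtain F where F: "lin uscale r F" "\<And>a b. a \<in> D \<Longrightarrow> b \<in> hdcar V \<Longrightarrow> F (utens H a b) = f a b"
    "\<And>t. t \<in> tensor_space (utens H) D (hdcar V) \<Longrightarrow> sweedler (utens H) D (hdcar V) t f = F t"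
    by (rule sweedler_extends[OF eD co_emb[OF C] r cbil_bilin[OF f]]) blast
  have "coV V (hdact V h v) f = F (hdcoact V (hdact V h v))"
    by (rule F(3)[OF co_facts(2)[OF C hdm_facts(3)[OF V v]]])
  also have "\<dots> = cop h (\<lambda>h1 h2. coV V v (\<lambda>d v'. F (utens H (adj h1 d) (hdact V h2 v'))))"
    unfolding hdm_facts(9)[OF V v] by (simp only: sweedler_lin[OF vs_u r F(1)])
  also have "\<dots> = cop h (\<lambda>h1 h2. coV V v (\<lambda>d v'. f (adj h1 d) (hdact V h2 v')))"
    by (rule sweedler_ext, rule co_cong[OF C v], rule F(2)[OF D_facts(3) hdm_facts(3)[OF V]])
  finally show ?thesis .
qed

lemma homI:
  assumes "f \<in> lin_maps (hdcar V) (hdcar V')"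
    and "\<And>h v. v \<in> hdcar V \<Longrightarrow> f (hdact V h v) = hdact V' h (f v)"
    and "\<And>v. v \<in> hdcar V \<Longrightarrow> hdcoact V' (f v) = coV V v (\<lambda>d v'. utens H d (f v'))"
  shows "f \<in> hom V V'"
  using assms by (simp add: hd_hom_def)

lemma homD:
  assumes "f \<in> hom V V'"
  shows "f \<in> lin_maps (hdcar V) (hdcar V')" "ulin (hdcar V) f" "v \<in> hdcar V \<Longrightarrow> f v \<in> hdcar V'"
    and "v \<in> hdcar V \<Longrightarrow> f (hdact V h v) = hdact V' h (f v)"
    and "v \<in> hdcar V \<Longrightarrow> hdcoact V' (f v) = coV V v (\<lambda>d v'. utens H d (f v'))"
    and "v \<notin> hdcar V \<Longrightarrow> f v = 0"
  using assms by (auto simp: hd_hom_def lin_maps_def)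

lemma hom_co:
  assumes "hdm V" "hdm V'" "f \<in> hom V V'" "v \<in> hdcar V" "vector_space r" "bilin hs D uscale (hdcar V') r K"
  shows "coV V' (f v) K = coV V v (\<lambda>d v'. K d (f v'))"
  by (rule co_transport(1)[OF hdm_facts(8)[OF assms(1)] assms(4,5) co_emb[OF hdm_facts(8)[OF assms(2)]] assms(6)
        homD(5)[OF assms(3,4)] homD(3)[OF assms(3)]])

subsection \<open>The averaging projection onto morphisms\<close>

definition avg_act :: "('k, 'h) hdmod \<Rightarrow> ('k, 'h) hdmod \<Rightarrow> ('k univ \<Rightarrow> 'k univ) \<Rightarrow> 'k univ \<Rightarrow> 'k univ"
  where "avg_act V V' f v = cop Lam (\<lambda>a b. hdact V' a (f (hdact V (S b) v)))"

definition avg :: "('k, 'h) hdmod \<Rightarrow> ('k, 'h) hdmod \<Rightarrow> ('k univ \<Rightarrow> 'k univ) \<Rightarrow> 'k univ \<Rightarrow> 'k univ"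
  where "avg V V' f v = (if v \<in> hdcar V
    then avg_co (\<lambda>v. v) (hdcar V) (hdcoact V) (hdcar V') (hdcoact V') (avg_act V V' f) v else 0)"

context
  fixes V V' f
  assumes V: "hdm V" and V': "hdm V'" and f: "f \<in> lin_maps (hdcar V) (hdcar V')"
begin

lemma avg_act_lin: "ulin (hdcar V) (avg_act V V' f)"
  unfolding avg_act_def
  by (intro lin_on_sweedler vs_u gl_act[OF V'] lin_comp[OF hdm_facts(4)[OF V] lin_mapsD(1)[OF f]])
    (auto intro!: lin_mapsD(2)[OF f] hdm_facts(3)[OF V])

lemma avg_act_in: "v \<in> hdcar V \<Longrightarrow> avg_act V V' f v \<in> hdcar V'"
  unfolding avg_act_def
  by (intro sweedler_in[OF embH embH vs_u hdm_facts(2)[OF V'] hopf_unfold(4)] hdm_facts(3)[OF V']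
      lin_mapsD(2)[OF f] hdm_facts(3)[OF V])

lemma avg_act_linear:
  assumes v: "v \<in> hdcar V"
  shows "avg_act V V' f (hdact V h v) = hdact V' h (avg_act V V' f v)"
proof -
  let ?K = "\<lambda>a b. hdact V' a (f (hdact V b v))"
  have m: "f (hdact V b v) \<in> hdcar V'" for b by (intro lin_mapsD(2)[OF f] hdm_facts(3)[OF V] v)
  have K: "hbil uscale ?K"
  proof (rule hbilI)
    show "hlin uscale (\<lambda>a. ?K a b)" for b by (rule hdm_facts(5)[OF V' m])
    have "hlin uscale (\<lambda>b. f (hdact V b v))"
      by (rule lin_comp[OF hdm_facts(5)[OF V v] lin_mapsD(1)[OF f]]) (use hdm_facts(3)[OF V v] in auto)
    then show "hlin uscale (\<lambda>b. ?K a b)" for a by (rule gl_act[OF V']) (rule m)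
  qed
  have "avg_act V V' f (hdact V h v) = cop Lam (\<lambda>a b. ?K a (S b * h))"
    unfolding avg_act_def by (simp only: hdm_facts(6)[OF V v])
  also have "\<dots> = cop Lam (\<lambda>a b. ?K (h * a) (S b))" by (rule Lam_casimir[OF vs_u K, symmetric])
  also have "\<dots> = cop Lam (\<lambda>a b. hdact V' h (?K a (S b)))" by (simp only: hdm_facts(6)[OF V' m])
  also have "\<dots> = hdact V' h (cop Lam (\<lambda>a b. ?K a (S b)))"
    by (rule sweedler_lin_on[OF embH embH vs_u vs_u hdm_facts(2,4)[OF V'] hopf_unfold(4), symmetric])
      (rule hdm_facts(3)[OF V' m])
  finally show ?thesis by (simp add: avg_act_def)
qed

lemma avg_act_id:
  assumes "f \<in> hom V V'" "v \<in> hdcar V"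
  shows "avg_act V V' f v = f v"
proof -
  have "avg_act V V' f v = cop Lam (\<lambda>a b. hdact V' (a * S b) (f v))"
    unfolding avg_act_def by (simp only: homD(3,4)[OF assms(1)] assms(2) hdm_facts(6)[OF V'])
  also have "\<dots> = \<epsilon> Lam *\<^sub>u hdact V' 1 (f v)"
    by (rule cop_S(2)[OF vs_u hdm_facts(5)[OF V']]) (rule homD(3)[OF assms])
  finally show ?thesis using hdm_facts(7)[OF V' homD(3)[OF assms]] by (simp add: eps_Lam)
qed

abbreviation (input) "avg1 \<equiv> avg_act V V' f"
lemmas CC = hdm_facts(8)[OF V] hdm_facts(8)[OF V']

text \<open>Averaging over the coaction keeps linearity over \<open>H\<close>, because the form is invariant.\<close>

lemma avg_co_linear:
  assumes v: "v \<in> hdcar V"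
  shows "avg_co (\<lambda>v. v) (hdcar V) (hdcoact V) (hdcar V') (hdcoact V') avg1 (hdact V h v) =
    hdact V' h (avg_co (\<lambda>v. v) (hdcar V) (hdcoact V) (hdcar V') (hdcoact V') avg1 v)"
proof -
  note u = vs_u
  note a = avg_co_arg[OF CC avg_act_lin avg_act_in]
  let ?t = "\<lambda>d e w. theta d e *\<^sub>u w"
  have t: "cbil uscale (hdcar V') uscale (?t d)" for d by (rule tw_cbil)
  have "avg_co (\<lambda>v. v) (hdcar V) (hdcoact V) (hdcar V') (hdcoact V') avg1 (hdact V h v) =
      cop h (\<lambda>h1 h2. coV V v (\<lambda>d v'. coV V' (avg1 (hdact V h2 v')) (?t (adj h1 d))))"
    unfolding avg_co_def by (rule co_act[OF V u a v])
  also have "\<dots> = cop h (\<lambda>h1 h2. coV V v (\<lambda>d v'. cop h2 (\<lambda>x y. coV V' (avg1 v') (\<lambda>e w. theta (adj h1 d) (adj x e) *\<^sub>u hdact V' y w))))"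
  proof (rule sweedler_ext, rule co_cong[OF CC(1) v])
    fix h1 h2 d v' assume v': "v' \<in> hdcar V"
    show "coV V' (avg1 (hdact V h2 v')) (?t (adj h1 d)) =
        cop h2 (\<lambda>x y. coV V' (avg1 v') (\<lambda>e w. theta (adj h1 d) (adj x e) *\<^sub>u hdact V' y w))"
      unfolding avg_act_linear[OF v'] by (rule co_act[OF V' u t avg_act_in[OF v']])
  qed
  also have "\<dots> = coV V v (\<lambda>d v'. cop h (\<lambda>h1 h2. cop h2 (\<lambda>x y. coV V' (avg1 v') (\<lambda>e w. theta (adj h1 d) (adj x e) *\<^sub>u hdact V' y w))))"
    by (rule sweedler_swap)
  also have "\<dots> = coV V v (\<lambda>d v'. coV V' (avg1 v') (\<lambda>e w. theta d e *\<^sub>u hdact V' h w))"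
  proof (rule co_cong[OF CC(1) v])
    fix d v' assume v': "v' \<in> hdcar V"
    have "cop h (\<lambda>h1 h2. cop h2 (\<lambda>x y. coV V' (avg1 v') (\<lambda>e w. theta (adj h1 d) (adj x e) *\<^sub>u hdact V' y w))) =
        coV V' (avg1 v') (\<lambda>e w. cop h (\<lambda>h1 h2. cop h2 (\<lambda>x y. theta (adj h1 d) (adj x e) *\<^sub>u hdact V' y w)))"
      by (subst sweedler_swap, rule sweedler_ext, rule sweedler_swap)
    also have "\<dots> = coV V' (avg1 v') (\<lambda>e w. theta d e *\<^sub>u hdact V' h w)"
    proof (rule co_cong[OF CC(2) avg_act_in[OF v']])
      fix e w assume w: "w \<in> hdcar V'"
      have "cop h (\<lambda>h1 h2. cop h2 (\<lambda>x y. theta (adj h1 d) (adj x e) *\<^sub>u hdact V' y w)) =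
          cop h (\<lambda>z y. cop z (\<lambda>h1 x. theta (adj h1 d) (adj x e) *\<^sub>u hdact V' y w))"
        by (rule cop_coassoc[OF u, symmetric]) (intro hl hl_theta hl_ad hl_act[OF V' w])+
      also have "\<dots> = cop h (\<lambda>z y. \<epsilon> z *\<^sub>u (theta d e *\<^sub>u hdact V' y w))"
      proof (rule sweedler_ext)
        fix z y
        have l: "lin (*) uscale (\<lambda>c. c *\<^sub>u hdact V' y w)" by (simp add: lin_on_def uv.scale_left_distrib)
        have "cop z (\<lambda>h1 x. theta (adj h1 d) (adj x e) *\<^sub>u hdact V' y w) =
            cop z (\<lambda>h1 x. theta (adj h1 d) (adj x e)) *\<^sub>u hdact V' y w"
          by (simp only: sweedler_lin[OF vs_k u l])
        then show "cop z (\<lambda>h1 x. theta (adj h1 d) (adj x e) *\<^sub>u hdact V' y w) = \<epsilon> z *\<^sub>u (theta d e *\<^sub>u hdact V' y w)"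
          by (simp add: theta_invariant)
      qed
      also have "\<dots> = theta d e *\<^sub>u hdact V' h w"
        by (rule cop_counit(1)[OF u]) (intro hl hl_act[OF V' w])
      finally show "cop h (\<lambda>h1 h2. cop h2 (\<lambda>x y. theta (adj h1 d) (adj x e) *\<^sub>u hdact V' y w)) = theta d e *\<^sub>u hdact V' h w" .
    qed
    finally show "cop h (\<lambda>h1 h2. cop h2 (\<lambda>x y. coV V' (avg1 v') (\<lambda>e w. theta (adj h1 d) (adj x e) *\<^sub>u hdact V' y w))) =
      coV V' (avg1 v') (\<lambda>e w. theta d e *\<^sub>u hdact V' h w)" .
  qed
  also have "\<dots> = coV V v (\<lambda>d v'. hdact V' h (coV V' (avg1 v') (?t d)))"
  proof (rule co_cong[OF CC(1) v])
    fix d v' assume v': "v' \<in> hdcar V"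
    have "hdact V' h (coV V' (avg1 v') (?t d)) = coV V' (avg1 v') (\<lambda>e w. hdact V' h (?t d e w))"
      by (rule co_lin_on[OF CC(2) u u hdm_facts(2,4)[OF V'] avg_act_in[OF v']])
        (rule uv.subspace_scale[OF hdm_facts(2)[OF V']])
    also have "\<dots> = coV V' (avg1 v') (\<lambda>e w. theta d e *\<^sub>u hdact V' h w)"
      by (rule co_cong[OF CC(2) avg_act_in[OF v']]) (rule lin_onD(2)[OF hdm_facts(4)[OF V']])
    finally show "coV V' (avg1 v') (\<lambda>e w. theta d e *\<^sub>u hdact V' h w) = hdact V' h (coV V' (avg1 v') (?t d))" ..
  qed
  also have "\<dots> = hdact V' h (coV V v (\<lambda>d v'. coV V' (avg1 v') (?t d)))"
    by (rule co_lin_on[OF CC(1) u u hdm_facts(2,4)[OF V'] v, symmetric]) (rule tw_in[OF CC avg_act_lin avg_act_in])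
  finally show ?thesis by (simp add: avg_co_def)
qed

lemma avg_hom: "avg V V' f \<in> hom V V'"
proof (rule homI)
  note l = avg_co_lin[OF CC avg_act_lin avg_act_in] and m = avg_co_in[OF CC avg_act_lin avg_act_in]
  show "avg V V' f \<in> lin_maps (hdcar V) (hdcar V')"
    using l m hdm_facts(2)[OF V]
    by (auto simp: lin_maps_def lin_on_def avg_def uv.subspace_add uv.subspace_scale)
  show "avg V V' f (hdact V h v) = hdact V' h (avg V V' f v)" if "v \<in> hdcar V" for h v
    using avg_co_linear[OF that] hdm_facts(3)[OF V that] that by (simp add: avg_def)
  show "hdcoact V' (avg V V' f v) = coV V v (\<lambda>d v'. utens H d (avg V V' f v'))" if v: "v \<in> hdcar V" for v
  proof -
    have "hdcoact V' (avg V V' f v) = coV V v (\<lambda>d v'. utens H d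
        (avg_co (\<lambda>v. v) (hdcar V) (hdcoact V) (hdcar V') (hdcoact V') avg1 v'))"
      unfolding avg_def using v avg_co_colinear[OF CC avg_act_lin avg_act_in v] by simp
    also have "\<dots> = coV V v (\<lambda>d v'. utens H d (avg V V' f v'))"
      by (rule co_cong[OF CC(1) v]) (simp add: avg_def)
    finally show ?thesis .
  qed
qed

lemma avg_id:
  assumes "f \<in> hom V V'"
  shows "avg V V' f = f"
proof
  fix v
  show "avg V V' f v = f v"
  proof (cases "v \<in> hdcar V")
    case True
    have "hdcoact V' (avg1 y) = coV V y (\<lambda>d z. utens H d (avg1 z))" if y: "y \<in> hdcar V" for y
    proof -
      have "coV V y (\<lambda>d z. utens H d (avg1 z)) = coV V y (\<lambda>d z. utens H d (f z))"
        by (rule co_cong[OF CC(1) y]) (simp add: avg_act_id[OF assms])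
      then show ?thesis using homD(5)[OF assms y] avg_act_id[OF assms y] by simp
    qed
    note c = this
    have "avg_co (\<lambda>v. v) (hdcar V) (hdcoact V) (hdcar V') (hdcoact V') avg1 v = avg1 v"
      by (rule avg_co_id[OF CC avg_act_lin avg_act_in True c])
    then show ?thesis using True avg_act_id[OF assms True] by (simp add: avg_def)
  qed (simp add: avg_def homD(6)[OF assms])
qed

lemma avg_post:
  assumes V'': "hdm V''" and g: "g \<in> hom V' V''"
  shows "avg V V'' (g \<circ> f) = g \<circ> avg V V' f"
proof
  fix v
  note u = vs_u
  have gf: "g \<circ> f \<in> lin_maps (hdcar V) (hdcar V'')"
    by (rule lin_maps_comp[OF f homD(1)[OF g] hdm_facts(2)[OF V']])
  have m: "f (hdact V b v) \<in> hdcar V'" if "v \<in> hdcar V" for b v by (intro lin_mapsD(2)[OF f] hdm_facts(3)[OF V] that)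
  have 1: "avg_act V V'' (g \<circ> f) v = g (avg1 v)" if v: "v \<in> hdcar V" for v
  proof -
    have "g (avg1 v) = cop Lam (\<lambda>a b. g (hdact V' a (f (hdact V (S b) v))))"
      unfolding avg_act_def
      by (rule sweedler_lin_on[OF embH embH u u hdm_facts(2)[OF V'] homD(2)[OF g] hopf_unfold(4)])
        (rule hdm_facts(3)[OF V' m[OF v]])
    then show ?thesis unfolding avg_act_def by (simp add: homD(4)[OF g m[OF v]])
  qed
  show "avg V V'' (g \<circ> f) v = (g \<circ> avg V V' f) v"
  proof (cases "v \<in> hdcar V")
    case v: True
    have "avg V V'' (g \<circ> f) v = coV V v (\<lambda>d y. coV V'' (g (avg1 y)) (\<lambda>e w. theta d e *\<^sub>u w))"
      by (simp add: v avg_def avg_co_def) (rule co_cong[OF CC(1) v], simp add: 1)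
    also have "\<dots> = coV V v (\<lambda>d y. g (coV V' (avg1 y) (\<lambda>e w. theta d e *\<^sub>u w)))"
    proof (rule co_cong[OF CC(1) v])
      fix d y assume y: "y \<in> hdcar V"
      note ay = avg_act_in[OF y]
      have "coV V'' (g (avg1 y)) (\<lambda>e w. theta d e *\<^sub>u w) = coV V' (avg1 y) (\<lambda>e w. theta d e *\<^sub>u g w)"
        by (rule hom_co[OF V' V'' g ay u cbil_bilin[OF tw_cbil]])
      also have "\<dots> = coV V' (avg1 y) (\<lambda>e w. g (theta d e *\<^sub>u w))"
        by (rule co_cong[OF CC(2) ay]) (rule lin_onD(2)[OF homD(2)[OF g], symmetric])
      also have "\<dots> = g (coV V' (avg1 y) (\<lambda>e w. theta d e *\<^sub>u w))"
        by (rule co_lin_on[OF CC(2) u u hdm_facts(2)[OF V'] homD(2)[OF g] ay, symmetric])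
          (rule uv.subspace_scale[OF hdm_facts(2)[OF V']])
      finally show "coV V'' (g (avg1 y)) (\<lambda>e w. theta d e *\<^sub>u w) = g (coV V' (avg1 y) (\<lambda>e w. theta d e *\<^sub>u w))" .
    qed
    also have "\<dots> = g (coV V v (\<lambda>d y. coV V' (avg1 y) (\<lambda>e w. theta d e *\<^sub>u w)))"
      by (rule co_lin_on[OF CC(1) u u hdm_facts(2)[OF V'] homD(2)[OF g] v, symmetric])
        (rule tw_in[OF CC avg_act_lin avg_act_in])
    finally show ?thesis using v by (simp add: avg_def avg_co_def)
  qed (simp add: avg_def lin_maps_0[OF homD(1)[OF g]])
qed

lemma avg_pre:
  assumes V0: "hdm V0" and g: "g \<in> hom V0 V"
  shows "avg V0 V' (f \<circ> g) = avg V V' f \<circ> g"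
proof
  fix v
  note u = vs_u
  note C0 = hdm_facts(8)[OF V0]
  have 1: "avg_act V0 V' (f \<circ> g) v = avg1 (g v)" if v: "v \<in> hdcar V0" for v
    unfolding avg_act_def by (simp add: homD(4)[OF g v])
  show "avg V0 V' (f \<circ> g) v = (avg V V' f \<circ> g) v"
  proof (cases "v \<in> hdcar V0")
    case v: True
    have "avg V0 V' (f \<circ> g) v = coV V0 v (\<lambda>d y. coV V' (avg1 (g y)) (\<lambda>e w. theta d e *\<^sub>u w))"
      by (simp add: v avg_def avg_co_def) (rule co_cong[OF C0 v], simp add: 1)
    also have "\<dots> = coV V (g v) (\<lambda>d y. coV V' (avg1 y) (\<lambda>e w. theta d e *\<^sub>u w))"
      by (rule hom_co[OF V0 V g v u cbil_bilin[OF avg_co_arg[OF CC avg_act_lin avg_act_in]], symmetric])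
    finally show ?thesis using homD(3)[OF g v] by (simp add: avg_def avg_co_def)
  next
    case False
    have "avg V V' f \<in> lin_maps (hdcar V) (hdcar V')" by (rule homD(1)[OF avg_hom])
    then show ?thesis using False lin_maps_0 by (simp add: avg_def[of V0] homD(6)[OF g])
  qed
qed

end

lemma avg_add:
  assumes V: "hdm V" and V': "hdm V'" and f: "f \<in> lin_maps (hdcar V) (hdcar V')" and g: "g \<in> lin_maps (hdcar V) (hdcar V')"
  shows "avg V V' (f + g) = avg V V' f + avg V V' g"
proof
  fix v
  note u = vs_u
  note C = hdm_facts(8)[OF V] and C' = hdm_facts(8)[OF V']
  have 1: "avg_act V V' (f + g) v = avg_act V V' f v + avg_act V V' g v" if v: "v \<in> hdcar V" for v
  proof -
    have m: "f (hdact V b v) \<in> hdcar V'" "g (hdact V b v) \<in> hdcar V'" for b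
      by (intro lin_mapsD(2)[OF f] lin_mapsD(2)[OF g] hdm_facts(3)[OF V] v)+
    show ?thesis unfolding avg_act_def plus_fun_apply[of f g] lin_onD(1)[OF hdm_facts(4)[OF V'] m(1) m(2)]
      by (rule sweedler_add)
  qed
  show "avg V V' (f + g) v = (avg V V' f + avg V V' g) v"
  proof (cases "v \<in> hdcar V")
    case v: True
    have "avg V V' (f + g) v = coV V v (\<lambda>d y. coV V' (avg_act V V' f y + avg_act V V' g y) (\<lambda>e w. theta d e *\<^sub>u w))"
      by (simp add: v avg_def avg_co_def) (rule co_cong[OF C v], simp add: 1)
    also have "\<dots> = coV V v (\<lambda>d y. coV V' (avg_act V V' f y) (\<lambda>e w. theta d e *\<^sub>u w) + coV V' (avg_act V V' g y) (\<lambda>e w. theta d e *\<^sub>u w))"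
      by (rule co_cong[OF C v], rule lin_onD(1)[OF co_lin[OF C' u tw_cbil]])
        (auto intro: avg_act_in[OF V V' f] avg_act_in[OF V V' g])
    finally show ?thesis using v by (simp add: avg_def avg_co_def sweedler_add)
  qed (simp add: avg_def)
qed

subsection \<open>Operators\<close>

text \<open>
  The rows of the coaction, unlike the coaction, are endomorphisms of the object.  Together with the action of \<open>H\<close>
  they are operators such that a morphism is a linear map that commutes with them.
\<close>

fun hdop :: "('k, 'h) hdmod \<Rightarrow> 'h + nat \<Rightarrow> 'k univ \<Rightarrow> 'k univ" where
  "hdop V (Inl h) v = hdact V h v" | "hdop V (Inr i) v = row i (hdcoact V v)"

lemma row_co:
  assumes "hdm V" "v \<in> hdcar V"
  shows "row i (hdcoact V v) = coV V v (\<lambda>d v'. hemb H d i *\<^sub>u v')" "row i (hdcoact V v) \<in> hdcar V"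
proof -
  note C = hdm_facts(8)[OF assms(1)]
  have "row i (hdcoact V v) = row i (coV V v (utens H))" using co_self[OF C assms(2)] by simp
  then show 1: "row i (hdcoact V v) = coV V v (\<lambda>d v'. hemb H d i *\<^sub>u v')"
    by (simp add: sweedler_lin[OF vs_u vs_u lin_row])
  show "row i (hdcoact V v) \<in> hdcar V"
    unfolding 1 using hdm_facts(2)[OF assms(1)]
    by (intro co_in[OF C vs_u _ assms(2)]) (auto intro: uv.subspace_scale)
qed

lemma hdop_in: "hdm V \<Longrightarrow> v \<in> hdcar V \<Longrightarrow> hdop V j v \<in> hdcar V"
  by (cases j) (auto simp: hdm_facts(3) row_co(2))

lemma hdop_lin: "hdm V \<Longrightarrow> ulin (hdcar V) (hdop V j)"
proof (cases j)
  case (Inr i)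
  assume V: "hdm V"
  have "ulin (hdcar V) (\<lambda>v. row i (hdcoact V v))"
    by (rule gl_comp[OF lin_row co_facts(1)[OF hdm_facts(8)[OF V]]])
  then show ?thesis by (simp add: Inr lin_on_def)
qed (use hdm_facts(4) in \<open>simp add: lin_on_def\<close>)

lemma hom_ops:
  assumes V: "hdm V" and V': "hdm V'"
  shows "hom V V' = {f \<in> lin_maps (hdcar V) (hdcar V'). \<forall>j\<in>UNIV. \<forall>v\<in>hdcar V. f (hdop V j v) = hdop V' j (f v)}"
proof -
  note u = vs_u and C = hdm_facts(8)[OF V]
  have "(hdcoact V' (f v) = coV V v (\<lambda>d v'. utens H d (f v'))) \<longleftrightarrow> (\<forall>i. f (hdop V (Inr i) v) = hdop V' (Inr i) (f v))"
    if f: "f \<in> lin_maps (hdcar V) (hdcar V')" and v: "v \<in> hdcar V" for f v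
  proof -
    have "f (row i (hdcoact V v)) = row i (coV V v (\<lambda>d v'. utens H d (f v')))" for i
    proof -
      have "f (row i (hdcoact V v)) = coV V v (\<lambda>d v'. f (hemb H d i *\<^sub>u v'))"
        unfolding row_co(1)[OF V v]
        by (rule co_lin_on[OF C u u hdm_facts(2)[OF V] lin_mapsD(1)[OF f] v]) (rule uv.subspace_scale[OF hdm_facts(2)[OF V]])
      also have "\<dots> = coV V v (\<lambda>d v'. hemb H d i *\<^sub>u f v')"
        by (rule co_cong[OF C v]) (rule lin_onD(2)[OF lin_mapsD(1)[OF f]])
      also have "\<dots> = row i (coV V v (\<lambda>d v'. utens H d (f v')))"
        by (simp add: sweedler_lin[OF u u lin_row])
      finally show ?thesis .
    qed
    then show ?thesis by (auto intro: row_eqI)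
  qed
  moreover have "(\<forall>j. P j) \<longleftrightarrow> (\<forall>h. P (Inl h)) \<and> (\<forall>i. P (Inr i))" for P :: "'h + nat \<Rightarrow> bool"
    by (metis sum.exhaust)
  ultimately show ?thesis by (auto simp: hd_hom_def)
qed

end

lemma lin_on_cong: "module.subspace s X \<Longrightarrow> vector_space s \<Longrightarrow> (\<And>x. x \<in> X \<Longrightarrow> f x = g x) \<Longrightarrow> lin_on s r X g \<Longrightarrow> lin_on s r X f"
proof -
  assume a: "module.subspace s X" "vector_space s" "\<And>x. x \<in> X \<Longrightarrow> f x = g x" "lin_on s r X g"
  interpret v: vector_space s by fact
  show ?thesis using a(3,4) v.subspace_add[OF a(1)] v.subspace_scale[OF a(1)] by (auto simp: lin_on_def)
qed

lemma lin_on_span_in: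
  assumes "vector_space s" "vector_space r" "lin_on s r (module.span s G) f" "module.subspace r Y"
    and "\<And>x. x \<in> G \<Longrightarrow> f x \<in> Y" "x \<in> module.span s G"
  shows "f x \<in> Y"
proof -
  interpret v: vector_space s by fact
  interpret w: vector_space r by fact
  have "x \<in> v.span G \<and> f x \<in> Y" using assms(6)
  proof (induction rule: v.span_induct_alt)
    case base
    have "f 0 = 0" by (rule lin_on_zero[OF assms(1,2) v.subspace_span assms(3)])
    then show ?case using w.subspace_0[OF assms(4)] v.span_zero by simp
  next
    case (step c x y)
    then have "x \<in> v.span G" "y \<in> v.span G" by (auto intro: v.span_base)
    moreover from this have "v.span G = v.span G" "s c x \<in> v.span G" by (auto intro: v.span_scale)
    ultimately show ?case
      using step assms(5)[of x] lin_onD[OF assms(3)] w.subspace_add[OF assms(4)] w.subspace_scale[OF assms(4)]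
      by (simp add: v.span_add)
  qed
  then show ?thesis ..
qed

lemma tensor_lift_emb:
  assumes A: "emb s A \<iota>" and B: "emb s' B \<kappa>" and r: "vector_space r" and f: "bilin s A s' B r f"
  shows "lin_on uscale r (tensor_space (\<lambda>a b. \<iota> a \<otimes> \<kappa> b) A B) (tensor_lift (\<lambda>a b. \<iota> a \<otimes> \<kappa> b) A B f)"
    and "a \<in> A \<Longrightarrow> b \<in> B \<Longrightarrow> tensor_lift (\<lambda>a b. \<iota> a \<otimes> \<kappa> b) A B f (\<iota> a \<otimes> \<kappa> b) = f a b"
proof -
  show "lin_on uscale r (tensor_space (\<lambda>a b. \<iota> a \<otimes> \<kappa> b) A B) (tensor_lift (\<lambda>a b. \<iota> a \<otimes> \<kappa> b) A B f)"
    by (rule lin_on_cong[OF tensor_space_subspace[OF A B] vs_u _ lin_sweedler_arg[OF A B r f]])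
      (simp add: tensor_lift_def)
  show "a \<in> A \<Longrightarrow> b \<in> B \<Longrightarrow> tensor_lift (\<lambda>a b. \<iota> a \<otimes> \<kappa> b) A B f (\<iota> a \<otimes> \<kappa> b) = f a b"
    using sweedler_pure[OF A B r f] tensor_space_pure[OF A B] by (simp add: tensor_lift_def)
qed

context hd_setting
begin

text \<open>
  All axioms are linear in the module element.  A space with linear structure maps is therefore an object as soon as it is
  spanned by images of objects under structure preserving maps.
\<close>

definition premor :: "('k, 'h) hdmod \<Rightarrow> ('k, 'h) hdmod \<Rightarrow> ('k univ \<Rightarrow> 'k univ) \<Rightarrow> bool"
  where "premor V Y f \<longleftrightarrow> ulin (hdcar V) f \<and> (\<forall>v\<in>hdcar V. f v \<in> hdcar Y \<and>
    (\<forall>h. hdact Y h (f v) = f (hdact V h v)) \<and> hdcoact Y (f v) = coV V v (\<lambda>d v'. utens H d (f v')))"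

lemma hdm_generated:
  assumes fd: "fd (hdcar Y)" and act: "\<And>h. ulin (hdcar Y) (hdact Y h)"
    and coa: "ulin (hdcar Y) (hdcoact Y)" and span: "hdcar Y = uv.span G"
    and gen: "\<And>y. y \<in> G \<Longrightarrow> \<exists>V f v. hdm V \<and> v \<in> hdcar V \<and> y = f v \<and> premor V Y f"
  shows "hdm Y"
proof -
  note u = vs_u
  let ?Z = "hdcar Y"
  have eY: "emb uscale ?Z (\<lambda>v. v)" by (rule emb_id[OF fd])
  have sZ: "usub ?Z" using fd by simp
  have eqI: "f y = g y" if y: "y \<in> ?Z" and l: "ulin ?Z f" "ulin ?Z g"
    and e: "\<And>V p v. hdm V \<Longrightarrow> v \<in> hdcar V \<Longrightarrow> premor V Y p \<Longrightarrow> f (p v) = g (p v)" for f g :: "'k univ \<Rightarrow> 'k univ" and y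
  proof (rule lin_on_eq_on_span[OF u u l[unfolded span] _ y[unfolded span]])
    fix x assume "x \<in> G"
    then show "f x = g x" using gen e by blast
  qed
  have act_in: "hdact Y h y \<in> ?Z" if y: "y \<in> ?Z" for h y
  proof (rule lin_on_span_in[OF u u act[unfolded span] sZ _ y[unfolded span]])
    fix x assume "x \<in> G"
    then obtain V f v where *: "hdm V" "v \<in> hdcar V" "x = f v" "premor V Y f" using gen by blast
    then show "hdact Y h x \<in> ?Z" using hdm_facts(3)[OF *(1,2), of h] by (simp add: premor_def)
  qed
  have coact_in: "hdcoact Y y \<in> tensor_space (utens H) D ?Z" if y: "y \<in> ?Z" for y
  proof (rule lin_on_span_in[OF u u coa[unfolded span] tensor_space_subspace[OF eD eY] _ y[unfolded span]])
    fix x assume "x \<in> G"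
    then obtain V f v where *: "hdm V" "v \<in> hdcar V" "x = f v" "premor V Y f" using gen by blast
    have b: "bilin hs D uscale ?Z uscale (\<lambda>d y. 0)" by (simp add: bilin_def lin_on_def)
    show "hdcoact Y x \<in> tensor_space (utens H) D ?Z"
      by (rule co_transport(2)[OF hdm_facts(8)[OF *(1)] *(2) u eY b, of _ f]) (use * in \<open>auto simp: premor_def\<close>)
  qed
  have act_in2: "lin_on s uscale X f \<Longrightarrow> f ` X \<subseteq> ?Z \<Longrightarrow> lin_on s uscale X (\<lambda>x. hdact Y h (f x))" for s and X :: "'k univ set" and f h
    by (rule lin_comp[OF _ act])
  have coY: "lin_on uscale r ?Z (\<lambda>y. coV Y y K)"
    if "vector_space r" "bilin hs D uscale ?Z r K" for r :: "'k \<Rightarrow> 'c::ab_group_add \<Rightarrow> 'c" and K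
    by (rule lin_comp[OF coa lin_sweedler_arg[OF eD eY that]]) (use coact_in in blast)
  have tr: "coV Y (p v) K = coV V v (\<lambda>d v'. K d (p v'))"
    if "hdm V" "v \<in> hdcar V" "premor V Y p" "bilin hs D uscale ?Z uscale K" for V v p K
    by (rule co_transport(1)[OF hdm_facts(8)[OF that(1)] that(2) u eY that(4)]) (use that in \<open>auto simp: premor_def\<close>)
  have lin_h: "hlin uscale (\<lambda>h. hdact Y h y)" if y: "y \<in> ?Z" for y
  proof (rule lin_onI)
    fix g h :: 'h
    show "hdact Y (g + h) y = hdact Y g y + hdact Y h y"
    proof (rule eqI[OF y act])
      show "ulin ?Z (\<lambda>y. hdact Y g y + hdact Y h y)"
        using act[of g] act[of h] by (simp add: lin_on_def uv.scale_right_distrib add_ac)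
      fix V p v assume *: "hdm V" "v \<in> hdcar V" "premor V Y p"
      then have p: "ulin (hdcar V) p" "\<And>h. hdact Y h (p v) = p (hdact V h v)" by (auto simp: premor_def)
      show "hdact Y (g + h) (p v) = hdact Y g (p v) + hdact Y h (p v)"
        unfolding p(2) hadd[OF hdm_facts(5)[OF *(1,2)]]
        by (rule lin_onD(1)[OF p(1)]) (intro hdm_facts(3) *)+
    qed
  next
    fix c and h :: 'h
    show "hdact Y (hs c h) y = c *\<^sub>u hdact Y h y"
    proof (rule eqI[OF y act])
      show "ulin ?Z (\<lambda>y. c *\<^sub>u hdact Y h y)" by (intro gl_scale u act)
      fix V p v assume *: "hdm V" "v \<in> hdcar V" "premor V Y p"
      then have p: "ulin (hdcar V) p" "\<And>h. hdact Y h (p v) = p (hdact V h v)" by (auto simp: premor_def)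
      show "hdact Y (hs c h) (p v) = c *\<^sub>u hdact Y h (p v)"
        unfolding p(2) hscl[OF hdm_facts(5)[OF *(1,2)]]
        by (rule lin_onD(2)[OF p(1)]) (intro hdm_facts(3) *)+
    qed
  qed
  have mult: "hdact Y (g * h) y = hdact Y g (hdact Y h y)" if y: "y \<in> ?Z" for g h y
    by (rule eqI[OF y act act_in2[OF act]]) (use act_in in \<open>auto simp: premor_def hdm_facts\<close>)
  have one: "hdact Y 1 y = y" if y: "y \<in> ?Z" for y
    by (rule eqI[OF y act gl_id]) (auto simp: premor_def hdm_facts)
  let ?K1 = "\<lambda>d y. sweedler (htens H) D D (comult_R H R d) (\<lambda>a b. hemb H a \<otimes> hemb H b \<otimes> y)"
  let ?K2 = "\<lambda>d y. coV Y y (\<lambda>e w. hemb H d \<otimes> hemb H e \<otimes> w)"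
  have hb: "hbil uscale (\<lambda>a b. hemb H a \<otimes> hemb H b \<otimes> y)" for y by (intro hl)
  have K1: "bilin hs D uscale ?Z uscale ?K1"
  proof (rule bilinI)
    show "lin_on hs uscale D (\<lambda>d. ?K1 d y)" for y
      by (rule lin_on_cong[OF D_facts(1) vs sweedler_DD[OF u hb]], assumption,
          rule lin_on_subset[OF hl_copR[OF u hl_id hb]]) simp
    show "ulin ?Z (\<lambda>y. ?K1 d y)" for d by (intro lin_on_sweedler gl u)
  qed
  have K2b: "bilin hs D uscale ?Z uscale (\<lambda>e w. hemb H d \<otimes> hemb H e \<otimes> w)" for d
    by (rule cbil_bilin, intro cbilI hl gl)
  have K2: "bilin hs D uscale ?Z uscale ?K2"
  proof (rule bilinI)
    show "lin_on hs uscale D (\<lambda>d. ?K2 d y)" for y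
      by (rule lin_on_subset[of _ _ UNIV], intro hl) simp
    show "ulin ?Z (\<lambda>y. ?K2 d y)" for d by (rule coY[OF u K2b])
  qed
  have coassoc: "coV Y y ?K1 = coV Y y ?K2" if y: "y \<in> ?Z" for y
  proof (rule eqI[OF y coY[OF u K1] coY[OF u K2]])
    fix V p v assume *: "hdm V" "v \<in> hdcar V" "premor V Y p"
    note C = hdm_facts(8)[OF *(1)]
    have p: "ulin (hdcar V) p" using *(3) by (simp add: premor_def)
    have "coV Y (p v) ?K1 = coV V v (\<lambda>d v'. ?K1 d (p v'))" by (rule tr[OF * K1])
    also have "\<dots> = coV V v (\<lambda>d v'. copR d (\<lambda>a b. hemb H a \<otimes> hemb H b \<otimes> p v'))"
      by (rule co_cong[OF C *(2)]) (rule sweedler_DD[OF u hb])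
    also have "\<dots> = coV V v (\<lambda>d v'. coV V v' (\<lambda>e w. hemb H d \<otimes> hemb H e \<otimes> p w))"
      by (rule co_coassoc[OF C u *(2)]) (intro hl gl p)+
    also have "\<dots> = coV V v (\<lambda>d v'. ?K2 d (p v'))"
      by (rule co_cong[OF C *(2)]) (rule tr[OF *(1) _ *(3) K2b, symmetric])
    also have "\<dots> = coV Y (p v) ?K2" by (rule tr[OF * K2, symmetric])
    finally show "coV Y (p v) ?K1 = coV Y (p v) ?K2" .
  qed
  have Ke: "bilin hs D uscale ?Z uscale (\<lambda>d w. \<epsilon> d *\<^sub>u w)" by (rule cbil_bilin, intro cbilI hl gl)
  have counit: "coV Y y (\<lambda>d w. \<epsilon> d *\<^sub>u w) = y" if y: "y \<in> ?Z" for y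
  proof (rule eqI[OF y coY[OF u Ke] gl_id])
    fix V p v assume *: "hdm V" "v \<in> hdcar V" "premor V Y p"
    show "coV Y (p v) (\<lambda>d w. \<epsilon> d *\<^sub>u w) = p v"
      unfolding tr[OF * Ke] by (rule co_counit[OF hdm_facts(8)[OF *(1)] u *(2)]) (use * in \<open>simp add: premor_def\<close>)
  qed
  have Kc: "bilin hs D uscale ?Z uscale (\<lambda>d v'. utens H (adj g d) (hdact Y h v'))" for g h
    by (rule cbil_bilin, intro cbilI hl hl_ad gl act)
  have compat: "hdcoact Y (hdact Y h y) = cop h (\<lambda>h1 h2. coV Y y (\<lambda>d v'. utens H (adj h1 d) (hdact Y h2 v')))"
    if y: "y \<in> ?Z" for h y
  proof (rule eqI[OF y])
    show "ulin ?Z (\<lambda>y. hdcoact Y (hdact Y h y))"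
      by (rule lin_comp[OF act coa]) (use act_in in blast)
    show "ulin ?Z (\<lambda>y. cop h (\<lambda>h1 h2. coV Y y (\<lambda>d v'. utens H (adj h1 d) (hdact Y h2 v'))))"
      by (intro lin_on_sweedler coY u Kc)
    fix V p v assume *: "hdm V" "v \<in> hdcar V" "premor V Y p"
    note C = hdm_facts(8)[OF *(1)]
    have p: "ulin (hdcar V) p" and pa: "\<And>v h. v \<in> hdcar V \<Longrightarrow> hdact Y h (p v) = p (hdact V h v)"
      and pc: "\<And>v. v \<in> hdcar V \<Longrightarrow> hdcoact Y (p v) = coV V v (\<lambda>d v'. utens H d (p v'))" using *(3) by (auto simp: premor_def)
    have "hdcoact Y (hdact Y h (p v)) = coV V (hdact V h v) (\<lambda>d v'. utens H d (p v'))"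
      unfolding pa[OF *(2)] by (rule pc[OF hdm_facts(3)[OF *(1,2)]])
    also have "\<dots> = cop h (\<lambda>h1 h2. coV V v (\<lambda>d v'. utens H (adj h1 d) (p (hdact V h2 v'))))"
      by (rule co_act[OF *(1) u _ *(2)]) (intro cbilI hl gl p)
    also have "\<dots> = cop h (\<lambda>h1 h2. coV Y (p v) (\<lambda>d v'. utens H (adj h1 d) (hdact Y h2 v')))"
      unfolding tr[OF * Kc] by (rule sweedler_ext, rule co_cong[OF C *(2)]) (simp add: pa)
    finally show "hdcoact Y (hdact Y h (p v)) =
      cop h (\<lambda>h1 h2. coV Y (p v) (\<lambda>d v'. utens H (adj h1 d) (hdact Y h2 v')))" .
  qed
  show ?thesis
    unfolding hd_module_def left_module_def left_comodule_def
    using fd act_in act lin_h mult one coa coact_in coassoc counit compat by blast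
qed

lemma hd_tensor_pure:
  assumes X: "fd X" and V: "hdm V"
  shows "hdcar (hd_tensor H D X V) = tensor_sp X (hdcar V)"
    and "ulin (tensor_sp X (hdcar V)) (hdact (hd_tensor H D X V) h)"
    and "ulin (tensor_sp X (hdcar V)) (hdcoact (hd_tensor H D X V))"
    and "x \<in> X \<Longrightarrow> v \<in> hdcar V \<Longrightarrow> hdact (hd_tensor H D X V) h (x \<otimes> v) = x \<otimes> hdact V h v"
    and "x \<in> X \<Longrightarrow> v \<in> hdcar V \<Longrightarrow> hdcoact (hd_tensor H D X V) (x \<otimes> v) = coV V v (\<lambda>d v'. utens H d (x \<otimes> v'))"
proof -
  note u = vs_u and e = emb_id[OF X] emb_id[OF hdm_facts(1)[OF V]]
  have b1: "ubilin X (hdcar V) (\<lambda>x v. x \<otimes> hdact V h v)" for h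
    by (intro bilinI gl hdm_facts(4)[OF V])
  have b2: "ubilin X (hdcar V) (\<lambda>x v. coV V v (\<lambda>d v'. utens H d (x \<otimes> v')))"
  proof (rule bilinI)
    show "ulin X (\<lambda>x. coV V v (\<lambda>d v'. utens H d (x \<otimes> v')))" for v by (intro lin_on_sweedler gl u)
    show "ulin (hdcar V) (\<lambda>v. coV V v (\<lambda>d v'. utens H d (x \<otimes> v')))" for x
      by (rule co_lin[OF hdm_facts(8)[OF V] u]) (intro cbilI hl gl)
  qed
  show "hdcar (hd_tensor H D X V) = tensor_sp X (hdcar V)" by (simp add: hd_tensor_def)
  show "ulin (tensor_sp X (hdcar V)) (hdact (hd_tensor H D X V) h)"
    using tensor_lift_emb(1)[OF e u b1] by (simp add: hd_tensor_def)
  show "ulin (tensor_sp X (hdcar V)) (hdcoact (hd_tensor H D X V))"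
    using tensor_lift_emb(1)[OF e u b2] by (simp add: hd_tensor_def)
  show "x \<in> X \<Longrightarrow> v \<in> hdcar V \<Longrightarrow> hdact (hd_tensor H D X V) h (x \<otimes> v) = x \<otimes> hdact V h v"
    using tensor_lift_emb(2)[OF e u b1] by (simp add: hd_tensor_def)
  show "x \<in> X \<Longrightarrow> v \<in> hdcar V \<Longrightarrow> hdcoact (hd_tensor H D X V) (x \<otimes> v) = coV V v (\<lambda>d v'. utens H d (x \<otimes> v'))"
    using tensor_lift_emb(2)[OF e u b2] by (simp add: hd_tensor_def)
qed

lemma hdm_hd_tensor:
  assumes X: "fd X" and V: "hdm V"
  shows "hdm (hd_tensor H D X V)"
proof (rule hdm_generated)
  note t = hd_tensor_pure[OF X V]
  show "fd (hdcar (hd_tensor H D X V))" unfolding t(1) by (rule fin_dim_tensor_sp[OF X hdm_facts(1)[OF V]])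
  show "hdcar (hd_tensor H D X V) = uv.span {x \<otimes> v |x v. x \<in> X \<and> v \<in> hdcar V}"
    unfolding t(1) by (rule tensor_sp_span)
  show "ulin (hdcar (hd_tensor H D X V)) (hdact (hd_tensor H D X V) h)" for h
    unfolding t(1) by (rule t)
  show "ulin (hdcar (hd_tensor H D X V)) (hdcoact (hd_tensor H D X V))"
    unfolding t(1) by (rule t)
  fix y assume "y \<in> {x \<otimes> v |x v. x \<in> X \<and> v \<in> hdcar V}"
  then obtain x v where xv: "y = x \<otimes> v" "x \<in> X" "v \<in> hdcar V" by blast
  have "premor V (hd_tensor H D X V) (\<lambda>v. x \<otimes> v)"
    unfolding premor_def t(1) using xv(2) t(4,5) by (auto intro!: gl)
  then show "\<exists>V' f v. hdm V' \<and> v \<in> hdcar V' \<and> y = f v \<and> premor V' (hd_tensor H D X V) f"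
    using xv V by blast
qed

lemma op_category_HD:
  "op_category {V. hdm V} hdcar UNIV hdop (hd_hom H D) (hd_tensor H D)"
proof (unfold_locales, goal_cases)
  case (1 U) then show ?case by (simp add: hdm_facts)
next
  case (2 U j u) then show ?case by (simp add: hdop_in)
next
  case (3 U j) then show ?case by (simp add: hdop_lin)
next
  case (4 U V) then show ?case using hom_ops[of U V] by simp
next
  case (5 X U) then show ?case by (simp add: hdm_hd_tensor)
next
  case (6 X U) show ?case by (simp add: hd_tensor_def)
next
  case (7 X U j x u)
  then have U: "hdm U" and X: "fd X" by auto
  show ?case
  proof (cases j)
    case (Inl h) then show ?thesis using 7 hd_tensor_pure(4)[OF X U] by simp
  next
    case (Inr i)
    have "row i (hdcoact (hd_tensor H D X U) (x \<otimes> u)) = coV U u (\<lambda>d v'. hemb H d i *\<^sub>u (x \<otimes> v'))"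
      unfolding hd_tensor_pure(5)[OF X U 7(4,5)] by (simp add: sweedler_lin[OF vs_u vs_u lin_row])
    also have "\<dots> = x \<otimes> coV U u (\<lambda>d v'. hemb H d i *\<^sub>u v')"
      by (simp only: sweedler_lin[OF vs_u vs_u lin_kron(2)] kron_right(2))
    finally show ?thesis using row_co(1)[OF U 7(5)] by (simp add: Inr)
  qed
qed

text \<open>
  The coefficients of a nonzero object span an adjoint-stable subcoalgebra, hence all of \<open>D\<close> by minimality.
\<close>

lemma coefficients_span:
  assumes V: "hdm V" and nz: "hdcar V \<noteq> {0}"
  shows "D = hv.span {coV V v (\<lambda>d v'. hs (\<psi> v') d) |v \<psi>. v \<in> hdcar V \<and> lin_on uscale (*) (hdcar V) \<psi>}" (is "D = hv.span ?G")
proof -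
  note u = vs_u and C = hdm_facts(8)[OF V]
  let ?C = "hv.span ?G"
  have G: "coV V v (\<lambda>d v'. hs (\<psi> v') d) \<in> ?C" if "v \<in> hdcar V" "lin_on uscale (*) (hdcar V) \<psi>" for v \<psi>
    by (rule hv.span_base) (use that in blast)
  have "?G \<subseteq> D"
    using D_facts(1) by (auto intro!: co_in[OF C vs] hv.subspace_scale)
  then have CD: "?C \<subseteq> D" by (rule hv.span_minimal[OF _ D_facts(1)])
  have ad: "adj h c \<in> ?C" if c: "c \<in> ?C" for h c
  proof (rule lin_on_span_in[OF vs vs _ hv.subspace_span _ c])
    show "lin_on hs hs ?C (adj h)" by (rule lin_on_subset[OF hl_ad(2)[OF hl_id]]) simp
    fix x assume "x \<in> ?G"
    then obtain v \<psi> where x: "x = coV V v (\<lambda>d v'. hs (\<psi> v') d)" "v \<in> hdcar V" "lin_on uscale (*) (hdcar V) \<psi>" by blast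
    let ?\<psi> = "\<lambda>y v'. \<psi> (hdact V (S' y) v')"
    have \<psi>l: "lin_on uscale (*) (hdcar V) (?\<psi> y)" for y
      by (rule lin_comp[OF hdm_facts(4)[OF V] x(3)]) (use hdm_facts(3)[OF V] in blast)
    have \<psi>h: "v' \<in> hdcar V \<Longrightarrow> hlin (*) (\<lambda>b. \<psi> (hdact V b v'))" for v'
      by (rule lin_comp[OF hdm_facts(5)[OF V] x(3)]) (use hdm_facts(3)[OF V] in auto)
    have "cop h (\<lambda>z y. coV V (hdact V z v) (\<lambda>d v'. hs (?\<psi> y v') d)) =
        cop h (\<lambda>z y. cop z (\<lambda>a b. coV V v (\<lambda>d v'. hs (\<psi> (hdact V (S' y * b) v')) (adj a d))))"
    proof (rule sweedler_ext)
      fix z y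
      have "coV V (hdact V z v) (\<lambda>d v'. hs (?\<psi> y v') d) = cop z (\<lambda>a b. coV V v (\<lambda>d v'. hs (?\<psi> y (hdact V b v')) (adj a d)))"
        by (rule co_act[OF V vs _ x(2)]) (intro cbilI hl gl_scale vs \<psi>l)
      also have "\<dots> = cop z (\<lambda>a b. coV V v (\<lambda>d v'. hs (\<psi> (hdact V (S' y * b) v')) (adj a d)))"
        by (rule sweedler_ext, rule co_cong[OF C x(2)]) (simp add: hdm_facts(6)[OF V])
      finally show "coV V (hdact V z v) (\<lambda>d v'. hs (?\<psi> y v') d) =
          cop z (\<lambda>a b. coV V v (\<lambda>d v'. hs (\<psi> (hdact V (S' y * b) v')) (adj a d)))" .
    qed
    also have "\<dots> = coV V v (\<lambda>d v'. cop h (\<lambda>z y. cop z (\<lambda>a b. hs (\<psi> (hdact V (S' y * b) v')) (adj a d))))"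
      by (subst sweedler_swap[of "utens H" D "hdcar V" "hdcoact V v"], rule sweedler_ext, rule sweedler_swap)
    also have "\<dots> = coV V v (\<lambda>d v'. hs (\<psi> v') (adj h d))"
    proof (rule co_cong[OF C x(2)])
      fix d v' assume v': "v' \<in> hdcar V"
      note p = hl_comp[OF \<psi>h[OF v']]
      have "cop h (\<lambda>z y. cop z (\<lambda>a b. hs (\<psi> (hdact V (S' y * b) v')) (adj a d))) =
          cop h (\<lambda>a w. cop w (\<lambda>b y. hs (\<psi> (hdact V (S' y * b) v')) (adj a d)))"
        by (rule cop_coassoc[OF vs]) (intro hl hl_ad hl_S' p)+
      also have "\<dots> = cop h (\<lambda>a w. hs (\<epsilon> w) (hs (\<psi> (hdact V 1 v')) (adj a d)))"
        by (subst cop_S'(2)[OF vs, where f = "\<lambda>z. hs (\<psi> (hdact V z v')) (adj a d)" for a]) (intro hl p | rule refl)+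
      also have "\<dots> = hs (\<psi> (hdact V 1 v')) (adj h d)" by (rule cop_counit(2)[OF vs]) (intro hl hl_ad)
      finally show "cop h (\<lambda>z y. cop z (\<lambda>a b. hs (\<psi> (hdact V (S' y * b) v')) (adj a d))) = hs (\<psi> v') (adj h d)"
        by (simp add: hdm_facts(7)[OF V v'])
    qed
    also have "\<dots> = adj h x"
      unfolding x(1) by (simp only: cop_lin[OF vs hl_ad(2)[OF hl_id]] hscl[OF hl_ad(2)[OF hl_id]])
    finally have "adj h x = cop h (\<lambda>z y. coV V (hdact V z v) (\<lambda>d v'. hs (?\<psi> y v') d))" ..
    also have "\<dots> \<in> ?C"
      by (rule sweedler_in[OF embH embH vs hv.subspace_span hopf_unfold(4)]) (rule G[OF hdm_facts(3)[OF V x(2)] \<psi>l])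
    finally show "adj h x \<in> ?C" .
  qed
  have hC: "fd (hemb H ` ?C)" by (rule fd_emb) simp
  have hCs: "usub (hemb H ` ?C)" using hC by simp
  note el = embD(4)[OF embH]
  have cl: "hlin uscale (comult_R H R)"
    unfolding comult_R_def by (intro hl_cop hl hl_ad)
  have sub: "comult_R H R c \<in> tensor_space (htens H) ?C ?C" if c: "c \<in> ?C" for c
    unfolding tensor_space_emb
  proof (rule lin_on_span_in[OF vs u _ tensor_sp_subspace _ c])
    show "lin_on hs uscale ?C (comult_R H R)" by (rule lin_on_subset[OF cl]) simp
    fix x assume "x \<in> ?G"
    then obtain v \<psi> where x: "x = coV V v (\<lambda>d v'. hs (\<psi> v') d)" "v \<in> hdcar V" "lin_on uscale (*) (hdcar V) \<psi>" by blast
    have "comult_R H R x = coV V v (\<lambda>d v'. \<psi> v' *\<^sub>u comult_R H R d)"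
      unfolding x(1) by (simp only: cop_lin[OF u cl] hscl[OF cl])
    also have "\<dots> = coV V v (\<lambda>d v'. copR d (\<lambda>a b. \<psi> v' *\<^sub>u htens H a b))"
      unfolding comult_R_def by (simp only: cop_lin_s[OF u])
    also have "\<dots> = coV V v (\<lambda>d v'. coV V v' (\<lambda>e w. \<psi> w *\<^sub>u htens H d e))"
      by (rule co_coassoc[OF C u x(2)]) (intro hl gl_scale u x(3))+
    finally have eq: "comult_R H R x = coV V v (\<lambda>d v'. coV V v' (\<lambda>e w. \<psi> w *\<^sub>u htens H d e))" .
    show "comult_R H R x \<in> tensor_sp (hemb H ` ?C) (hemb H ` ?C)"
    proof (rule tensor_sp_rows_cols[OF hC hC])
      show "row i (comult_R H R x) \<in> hemb H ` ?C" for i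
      proof -
        have "row i (comult_R H R x) = coV V v (\<lambda>d v'. hemb H d i *\<^sub>u hemb H (coV V v' (\<lambda>e w. hs (\<psi> w) e)))"
          unfolding eq
          by (simp add: sweedler_lin[OF u u lin_row] lin_onD(2)[OF lin_row] cop_lin[OF u el] hscl[OF el] cop_lin_s[OF u] mult.commute)
        also have "\<dots> \<in> hemb H ` ?C"
          by (rule co_in[OF C u hCs x(2)], rule uv.subspace_scale[OF hCs], rule imageI, rule G[OF _ x(3)])
        finally show ?thesis .
      qed
      show "col j (comult_R H R x) \<in> hemb H ` ?C" for j
      proof -
        let ?p = "\<lambda>v'. coV V v' (\<lambda>e w. \<psi> w * hemb H e j)"
        have ej: "hlin (*) (\<lambda>e. hemb H e j)" using el by (simp add: lin_on_def)
        have p: "lin_on uscale (*) (hdcar V) ?p"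
          by (rule co_lin[OF C vs_k]) (intro cbilI hl_kmult ej gl_kmult x(3))
        have "col j (comult_R H R x) = coV V v (\<lambda>d v'. ?p v' *\<^sub>u hemb H d)"
        proof -
          have l: "lin (*) uscale (\<lambda>c. c *\<^sub>u hemb H d)" for d by (simp add: lin_on_def uv.scale_left_distrib)
          show ?thesis unfolding eq
            by (simp add: sweedler_lin[OF u u lin_col] lin_onD(2)[OF lin_col] sweedler_lin[OF vs_k u l])
        qed
        also have "\<dots> = hemb H (coV V v (\<lambda>d v'. hs (?p v') d))" by (simp add: cop_lin[OF u el] hscl[OF el])
        also have "\<dots> \<in> hemb H ` ?C" by (rule imageI, rule G[OF x(2) p])
        finally show ?thesis .
      qed
    qed
  qed
  have "?C \<noteq> {0}"
  proof
    assume C0: "?C = {0}"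
    obtain v where v: "v \<in> hdcar V" "v \<noteq> 0" using nz uv.subspace_0[OF hdm_facts(2)[OF V]] by blast
    have "v i = 0" for i
    proof -
      have l: "lin_on uscale (*) (hdcar V) (\<lambda>v. v i)" by (simp add: lin_on_def)
      have "v i = coV V v (\<lambda>d v'. \<epsilon> d * v' i)" by (rule co_counit[OF C vs_k v(1) l, symmetric])
      also have "\<dots> = \<epsilon> (coV V v (\<lambda>d v'. hs (v' i) d))"
        by (simp add: cop_lin[OF vs_k hopf_unfold(5)] hscl[OF hopf_unfold(5)] mult.commute)
      also have "coV V v (\<lambda>d v'. hs (v' i) d) = 0" using G[OF v(1) l] C0 by simp
      finally show ?thesis using lin_zero[OF vs vs_k hopf_unfold(5)] by simp
    qed
    then show False using v(2) by (simp add: fun_eq_iff)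
  qed
  then have "adjoint_stable_subcoalgebra H R ?C"
    using ad sub by (simp add: adjoint_stable_subcoalgebra_def subcoalgebra_def)
  then show ?thesis using D_facts(5) CD by blast
qed

end

section \<open>The free object and the generator property\<close>

lemma hl_kmult_id: "lin (*) (*) (\<lambda>x. x * (c::'k::field))" "lin (*) (*) (\<lambda>x. (c::'k::field) * x)"
  by (auto simp: lin_on_def algebra_simps)

lemma sweedler_sum_pairs:
  "sweedler \<tau> A B t (\<lambda>a b. \<Sum>(c, d)\<leftarrow>xs. f a b c d :: 'c::comm_monoid_add) = (\<Sum>(c, d)\<leftarrow>xs. sweedler \<tau> A B t (\<lambda>a b. f a b c d))"
  by (induction xs) (auto simp: sweedler_zero sweedler_add)

locale hd_free = hd_setting H R lam Lam D for H :: "('k::field, 'h::ring_1) hopf" and R lam Lam D +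
  fixes W :: "('k, 'w::ab_group_add) comod"
  assumes W: "fin_dim_left_comodule H R D W" and W0: "\<exists>w::'w. w \<noteq> 0"
begin

abbreviation "ws \<equiv> wscale W"
abbreviation "\<tau> \<equiv> dtens H (wemb W)"
abbreviation "P \<equiv> free_hd H D W"
abbreviation coW :: "'w \<Rightarrow> ('h \<Rightarrow> 'w \<Rightarrow> 'c::comm_monoid_add) \<Rightarrow> 'c" where "coW w f \<equiv> co (wemb W) UNIV (wcoact W) w f"

lemma CW: "comod ws UNIV (wemb W) (wcoact W)"
  using W emb_embed by (auto simp: fin_dim_left_comodule_def comod_def)

lemmas eW = co_emb[OF CW] and vsW = embD(1)[OF co_emb[OF CW]]

lemma gl_wemb: "lin_on ws uscale UNIV (\<lambda>w. wemb W w)"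
  by (rule embD(4)[OF eW])

lemma P_car: "hdcar P = tensor_space \<tau> UNIV UNIV"
  by (simp add: free_hd_def Let_def)

lemma P_span: "hdcar P = uv.span {\<tau> h w |h w. True}"
  unfolding P_car tensor_space_def by (rule arg_cong[where f = "uv.span"]) blast

lemma P_sub: "usub (hdcar P)"
  unfolding P_span by simp

lemma \<tau>_in: "\<tau> h w \<in> hdcar P"
  unfolding P_car by (rule tensor_space_pure[OF embH eW]) auto

lemma P_fd: "fd (hdcar P)"
  unfolding P_car by (rule fin_dim_tensor_space[OF embH eW])

lemma eP: "emb uscale (hdcar P) (\<lambda>v. v)"
  by (rule emb_id[OF P_fd])

lemma P_act_bilin: "bilin hs UNIV ws UNIV uscale (\<lambda>h w. \<tau> (g * h) w)"
  by (rule bilinI) (intro hl gl gl_wemb)+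

lemma P_co_cbil: "cbil ws UNIV uscale (\<lambda>d w'. utens H (adj g d) (\<tau> h w'))"
  by (intro cbilI hl hl_ad gl gl_wemb)

lemma P_co_bilin: "bilin hs UNIV ws UNIV uscale (\<lambda>h w. cop h (\<lambda>h1 h2. coW w (\<lambda>d w'. utens H (adj h1 d) (\<tau> h2 w'))))"
proof (rule bilinI)
  show "hlin uscale (\<lambda>h. cop h (\<lambda>h1 h2. coW w (\<lambda>d w'. utens H (adj h1 d) (\<tau> h2 w'))))" for w by (intro hl hl_ad)
  show "lin_on ws uscale UNIV (\<lambda>w. cop h (\<lambda>h1 h2. coW w (\<lambda>d w'. utens H (adj h1 d) (\<tau> h2 w'))))" for h
    by (intro lin_on_sweedler co_lin[OF CW] vs_u P_co_cbil)
qed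

lemma P_struct:
  "ulin (hdcar P) (hdact P g)" "hdact P g (\<tau> h w) = \<tau> (g * h) w"
  "ulin (hdcar P) (hdcoact P)"
  "hdcoact P (\<tau> h w) = cop h (\<lambda>h1 h2. coW w (\<lambda>d w'. utens H (adj h1 d) (\<tau> h2 w')))"
  using tensor_lift_emb[OF embH eW vs_u P_act_bilin] tensor_lift_emb[OF embH eW vs_u P_co_bilin]
  unfolding P_car by (simp_all add: free_hd_def Let_def)

lemma P_eqI:
  assumes "t \<in> hdcar P" "lin_on uscale r (hdcar P) f" "lin_on uscale r (hdcar P) g" "vector_space r"
    and "\<And>h w. f (\<tau> h w) = g (\<tau> h w)"
  shows "f t = g t"
  using assms lin_on_eq_on_span[OF vs_u assms(4), of "{\<tau> h w |h w. True}" f g t]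
  unfolding P_span by blast

lemma P_in:
  assumes "t \<in> hdcar P" "ulin (hdcar P) f" "usub Y" "\<And>h w. f (\<tau> h w) \<in> Y"
  shows "f t \<in> Y"
proof -
  have l: "ulin (uv.span {\<tau> h w |h w. True}) f" using assms(2) unfolding P_span .
  have t: "t \<in> uv.span {\<tau> h w |h w. True}" using assms(1) unfolding P_span .
  show ?thesis by (rule lin_on_span_in[OF vs_u vs_u l assms(3) _ t]) (use assms(4) in blast)
qed

lemma P_act_in: "t \<in> hdcar P \<Longrightarrow> hdact P g t \<in> hdcar P"
  by (rule P_in[OF _ P_struct(1) P_sub]) (simp_all add: P_struct \<tau>_in)

lemma P_coact_in: "t \<in> hdcar P \<Longrightarrow> hdcoact P t \<in> tensor_space (utens H) D (hdcar P)"
proof (rule P_in[OF _ P_struct(3) tensor_space_subspace[OF eD eP]], assumption)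
  fix h w
  have m: "utens H (adj h1 d) (\<tau> h2 w') \<in> tensor_space (utens H) D (hdcar P)" if "d \<in> D" for h1 h2 d w'
    by (rule tensor_space_pure[OF eD eP D_facts(3)[OF that] \<tau>_in])
  show "hdcoact P (\<tau> h w) \<in> tensor_space (utens H) D (hdcar P)"
    unfolding P_struct
    by (rule sweedler_in[OF embH embH vs_u tensor_space_subspace[OF eD eP] hopf_unfold(4)],
        rule co_in[OF CW vs_u tensor_space_subspace[OF eD eP] UNIV_I], rule m)
qed

lemma co_P_pure:
  assumes r: "vector_space r" and K: "bilin hs D uscale (hdcar P) r K"
  shows "coV P (\<tau> h w) K = cop h (\<lambda>h1 h2. coW w (\<lambda>d w'. K (adj h1 d) (\<tau> h2 w')))"
proof -
  obtain F where F: "lin uscale r F" "\<And>a b. a \<in> D \<Longrightarrow> b \<in> hdcar P \<Longrightarrow> F (utens H a b) = K a b"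
    "\<And>t. t \<in> tensor_space (utens H) D (hdcar P) \<Longrightarrow> sweedler (utens H) D (hdcar P) t K = F t"
    by (rule sweedler_extends[OF eD eP r K]) blast
  have "coV P (\<tau> h w) K = F (hdcoact P (\<tau> h w))" by (rule F(3)[OF P_coact_in[OF \<tau>_in]])
  also have "\<dots> = cop h (\<lambda>h1 h2. coW w (\<lambda>d w'. F (utens H (adj h1 d) (\<tau> h2 w'))))"
    unfolding P_struct by (simp only: sweedler_lin[OF vs_u r F(1)])
  also have "\<dots> = cop h (\<lambda>h1 h2. coW w (\<lambda>d w'. K (adj h1 d) (\<tau> h2 w')))"
    by (rule sweedler_ext, rule co_cong[OF CW UNIV_I], rule F(2)[OF D_facts(3) \<tau>_in])
  finally show ?thesis .
qed

lemma co_P_lin: "vector_space r \<Longrightarrow> bilin hs D uscale (hdcar P) r K \<Longrightarrow> lin_on uscale r (hdcar P) (\<lambda>t. coV P t K)"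
  by (rule lin_comp[OF P_struct(3) lin_sweedler_arg[OF eD eP]]) (assumption | rule image_subsetI P_coact_in)+

lemma hl_\<tau>: "hlin hs f \<Longrightarrow> hlin uscale (\<lambda>x. \<tau> (f x) w)"
  by (intro hl)

lemma hdm_P: "hdm P"
proof -
  note u = vs_u
  let ?Z = "hdcar P"
  have lin_h: "hlin uscale (\<lambda>h. hdact P h t)" if t: "t \<in> ?Z" for t
  proof (rule lin_onI)
    show "hdact P (g + h) t = hdact P g t + hdact P h t" for g h
    proof (rule P_eqI[OF t P_struct(1) _ u])
      show "ulin ?Z (\<lambda>y. hdact P g y + hdact P h y)"
        using P_struct(1)[of g] P_struct(1)[of h] by (simp add: lin_on_def uv.scale_right_distrib add_ac)
    qed (simp only: P_struct(2) distrib_right hadd[OF hl_\<tau>[OF hl_id]])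
    show "hdact P (hs c h) t = c *\<^sub>u hdact P h t" for c h
      by (rule P_eqI[OF t P_struct(1) _ u]) (intro gl_scale u P_struct(1), simp only: P_struct(2) mult_scale hscl[OF hl_\<tau>[OF hl_id]])
  qed
  have mult: "hdact P (g * h) t = hdact P g (hdact P h t)" if t: "t \<in> ?Z" for g h t
    by (rule P_eqI[OF t P_struct(1) lin_comp[OF P_struct(1) P_struct(1)] u])
      (auto simp: P_act_in P_struct(2) mult.assoc)
  have one: "hdact P 1 t = t" if t: "t \<in> ?Z" for t
    by (rule P_eqI[OF t P_struct(1) gl_id u]) (simp add: P_struct(2))
  let ?K1 = "\<lambda>d y. sweedler (htens H) D D (comult_R H R d) (\<lambda>a b. hemb H a \<otimes> hemb H b \<otimes> y)"
  let ?K2 = "\<lambda>d y. coV P y (\<lambda>e w. hemb H d \<otimes> hemb H e \<otimes> w)"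
  have hb: "hbil uscale (\<lambda>a b. hemb H a \<otimes> hemb H b \<otimes> y)" for y by (intro hl)
  have K1: "bilin hs D uscale ?Z uscale ?K1"
  proof (rule bilinI)
    show "lin_on hs uscale D (\<lambda>d. ?K1 d y)" for y
      by (rule lin_on_cong[OF D_facts(1) vs sweedler_DD[OF u hb]], assumption,
          rule lin_on_subset[OF hl_copR[OF u hl_id hb]]) simp
    show "ulin ?Z (\<lambda>y. ?K1 d y)" for d by (intro lin_on_sweedler gl u)
  qed
  have K2b: "bilin hs D uscale ?Z uscale (\<lambda>e w. hemb H d \<otimes> hemb H e \<otimes> w)" for d
    by (rule cbil_bilin, intro cbilI hl gl)
  have K2: "bilin hs D uscale ?Z uscale ?K2"
  proof (rule bilinI)
    show "lin_on hs uscale D (\<lambda>d. ?K2 d y)" for y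
      by (rule lin_on_subset[of _ _ UNIV], intro hl) simp
    show "ulin ?Z (\<lambda>y. ?K2 d y)" for d by (rule co_P_lin[OF u K2b])
  qed
  let ?M = "\<lambda>x d y e z w. hemb H (adj x d) \<otimes> hemb H (adj y e) \<otimes> \<tau> z w"
  have coassoc: "coV P t ?K1 = coV P t ?K2" if t: "t \<in> ?Z" for t
  proof (rule P_eqI[OF t co_P_lin[OF u K1] co_P_lin[OF u K2] u])
    fix h w
    have "coV P (\<tau> h w) ?K1 = cop h (\<lambda>h1 h2. coW w (\<lambda>d w'. ?K1 (adj h1 d) (\<tau> h2 w')))" by (rule co_P_pure[OF u K1])
    also have "\<dots> = cop h (\<lambda>h1 h2. coW w (\<lambda>d w'. cop h1 (\<lambda>x y. copR d (\<lambda>a b. ?M x a y b h2 w'))))"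
    proof (rule sweedler_ext, rule co_cong[OF CW UNIV_I])
      fix h1 h2 d w' assume "d \<in> D"
      then show "?K1 (adj h1 d) (\<tau> h2 w') = cop h1 (\<lambda>x y. copR d (\<lambda>a b. ?M x a y b h2 w'))"
        using sweedler_DD[OF u hb D_facts(3)] copR_ad[OF u hb] by simp
    qed
    also have "\<dots> = cop h (\<lambda>h1 h2. cop h1 (\<lambda>x y. coW w (\<lambda>d w'. copR d (\<lambda>a b. ?M x a y b h2 w'))))"
      by (rule sweedler_ext, rule sweedler_swap)
    also have "\<dots> = cop h (\<lambda>h1 h2. cop h1 (\<lambda>x y. coW w (\<lambda>d w'. coW w' (\<lambda>e w''. ?M x d y e h2 w''))))"
      by (rule sweedler_ext, rule sweedler_ext, rule co_coassoc[OF CW u UNIV_I]) (intro hl hl_ad gl gl_wemb)+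
    also have "\<dots> = cop h (\<lambda>x z. cop z (\<lambda>y h2. coW w (\<lambda>d w'. coW w' (\<lambda>e w''. ?M x d y e h2 w''))))"
      by (rule cop_coassoc[OF u]) (intro hl hl_ad)+
    also have "\<dots> = cop h (\<lambda>h1 h2. coW w (\<lambda>d w'. cop h2 (\<lambda>y z. coW w' (\<lambda>e w''. ?M h1 d y e z w''))))"
      by (rule sweedler_ext, rule sweedler_swap)
    also have "\<dots> = cop h (\<lambda>h1 h2. coW w (\<lambda>d w'. ?K2 (adj h1 d) (\<tau> h2 w')))"
      by (simp only: co_P_pure[OF u K2b])
    also have "\<dots> = coV P (\<tau> h w) ?K2" by (rule co_P_pure[OF u K2, symmetric])
    finally show "coV P (\<tau> h w) ?K1 = coV P (\<tau> h w) ?K2" .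
  qed
  have Ke: "bilin hs D uscale ?Z uscale (\<lambda>d w. \<epsilon> d *\<^sub>u w)" by (rule cbil_bilin, intro cbilI hl gl)
  have counit: "coV P t (\<lambda>d w. \<epsilon> d *\<^sub>u w) = t" if t: "t \<in> ?Z" for t
  proof (rule P_eqI[OF t co_P_lin[OF u Ke] gl_id u])
    fix h w
    have "coV P (\<tau> h w) (\<lambda>d w. \<epsilon> d *\<^sub>u w) = cop h (\<lambda>h1 h2. coW w (\<lambda>d w'. \<epsilon> h1 *\<^sub>u (\<epsilon> d *\<^sub>u \<tau> h2 w')))"
      unfolding co_P_pure[OF u Ke] by (simp add: eps_ad)
    also have "\<dots> = cop h (\<lambda>h1 h2. \<epsilon> h1 *\<^sub>u coW w (\<lambda>d w'. \<epsilon> d *\<^sub>u \<tau> h2 w'))"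
      by (simp only: cop_lin_s[OF u, symmetric])
    also have "\<dots> = cop h (\<lambda>h1 h2. \<epsilon> h1 *\<^sub>u \<tau> h2 w)"
      by (rule sweedler_ext, rule arg_cong[where f = "\<lambda>z. _ *\<^sub>u z"], rule co_counit[OF CW u UNIV_I]) (intro gl gl_wemb)
    also have "\<dots> = \<tau> h w" by (rule cop_counit(1)[OF u]) (intro hl)
    finally show "coV P (\<tau> h w) (\<lambda>d w. \<epsilon> d *\<^sub>u w) = \<tau> h w" .
  qed
  have Kc: "bilin hs D uscale ?Z uscale (\<lambda>d v'. utens H (adj g d) (hdact P h v'))" for g h
    by (rule cbil_bilin, intro cbilI hl hl_ad gl P_struct(1))
  have compat: "hdcoact P (hdact P g t) = cop g (\<lambda>h1 h2. coV P t (\<lambda>d v'. utens H (adj h1 d) (hdact P h2 v')))"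
    if t: "t \<in> ?Z" for g t
  proof (rule P_eqI[OF t _ _ u])
    show "ulin ?Z (\<lambda>t. hdcoact P (hdact P g t))"
      by (rule lin_comp[OF P_struct(1,3)]) (use P_act_in in blast)
    show "ulin ?Z (\<lambda>t. cop g (\<lambda>h1 h2. coV P t (\<lambda>d v'. utens H (adj h1 d) (hdact P h2 v'))))"
      by (intro lin_on_sweedler u co_P_lin Kc)
    fix h w
    have "hdcoact P (hdact P g (\<tau> h w)) = cop g (\<lambda>g1 g2. cop h (\<lambda>h1 h2. coW w (\<lambda>d w'. utens H (adj (g1 * h1) d) (\<tau> (g2 * h2) w'))))"
      unfolding P_struct by (rule cop_mult[OF u]) (intro hl hl_ad)
    also have "\<dots> = cop g (\<lambda>g1 g2. coV P (\<tau> h w) (\<lambda>d v'. utens H (adj g1 d) (hdact P g2 v')))"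
      unfolding co_P_pure[OF u Kc] by (simp only: ad_mult P_struct(2))
    finally show "hdcoact P (hdact P g (\<tau> h w)) = cop g (\<lambda>h1 h2. coV P (\<tau> h w) (\<lambda>d v'. utens H (adj h1 d) (hdact P h2 v')))" .
  qed
  show ?thesis
    unfolding hd_module_def left_module_def left_comodule_def
    using P_fd P_act_in P_struct(1,3) lin_h mult one P_coact_in coassoc counit compat by blast
qed

text \<open>
  The extension is \<open>h \<otimes> w \<mapsto> h g w\<close>.  It is colinear because \<open>V\<close> and \<open>P\<close> have the same rule for the coaction of
  \<open>h v\<close>.
\<close>

lemma free_hom:
  assumes V: "hdm V" and g: "lin_on ws uscale UNIV g" "\<And>w. g w \<in> hdcar V"
    and gc: "\<And>w. hdcoact V (g w) = coW w (\<lambda>d w'. utens H d (g w'))"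
  obtains f where "f \<in> hom P V" "\<And>w. f (\<tau> 1 w) = g w"
proof -
  note u = vs_u
  define f where "f = tensor_lift \<tau> UNIV UNIV (\<lambda>h w. hdact V h (g w))"
  have b: "bilin hs UNIV ws UNIV uscale (\<lambda>h w. hdact V h (g w))"
    by (rule bilinI) (intro hl_act[OF V g(2) hl_id] gl_act[OF V g(1) g(2)])+
  have fl: "ulin (hdcar P) f" and fp: "f (\<tau> h w) = hdact V h (g w)" for h w
    using tensor_lift_emb[OF embH eW u b] by (simp_all add: f_def P_car)
  have f_in: "f t \<in> hdcar V" if "t \<in> hdcar P" for t
    by (rule P_in[OF that fl hdm_facts(2)[OF V]]) (simp add: fp hdm_facts(3)[OF V g(2)])
  have "f \<in> hom P V"
  proof (rule homI)
    show "f \<in> lin_maps (hdcar P) (hdcar V)"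
      using fl f_in by (auto simp: lin_maps_def) (simp add: f_def tensor_lift_def P_car)
    show "f (hdact P h t) = hdact V h (f t)" if t: "t \<in> hdcar P" for h t
    proof (rule P_eqI[OF t lin_comp[OF P_struct(1) fl] lin_comp[OF fl hdm_facts(4)[OF V]] u])
      show "f (hdact P h (\<tau> h' w)) = hdact V h (f (\<tau> h' w))" for h' w
        unfolding P_struct(2) fp by (rule hdm_facts(6)[OF V g(2)])
    qed (use P_act_in f_in in auto)
    have K: "bilin hs D uscale (hdcar P) uscale (\<lambda>d v'. utens H d (f v'))"
      by (rule cbil_bilin, intro cbilI hl gl fl)
    show "hdcoact V (f t) = coV P t (\<lambda>d v'. utens H d (f v'))" if t: "t \<in> hdcar P" for t
    proof (rule P_eqI[OF t lin_comp[OF fl co_facts(1)[OF hdm_facts(8)[OF V]]] co_P_lin[OF u K] u])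
      fix h w
      have bb: "bilin hs D uscale (hdcar V) uscale (\<lambda>d v'. utens H (adj h1 d) (hdact V h2 v'))" for h1 h2
        by (rule cbil_bilin, intro cbilI hl hl_ad gl hdm_facts(4)[OF V])
      have "hdcoact V (f (\<tau> h w)) = cop h (\<lambda>h1 h2. coV V (g w) (\<lambda>d v'. utens H (adj h1 d) (hdact V h2 v')))"
        unfolding fp by (rule hdm_facts(9)[OF V g(2)])
      also have "\<dots> = cop h (\<lambda>h1 h2. coW w (\<lambda>d w'. utens H (adj h1 d) (hdact V h2 (g w'))))"
        by (rule sweedler_ext, rule co_transport(1)[OF CW UNIV_I u co_emb[OF hdm_facts(8)[OF V]] bb gc g(2)])
      also have "\<dots> = coV P (\<tau> h w) (\<lambda>d v'. utens H d (f v'))"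
        unfolding co_P_pure[OF u K] by (simp only: fp)
      finally show "hdcoact V (f (\<tau> h w)) = coV P (\<tau> h w) (\<lambda>d v'. utens H d (f v'))" .
    qed (use f_in in auto)
  qed
  moreover have "f (\<tau> 1 w) = g w" for w unfolding fp by (rule hdm_facts(7)[OF V g(2)])
  ultimately show thesis using that by blast
qed

text \<open>
  Every nonzero object receives a nonzero morphism from the free object.  Otherwise all averages of rank one maps from \<open>W\<close>
  vanish; as the coefficients of the object span \<open>D\<close>, the form would then vanish on
  the coefficients of \<open>W\<close> against \<open>D\<close>, contradicting its normalisation by the counit.
\<close>

lemma nonzero_hom:
  assumes V: "hdm V" and nz: "hdcar V \<noteq> {0}"
  shows "\<exists>f\<in>hom P V. \<exists>p\<in>hdcar P. f p \<noteq> 0"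
proof (rule ccontr)
  assume no: "\<not> (\<exists>f\<in>hom P V. \<exists>p\<in>hdcar P. f p \<noteq> 0)"
  note u = vs_u and C = hdm_facts(8)[OF V] and k = vs_k
  have avg0: "coW w (\<lambda>d w'. coV V (\<phi> w' *\<^sub>u v) (\<lambda>e x. theta d e *\<^sub>u x)) = 0"
    if \<phi>: "lin ws (*) \<phi>" and v: "v \<in> hdcar V" for \<phi> v w
  proof -
    let ?f = "\<lambda>w. \<phi> w *\<^sub>u v"
    have f: "lin_on ws uscale UNIV ?f" "?f w \<in> hdcar V" for w
      using \<phi> v uv.subspace_scale[OF hdm_facts(2)[OF V]] by (auto intro: gl_scale u)
    let ?g = "avg_co (wemb W) UNIV (wcoact W) (hdcar V) (hdcoact V) ?f"
    obtain h where h: "h \<in> hom P V" "\<And>w. h (\<tau> 1 w) = ?g w"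
      by (rule free_hom[OF V avg_co_lin[OF CW C f] avg_co_in[OF CW C f UNIV_I] avg_co_colinear[OF CW C f UNIV_I]]) blast+
    have "?g w = 0" using no h \<tau>_in by metis
    then show ?thesis by (simp add: avg_co_def)
  qed
  have vanish: "coW w (\<lambda>d w'. \<phi> w' * theta d c) = 0" if \<phi>: "lin ws (*) \<phi>" and c: "c \<in> D" for \<phi> w c
  proof -
    let ?G = "{coV V v (\<lambda>d v'. hs (\<psi> v') d) |v \<psi>. v \<in> hdcar V \<and> lin_on uscale (*) (hdcar V) \<psi>}"
    have cs: "c \<in> hv.span ?G" using coefficients_span[OF V nz] c by simp
    have "(\<lambda>c. coW w (\<lambda>d w'. \<phi> w' * theta d c)) c = (\<lambda>_. 0) c"
    proof (rule lin_on_eq_on_span[OF vs k _ _ _ cs])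
      show "lin_on hs (*) (hv.span ?G) (\<lambda>c. coW w (\<lambda>d w'. \<phi> w' * theta d c))"
        by (rule lin_on_subset[of _ _ UNIV], intro hl hl_theta) simp
      show "lin_on hs (*) (hv.span ?G) (\<lambda>_. 0 :: 'k)" by (simp add: lin_on_def)
      fix x assume "x \<in> ?G"
      then obtain v \<psi> where x: "x = coV V v (\<lambda>d v'. hs (\<psi> v') d)" "v \<in> hdcar V" "lin_on uscale (*) (hdcar V) \<psi>" by blast
      have th: "theta d x = coV V v (\<lambda>e v'. \<psi> v' * theta d e)" for d
        unfolding x(1) by (simp only: cop_lin[OF k hl_theta(2)[OF hl_id]] hscl[OF hl_theta(2)[OF hl_id]])
      have m: "coV V v (\<lambda>e x. theta d e *\<^sub>u x) \<in> hdcar V" for d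
        by (rule co_in[OF C u hdm_facts(2)[OF V] x(2)]) (rule uv.subspace_scale[OF hdm_facts(2)[OF V]])
      have \<psi>m: "\<psi> (coV V v (\<lambda>e x. theta d e *\<^sub>u x)) = theta d x" for d
      proof -
        have "\<psi> (coV V v (\<lambda>e x. theta d e *\<^sub>u x)) = coV V v (\<lambda>e v'. \<psi> (theta d e *\<^sub>u v'))"
          by (rule co_lin_on[OF C u k hdm_facts(2)[OF V] x(3,2)]) (rule uv.subspace_scale[OF hdm_facts(2)[OF V]])
        also have "\<dots> = coV V v (\<lambda>e v'. \<psi> v' * theta d e)"
          by (rule co_cong[OF C x(2)]) (simp add: lin_onD(2)[OF x(3)] mult.commute)
        finally show ?thesis by (simp add: th)
      qed
      have sc: "coV V (\<phi> w' *\<^sub>u v) (\<lambda>e x. theta d e *\<^sub>u x) = \<phi> w' *\<^sub>u coV V v (\<lambda>e x. theta d e *\<^sub>u x)" for d w'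
        by (rule lin_onD(2)[OF co_lin[OF C u tw_cbil] x(2)])
      have "coW w (\<lambda>d w'. \<phi> w' * theta d x) = coW w (\<lambda>d w'. \<psi> (\<phi> w' *\<^sub>u coV V v (\<lambda>e x. theta d e *\<^sub>u x)))"
        by (simp only: lin_onD(2)[OF x(3) m] \<psi>m)
      also have "\<dots> = \<psi> (coW w (\<lambda>d w'. \<phi> w' *\<^sub>u coV V v (\<lambda>e x. theta d e *\<^sub>u x)))"
        by (rule co_lin_on[OF CW u k hdm_facts(2)[OF V] x(3) UNIV_I, symmetric]) (rule uv.subspace_scale[OF hdm_facts(2)[OF V] m])
      also have "coW w (\<lambda>d w'. \<phi> w' *\<^sub>u coV V v (\<lambda>e x. theta d e *\<^sub>u x)) = 0"
        using avg0[OF \<phi> x(2), of w] by (simp only: sc)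
      also have "\<psi> 0 = 0" by (rule lin_on_zero[OF u k hdm_facts(2)[OF V] x(3)])
      finally show "coW w (\<lambda>d w'. \<phi> w' * theta d x) = 0" .
    qed
    then show ?thesis by simp
  qed
  obtain ds where "dual_sys hs D ds" by (rule dual_system[OF vs embD(2)[OF eD]])
  note ds = dual_sysD[OF this]
  have "w = 0" for w :: 'w
  proof (rule linear_separates[OF vsW embD(2)[OF eW] UNIV_I])
    fix \<phi> assume \<phi>: "lin ws (*) \<phi>"
    have exp: "theta d e = (\<Sum>(b, \<xi>)\<leftarrow>ds. \<xi> e * theta d b)" if "e \<in> D" for d e
    proof -
      have "theta d e = theta d (\<Sum>(b, \<xi>)\<leftarrow>ds. hs (\<xi> e) b)" by (rule arg_cong[OF ds(2)[OF that]])
      also have "\<dots> = (\<Sum>(b, \<xi>)\<leftarrow>ds. theta d (hs (\<xi> e) b))" by (rule lin_sum_pairs[OF vs k hl_theta(2)[OF hl_id]])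
      finally show ?thesis by (simp only: hscl[OF hl_theta(2)[OF hl_id]])
    qed
    let ?p = "\<lambda>\<xi> w'. coW w' (\<lambda>e z. \<xi> e * \<phi> z)"
    have "\<phi> w = coW w (\<lambda>d w'. \<epsilon> d * \<phi> w')" by (rule co_counit[OF CW k UNIV_I \<phi>, symmetric])
    also have "\<dots> = coW w (\<lambda>d w'. copR d (\<lambda>a b. theta a b * \<phi> w'))"
    proof (rule sweedler_ext)
      fix d w'
      have "copR d (\<lambda>a b. theta a b * \<phi> w') = copR d (\<lambda>a b. theta a b) * \<phi> w'"
        by (simp only: sweedler_lin[OF k k hl_kmult_id(1)])
      then show "\<epsilon> d * \<phi> w' = copR d (\<lambda>a b. theta a b * \<phi> w')" by (simp only: theta_counit)
    qed
    also have "\<dots> = coW w (\<lambda>d w'. coW w' (\<lambda>e z. theta d e * \<phi> z))"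
      by (rule co_coassoc[OF CW k UNIV_I]) (intro hl hl_theta gl_kmult \<phi>)+
    also have "\<dots> = coW w (\<lambda>d w'. \<Sum>(b, \<xi>)\<leftarrow>ds. ?p \<xi> w' * theta d b)"
    proof (rule sweedler_ext)
      fix d w'
      have "coW w' (\<lambda>e z. theta d e * \<phi> z) = coW w' (\<lambda>e z. \<Sum>(b, \<xi>)\<leftarrow>ds. \<xi> e * \<phi> z * theta d b)"
      proof (rule co_cong[OF CW UNIV_I])
        fix e z assume "e \<in> D"
        have "(\<Sum>(b, \<xi>)\<leftarrow>xs. \<xi> e * theta d b) * \<phi> z = (\<Sum>(b, \<xi>)\<leftarrow>xs. \<xi> e * \<phi> z * theta d b)" for xs
          by (induction xs) (auto simp: algebra_simps)
        then show "theta d e * \<phi> z = (\<Sum>(b, \<xi>)\<leftarrow>ds. \<xi> e * \<phi> z * theta d b)"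
          unfolding exp[OF \<open>e \<in> D\<close>] .
      qed
      also have "\<dots> = (\<Sum>(b, \<xi>)\<leftarrow>ds. ?p \<xi> w' * theta d b)"
        unfolding sweedler_sum_pairs by (simp only: sweedler_lin[OF k k hl_kmult_id(1)])
      finally show "coW w' (\<lambda>e z. theta d e * \<phi> z) = (\<Sum>(b, \<xi>)\<leftarrow>ds. ?p \<xi> w' * theta d b)" .
    qed
    also have "\<dots> = (\<Sum>(b, \<xi>)\<leftarrow>ds. coW w (\<lambda>d w'. ?p \<xi> w' * theta d b))"
      by (rule sweedler_sum_pairs)
    also have "(\<Sum>(b, \<xi>)\<leftarrow>ds. coW w (\<lambda>d w'. ?p \<xi> w' * theta d b)) = (\<Sum>(b, \<xi>)\<leftarrow>ds. 0)"
    proof (intro arg_cong[where f = sum_list] map_cong refl, clarify)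
      fix b \<xi> assume b: "(b, \<xi>) \<in> set ds"
      show "coW w (\<lambda>d w'. ?p \<xi> w' * theta d b) = 0"
        by (rule vanish) (use ds(1)[OF b] in \<open>auto intro!: co_lin[OF CW k] cbilI hl_kmult gl_kmult \<phi>\<close>)
    qed
    also have "\<dots> = 0" by (simp add: case_prod_unfold)
    finally show "\<phi> w = 0" by simp
  qed
  then show False using W0 by blast
qed

end

section \<open>Spaces of linear maps\<close>

interpretation fv: vector_space "fscale :: 'k::field \<Rightarrow> ('a \<Rightarrow> 'k univ) \<Rightarrow> 'a \<Rightarrow> 'k univ"
  by (rule vs_f)

definition rank1 :: "'k::field univ set \<Rightarrow> ('k univ \<Rightarrow> 'k) \<Rightarrow> 'k univ \<Rightarrow> 'k univ \<Rightarrow> 'k univ"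
  where "rank1 X \<psi> c x = (if x \<in> X then \<psi> x *\<^sub>u c else 0)"

lemma rank1_lin_maps: "usub X \<Longrightarrow> usub Y \<Longrightarrow> lin uscale (*) \<psi> \<Longrightarrow> c \<in> Y \<Longrightarrow> rank1 X \<psi> c \<in> lin_maps X Y"
  by (auto simp: lin_maps_def lin_on_def rank1_def uv.subspace_add uv.subspace_scale uv.scale_left_distrib)

lemma fscale_apply: "fscale c f x = c *\<^sub>u f x"
  by (simp add: fscale_def)

lemma lin_maps_subspace: "usub X \<Longrightarrow> usub Y \<Longrightarrow> fv.subspace (lin_maps X Y)"
proof (rule fv.subspaceI)
  assume X: "usub X" and Y: "usub Y"
  note u = vs_u
  show "0 \<in> lin_maps X Y" using uv.subspace_0[OF Y] by (auto simp: lin_maps_def lin_on_def)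
  fix f g assume f: "f \<in> lin_maps X Y" and g: "g \<in> lin_maps X Y"
  show "f + g \<in> lin_maps X Y" using lin_mapsD[OF f] lin_mapsD[OF g] uv.subspace_add[OF Y]
    by (auto simp: lin_maps_def lin_on_def uv.scale_right_distrib add_ac)
next
  fix c f assume X: "usub X" and Y: "usub Y" and f: "f \<in> lin_maps X Y"
  show "fscale c f \<in> lin_maps X Y" using lin_mapsD[OF f] uv.subspace_scale[OF Y]
    by (auto simp: lin_maps_def lin_on_def fscale_apply uv.scale_right_distrib mult.commute)
qed

lemma sum_pairs_fun: "(\<Sum>(a, b)\<leftarrow>xs. f a b) x = (\<Sum>(a, b)\<leftarrow>xs. f a b (x :: 'a) :: 'b::comm_monoid_add)"
  by (induction xs) auto

lemma lin_maps_decomp: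
  assumes f: "f \<in> lin_maps X Y" and X: "usub X"
    and xs: "\<And>b \<xi>. (b, \<xi>) \<in> set xs \<Longrightarrow> b \<in> X" "\<And>x. x \<in> X \<Longrightarrow> x = (\<Sum>(b, \<xi>)\<leftarrow>xs. \<xi> x *\<^sub>u b)"
  shows "f = (\<Sum>(b, \<xi>)\<leftarrow>xs. rank1 X \<xi> (f b))"
proof
  fix x
  show "f x = (\<Sum>(b, \<xi>)\<leftarrow>xs. rank1 X \<xi> (f b)) x"
  proof (cases "x \<in> X")
    case True
    have "f x = f (\<Sum>(b, \<xi>)\<leftarrow>xs. \<xi> x *\<^sub>u b)" by (rule arg_cong[OF xs(2)[OF True]])
    also have "\<dots> = (\<Sum>(b, \<xi>)\<leftarrow>xs. f (\<xi> x *\<^sub>u b))"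
      by (rule lin_on_sum_pairs[OF vs_u vs_u X lin_mapsD(1)[OF f]])
        (use xs(1) uv.subspace_scale[OF X] in blast)
    also have "\<dots> = (\<Sum>(b, \<xi>)\<leftarrow>xs. rank1 X \<xi> (f b) x)"
      by (rule sum_pairs_cong)
        (use xs(1) lin_onD(2)[OF lin_mapsD(1)[OF f]] True in \<open>force simp: rank1_def\<close>)
    finally show ?thesis by (simp only: sum_pairs_fun)
  next
    case False
    have "(\<Sum>(b, \<xi>)\<leftarrow>ys. rank1 X \<xi> (f b) x) = 0" for ys
      using False by (induction ys) (auto simp: rank1_def)
    then show ?thesis using lin_mapsD(3)[OF f False] by (simp only: sum_pairs_fun)
  qed
qed

lemma fin_dim_lin_maps:
  assumes X: "fd X" and Y: "fd Y"
  shows "fin_dim fscale (lin_maps X Y)"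
proof -
  obtain xs where "dual_sys uscale X xs" by (rule dual_system[OF vs_u X])
  note xs = dual_sysD[OF this]
  obtain ys where "dual_sys uscale Y ys" by (rule dual_system[OF vs_u Y])
  note ys = dual_sysD[OF this]
  let ?B = "(\<lambda>(p, q). rank1 X (snd p) (fst q)) ` (set xs \<times> set ys)"
  have "f \<in> fv.span ?B" if f: "f \<in> lin_maps X Y" for f
  proof -
    have "rank1 X \<xi> (f b) \<in> fv.span ?B" if b: "(b, \<xi>) \<in> set xs" for b \<xi>
    proof -
      have "f b \<in> Y" using xs(1)[OF b] lin_mapsD(2)[OF f] by blast
      have "rank1 X \<xi> (f b) x = (\<Sum>(c, \<eta>)\<leftarrow>ys. fscale (\<eta> (f b)) (rank1 X \<xi> c)) x" for x
      proof -
        have "rank1 X \<xi> (f b) x = rank1 X \<xi> (\<Sum>(c, \<eta>)\<leftarrow>ys. \<eta> (f b) *\<^sub>u c) x"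
          by (rule arg_cong[OF ys(2)[OF \<open>f b \<in> Y\<close>], where f = "\<lambda>z. rank1 X \<xi> z x"])
        also have "\<dots> = (\<Sum>(c, \<eta>)\<leftarrow>ys. rank1 X \<xi> (\<eta> (f b) *\<^sub>u c) x)"
          by (rule lin_sum_pairs[OF vs_u vs_u, where f = "\<lambda>z. rank1 X \<xi> z x"])
            (auto simp: lin_on_def rank1_def uv.scale_right_distrib mult.commute)
        also have "\<dots> = (\<Sum>(c, \<eta>)\<leftarrow>ys. fscale (\<eta> (f b)) (rank1 X \<xi> c) x)"
          by (rule sum_pairs_cong) (auto simp: rank1_def fscale_apply mult.commute)
        finally show ?thesis by (simp only: sum_pairs_fun)
      qed
      then have "rank1 X \<xi> (f b) = (\<Sum>(c, \<eta>)\<leftarrow>ys. fscale (\<eta> (f b)) (rank1 X \<xi> c))" by (rule ext)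
      also have "\<dots> \<in> fv.span ?B"
        by (intro subspace_sum_pairs[OF vs_f fv.subspace_span] fv.span_scale fv.span_base) (use b in force)
      finally show ?thesis .
    qed
    then have "(\<Sum>(b, \<xi>)\<leftarrow>xs. rank1 X \<xi> (f b)) \<in> fv.span ?B"
      by (intro subspace_sum_pairs[OF vs_f fv.subspace_span])
    moreover have "f = (\<Sum>(b, \<xi>)\<leftarrow>xs. rank1 X \<xi> (f b))"
      by (rule lin_maps_decomp[OF f]) (use X xs in auto)
    ultimately show ?thesis by (rule ssubst[rotated])
  qed
  then show ?thesis
    using X Y by (intro fin_dimI[OF vs_f lin_maps_subspace, of X Y ?B]) auto
qed

lemma lin_image_span:
  assumes f: "f \<in> lin_maps X Y" and X: "X = uv.span G"
  shows "f ` X = uv.span (f ` G)"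
proof
  note u = vs_u
  have G: "G \<subseteq> X" unfolding X by (rule uv.span_superset)
  have l: "ulin (uv.span G) f" using lin_mapsD(1)[OF f] unfolding X .
  have "f x \<in> uv.span (f ` G)" if "x \<in> X" for x
    by (rule lin_on_span_in[OF u u l, of _ x]) (use that X uv.span_base in \<open>auto simp: uv.span_base\<close>)
  then show "f ` X \<subseteq> uv.span (f ` G)" by blast
  have s: "usub (f ` X)" by (rule subspace_image[OF u u _ lin_mapsD(1)[OF f]]) (simp add: X)
  show "uv.span (f ` G) \<subseteq> f ` X" by (rule uv.span_minimal[OF _ s]) (use G in blast)
qed

section \<open>The endomorphism algebra of the free object\<close>

context hd_free
begin

lemma hom_subspace:
  assumes V: "hdm V" and V': "hdm V'"
  shows "fv.subspace (hom V V')"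
proof -
  note s = lin_maps_subspace[OF hdm_facts(2)[OF V] hdm_facts(2)[OF V']]
  show "fv.subspace (hom V V')"
    unfolding hom_ops[OF V V'] ball_UNIV
  proof (rule fv.subspaceI)
    note u = vs_u and o = hdop_lin[OF V']
    show "0 \<in> {f \<in> lin_maps (hdcar V) (hdcar V'). \<forall>j. \<forall>v\<in>hdcar V. f (hdop V j v) = hdop V' j (f v)}"
      using fv.subspace_0[OF s] lin_on_zero[OF u u hdm_facts(2)[OF V'] o] by simp
    have m: "f v \<in> hdcar V'" if "f \<in> lin_maps (hdcar V) (hdcar V')" "v \<in> hdcar V" for f v using lin_mapsD(2) that by blast
    fix f assume f: "f \<in> {f \<in> lin_maps (hdcar V) (hdcar V'). \<forall>j. \<forall>v\<in>hdcar V. f (hdop V j v) = hdop V' j (f v)}" (is "_ \<in> ?S")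
    fix g assume g: "g \<in> ?S"
    show "f + g \<in> ?S" using f g fv.subspace_add[OF s] by (simp add: lin_onD(1)[OF o] m)
  next
    fix c f assume f: "f \<in> {f \<in> lin_maps (hdcar V) (hdcar V'). \<forall>j. \<forall>v\<in>hdcar V. f (hdop V j v) = hdop V' j (f v)}" (is "_ \<in> ?S")
    show "fscale c f \<in> ?S"
      using f fv.subspace_scale[OF s] lin_mapsD(2)[of f "hdcar V" "hdcar V'"] by (simp add: fscale_apply lin_onD(2)[OF hdop_lin[OF V']])
  qed
qed

lemma hom_fd: "hdm V \<Longrightarrow> hdm V' \<Longrightarrow> fin_dim fscale (hom V V')"
  using fin_dim_mono[OF vs_f fin_dim_lin_maps hom_subspace] hdm_facts(1) homD(1) by blast

lemma hom_compose: "\<lbrakk>hdm V; hdm V'; hdm V''; f \<in> hom V V'; g \<in> hom V' V''\<rbrakk> \<Longrightarrow> g \<circ> f \<in> hom V V''"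
  using op_category.hm_comp[OF op_category_HD] by simp

lemma hom_id: "hdm V \<Longrightarrow> id_map (hdcar V) \<in> hom V V"
  using op_category.hm_id[OF op_category_HD] by simp

lemma avg_zero: "hdm V \<Longrightarrow> hdm V' \<Longrightarrow> avg V V' 0 = 0"
  using avg_id[OF _ _ homD(1)] fv.subspace_0[OF hom_subspace] by blast

lemma avg_sum:
  assumes V: "hdm V" and V': "hdm V'" and f: "\<And>a b. (a, b) \<in> set xs \<Longrightarrow> f a b \<in> lin_maps (hdcar V) (hdcar V')"
  shows "avg V V' (\<Sum>(a, b)\<leftarrow>xs. f a b) = (\<Sum>(a, b)\<leftarrow>xs. avg V V' (f a b))"
    and "(\<Sum>(a, b)\<leftarrow>xs. f a b) \<in> lin_maps (hdcar V) (hdcar V')"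
proof -
  note s = lin_maps_subspace[OF hdm_facts(2)[OF V] hdm_facts(2)[OF V']]
  have "avg V V' (\<Sum>(a, b)\<leftarrow>xs. f a b) = (\<Sum>(a, b)\<leftarrow>xs. avg V V' (f a b)) \<and>
      (\<Sum>(a, b)\<leftarrow>xs. f a b) \<in> lin_maps (hdcar V) (hdcar V')" using f
  proof (induction xs)
    case Nil show ?case unfolding list.map sum_list.Nil using avg_zero[OF V V'] fv.subspace_0[OF s] by blast
  next
    case (Cons p xs)
    obtain a b where p: "p = (a, b)" by (cases p)
    have m: "f a b \<in> lin_maps (hdcar V) (hdcar V')" using Cons.prems p by simp
    have IH: "avg V V' (\<Sum>(a, b)\<leftarrow>xs. f a b) = (\<Sum>(a, b)\<leftarrow>xs. avg V V' (f a b))"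
      "(\<Sum>(a, b)\<leftarrow>xs. f a b) \<in> lin_maps (hdcar V) (hdcar V')" using Cons by auto
    show ?case unfolding p list.map case_prod_conv sum_list.Cons avg_add[OF V V' m IH(2)] IH(1)
      using fv.subspace_add[OF s m IH(2)] by blast
  qed
  then show "avg V V' (\<Sum>(a, b)\<leftarrow>xs. f a b) = (\<Sum>(a, b)\<leftarrow>xs. avg V V' (f a b))"
    "(\<Sum>(a, b)\<leftarrow>xs. f a b) \<in> lin_maps (hdcar V) (hdcar V')" by auto
qed

lemma image_object:
  assumes V: "hdm V" and z: "z \<in> hom V V"
  shows "hdm \<lparr>hdcar = z ` hdcar V, hdact = hdact V, hdcoact = hdcoact V\<rparr>" (is "hdm ?Y")
proof (rule hdm_generated[where G = "z ` hdcar V"])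
  note u = vs_u
  have sub: "z ` hdcar V \<subseteq> hdcar V" using homD(3)[OF z] by blast
  show "fd (hdcar ?Y)" using fin_dim_image[OF u u hdm_facts(1)[OF V] homD(2)[OF z]] by simp
  show "ulin (hdcar ?Y) (hdact ?Y h)" for h using lin_on_subset[OF hdm_facts(4)[OF V] sub] by simp
  show "ulin (hdcar ?Y) (hdcoact ?Y)"
    using lin_on_subset[OF co_facts(1)[OF hdm_facts(8)[OF V]] sub] by simp
  show "hdcar ?Y = uv.span (z ` hdcar V)"
    using subspace_span_self[OF subspace_image[OF u u hdm_facts(2)[OF V] homD(2)[OF z]]] by simp
  fix y assume "y \<in> z ` hdcar V"
  moreover have "premor V ?Y z" using homD[OF z] by (simp add: premor_def)
  ultimately show "\<exists>V' f v. hdm V' \<and> v \<in> hdcar V' \<and> y = f v \<and> premor V' ?Y f" using V by blast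
qed

text \<open>
  Every object is a direct summand of a power of \<open>P\<close>.  The sum \<open>V\<^sub>0\<close> of all images of \<open>P\<close> has an equivariant
  projection, the average of a linear one, which factors through a power of \<open>P\<close>.  Its complement receives no nonzero map
  from \<open>P\<close>, so it vanishes.
\<close>

lemma dual_basis:
  assumes V: "hdm V"
  obtains fs where "\<And>f g. (f, g) \<in> set fs \<Longrightarrow> f \<in> hom P V \<and> g \<in> hom V P"
    and "\<And>v. v \<in> hdcar V \<Longrightarrow> v = (\<Sum>(f, g)\<leftarrow>fs. f (g v))"
proof -
  note u = vs_u and P = hdm_P and sV = hdm_facts(2)[OF V]
  let ?G = "{f p |f p. f \<in> hom P V \<and> p \<in> hdcar P}"
  let ?V0 = "uv.span ?G"
  have V0: "?V0 \<subseteq> hdcar V" by (rule uv.span_minimal[OF _ sV]) (use homD(3) in blast)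
  have fd: "fd ?V0" by (rule fin_dim_mono[OF u hdm_facts(1)[OF V] _ V0]) simp
  obtain xs where "dual_sys uscale ?V0 xs" by (rule dual_system[OF u fd])
  note xs = dual_sysD[OF this]
  define Q where "Q h \<longleftrightarrow> (\<exists>fs. (\<forall>(f, g)\<in>set fs. f \<in> hom P V \<and> g \<in> hom V P) \<and> h = (\<Sum>(f, g)\<leftarrow>fs. f \<circ> g))" for h
  have Q0: "Q 0" unfolding Q_def by (rule exI[of _ "[]"]) simp
  have Qadd: "Q (h + h')" if hh: "Q h" "Q h'" for h h'
  proof -
    obtain fs fs' where fs: "\<forall>(f, g)\<in>set fs. f \<in> hom P V \<and> g \<in> hom V P" "h = (\<Sum>(f, g)\<leftarrow>fs. f \<circ> g)"
      "\<forall>(f, g)\<in>set fs'. f \<in> hom P V \<and> g \<in> hom V P" "h' = (\<Sum>(f, g)\<leftarrow>fs'. f \<circ> g)" using hh unfolding Q_def by blast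
    then show ?thesis unfolding Q_def by (intro exI[of _ "fs @ fs'"]) auto
  qed
  have Qsum: "Q (\<Sum>(b, \<xi>)\<leftarrow>xs. F b \<xi>)" if "\<And>b \<xi>. (b, \<xi>) \<in> set xs \<Longrightarrow> Q (F b \<xi>)"
    for xs :: "('k univ \<times> ('k univ \<Rightarrow> 'k)) list" and F
    using that by (induction xs) (auto simp: Q0 intro!: Qadd)
  have Qrank: "Q (avg V V (rank1 (hdcar V) \<xi> b))" if \<xi>: "lin uscale (*) \<xi>" and b: "b \<in> ?V0" for b \<xi>
  proof -
    have "b \<in> hdcar V \<and> Q (avg V V (rank1 (hdcar V) \<xi> b))" using b
    proof (induction rule: uv.span_induct_alt)
      case base
      have "rank1 (hdcar V) \<xi> 0 = 0" unfolding rank1_def uv.scale_zero_right by (simp add: fun_eq_iff)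
      then have "avg V V (rank1 (hdcar V) \<xi> 0) = 0" using avg_zero[OF V V] by simp
      with Q0 uv.subspace_0[OF sV] show ?case by (simp only: simp_thms)
    next
      case (step c x y)
      then obtain f p where fp: "f \<in> hom P V" "p \<in> hdcar P" "x = f p" by blast
      let ?f = "fscale c f"
      have f: "?f \<in> hom P V" by (rule fv.subspace_scale[OF hom_subspace[OF P V] fp(1)])
      have x: "c *\<^sub>u x = ?f p" by (simp add: fp fscale_apply)
      have xV: "c *\<^sub>u x \<in> hdcar V" unfolding x by (rule homD(3)[OF f fp(2)])
      have r: "rank1 (hdcar V) \<xi> (c *\<^sub>u x) = ?f \<circ> rank1 (hdcar V) \<xi> p"
        using lin_onD(2)[OF homD(2)[OF f] fp(2)] lin_maps_0[OF homD(1)[OF f]] by (auto simp: x rank1_def fun_eq_iff)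
      have rp: "rank1 (hdcar V) \<xi> p \<in> lin_maps (hdcar V) (hdcar P)"
        by (rule rank1_lin_maps[OF sV hdm_facts(2)[OF P] \<xi> fp(2)])
      have "avg V V (rank1 (hdcar V) \<xi> (c *\<^sub>u x)) = ?f \<circ> avg V P (rank1 (hdcar V) \<xi> p)"
        unfolding r by (rule avg_post[OF V P rp V f])
      moreover have "Q (?f \<circ> avg V P (rank1 (hdcar V) \<xi> p))"
        unfolding Q_def using f avg_hom[OF V P rp] by (intro exI[of _ "[(?f, avg V P (rank1 (hdcar V) \<xi> p))]"]) simp
      moreover have "rank1 (hdcar V) \<xi> (c *\<^sub>u x + y) = rank1 (hdcar V) \<xi> (c *\<^sub>u x) + rank1 (hdcar V) \<xi> y"
        by (auto simp: rank1_def fun_eq_iff algebra_simps)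
      moreover have "avg V V (rank1 (hdcar V) \<xi> (c *\<^sub>u x) + rank1 (hdcar V) \<xi> y) =
          avg V V (rank1 (hdcar V) \<xi> (c *\<^sub>u x)) + avg V V (rank1 (hdcar V) \<xi> y)"
        by (rule avg_add[OF V V]) (use rank1_lin_maps[OF sV sV \<xi>] xV step in auto)
      ultimately have "avg V V (rank1 (hdcar V) \<xi> (c *\<^sub>u x + y)) = (?f \<circ> avg V P (rank1 (hdcar V) \<xi> p)) + avg V V (rank1 (hdcar V) \<xi> y)"
        and "Q (?f \<circ> avg V P (rank1 (hdcar V) \<xi> p))" by (simp_all only:)
      with step Qadd xV uv.subspace_add[OF sV] show ?case by (simp only: simp_thms)
    qed
    then show ?thesis ..
  qed
  let ?l = "\<Sum>(b, \<xi>)\<leftarrow>xs. rank1 (hdcar V) \<xi> b"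
  let ?e = "avg V V ?l"
  have rl: "rank1 (hdcar V) \<xi> b \<in> lin_maps (hdcar V) (hdcar V)" if "(b, \<xi>) \<in> set xs" for b \<xi>
    using rank1_lin_maps[OF sV sV] xs(1)[OF that] V0 by blast
  note e0 = avg_sum[OF V V, where xs = xs and f = "\<lambda>b \<xi>. rank1 (hdcar V) \<xi> b", OF rl]
  have "?e = (\<Sum>(b, \<xi>)\<leftarrow>xs. avg V V (rank1 (hdcar V) \<xi> b))" by (rule e0(1))
  moreover have "Q (\<Sum>(b, \<xi>)\<leftarrow>xs. avg V V (rank1 (hdcar V) \<xi> b))" by (rule Qsum) (use Qrank xs(1) in blast)
  ultimately have "Q ?e" by (simp only:)
  then obtain fs where fs: "\<And>f g. (f, g) \<in> set fs \<Longrightarrow> f \<in> hom P V \<and> g \<in> hom V P" "?e = (\<Sum>(f, g)\<leftarrow>fs. f \<circ> g)"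
    unfolding Q_def by blast
  have eh: "?e \<in> hom V V" by (rule avg_hom[OF V V e0(2)])
  have ef: "?e (f p) = f p" if f: "f \<in> hom P V" and p: "p \<in> hdcar P" for f p
  proof -
    have "?l (f x) = f x" for x
    proof (cases "x \<in> hdcar P")
      case True
      then have "f x \<in> ?V0" using f by (intro uv.span_base) blast
      have "?l (f x) = (\<Sum>(b, \<xi>)\<leftarrow>xs. \<xi> (f x) *\<^sub>u b)"
        unfolding sum_pairs_fun using homD(3)[OF f True] by (simp add: rank1_def)
      also have "\<dots> = f x" by (rule xs(2)[OF \<open>f x \<in> ?V0\<close>, symmetric])
      finally show ?thesis .
    next
      case False
      have "f x = 0" by (rule homD(6)[OF f False])
      then show ?thesis using lin_maps_0[OF e0(2)] by simp
    qed
    then have "?l \<circ> f = f" by (simp add: fun_eq_iff)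
    then have "?e \<circ> f = f" using avg_pre[OF V V e0(2) P f] avg_id[OF P V homD(1)[OF f] f] by simp
    then show ?thesis by (metis comp_apply)
  qed
  have eq: "?e v = (\<Sum>(f, g)\<leftarrow>fs. f (g v))" for v using fun_cong[OF fs(2), of v] by (simp add: sum_pairs_fun)
  have ee: "?e (?e v) = ?e v" if v: "v \<in> hdcar V" for v
  proof -
    have m: "f (g v) \<in> hdcar V" if "(f, g) \<in> set fs" for f g using fs(1)[OF that] homD(3) v by blast
    have "?e (\<Sum>(f, g)\<leftarrow>fs. f (g v)) = (\<Sum>(f, g)\<leftarrow>fs. ?e (f (g v)))"
      by (rule lin_on_sum_pairs[OF u u sV homD(2)[OF eh]]) (rule m)
    also have "\<dots> = (\<Sum>(f, g)\<leftarrow>fs. f (g v))"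
      by (rule sum_pairs_cong) (use ef fs(1) homD(3) v in fastforce)
    finally show ?thesis by (simp only: eq[of v])
  qed
  have "?e v = v" if v: "v \<in> hdcar V" for v
  proof (rule ccontr)
    assume ne: "?e v \<noteq> v"
    let ?z = "id_map (hdcar V) - ?e"
    have z: "?z \<in> hom V V" by (rule fv.subspace_diff[OF hom_subspace[OF V V] hom_id[OF V] eh])
    have zv: "?z w = w - ?e w" if "w \<in> hdcar V" for w using that by simp
    let ?Y = "\<lparr>hdcar = ?z ` hdcar V, hdact = hdact V, hdcoact = hdcoact V\<rparr>"
    have "?z v \<in> hdcar ?Y" "?z v \<noteq> 0" using v ne zv[OF v] by auto
    then have nz: "hdcar ?Y \<noteq> {0}" by blast
    obtain f p where f: "f \<in> hom P ?Y" and p: "p \<in> hdcar P" "f p \<noteq> 0"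
      using nonzero_hom[OF image_object[OF V z] nz] by blast
    have "f \<in> hom P V"
      by (rule homI) (use homD[OF f] homD(3)[OF z] in \<open>auto simp: lin_maps_def\<close>)
    then have 1: "?e (f p) = f p" by (rule ef[OF _ p(1)])
    obtain w where w: "w \<in> hdcar V" "f p = ?z w" using homD(3)[OF f p(1)] by auto
    have ew: "?e w \<in> hdcar V" by (rule homD(3)[OF eh w(1)])
    have "?e (w - ?e w) = ?e w - ?e (?e w)" by (rule lin_on_diff[OF u u sV homD(2)[OF eh] w(1) ew])
    then have "?e (f p) = 0" using ee[OF w(1)] w(2) zv[OF w(1)] by simp
    then show False using 1 p(2) by simp
  qed
  then have "v = (\<Sum>(f, g)\<leftarrow>fs. f (g v))" if "v \<in> hdcar V" for v using eq[of v] that by (metis (lifting))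
  then show thesis using that fs(1) by blast
qed

abbreviation "A \<equiv> End_alg H D P"

lemma A_sel [simp]: "acarrier A = hom P P" "ascale A = fscale" "amult A = (\<circ>)" "aone A = id_map (hdcar P)"
  by (simp_all add: End_alg_def)

lemma hom_comp_lin:
  assumes "hdm V" "hdm V'" "hdm V''"
  shows "g \<in> hom V' V'' \<Longrightarrow> lin_on fscale fscale (hom V V') (\<lambda>f. g \<circ> f)"
    and "lin_on fscale fscale (hom V' V'') (\<lambda>g. g \<circ> f)"
proof -
  show "lin_on fscale fscale (hom V' V'') (\<lambda>g. g \<circ> f)" by (auto simp: lin_on_def fscale_apply fun_eq_iff)
  assume g: "g \<in> hom V' V''"
  have g0: "g 0 = 0" by (rule lin_maps_0[OF homD(1)[OF g]])
  have "g (f x + f' x) = g (f x) + g (f' x)" if ff: "f \<in> hom V V'" "f' \<in> hom V V'" for f f' x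
    by (cases "x \<in> hdcar V") (simp_all add: lin_onD(1)[OF homD(2)[OF g]] homD(3)[OF ff(1)] homD(3)[OF ff(2)] homD(6)[OF ff(1)] homD(6)[OF ff(2)] g0)
  moreover have "g (c *\<^sub>u f x) = c *\<^sub>u g (f x)" if ff: "f \<in> hom V V'" for f c x
  proof (cases "x \<in> hdcar V")
    case False
    have "g (c *\<^sub>u f x) = g 0" unfolding homD(6)[OF ff False] uv.scale_zero_right ..
    then show ?thesis unfolding homD(6)[OF ff False] g0 uv.scale_zero_right .
  qed (rule lin_onD(2)[OF homD(2)[OF g] homD(3)[OF ff]])
  ultimately show "lin_on fscale fscale (hom V V') (\<lambda>f. g \<circ> f)" by (simp add: lin_on_def fscale_def comp_def plus_fun_def)
qed

lemma A_algebra: "k_algebra A"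
  unfolding k_algebra_def A_sel
  using vs_f hom_subspace[OF hdm_P hdm_P] hom_id[OF hdm_P] hom_compose[OF hdm_P hdm_P hdm_P]
    hom_comp_lin[OF hdm_P hdm_P hdm_P] lin_maps_id[OF homD(1)] by (auto simp: comp_assoc)

text \<open>
  The endomorphism algebra is von Neumann regular: a linear quasi-inverse of \<open>x\<close> may be averaged.
\<close>

lemma A_regular:
  assumes x: "x \<in> hom P P"
  obtains y where "y \<in> hom P P" "x \<circ> (y \<circ> x) = x"
proof -
  note u = vs_u and P = hdm_P and sP = hdm_facts(2)[OF hdm_P]
  have fd: "fd (x ` hdcar P)" by (rule fin_dim_image[OF u u hdm_facts(1)[OF P] homD(2)[OF x]])
  obtain xs where "dual_sys uscale (x ` hdcar P) xs" by (rule dual_system[OF u fd])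
  note xs = dual_sysD[OF this]
  let ?i = "inv_into (hdcar P) x"
  have i: "?i b \<in> hdcar P" "x (?i b) = b" if "(b, \<xi>) \<in> set xs" for b \<xi>
    using xs(1)[OF that] by (auto simp: inv_into_into f_inv_into_f)
  have rl: "rank1 (hdcar P) \<xi> (?i b) \<in> lin_maps (hdcar P) (hdcar P)" if "(b, \<xi>) \<in> set xs" for b \<xi>
    using rank1_lin_maps[OF sP sP] xs(1)[OF that] i(1)[OF that] by blast
  let ?y = "\<Sum>(b, \<xi>)\<leftarrow>xs. rank1 (hdcar P) \<xi> (?i b)"
  have y: "?y \<in> lin_maps (hdcar P) (hdcar P)" by (rule avg_sum(2)[OF P P rl])
  have "x (?y (x p)) = x p" for p
  proof (cases "p \<in> hdcar P")
    case True
    have "?y (x p) = (\<Sum>(b, \<xi>)\<leftarrow>xs. \<xi> (x p) *\<^sub>u ?i b)"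
      unfolding sum_pairs_fun using homD(3)[OF x True] by (simp add: rank1_def)
    then have "x (?y (x p)) = x (\<Sum>(b, \<xi>)\<leftarrow>xs. \<xi> (x p) *\<^sub>u ?i b)" by simp
    also have "\<dots> = (\<Sum>(b, \<xi>)\<leftarrow>xs. x (\<xi> (x p) *\<^sub>u ?i b))"
      by (rule lin_on_sum_pairs[OF u u sP homD(2)[OF x]]) (use i(1) uv.subspace_scale[OF sP] in blast)
    also have "\<dots> = (\<Sum>(b, \<xi>)\<leftarrow>xs. \<xi> (x p) *\<^sub>u b)"
      by (rule sum_pairs_cong) (use i lin_onD(2)[OF homD(2)[OF x]] in force)
    also have "\<dots> = x p" by (rule xs(2)[symmetric]) (use True in blast)
    finally show ?thesis .
  qed (simp add: homD(6)[OF x] lin_maps_0[OF y] lin_maps_0[OF homD(1)[OF x]])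
  then have e: "x \<circ> (?y \<circ> x) = x" by (simp add: fun_eq_iff)
  have yx: "?y \<circ> x \<in> lin_maps (hdcar P) (hdcar P)" by (rule lin_maps_comp[OF homD(1)[OF x] y sP])
  (* averaging the middle factor of this equation is allowed, as x is a morphism *)
  have "x \<circ> (avg P P ?y \<circ> x) = avg P P (x \<circ> (?y \<circ> x))"
    using avg_post[OF P P yx P x] avg_pre[OF P P y P x] by simp
  also have "\<dots> = x" unfolding e by (rule avg_id[OF P P homD(1)[OF x] x])
  finally show thesis using that avg_hom[OF P P y] by blast
qed

text \<open>
  In a regular algebra a finitely generated left ideal \<open>I\<close> contains a right identity \<open>g\<close> for itself, and the
  annihilator of \<open>g\<close> is a complement.
\<close>

lemma A_semisimple: "semisimple_algebra A"
  unfolding semisimple_algebra_def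
proof (intro conjI allI impI)
  note P = hdm_P and PP = hom_subspace[OF hdm_P hdm_P] and cmp = hom_compose[OF hdm_P hdm_P hdm_P]
    and cl = hom_comp_lin[OF hdm_P hdm_P hdm_P]
  show "k_algebra A" by (rule A_algebra)
  fix I assume "left_ideal A I"
  then have I: "I \<subseteq> hom P P" "fv.subspace I" "\<And>a x. a \<in> hom P P \<Longrightarrow> x \<in> I \<Longrightarrow> a \<circ> x \<in> I"
    by (auto simp: left_ideal_def)
  have dl: "x \<circ> (e - f) = (x \<circ> e) - (x \<circ> f)" if "x \<in> hom P P" "e \<in> hom P P" "f \<in> hom P P" for x e f
    by (rule lin_on_diff[OF vs_f vs_f PP cl(1)[OF that(1)] that(2,3)])
  have dr: "(e - f) \<circ> x = (e \<circ> x) - (f \<circ> x)" for x e f :: "'k univ \<Rightarrow> 'k univ" by (simp add: fun_eq_iff)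
  have gen: "\<exists>g\<in>I. \<forall>x\<in>set xs. x \<circ> g = x" if "set xs \<subseteq> I" for xs
    using that
  proof (induction xs)
    case Nil then show ?case using fv.subspace_0[OF I(2)] by auto
  next
    case (Cons x xs)
    then obtain e where e: "e \<in> I" "\<And>y. y \<in> set xs \<Longrightarrow> y \<circ> e = y" unfolding list.set insert_subset by blast
    have x: "x \<in> I" "x \<in> hom P P" and eh: "e \<in> hom P P" using Cons.prems I(1) e(1) by auto
    (* e fixes xs from the right; ?f below satisfies ?x ?f = ?x, and e + ?f - e ?f fixes x and still fixes xs *)
    let ?x = "x - (x \<circ> e)"
    have x': "?x \<in> I" "?x \<in> hom P P"
      using fv.subspace_diff[OF I(2) x(1) I(3)[OF x(2) e(1)]] I(1) by auto
    obtain y where y: "y \<in> hom P P" "?x \<circ> (y \<circ> ?x) = ?x" by (rule A_regular[OF x'(2)]) blast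
    let ?f = "y \<circ> ?x"
    have f: "?f \<in> I" "?f \<in> hom P P" using I(3)[OF y(1) x'(1)] I(1) by auto
    have ef: "e \<circ> ?f \<in> I" "e \<circ> ?f \<in> hom P P" using I(3)[OF eh f(1)] I(1) by auto
    have fef: "?f - (e \<circ> ?f) \<in> hom P P" by (rule fv.subspace_diff[OF PP f(2) ef(2)])
    let ?g = "e + (?f - (e \<circ> ?f))"
    have g: "?g \<in> I" by (intro fv.subspace_add[OF I(2)] fv.subspace_diff[OF I(2)] e(1) f(1) ef(1))
    have mg: "z \<circ> ?g = (z \<circ> e) + ((z - (z \<circ> e)) \<circ> ?f)" if z: "z \<in> hom P P" for z
    proof -
      have "z \<circ> ?g = (z \<circ> e) + (z \<circ> (?f - (e \<circ> ?f)))" by (rule lin_onD(1)[OF cl(1)[OF z] eh fef])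
      also have "z \<circ> (?f - (e \<circ> ?f)) = (z \<circ> ?f) - (z \<circ> (e \<circ> ?f))" by (rule dl[OF z f(2) ef(2)])
      also have "\<dots> = (z - (z \<circ> e)) \<circ> ?f" by (simp add: fun_eq_iff)
      finally show ?thesis .
    qed
    have "x \<circ> ?g = x" unfolding mg[OF x(2)] y(2) by simp
    moreover have "z \<circ> ?g = z" if z: "z \<in> set xs" for z
    proof -
      have "z \<in> hom P P" using Cons.prems z I(1) by auto
      from mg[OF this] show ?thesis unfolding e(2)[OF z] by (simp add: fun_eq_iff)
    qed
    ultimately show ?case using g unfolding list.set by blast
  qed
  have "fin_dim fscale I" by (rule fin_dim_mono[OF vs_f hom_fd[OF P P] I(2,1)])
  then obtain B where B: "finite B" "I = fv.span B" by (auto simp: fin_dim_def)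
  obtain xs where xs: "set xs = B" using B(1) finite_list by blast
  have "set xs \<subseteq> I" using xs B(2) fv.span_superset by auto
  then obtain g where g: "g \<in> I" "\<And>x. x \<in> B \<Longrightarrow> x \<circ> g = x" using gen[of xs] xs by auto
  have gI: "a \<circ> g = a" if a: "a \<in> I" for a
  proof -
    have "(\<lambda>a. a \<circ> g) a = (\<lambda>a. a) a"
      by (rule lin_on_eq_on_span[OF vs_f vs_f, where S = B and f = "\<lambda>a. a \<circ> g" and g = "\<lambda>a. a"])
        (use a B(2) g(2) lin_on_subset[OF cl(2) I(1)] in \<open>auto simp: gl_id\<close>)
    then show ?thesis .
  qed
  have gh: "g \<in> hom P P" using g(1) I(1) by blast
  let ?J = "{a \<in> hom P P. a \<circ> g = 0}"
  have J: "left_ideal A ?J"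
    unfolding left_ideal_def A_sel
  proof (intro conjI ballI)
    show "fv.subspace ?J"
      by (rule fv.subspaceI) (use PP in \<open>auto simp: fv.subspace_0 fv.subspace_add fv.subspace_scale fun_eq_iff fscale_apply\<close>)
    show "a \<circ> x \<in> ?J" if "a \<in> hom P P" "x \<in> ?J" for a x
    proof -
      have "(a \<circ> x) \<circ> g = a \<circ> 0" using that(2) by (simp only: comp_assoc mem_Collect_eq)
      also have "\<dots> = 0" using lin_maps_0[OF homD(1)[OF that(1)]] by (simp add: fun_eq_iff)
      finally show ?thesis using that cmp by blast
    qed
  qed auto
  have "I \<inter> ?J = {0}"
  proof (intro equalityI subsetI)
    fix a assume a: "a \<in> I \<inter> ?J"
    then have "a \<circ> g = a" "a \<circ> g = 0" using gI by blast+
    then show "a \<in> {0}" by (simp only: singleton_iff)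
  next
    fix a :: "'k univ \<Rightarrow> 'k univ" assume "a \<in> {0}"
    moreover have "0 \<circ> g = 0" by (rule ext) simp
    ultimately show "a \<in> I \<inter> ?J" using fv.subspace_0[OF I(2)] fv.subspace_0[OF PP] by blast
  qed
  moreover have "acarrier A = {x + y |x y. x \<in> I \<and> y \<in> ?J}"
  proof (intro equalityI subsetI)
    fix a assume "a \<in> acarrier A"
    then have a: "a \<in> hom P P" by simp
    have ag: "a \<circ> g \<in> I" by (rule I(3)[OF a g(1)])
    have "a - (a \<circ> g) \<in> hom P P" using fv.subspace_diff[OF PP a] ag I(1) by blast
    moreover have "(a - (a \<circ> g)) \<circ> g = 0" unfolding dr gI[OF ag] by simp
    moreover have "a = (a \<circ> g) + (a - (a \<circ> g))" by simp
    ultimately show "a \<in> {x + y |x y. x \<in> I \<and> y \<in> ?J}" using ag by blast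
  next
    fix a assume "a \<in> {x + y |x y. x \<in> I \<and> y \<in> ?J}"
    then show "a \<in> acarrier A" using I(1) fv.subspace_add[OF PP] by auto
  qed
  ultimately show "\<exists>J. left_ideal A J \<and> I \<inter> J = {0} \<and> acarrier A = {x + y |x y. x \<in> I \<and> y \<in> J}"
    using J by blast
qed

end

section \<open>Isomorphisms in module categories\<close>

lemma iso_arr_comp:
  assumes "category C" "iso_arr C x y f" "iso_arr C y z g"
  shows "iso_arr C x z (Comp C g f)"
proof -
  interpret category C by fact
  obtain f' g' where i: "f \<in> homset C x y" "f' \<in> homset C y x" "Comp C f' f = Id C x" "Comp C f f' = Id C y"
    "g \<in> homset C y z" "g' \<in> homset C z y" "Comp C g' g = Id C y" "Comp C g g' = Id C z"
    using assms(2,3) by (auto simp: iso_arr_def)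
  note gf = comp_arr[OF i(1,5)] and fg = comp_arr[OF i(6,2)]
  have "Comp C g' (Comp C g f) = f" using comp_assoc[OF i(1,5,6)] comp_id[OF i(1)] by (simp only: i(7))
  then have "Comp C (Comp C f' g') (Comp C g f) = Id C x" using comp_assoc[OF gf i(6,2)] by (simp only: i(3))
  moreover have "Comp C f (Comp C f' g') = g'" using comp_assoc[OF i(6,2,1)] comp_id[OF i(6)] by (simp only: i(4))
  then have "Comp C (Comp C g f) (Comp C f' g') = Id C z" using comp_assoc[OF fg i(1,5)] by (simp only: i(8))
  ultimately show ?thesis using gf fg unfolding iso_arr_def by blast
qed

lemma iso_arr_ftor: "is_ftor M N F \<Longrightarrow> iso_arr M x y f \<Longrightarrow> x \<in> Obj M \<Longrightarrow> y \<in> Obj M \<Longrightarrow> iso_arr N (fobj F x) (fobj F y) (farr F f)"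
  unfolding is_ftor_def iso_arr_def by metis

lemma iso_arr_marr:
  assumes "module_category C M" "X \<in> Obj C" "iso_arr M U V f" "U \<in> Obj M" "V \<in> Obj M"
  shows "iso_arr M (mob M X U) (mob M X V) (marr M (Id C X) f)"
proof -
  interpret module_category C M by fact
  obtain g where g: "f \<in> homset M U V" "g \<in> homset M V U" "Comp M g f = Id M U" "Comp M f g = Id M V"
    using assms(3) by (auto simp: iso_arr_def)
  have i: "Id C X \<in> homset C X X" "Comp C (Id C X) (Id C X) = Id C X" using id_arr[OF assms(2)] comp_id by auto
  show ?thesis unfolding iso_arr_def
    using g marr_arr[OF i(1)] marr_comp[OF i(1) i(1) g(1,2)] marr_comp[OF i(1) i(1) g(2,1)] marr_id[OF assms(2)] assms(4,5)
    by (auto simp: i(2))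
qed

section \<open>Right modules as a module category\<close>

lemma lin_on_plus: "lin_on s uscale X f \<Longrightarrow> lin_on s uscale X g \<Longrightarrow> lin_on s uscale X (\<lambda>x. f x + g x)"
  by (simp add: lin_on_def uv.scale_right_distrib add_ac)

lemma lin_on_scaled: "lin_on s uscale X f \<Longrightarrow> lin_on s uscale X (\<lambda>x. c *\<^sub>u f x)"
  by (simp add: lin_on_def uv.scale_right_distrib mult.commute)

lemma right_moduleD:
  assumes "right_module A U"
  shows "fd (rcar U)" "u \<in> rcar U \<Longrightarrow> a \<in> acarrier A \<Longrightarrow> ract U u a \<in> rcar U"
    "a \<in> acarrier A \<Longrightarrow> ulin (rcar U) (\<lambda>u. ract U u a)"
    "u \<in> rcar U \<Longrightarrow> lin_on (ascale A) uscale (acarrier A) (ract U u)"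
    "u \<in> rcar U \<Longrightarrow> a \<in> acarrier A \<Longrightarrow> b \<in> acarrier A \<Longrightarrow> ract U u (amult A a b) = ract U (ract U u a) b"
    "u \<in> rcar U \<Longrightarrow> ract U u (aone A) = u"
  using assms by (simp_all add: right_module_def)

lemma r_tensor_act:
  assumes X: "fd X" and U: "right_module A U" and a: "a \<in> acarrier A"
  shows "(\<lambda>t. ract (r_tensor X U) t a) \<in> lin_maps (tensor_sp X (rcar U)) (tensor_sp X (rcar U))"
    and "x \<in> X \<Longrightarrow> u \<in> rcar U \<Longrightarrow> ract (r_tensor X U) (x \<otimes> u) a = x \<otimes> ract U u a"
proof -
  note U' = right_moduleD[OF U]
  have b: "ubilin X (rcar U) (\<lambda>x u. x \<otimes> ract U u a)"
    by (rule bilin_kron_maps[OF _ U'(3)[OF a]]) (simp add: lin_on_def)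
  show "(\<lambda>t. ract (r_tensor X U) t a) \<in> lin_maps (tensor_sp X (rcar U)) (tensor_sp X (rcar U))"
    unfolding r_tensor_def rmod.simps using tensor_lift_lin_maps[OF X U'(1) b tensor_sp_subspace] U'(2)[OF _ a] pure_in by blast
  show "x \<in> X \<Longrightarrow> u \<in> rcar U \<Longrightarrow> ract (r_tensor X U) (x \<otimes> u) a = x \<otimes> ract U u a"
    unfolding r_tensor_def rmod.simps by (rule tensor_lift_pure[OF X U'(1) b])
qed

lemma r_tensor_car: "rcar (r_tensor X U) = tensor_sp X (rcar U)"
  by (simp add: r_tensor_def)

lemma right_module_r_tensor:
  assumes A: "k_algebra A" and X: "fd X" and U: "right_module A U"
  shows "right_module A (r_tensor X U)"
proof -
  note U' = right_moduleD[OF U] and u = vs_u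
  note l = r_tensor_act[OF X U]
  have A': "vector_space (ascale A)" "module.subspace (ascale A) (acarrier A)" "aone A \<in> acarrier A"
    "\<And>a b. a \<in> acarrier A \<Longrightarrow> b \<in> acarrier A \<Longrightarrow> amult A a b \<in> acarrier A"
    using A by (auto simp: k_algebra_def)
  interpret A: vector_space "ascale A" by (rule A'(1))
  have ext: "f t = g t" if "ulin (tensor_sp X (rcar U)) f" "ulin (tensor_sp X (rcar U)) g"
    "t \<in> tensor_sp X (rcar U)" "\<And>x u. x \<in> X \<Longrightarrow> u \<in> rcar U \<Longrightarrow> f (x \<otimes> u) = g (x \<otimes> u)" for f g t
    by (rule lin_on_eq_on_span[OF u u, of "{x \<otimes> u |x u. x \<in> X \<and> u \<in> rcar U}"]) (use that in \<open>auto simp: tensor_sp_span\<close>)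
  show ?thesis
    unfolding right_module_def r_tensor_car
  proof (intro conjI ballI)
    show "fd (tensor_sp X (rcar U))" by (rule fin_dim_tensor_sp[OF X U'(1)])
    fix t assume t: "t \<in> tensor_sp X (rcar U)"
    show "lin_on (ascale A) uscale (acarrier A) (ract (r_tensor X U) t)"
    proof (rule lin_onI)
      fix a b assume ab: "a \<in> acarrier A" "b \<in> acarrier A"
      note s = A.subspace_add[OF A'(2) ab]
      show "ract (r_tensor X U) t (a + b) = ract (r_tensor X U) t a + ract (r_tensor X U) t b"
        by (rule ext[OF lin_mapsD(1)[OF l(1)[OF s]] lin_on_plus[OF lin_mapsD(1)[OF l(1)] lin_mapsD(1)[OF l(1)]]
              t, OF ab]) (simp only: l(2) s ab lin_onD(1)[OF U'(4)] kron_right)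
    next
      fix c a assume a: "a \<in> acarrier A"
      note s = A.subspace_scale[OF A'(2) a]
      show "ract (r_tensor X U) t (ascale A c a) = c *\<^sub>u ract (r_tensor X U) t a"
        by (rule ext[OF lin_mapsD(1)[OF l(1)[OF s]] lin_on_scaled[OF lin_mapsD(1)[OF l(1)]] t, OF a])
          (simp only: l(2) s a lin_onD(2)[OF U'(4)] kron_right)
    qed
    show "ract (r_tensor X U) t (aone A) = t"
      by (rule ext[OF lin_mapsD(1)[OF l(1)[OF A'(3)]], of "\<lambda>t. t"]) (simp_all add: l(2)[OF A'(3)] U'(6) t lin_on_def)
    fix a assume a: "a \<in> acarrier A"
    show "ract (r_tensor X U) t a \<in> tensor_sp X (rcar U)" by (rule lin_mapsD(2)[OF l(1)[OF a] t])
    fix b assume b: "b \<in> acarrier A"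
    show "ract (r_tensor X U) t (amult A a b) = ract (r_tensor X U) (ract (r_tensor X U) t a) b"
      by (rule ext[OF lin_mapsD(1)[OF l(1)[OF A'(4)[OF a b]]]
            lin_mapsD(1)[OF lin_maps_comp[OF l(1)[OF a] l(1)[OF b] tensor_sp_subspace, unfolded comp_def]] t])
        (simp only: l(2) A'(4) a b U'(2,5))
  qed (rule lin_mapsD(1)[OF l(1)])
qed

lemma op_category_Mod:
  assumes A: "k_algebra A"
  shows "op_category {U. right_module A U} rcar (acarrier A) (\<lambda>U a u. ract U u a) (r_hom A) r_tensor"
  by unfold_locales
    (auto simp: right_moduleD r_hom_def r_tensor_car r_tensor_act intro: right_module_r_tensor[OF A])

section \<open>The two functors on objects\<close>

context hd_free
begin

abbreviation "FO V \<equiv> Hom_obj H D P V"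
abbreviation "GO U \<equiv> Tensor_obj H D A P U"
abbreviation "e V \<equiv> hom_emb H D P V"
abbreviation "ei V \<equiv> hom_inv H D P V"
abbreviation "rm U \<equiv> right_module A U"
abbreviation "b U u p \<equiv> bal_map A P U (u \<otimes> p)"

lemma FO_car: "rcar (FO V) = e V ` hom P V"
  by (simp add: Hom_obj_def)

lemma e_emb: "hdm V \<Longrightarrow> emb fscale (hom P V) (e V)"
  by (rule emb_embed[OF vs_f hom_fd[OF hdm_P]])

lemma ei_e: "hdm V \<Longrightarrow> f \<in> hom P V \<Longrightarrow> ei V (e V f) = f"
  by (rule inv_into_f_f[OF embD(5)[OF e_emb]])

lemma e_in: "f \<in> hom P V \<Longrightarrow> e V f \<in> rcar (FO V)"
  by (simp add: FO_car)

lemma FO_act: "hdm V \<Longrightarrow> f \<in> hom P V \<Longrightarrow> ract (FO V) (e V f) a = e V (f \<circ> a)"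
  by (simp add: Hom_obj_def ei_e)

definition hom_lift :: "('k, 'h) hdmod \<Rightarrow> (('k univ \<Rightarrow> 'k univ) \<Rightarrow> 'k univ) \<Rightarrow> 'k univ \<Rightarrow> 'k univ"
  where "hom_lift V g u = (if u \<in> rcar (FO V) then g (ei V u) else 0)"

lemma hom_lift_e: "hdm V \<Longrightarrow> f \<in> hom P V \<Longrightarrow> hom_lift V g (e V f) = g f"
  by (simp add: hom_lift_def e_in ei_e)

lemma hom_lift_lin_maps:
  assumes V: "hdm V" and g: "lin_on fscale uscale (hom P V) g" "\<And>f. f \<in> hom P V \<Longrightarrow> g f \<in> Z"
  shows "hom_lift V g \<in> lin_maps (rcar (FO V)) Z"
proof -
  note l = embD(4)[OF e_emb[OF V]] and s = embD(3)[OF e_emb[OF V]]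
  have "ulin (rcar (FO V)) (hom_lift V g)"
  proof (rule lin_onI)
    fix x y assume "x \<in> rcar (FO V)" "y \<in> rcar (FO V)"
    then obtain f f' where f: "f \<in> hom P V" "x = e V f" "f' \<in> hom P V" "y = e V f'" by (auto simp: FO_car)
    have "hom_lift V g (e V (f + f')) = g f + g f'"
      using hom_lift_e[OF V fv.subspace_add[OF s f(1,3)]] lin_onD(1)[OF g(1) f(1,3)] by (simp only:)
    then show "hom_lift V g (x + y) = hom_lift V g x + hom_lift V g y"
      by (simp only: lin_onD(1)[OF l f(1,3)] f(2,4) hom_lift_e[OF V f(1)] hom_lift_e[OF V f(3)])
  next
    fix c x assume "x \<in> rcar (FO V)"
    then obtain f where f: "f \<in> hom P V" "x = e V f" by (auto simp: FO_car)
    have "hom_lift V g (e V (fscale c f)) = c *\<^sub>u g f"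
      using hom_lift_e[OF V fv.subspace_scale[OF s f(1)]] lin_onD(2)[OF g(1) f(1)] by (simp only:)
    then show "hom_lift V g (c *\<^sub>u x) = c *\<^sub>u hom_lift V g x"
      by (simp only: lin_onD(2)[OF l f(1)] f(2) hom_lift_e[OF V f(1)])
  qed
  moreover have "hom_lift V g x \<in> Z" if "x \<in> rcar (FO V)" for x
    using that g(2) hom_lift_e[OF V] by (auto simp: FO_car)
  ultimately show ?thesis by (auto simp: lin_maps_def hom_lift_def)
qed

lemma rm_FO:
  assumes V: "hdm V"
  shows "rm (FO V)"
proof -
  note P = hdm_P and cl = hom_comp_lin[OF hdm_P hdm_P V] and cmp = hom_compose[OF hdm_P hdm_P V]
  note l = embD(4)[OF e_emb[OF V]]
  have act: "ulin (rcar (FO V)) (\<lambda>u. ract (FO V) u a)" if a: "a \<in> hom P P" for a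
  proof (rule lin_on_cong[OF _ vs_u])
    show "usub (rcar (FO V))" unfolding FO_car
      by (rule subspace_image[OF vs_f vs_u hom_subspace[OF P V] l])
    have "lin_on fscale uscale (hom P V) (\<lambda>f. e V (f \<circ> a))"
      by (rule lin_comp[OF cl(2) l]) (use cmp[OF a] in blast)
    then show "ulin (rcar (FO V)) (hom_lift V (\<lambda>f. e V (f \<circ> a)))"
      by (rule lin_mapsD(1)[OF hom_lift_lin_maps[OF V _, where Z = UNIV]]) simp
    show "\<And>x. x \<in> rcar (FO V) \<Longrightarrow> ract (FO V) x a = hom_lift V (\<lambda>f. e V (f \<circ> a)) x"
      by (auto simp: FO_car FO_act[OF V] hom_lift_e[OF V])
  qed
  have arg: "lin_on fscale uscale (hom P P) (ract (FO V) (e V f))" if f: "f \<in> hom P V" for f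
    unfolding FO_act[OF V f] by (rule lin_comp[OF cl(1)[OF f] l]) (use cmp[OF _ f] in blast)
  show ?thesis
    unfolding right_module_def A_sel
    using fin_dim_image[OF vs_f vs_u hom_fd[OF P V] l] act arg cmp lin_maps_id(1)[OF homD(1)]
    by (auto simp: FO_car FO_act[OF V] FO_act[OF V cmp] comp_assoc)
qed

definition balanced :: "('k, 'k univ \<Rightarrow> 'k univ) rmod \<Rightarrow> ('k univ \<Rightarrow> 'k univ \<Rightarrow> 'k univ) \<Rightarrow> bool"
  where "balanced U f \<longleftrightarrow> ubilin (rcar U) (hdcar P) f \<and>
    (\<forall>u\<in>rcar U. \<forall>a\<in>hom P P. \<forall>p\<in>hdcar P. f (ract U u a) p = f u (a p))"

context
  fixes U assumes U: "rm U"
begin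

lemmas U' = right_moduleD[OF U, unfolded A_sel]

abbreviation (input) "UP \<equiv> tensor_sp (rcar U) (hdcar P)"

lemma bal_rel_sub: "usub (bal_rel A P U)" "bal_rel A P U \<subseteq> UP"
proof -
  show "usub (bal_rel A P U)" by (simp add: bal_rel_def)
  show "bal_rel A P U \<subseteq> UP" unfolding bal_rel_def A_sel
    by (rule uv.span_minimal) (use U'(2) homD(3) in \<open>force intro: uv.subspace_diff\<close>, simp)
qed

lemmas bal_spec = quot_map_spec[OF vs_u fin_dim_tensor_sp[OF U'(1) P_fd] bal_rel_sub]

lemma GO_car: "hdcar (GO U) = bal_map A P U ` UP"
  by (simp add: Tensor_obj_def)

lemma b_in: "u \<in> rcar U \<Longrightarrow> p \<in> hdcar P \<Longrightarrow> b U u p \<in> hdcar (GO U)"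
  by (auto simp: GO_car)

lemma GO_fd: "fd (hdcar (GO U))"
  unfolding GO_car by (rule fin_dim_image[OF vs_u vs_u fin_dim_tensor_sp[OF U'(1) P_fd] bal_spec(1)])

lemma GO_span:
  assumes Z: "rcar U = uv.span Z"
  shows "hdcar (GO U) = uv.span {b U u p |u p. u \<in> Z \<and> p \<in> hdcar P}"
proof
  note u = vs_u
  have ZU: "Z \<subseteq> rcar U" unfolding Z by (rule uv.span_superset)
  have *: "UP = uv.span {u \<otimes> p |u p. u \<in> Z \<and> p \<in> hdcar P}"
    by (rule tensor_sp_span_gen[OF Z subspace_span_self[OF P_sub]])
  have "bal_map A P U t \<in> uv.span {b U u p |u p. u \<in> Z \<and> p \<in> hdcar P}" if "t \<in> UP" for t
  proof (rule lin_on_span_in[OF u u, where G = "{u \<otimes> p |u p. u \<in> Z \<and> p \<in> hdcar P}" and f = "bal_map A P U" and x = t])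
    show "ulin (uv.span {u \<otimes> p |u p. u \<in> Z \<and> p \<in> hdcar P}) (bal_map A P U)"
      by (rule lin_on_subset[OF bal_spec(1) equalityD1[OF *[symmetric]]])
    show "bal_map A P U x \<in> uv.span {b U u p |u p. u \<in> Z \<and> p \<in> hdcar P}"
      if "x \<in> {u \<otimes> p |u p. u \<in> Z \<and> p \<in> hdcar P}" for x
      by (rule uv.span_base) (use that in blast)
  qed (use that * in auto)
  then show "hdcar (GO U) \<subseteq> uv.span {b U u p |u p. u \<in> Z \<and> p \<in> hdcar P}" unfolding GO_car by blast
  show "uv.span {b U u p |u p. u \<in> Z \<and> p \<in> hdcar P} \<subseteq> hdcar (GO U)"
    by (rule uv.span_minimal) (use b_in ZU fd_usub[OF GO_fd] in blast)+
qed

lemma b_bilin: "ubilin (rcar U) (hdcar P) (b U)"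
  unfolding bilin_def using bal_spec(1)
  by (auto intro!: lin_comp[where g = "bal_map A P U" and Y = UP and s' = uscale] lin_on_subset[OF lin_kron(1)] lin_on_subset[OF lin_kron(2)])

lemma b_balanced: "balanced U (b U)"
  unfolding balanced_def
proof (intro conjI ballI)
  fix u a p assume *: "u \<in> rcar U" "a \<in> hom P P" "p \<in> hdcar P"
  have m: "ract U u a \<otimes> p \<in> UP" "u \<otimes> a p \<in> UP" using * U'(2) homD(3) by auto
  have "ract U u a \<otimes> p - u \<otimes> a p \<in> bal_rel A P U" unfolding bal_rel_def A_sel by (rule uv.span_base) (use * in blast)
  then have "bal_map A P U (ract U u a \<otimes> p - u \<otimes> a p) = 0"
    using bal_spec(2) bal_rel_sub(2) by blast
  then show "b U (ract U u a) p = b U u (a p)"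
    unfolding lin_on_diff[OF vs_u vs_u tensor_sp_subspace bal_spec(1) m] by (rule right_minus_eq[THEN iffD1])
qed (rule b_bilin)

text \<open>
  The universal property of \<open>U \<otimes>\<^sub>A P\<close>.  The linear extension of \<open>f\<close> to \<open>U \<otimes> P\<close> vanishes on the relations, so its
  value does not depend on the chosen preimage.
\<close>

lemma sweedler_balanced:
  assumes f: "balanced U f"
  shows "ulin (hdcar (GO U)) (\<lambda>y. sweedler (\<otimes>) (rcar U) (hdcar P) (bal_rep A P U y) f)" (is "lin_on _ _ _ ?g")
    and "u \<in> rcar U \<Longrightarrow> p \<in> hdcar P \<Longrightarrow> sweedler (\<otimes>) (rcar U) (hdcar P) (bal_rep A P U (b U u p)) f = f u p"
proof -
  note v = vs_u and e = emb_id[OF U'(1)] emb_id[OF P_fd]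
  let ?q = "bal_map A P U" and ?L = "\<lambda>t. sweedler (\<otimes>) (rcar U) (hdcar P) t f"
  have f': "ubilin (rcar U) (hdcar P) f" using f by (simp add: balanced_def)
  have L: "ulin UP ?L" by (rule lin_sweedler_arg[OF e v f'])
  have pure: "?L (u \<otimes> p) = f u p" if "u \<in> rcar U" "p \<in> hdcar P" for u p by (rule sweedler_pure[OF e v f' that])
  have N: "?L t = 0" if t: "t \<in> bal_rel A P U" for t
  proof -
    let ?B = "{ract U u a \<otimes> p - u \<otimes> a p |u a p. u \<in> rcar U \<and> a \<in> acarrier A \<and> p \<in> hdcar P}"
    have B: "bal_rel A P U = uv.span ?B" by (simp only: bal_rel_def)
    show ?thesis
    proof (rule lin_on_eq_on_span[OF v v, where S = ?B and f = ?L and g = "\<lambda>_. 0"])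
      show "ulin (uv.span ?B) ?L" using lin_on_subset[OF L bal_rel_sub(2)] unfolding B .
      show "ulin (uv.span ?B) (\<lambda>_. 0)" by (rule lin_onI) (simp_all only: add_0 uv.scale_zero_right)
      show "t \<in> uv.span ?B" using t unfolding B .
      fix y assume "y \<in> ?B"
      then obtain u a p where y: "y = ract U u a \<otimes> p - u \<otimes> a p" "u \<in> rcar U" "a \<in> hom P P" "p \<in> hdcar P"
        unfolding A_sel by blast
      have m: "ract U u a \<in> rcar U" "a p \<in> hdcar P" using y U'(2) homD(3) by auto
      have "?L y = ?L (ract U u a \<otimes> p) - ?L (u \<otimes> a p)"
        unfolding y(1) by (rule lin_on_diff[OF v v tensor_sp_subspace L]) (use y m in auto)
      also have "\<dots> = 0" using f y by (simp add: pure m balanced_def)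
      finally show "?L y = 0" .
    qed
  qed
  have rep: "bal_rep A P U (?q t) \<in> UP" "?q (bal_rep A P U (?q t)) = ?q t" if "t \<in> UP" for t
    using that by (auto simp: inv_into_into f_inv_into_f)
  have gq: "?g (?q t) = ?L t" if t: "t \<in> UP" for t
  proof -
    let ?r = "bal_rep A P U (?q t)"
    have m: "?r - t \<in> UP" by (rule uv.subspace_diff[OF tensor_sp_subspace rep(1)[OF t] t])
    have "?q (?r - t) = 0" unfolding lin_on_diff[OF v v tensor_sp_subspace bal_spec(1) rep(1)[OF t] t] rep(2)[OF t] by simp
    then have "?L (?r - t) = 0" using bal_spec(2)[OF m] N by blast
    then show ?thesis unfolding lin_on_diff[OF v v tensor_sp_subspace L rep(1)[OF t] t] by (rule right_minus_eq[THEN iffD1])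
  qed
  show "ulin (hdcar (GO U)) ?g"
    unfolding GO_car
  proof (rule lin_onI)
    fix x y assume "x \<in> ?q ` UP" "y \<in> ?q ` UP"
    then obtain t t' where t: "t \<in> UP" "x = ?q t" "t' \<in> UP" "y = ?q t'" by blast
    have "x + y = ?q (t + t')" unfolding t lin_onD(1)[OF bal_spec(1) t(1,3)] ..
    then show "?g (x + y) = ?g x + ?g y"
      using gq[OF uv.subspace_add[OF tensor_sp_subspace t(1,3)]] lin_onD(1)[OF L t(1,3)] gq[OF t(1)] gq[OF t(3)] t(2,4) by (simp only:)
  next
    fix c x assume "x \<in> ?q ` UP"
    then obtain t where t: "t \<in> UP" "x = ?q t" by blast
    have "c *\<^sub>u x = ?q (c *\<^sub>u t)" unfolding t lin_onD(2)[OF bal_spec(1) t(1)] ..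
    then show "?g (c *\<^sub>u x) = c *\<^sub>u ?g x"
      using gq[OF uv.subspace_scale[OF tensor_sp_subspace t(1)]] lin_onD(2)[OF L t(1)] gq[OF t(1)] t(2) by (simp only:)
  qed
  show "u \<in> rcar U \<Longrightarrow> p \<in> hdcar P \<Longrightarrow> ?g (b U u p) = f u p" using gq pure by simp
qed

end

definition bal_lift :: "('k, 'k univ \<Rightarrow> 'k univ) rmod \<Rightarrow> ('k univ \<Rightarrow> 'k univ \<Rightarrow> 'k univ) \<Rightarrow> 'k univ \<Rightarrow> 'k univ"
  where "bal_lift U f y = (if y \<in> hdcar (GO U) then sweedler (\<otimes>) (rcar U) (hdcar P) (bal_rep A P U y) f else 0)"

lemma bal_lift_b:
  assumes "rm U" "balanced U f" "u \<in> rcar U" "p \<in> hdcar P"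
  shows "bal_lift U f (b U u p) = f u p"
  using b_in[OF assms(1,3,4)] sweedler_balanced(2)[OF assms] by (simp add: bal_lift_def)

lemma bal_lift_lin_maps:
  assumes U: "rm U" and f: "balanced U f" and Z: "usub Z" "\<And>u p. u \<in> rcar U \<Longrightarrow> p \<in> hdcar P \<Longrightarrow> f u p \<in> Z"
  shows "bal_lift U f \<in> lin_maps (hdcar (GO U)) Z"
proof -
  note v = vs_u
  have s: "rcar U = uv.span (rcar U)" by (rule subspace_span_self[OF fd_usub[OF right_moduleD(1)[OF U]]])
  have l: "ulin (hdcar (GO U)) (bal_lift U f)"
    by (rule lin_on_cong[OF fd_usub[OF GO_fd[OF U]] v _ sweedler_balanced(1)[OF U f]]) (simp add: bal_lift_def)
  have "bal_lift U f y \<in> Z" if y: "y \<in> hdcar (GO U)" for y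
    by (rule lin_on_span_in[OF v v l[unfolded GO_span[OF U s]] Z(1)])
      (use bal_lift_b[OF U f] Z(2) y[unfolded GO_span[OF U s]] in auto)
  then show ?thesis using l by (auto simp: lin_maps_def bal_lift_def)
qed

lemma GO_struct:
  assumes U: "rm U"
  shows "ulin (hdcar (GO U)) (hdact (GO U) h)" "ulin (hdcar (GO U)) (hdcoact (GO U))"
    and "u \<in> rcar U \<Longrightarrow> p \<in> hdcar P \<Longrightarrow> hdact (GO U) h (b U u p) = b U u (hdact P h p)"
    and "u \<in> rcar U \<Longrightarrow> p \<in> hdcar P \<Longrightarrow> hdcoact (GO U) (b U u p) = coV P p (\<lambda>d p'. utens H d (b U u p'))"
proof -
  note v = vs_u and P = hdm_P and U' = right_moduleD[OF U, unfolded A_sel]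
  note bl = b_bilin[OF U, unfolded bilin_def] and bb = b_balanced[OF U, unfolded balanced_def]
  let ?f = "\<lambda>u p. u \<otimes> hdact P h p" and ?UP = "tensor_sp (rcar U) (hdcar P)"
  let ?g = "\<lambda>u p. b U u (hdact P h p)"
  have g: "balanced U ?g"
    unfolding balanced_def bilin_def
  proof (intro conjI ballI)
    show "ulin (rcar U) (\<lambda>u. ?g u p)" if "p \<in> hdcar P" for p
      using bl hdm_facts(3)[OF P that] by blast
    show "ulin (hdcar P) (?g u)" if "u \<in> rcar U" for u
      by (rule lin_comp[OF hdm_facts(4)[OF P] bspec[OF conjunct2[OF bl] that]]) (use hdm_facts(3)[OF P] in blast)
    show "?g (ract U u a) p = ?g u (a p)" if "u \<in> rcar U" "a \<in> hom P P" "p \<in> hdcar P" for u a p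
      using bb that hdm_facts(3)[OF P that(3)] homD(4)[OF that(2,3)] by simp
  qed
  have "bal_rep A P U y \<in> ?UP" if "y \<in> hdcar (GO U)" for y
    using that unfolding GO_car[OF U] by (rule inv_into_into)
  then have act: "hdact (GO U) h y = sweedler (\<otimes>) (rcar U) (hdcar P) (bal_rep A P U y) ?g" if "y \<in> hdcar (GO U)" for y
    unfolding Tensor_obj_def hdmod.simps
    by (rule sweedler_lin_on[OF emb_id[OF U'(1)] emb_id[OF P_fd] v v tensor_sp_subspace bal_spec(1)[OF U]])
      (use that hdm_facts(3)[OF P] GO_car[OF U] in auto)
  show "ulin (hdcar (GO U)) (hdact (GO U) h)"
    by (rule lin_on_cong[OF fd_usub[OF GO_fd[OF U]] v act sweedler_balanced(1)[OF U g]])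
  show "u \<in> rcar U \<Longrightarrow> p \<in> hdcar P \<Longrightarrow> hdact (GO U) h (b U u p) = ?g u p"
    using act[OF b_in[OF U]] sweedler_balanced(2)[OF U g] by simp
  let ?k = "\<lambda>u p. coV P p (\<lambda>d p'. utens H d (b U u p'))"
  have K: "bilin hs D uscale (hdcar P) uscale (\<lambda>d p'. utens H d (b U u p'))" if u: "u \<in> rcar U" for u
  proof (rule bilinI)
    show "lin_on hs uscale D (\<lambda>d. utens H d (b U u p'))" for p'
      by (rule lin_comp[OF lin_on_subset[OF embD(4)[OF embH] subset_UNIV] lin_kron(1)]) simp
    show "ulin (hdcar P) (\<lambda>p'. utens H d (b U u p'))" for d
      by (rule lin_comp[OF bspec[OF conjunct2[OF bl] u] lin_kron(2)]) simp
  qed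
  have k: "balanced U ?k"
    unfolding balanced_def bilin_def
  proof (intro conjI ballI)
    fix u assume u: "u \<in> rcar U"
    show "ulin (hdcar P) (?k u)" by (rule co_P_lin[OF v K[OF u]])
    show "?k (ract U u a) p = ?k u (a p)" if a: "a \<in> hom P P" and p: "p \<in> hdcar P" for a p
    proof -
      have "?k u (a p) = coV P p (\<lambda>d p'. utens H d (b U u (a p')))" by (rule hom_co[OF P P a p v K[OF u]])
      also have "\<dots> = ?k (ract U u a) p"
        by (rule sweedler_cong[OF eD eP P_coact_in[OF p]]) (use bb u a in simp)
      finally show ?thesis ..
    qed
  next
    fix p assume p: "p \<in> hdcar P"
    show "ulin (rcar U) (\<lambda>u. ?k u p)"
    proof (rule lin_on_sweedler_in[OF eD eP v P_coact_in[OF p]])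
      fix d p' assume "p' \<in> hdcar P"
      then show "ulin (rcar U) (\<lambda>u. utens H d (b U u p'))"
        by (intro lin_comp[OF bspec[OF conjunct1[OF bl]] lin_kron(2)]) simp_all
    qed
  qed
  have "hdcoact (GO U) = (\<lambda>y. sweedler (\<otimes>) (rcar U) (hdcar P) (bal_rep A P U y) ?k)" by (simp add: Tensor_obj_def)
  then show "ulin (hdcar (GO U)) (hdcoact (GO U))"
    and "u \<in> rcar U \<Longrightarrow> p \<in> hdcar P \<Longrightarrow> hdcoact (GO U) (b U u p) = ?k u p"
    using sweedler_balanced[OF U k] by (simp_all only:)
qed

definition \<beta> :: "('k, 'k univ \<Rightarrow> 'k univ) rmod \<Rightarrow> 'k univ \<Rightarrow> 'k univ \<Rightarrow> 'k univ"
  where "\<beta> U u p = (if p \<in> hdcar P then b U u p else 0)"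

lemma hdm_GO:
  assumes U: "rm U"
  shows "hdm (GO U)"
proof (rule hdm_generated[OF GO_fd[OF U] GO_struct(1,2)[OF U] GO_span[OF U subspace_span_self[OF fd_usub[OF right_moduleD(1)[OF U]]]]])
  fix y assume "y \<in> {b U u p |u p. u \<in> rcar U \<and> p \<in> hdcar P}"
  then obtain u p where y: "y = b U u p" "u \<in> rcar U" "p \<in> hdcar P" by blast
  have "premor P (GO U) (b U u)"
    using b_bilin[OF U] b_in[OF U y(2)] GO_struct(3,4)[OF U y(2)] y(2) by (auto simp: premor_def bilin_def)
  then show "\<exists>V f v. hdm V \<and> v \<in> hdcar V \<and> y = f v \<and> premor V (GO U) f"
    by (intro exI[of _ P] exI[of _ "b U u"] exI[of _ p] conjI hdm_P y(1,3))
qed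

lemma \<beta>_hom:
  assumes U: "rm U" and u: "u \<in> rcar U"
  shows "\<beta> U u \<in> hom P (GO U)"
proof (rule homI)
  note P = hdm_P
  have "ulin (hdcar P) (\<beta> U u)"
    by (rule lin_on_cong[OF P_sub vs_u]) (use b_bilin[OF U] u in \<open>auto simp: \<beta>_def bilin_def\<close>)
  then show "\<beta> U u \<in> lin_maps (hdcar P) (hdcar (GO U))" using b_in[OF U u] by (auto simp: lin_maps_def \<beta>_def)
  fix p assume p: "p \<in> hdcar P"
  show "\<beta> U u (hdact P h p) = hdact (GO U) h (\<beta> U u p)" for h
    using GO_struct(3)[OF U u p] p hdm_facts(3)[OF P p] by (simp add: \<beta>_def)
  have "hdcoact (GO U) (\<beta> U u p) = coV P p (\<lambda>d p'. utens H d (b U u p'))" using GO_struct(4)[OF U u p] p by (simp add: \<beta>_def)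
  also have "\<dots> = coV P p (\<lambda>d p'. utens H d (\<beta> U u p'))"
    by (rule sweedler_cong[OF eD eP P_coact_in[OF p]]) (simp add: \<beta>_def)
  finally show "hdcoact (GO U) (\<beta> U u p) = coV P p (\<lambda>d p'. utens H d (\<beta> U u p'))" .
qed

section \<open>The functors and their module structures\<close>

interpretation HC: op_category "{V. hdm V}" hdcar UNIV hdop "hd_hom H D" "hd_tensor H D" by (rule op_category_HD)
interpretation MC: op_category "{U. rm U}" rcar "acarrier A" "\<lambda>U a u. ract U u a" "r_hom A" r_tensor
  by (rule op_category_Mod[OF A_algebra])

abbreviation "HX X V \<equiv> hd_tensor H D X V"

lemma hom_val: "hdm V \<Longrightarrow> k \<in> hom P V \<Longrightarrow> k p \<in> hdcar V"
  by (cases "p \<in> hdcar P") (metis homD(3), metis homD(6) uv.subspace_0 hdm_facts(2))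

lemma HX_car: "hdcar (HX X V) = tensor_sp X (hdcar V)"
  by (simp add: hd_tensor_def)

lemma rm_sub: "rm U \<Longrightarrow> usub (rcar U)"
  using fd_usub right_moduleD(1) by blast

lemma FO_sub: "hdm V \<Longrightarrow> usub (rcar (FO V))"
  using rm_sub rm_FO by blast

lemma r_homD: "f \<in> r_hom A U U' \<Longrightarrow> f \<in> lin_maps (rcar U) (rcar U')"
  "f \<in> r_hom A U U' \<Longrightarrow> u \<in> rcar U \<Longrightarrow> a \<in> hom P P \<Longrightarrow> f (ract U u a) = ract U' (f u) a"
  by (simp_all add: r_hom_def)

lemma r_homI:
  assumes "f \<in> lin_maps (rcar U) (rcar U')" "\<And>u a. u \<in> rcar U \<Longrightarrow> a \<in> hom P P \<Longrightarrow> f (ract U u a) = ract U' (f u) a"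
  shows "f \<in> r_hom A U U'"
  using assms by (simp add: r_hom_def)

lemma e_lin: "hdm V \<Longrightarrow> lin_on fscale uscale (hom P V) (e V)"
  by (rule embD(4)[OF e_emb])

lemma FO_elem: "u \<in> rcar (FO V) \<Longrightarrow> (\<And>k. k \<in> hom P V \<Longrightarrow> u = e V k \<Longrightarrow> thesis) \<Longrightarrow> thesis"
  unfolding FO_car by blast

definition Fm :: "('k, 'h) hdmod \<Rightarrow> ('k, 'h) hdmod \<Rightarrow> ('k univ \<Rightarrow> 'k univ) \<Rightarrow> 'k univ \<Rightarrow> 'k univ"
  where "Fm V V' \<phi> = hom_lift V (\<lambda>f. e V' (\<phi> \<circ> f))"

lemma farr_F: "farr (Hom_ftor H D P) (marr_of V V' \<phi>) = marr_of (FO V) (FO V') (Fm V V' \<phi>)"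
  by (simp add: Hom_ftor_def Fm_def hom_lift_def fun_eq_iff)

lemma Fm_e: "hdm V \<Longrightarrow> k \<in> hom P V \<Longrightarrow> Fm V V' \<phi> (e V k) = e V' (\<phi> \<circ> k)"
  by (simp add: Fm_def hom_lift_e)

lemma Fm_hom:
  assumes V: "hdm V" "hdm V'" and \<phi>: "\<phi> \<in> hom V V'"
  shows "Fm V V' \<phi> \<in> r_hom A (FO V) (FO V')"
proof (rule r_homI)
  note c = hom_compose[OF hdm_P V _ \<phi>] and c' = hom_compose[OF hdm_P hdm_P V(1)]
  show "Fm V V' \<phi> \<in> lin_maps (rcar (FO V)) (rcar (FO V'))"
    unfolding Fm_def
    by (rule hom_lift_lin_maps[OF V(1) lin_comp[OF hom_comp_lin(1)[OF hdm_P V \<phi>] e_lin[OF V(2)]] e_in]) (use c in auto)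
  fix u a assume "u \<in> rcar (FO V)" and a: "a \<in> hom P P"
  then obtain k where k: "k \<in> hom P V" "u = e V k" by (blast elim: FO_elem)
  show "Fm V V' \<phi> (ract (FO V) u a) = ract (FO V') (Fm V V' \<phi> u) a"
    by (simp only: k FO_act[OF V(1) k(1)] Fm_e[OF V(1) k(1)] Fm_e[OF V(1) c'[OF a k(1)]] FO_act[OF V(2) c[OF k(1)]] comp_assoc)
qed

lemma pt_hom:
  assumes X: "fd X" and V: "hdm V" and x: "x \<in> X" and k: "k \<in> hom P V"
  shows "(\<lambda>p. x \<otimes> k p) \<in> hom P (HX X V)"
  unfolding hom_ops[OF hdm_P hdm_hd_tensor[OF X V]]
proof (intro CollectI conjI ballI)
  show "(\<lambda>p. x \<otimes> k p) \<in> lin_maps (hdcar P) (hdcar (HX X V))"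
    unfolding lin_maps_def HX_car
    using lin_comp[OF homD(2)[OF k] lin_kron(2)] hom_val[OF V k] homD(6)[OF k] kron_right(3) x by auto
  fix j p assume "p \<in> hdcar P"
  then have "k (hdop P j p) = hdop V j (k p)" using k unfolding hom_ops[OF hdm_P V] by blast
  then show "x \<otimes> k (hdop P j p) = hdop (HX X V) j (x \<otimes> k p)"
    using HC.act_op[OF X _ _ x hom_val[OF V k]] V by simp
qed

abbreviation "RX X U \<equiv> r_tensor X U"

lemma rm_RX: "fd X \<Longrightarrow> rm U \<Longrightarrow> rm (RX X U)"
  by (rule right_module_r_tensor[OF A_algebra])

lemma bal_lift_hom_gen:
  assumes U: "rm U" and V: "hdm V" and f: "balanced U f" and Z: "rcar U = uv.span Z"
    and i: "\<And>u p. u \<in> rcar U \<Longrightarrow> p \<in> hdcar P \<Longrightarrow> f u p \<in> hdcar V"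
    and k: "\<And>u. u \<in> Z \<Longrightarrow> \<exists>k\<in>hom P V. \<forall>p\<in>hdcar P. f u p = k p"
  shows "bal_lift U f \<in> hom (GO U) V"
proof (rule HC.hm_genI[OF _ _ _ GO_span[OF U Z]])
  show "bal_lift U f \<in> lin_maps (hdcar (GO U)) (hdcar V)" by (rule bal_lift_lin_maps[OF U f hdm_facts(2)[OF V] i])
  fix j y assume "y \<in> {b U u p |u p. u \<in> Z \<and> p \<in> hdcar P}"
  then obtain u p where y: "y = b U u p" "u \<in> Z" "p \<in> hdcar P" by blast
  have u: "u \<in> rcar U" using y(2) Z uv.span_superset by blast
  obtain k' where k': "k' \<in> hom P V" "\<And>p. p \<in> hdcar P \<Longrightarrow> f u p = k' p" using k[OF y(2)] by blast
  note h = hom_ops[OF hdm_P hdm_GO[OF U]] hom_ops[OF hdm_P V] and jp = hdop_in[OF hdm_P y(3)]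
  have "\<beta> U u (hdop P j p) = hdop (GO U) j (\<beta> U u p)" using \<beta>_hom[OF U u] y(3) unfolding h by blast
  then have "hdop (GO U) j y = b U u (hdop P j p)" using y jp by (simp add: \<beta>_def)
  moreover have "k' (hdop P j p) = hdop V j (k' p)" using k'(1) y(3) unfolding h by blast
  ultimately show "bal_lift U f (hdop (GO U) j y) = hdop V j (bal_lift U f y)"
    using y u jp by (simp add: bal_lift_b[OF U f] k'(2))
qed (use V hdm_GO[OF U] in auto)

lemma b_lin:
  assumes "rm U"
  shows "p \<in> hdcar P \<Longrightarrow> ulin (rcar U) (\<lambda>u. b U u p)"
    and "u \<in> rcar U \<Longrightarrow> ulin (hdcar P) (b U u)"
    and "u \<in> rcar U \<Longrightarrow> a \<in> hom P P \<Longrightarrow> p \<in> hdcar P \<Longrightarrow> b U (ract U u a) p = b U u (a p)"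
  using b_balanced[OF assms] by (auto simp: balanced_def bilin_def)

lemma balancedI:
  assumes "\<And>p. p \<in> hdcar P \<Longrightarrow> ulin (rcar U) (\<lambda>u. f u p)"
    and "\<And>u. u \<in> rcar U \<Longrightarrow> ulin (hdcar P) (f u)"
    and "\<And>u a p. u \<in> rcar U \<Longrightarrow> a \<in> hom P P \<Longrightarrow> p \<in> hdcar P \<Longrightarrow> f (ract U u a) p = f u (a p)"
  shows "balanced U f"
  using assms by (auto simp: balanced_def bilin_def)

definition Gm :: "('k, 'k univ \<Rightarrow> 'k univ) rmod \<Rightarrow> ('k, 'k univ \<Rightarrow> 'k univ) rmod \<Rightarrow> ('k univ \<Rightarrow> 'k univ) \<Rightarrow> 'k univ \<Rightarrow> 'k univ"
  where "Gm U U' \<phi> = bal_lift U (\<lambda>u. b U' (\<phi> u))"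

lemma Gm:
  assumes U: "rm U" "rm U'" and \<phi>: "\<phi> \<in> r_hom A U U'"
  shows "u \<in> rcar U \<Longrightarrow> p \<in> hdcar P \<Longrightarrow> Gm U U' \<phi> (b U u p) = b U' (\<phi> u) p"
    and "Gm U U' \<phi> \<in> hom (GO U) (GO U')"
    and "farr (Tensor_ftor H D A P) (marr_of U U' \<phi>) = marr_of (GO U) (GO U') (Gm U U' \<phi>)"
proof -
  note l = lin_mapsD[OF r_homD(1)[OF \<phi>]] and u = vs_u
  note b' = b_lin[OF U(2)] and sU = subspace_span_self[OF rm_sub[OF U(1)]]
  have f: "balanced U (\<lambda>u. b U' (\<phi> u))"
  proof (rule balancedI)
    show "ulin (rcar U) (\<lambda>u. b U' (\<phi> u) p)" if "p \<in> hdcar P" for p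
      by (rule lin_comp[OF l(1) b'(1)[OF that]]) (use l(2) in blast)
  qed (use l(2) b' r_homD(2)[OF \<phi>] in simp_all)
  show "u \<in> rcar U \<Longrightarrow> p \<in> hdcar P \<Longrightarrow> Gm U U' \<phi> (b U u p) = b U' (\<phi> u) p"
    unfolding Gm_def by (rule bal_lift_b[OF U(1) f])
  show "Gm U U' \<phi> \<in> hom (GO U) (GO U')" unfolding Gm_def
    by (rule bal_lift_hom_gen[OF U(1) hdm_GO[OF U(2)] f sU b_in[OF U(2) l(2)]])
      (use \<beta>_hom[OF U(2) l(2)] in \<open>auto intro!: bexI[of _ "\<beta> U' (\<phi> _)"] simp: \<beta>_def\<close>)
  have "bal_map A P U' (sweedler (\<otimes>) (rcar U) (hdcar P) (bal_rep A P U y) (\<lambda>u p. \<phi> u \<otimes> p)) = Gm U U' \<phi> y"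
    if y: "y \<in> hdcar (GO U)" for y
  proof -
    have "bal_rep A P U y \<in> tensor_sp (rcar U) (hdcar P)" using y unfolding GO_car[OF U(1)] by (rule inv_into_into)
    from sweedler_lin_on[OF emb_id[OF right_moduleD(1)[OF U(1)]] emb_id[OF P_fd] u u tensor_sp_subspace bal_spec(1)[OF U(2)] this]
    show ?thesis using y l(2) by (simp add: Gm_def bal_lift_def)
  qed
  then show "farr (Tensor_ftor H D A P) (marr_of U U' \<phi>) = marr_of (GO U) (GO U') (Gm U U' \<phi>)"
    by (auto simp: Tensor_ftor_def fun_eq_iff Gm_def bal_lift_def)
qed

text \<open>
  The module structure \<open>t : (X \<otimes> U) \<otimes>\<^sub>A P \<rightarrow> X \<otimes> (U \<otimes>\<^sub>A P)\<close>, the reassociation of tensors.  The inverse applies the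
  functor to \<open>u \<mapsto> x \<otimes> u\<close> for each \<open>x\<close>.
\<close>

definition tm :: "'k univ set \<Rightarrow> ('k, 'k univ \<Rightarrow> 'k univ) rmod \<Rightarrow> 'k univ \<Rightarrow> 'k univ"
  where "tm X U = bal_lift (RX X U) (\<lambda>t p. sweedler (\<otimes>) X (rcar U) t (\<lambda>x u. x \<otimes> b U u p))"

lemma RX_span: "Z = uv.span G \<Longrightarrow> rm U \<Longrightarrow> rcar (RX Z U) = uv.span {x \<otimes> u |x u. x \<in> G \<and> u \<in> rcar U}"
  unfolding r_tensor_car by (rule tensor_sp_span_gen[OF _ subspace_span_self[OF rm_sub]])

lemma RX_in: "x \<in> X \<Longrightarrow> u \<in> rcar U \<Longrightarrow> x \<otimes> u \<in> rcar (RX X U)"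
  by (simp add: r_tensor_car)

lemma GO_RX_span:
  assumes "fd X" "X = uv.span G" "rm U"
  shows "hdcar (GO (RX X U)) = uv.span {b (RX X U) (x \<otimes> u) p |x u p. x \<in> G \<and> u \<in> rcar U \<and> p \<in> hdcar P}"
  unfolding GO_span[OF rm_RX[OF assms(1,3)] RX_span[OF assms(2,3)]] by (rule arg_cong[where f = "uv.span"]) blast

lemma HX_GO_span:
  assumes "fd X" "rm U"
  shows "hdcar (HX X (GO U)) = uv.span {x \<otimes> b U u p |x u p. x \<in> X \<and> u \<in> rcar U \<and> p \<in> hdcar P}"
  unfolding HX_car tensor_sp_span_gen[OF subspace_span_self[OF fd_usub[OF assms(1)]] GO_span[OF assms(2) subspace_span_self[OF rm_sub[OF assms(2)]]]]
  by (rule arg_cong[where f = "uv.span"]) blast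

lemma tm:
  assumes X: "fd X" and U: "rm U"
  shows "x \<in> X \<Longrightarrow> u \<in> rcar U \<Longrightarrow> p \<in> hdcar P \<Longrightarrow> tm X U (b (RX X U) (x \<otimes> u) p) = x \<otimes> b U u p"
    and "tm X U \<in> hom (GO (RX X U)) (HX X (GO U))"
    and "iso_arr HC.Cat (GO (RX X U)) (HX X (GO U)) (marr_of (GO (RX X U)) (HX X (GO U)) (tm X U))"
proof -
  note us = vs_u and fU = right_moduleD(1)[OF U] and e = emb_id[OF X] emb_id[OF right_moduleD(1)[OF U]]
  note R = rm_RX[OF X U] and bl = b_lin[OF U] and sX = subspace_span_self[OF fd_usub[OF X]]
  let ?f = "\<lambda>t p. sweedler (\<otimes>) X (rcar U) t (\<lambda>x u. x \<otimes> b U u p)"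
  have bi: "ubilin X (rcar U) (\<lambda>x u. x \<otimes> b U u p)" if "p \<in> hdcar P" for p
    by (rule bilin_kron_maps[OF _ bl(1)[OF that]]) (simp add: lin_on_def)
  have "ubilin (tensor_sp X (rcar U)) (hdcar P) ?f"
    by (rule sweedler_kron_bilin[OF X fU bi], assumption) (rule lin_comp[OF bl(2) lin_kron(2)], simp_all)
  then have l: "ulin (rcar (RX X U)) (\<lambda>t. ?f t p)" "ulin (hdcar P) (?f t)"
    if "p \<in> hdcar P" "t \<in> rcar (RX X U)" for t p
    using that by (auto simp: bilin_def r_tensor_car)
  have pure: "?f (x \<otimes> u) p = x \<otimes> b U u p" if "x \<in> X" "u \<in> rcar U" "p \<in> hdcar P" for x u p
    by (rule sweedler_pure[OF e us bi[OF that(3)] that(1,2)])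
  have f: "balanced (RX X U) ?f"
  proof (rule balancedI)
    fix t a p assume t: "t \<in> rcar (RX X U)" and a: "a \<in> hom P P" and p: "p \<in> hdcar P"
    have a': "a \<in> acarrier A" using a by simp
    have ap: "a p \<in> hdcar P" by (rule homD(3)[OF a p])
    note act = r_tensor_act[OF X U a']
    let ?S = "{x \<otimes> u |x u. x \<in> X \<and> u \<in> rcar U}"
    have S: "rcar (RX X U) = uv.span ?S" by (rule RX_span[OF sX U])
    show "?f (ract (RX X U) t a) p = ?f t (a p)"
    proof (rule lin_on_eq_on_span[OF us us, where f = "\<lambda>t. ?f (ract (RX X U) t a) p" and g = "\<lambda>t. ?f t (a p)" and S = ?S])
      show "ulin (uv.span ?S) (\<lambda>t. ?f (ract (RX X U) t a) p)" unfolding S[symmetric]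
        by (rule lin_comp[OF lin_mapsD(1)[OF act(1)[folded r_tensor_car]] l(1)[OF p t]])
          (use lin_mapsD(2)[OF act(1)] in \<open>auto simp: r_tensor_car\<close>)
      show "ulin (uv.span ?S) (\<lambda>t. ?f t (a p))" unfolding S[symmetric] by (rule l(1)[OF ap t])
      show "t \<in> uv.span ?S" using t unfolding S .
      fix t assume "t \<in> ?S"
      then obtain x u where x: "x \<in> X" "u \<in> rcar U" "t = x \<otimes> u" by blast
      show "?f (ract (RX X U) t a) p = ?f t (a p)"
        unfolding x(3) act(2)[OF x(1,2)] pure[OF x(1) right_moduleD(2)[OF U x(2) a'] p] pure[OF x(1,2) ap] bl(3)[OF x(2) a p] ..
    qed
  next
    show "ulin (rcar (RX X U)) (\<lambda>t. ?f t p)" if "p \<in> hdcar P" for p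
      by (rule l(1)[OF that uv.subspace_0[OF rm_sub[OF R]]])
    show "ulin (hdcar P) (?f t)" if "t \<in> rcar (RX X U)" for t
      by (rule l(2)[OF uv.subspace_0[OF P_sub] that])
  qed
  show t: "tm X U (b (RX X U) (x \<otimes> u) p) = x \<otimes> b U u p" if "x \<in> X" "u \<in> rcar U" "p \<in> hdcar P" for x u p
    unfolding tm_def using bal_lift_b[OF R f RX_in[OF that(1,2)] that(3)] pure[OF that] by simp
  show th: "tm X U \<in> hom (GO (RX X U)) (HX X (GO U))"
    unfolding tm_def
  proof (rule bal_lift_hom_gen[OF R hdm_hd_tensor[OF X hdm_GO[OF U]] f RX_span[OF sX U]])
    show "?f t p \<in> hdcar (HX X (GO U))" if "t \<in> rcar (RX X U)" "p \<in> hdcar P" for t p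
      unfolding HX_car by (rule sweedler_in[OF e us tensor_sp_subspace that(1)[unfolded r_tensor_car]]) (use b_in[OF U] that in auto)
    fix t assume "t \<in> {x \<otimes> u |x u. x \<in> X \<and> u \<in> rcar U}"
    then obtain x u where x: "x \<in> X" "u \<in> rcar U" "t = x \<otimes> u" by blast
    show "\<exists>k\<in>hom P (HX X (GO U)). \<forall>p\<in>hdcar P. ?f t p = k p"
      by (rule bexI[OF _ pt_hom[OF X hdm_GO[OF U] x(1) \<beta>_hom[OF U x(2)]]]) (use pure x in \<open>simp add: \<beta>_def\<close>)
  qed
  define ins where "ins x u = (if u \<in> rcar U then x \<otimes> u else 0)" for x u :: "'k univ"
  have ins: "ins x \<in> r_hom A U (RX X U)" if x: "x \<in> X" for x
  proof (rule r_homI)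
    have "ulin (rcar U) (ins x)"
      by (rule lin_on_cong[OF rm_sub[OF U] us _ lin_on_subset[OF lin_kron(2) subset_UNIV]]) (simp add: ins_def)
    then show "ins x \<in> lin_maps (rcar U) (rcar (RX X U))" using x by (auto simp: lin_maps_def ins_def RX_in)
    show "ins x (ract U u a) = ract (RX X U) (ins x u) a" if "u \<in> rcar U" "a \<in> hom P P" for u a
      using that r_tensor_act(2)[OF X U _ x that(1), of a] right_moduleD(2)[OF U that(1), of a] by (simp add: ins_def)
  qed
  let ?g = "\<lambda>x. Gm U (RX X U) (ins x)"
  note GU = hdm_facts(1)[OF hdm_GO[OF U]] and gl = homD[OF Gm(2)[OF U R ins]]
  have gb: "?g x (b U u p) = b (RX X U) (x \<otimes> u) p" if "x \<in> X" "u \<in> rcar U" "p \<in> hdcar P" for x u p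
    using Gm(1)[OF U R ins[OF that(1)] that(2,3)] that(2) by (simp add: ins_def)
  let ?B = "{b U u p |u p. u \<in> rcar U \<and> p \<in> hdcar P}"
  have B: "hdcar (GO U) = uv.span ?B" by (rule GO_span[OF U subspace_span_self[OF rm_sub[OF U]]])
  have gbil: "ubilin X (hdcar (GO U)) ?g"
  proof (rule bilinI)
    fix y assume y: "y \<in> hdcar (GO U)"
    show "ulin X (\<lambda>x. ?g x y)"
    proof (rule lin_onI)
      fix x x' assume x: "x \<in> X" "x' \<in> X"
      note s = uv.subspace_add[OF fd_usub[OF X] x]
      show "?g (x + x') y = ?g x y + ?g x' y"
      proof (rule lin_on_eq_on_span[OF us us gl(2)[OF s, unfolded B], where g = "\<lambda>y. ?g x y + ?g x' y"])
        show "ulin (uv.span ?B) (\<lambda>y. ?g x y + ?g x' y)" unfolding B[symmetric]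
          by (rule lin_on_plus[OF gl(2)[OF x(1)] gl(2)[OF x(2)]])
        fix y assume "y \<in> ?B"
        then obtain u p where y': "u \<in> rcar U" "p \<in> hdcar P" "y = b U u p" by blast
        show "?g (x + x') y = ?g x y + ?g x' y"
          unfolding y'(3) gb[OF s y'(1,2)] gb[OF x(1) y'(1,2)] gb[OF x(2) y'(1,2)] kron_left(1)[of x x' u]
          by (rule lin_onD(1)[OF b_lin(1)[OF R y'(2)] RX_in[OF x(1) y'(1)] RX_in[OF x(2) y'(1)]])
      qed (use y B in simp)
    next
      fix c x assume x: "x \<in> X"
      note s = uv.subspace_scale[OF fd_usub[OF X] x]
      show "?g (c *\<^sub>u x) y = c *\<^sub>u ?g x y"
      proof (rule lin_on_eq_on_span[OF us us gl(2)[OF s, unfolded B], where g = "\<lambda>y. c *\<^sub>u ?g x y"])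
        show "ulin (uv.span ?B) (\<lambda>y. c *\<^sub>u ?g x y)" unfolding B[symmetric]
          by (rule lin_on_scaled[OF gl(2)[OF x]])
        fix y assume "y \<in> ?B"
        then obtain u p where y': "u \<in> rcar U" "p \<in> hdcar P" "y = b U u p" by blast
        show "?g (c *\<^sub>u x) y = c *\<^sub>u ?g x y"
          unfolding y'(3) gb[OF s y'(1,2)] gb[OF x y'(1,2)] kron_left(2)[of c x u]
          by (rule lin_onD(2)[OF b_lin(1)[OF R y'(2)] RX_in[OF x y'(1)]])
      qed (use y B in simp)
    qed
  qed (rule gl(2))
  define ti where "ti = tensor_lift (\<otimes>) X (hdcar (GO U)) ?g"
  have ti: "ti \<in> lin_maps (hdcar (HX X (GO U))) (hdcar (GO (RX X U)))"
    unfolding ti_def HX_car by (rule tensor_lift_lin_maps[OF X GU gbil hdm_facts(2)[OF hdm_GO[OF R]] gl(3)])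
  have tib: "ti (x \<otimes> b U u p) = b (RX X U) (x \<otimes> u) p" if "x \<in> X" "u \<in> rcar U" "p \<in> hdcar P" for x u p
    unfolding ti_def using tensor_lift_pure[OF X GU gbil that(1) b_in[OF U that(2,3)]] gb[OF that] by simp
  show "iso_arr HC.Cat (GO (RX X U)) (HX X (GO U)) (marr_of (GO (RX X U)) (HX X (GO U)) (tm X U))"
    by (rule HC.iso_arr_genI[OF _ _ th ti GO_RX_span[OF X sX U] HX_GO_span[OF X U]])
      (use hdm_GO[OF R] hdm_hd_tensor[OF X hdm_GO[OF U]] in \<open>auto simp: t tib\<close>)
qed

text \<open>
  The counit \<open>Hom(P, V) \<otimes>\<^sub>A P \<rightarrow> V\<close> is evaluation.  A dual basis of \<open>V\<close> with respect to \<open>P\<close> gives the inverse.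
\<close>

definition em :: "('k, 'h) hdmod \<Rightarrow> 'k univ \<Rightarrow> 'k univ"
  where "em V = bal_lift (FO V) (ei V)"

lemma em:
  assumes V: "hdm V"
  shows "k \<in> hom P V \<Longrightarrow> p \<in> hdcar P \<Longrightarrow> em V (b (FO V) (e V k) p) = k p"
    and "em V \<in> hom (GO (FO V)) V"
    and "iso_arr HC.Cat (GO (FO V)) V (marr_of (GO (FO V)) V (em V))"
proof -
  note us = vs_u and U = rm_FO[OF V] and sU = FO_sub[OF V] and bl = b_lin[OF rm_FO[OF V]]
  have f: "balanced (FO V) (ei V)"
  proof (rule balancedI)
    fix p
    have "lin_on fscale uscale (hom P V) (\<lambda>k. k p)" by (simp add: lin_on_def fscale_apply)
    then have "ulin (rcar (FO V)) (hom_lift V (\<lambda>k. k p))"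
      by (rule lin_mapsD(1)[OF hom_lift_lin_maps[OF V, where Z = UNIV]]) simp
    then show "ulin (rcar (FO V)) (\<lambda>u. ei V u p)"
      by (rule lin_on_cong[OF sU us, rotated]) (simp add: hom_lift_def)
  qed (auto simp: FO_car ei_e[OF V] FO_act[OF V] homD(2) hom_compose[OF hdm_P hdm_P V])
  show em: "em V (b (FO V) (e V k) p) = k p" if "k \<in> hom P V" "p \<in> hdcar P" for k p
    unfolding em_def using bal_lift_b[OF U f e_in[OF that(1)] that(2)] ei_e[OF V that(1)] by simp
  show eh: "em V \<in> hom (GO (FO V)) V"
    unfolding em_def
    by (rule bal_lift_hom_gen[OF U V f subspace_span_self[OF sU]]) (auto simp: FO_car ei_e[OF V] homD(3))
  obtain fs where fs: "\<And>f g. (f, g) \<in> set fs \<Longrightarrow> f \<in> hom P V \<and> g \<in> hom V P"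
    "\<And>v. v \<in> hdcar V \<Longrightarrow> v = (\<Sum>(f, g)\<leftarrow>fs. f (g v))" by (rule dual_basis[OF V]) blast
  (* the inverse sends v to the sum of f \<otimes> g v over the dual basis *)
  define h where "h v = (if v \<in> hdcar V then \<Sum>(f, g)\<leftarrow>fs. b (FO V) (e V f) (g v) else 0)" for v
  have bin: "b (FO V) (e V f) (g v) \<in> hdcar (GO (FO V))" if "(f, g) \<in> set fs" "v \<in> hdcar V" for f g v
    by (rule b_in[OF U e_in]) (use fs(1)[OF that(1)] homD(3) that(2) in auto)
  have "ulin (hdcar V) (\<lambda>v. \<Sum>(f, g)\<leftarrow>fs. b (FO V) (e V f) (g v))"
  proof (rule lin_sum_list[OF us])
    fix q assume q: "q \<in> set fs"
    have m: "fst q \<in> hom P V" "snd q \<in> hom V P" using fs(1)[of "fst q" "snd q"] q by auto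
    have "ulin (hdcar V) (\<lambda>v. b (FO V) (e V (fst q)) (snd q v))"
      by (rule lin_comp[OF homD(2)[OF m(2)] bl(2)[OF e_in[OF m(1)]]]) (use homD(3)[OF m(2)] in blast)
    then show "ulin (hdcar V) (\<lambda>v. case q of (f, g) \<Rightarrow> b (FO V) (e V f) (g v))" by (simp add: case_prod_unfold)
  qed
  then have "ulin (hdcar V) h"
    by (rule lin_on_cong[OF hdm_facts(2)[OF V] us, rotated]) (simp add: h_def)
  moreover have "h v \<in> hdcar (GO (FO V))" if "v \<in> hdcar V" for v
    unfolding h_def if_P[OF that]
    by (rule subspace_sum_pairs[OF us hdm_facts(2)[OF hdm_GO[OF U]], where g = "\<lambda>f g. b (FO V) (e V f) (g v)"]) (rule bin[OF _ that])
  ultimately have h: "h \<in> lin_maps (hdcar V) (hdcar (GO (FO V)))" by (auto simp: lin_maps_def h_def)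
  have 1: "em V (h v) = v" if v: "v \<in> hdcar V" for v
  proof -
    have "em V (h v) = em V (\<Sum>(f, g)\<leftarrow>fs. b (FO V) (e V f) (g v))" by (simp only: h_def if_P[OF v])
    also have "\<dots> = (\<Sum>(f, g)\<leftarrow>fs. em V (b (FO V) (e V f) (g v)))"
      by (rule lin_on_sum_pairs[OF us us hdm_facts(2)[OF hdm_GO[OF U]] homD(2)[OF eh], where g = "\<lambda>f g. b (FO V) (e V f) (g v)"]) (rule bin[OF _ v])
    also have "\<dots> = (\<Sum>(f, g)\<leftarrow>fs. f (g v))"
    proof (rule sum_pairs_cong)
      fix f g assume "(f, g) \<in> set fs"
      then have "f \<in> hom P V" "g \<in> hom V P" using fs(1) by blast+
      then show "em V (b (FO V) (e V f) (g v)) = f (g v)" by (intro em homD(3)[OF _ v])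
    qed
    also have "\<dots> = v" by (rule fs(2)[OF v, symmetric])
    finally show ?thesis .
  qed
  have 2: "h (em V (b (FO V) (e V k) p)) = b (FO V) (e V k) p" if k: "k \<in> hom P V" and p: "p \<in> hdcar P" for k p
  proof -
    have gk: "g \<circ> k \<in> hom P P" "f \<circ> (g \<circ> k) \<in> hom P V" if "(f, g) \<in> set fs" for f g
      using hom_compose[OF hdm_P V hdm_P k] hom_compose[OF hdm_P hdm_P V] fs(1)[OF that] by blast+
    have "h (em V (b (FO V) (e V k) p)) = (\<Sum>(f, g)\<leftarrow>fs. b (FO V) (e V f) (g (k p)))"
      unfolding em[OF k p] h_def if_P[OF homD(3)[OF k p]] ..
    also have "\<dots> = (\<Sum>(f, g)\<leftarrow>fs. b (FO V) (e V (f \<circ> (g \<circ> k))) p)"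
    proof (rule sum_pairs_cong)
      fix f g assume m: "(f, g) \<in> set fs"
      then have "f \<in> hom P V" using fs(1) by blast
      with bl(3)[OF e_in gk(1)[OF m] p] show "b (FO V) (e V f) (g (k p)) = b (FO V) (e V (f \<circ> (g \<circ> k))) p"
        by (simp add: FO_act[OF V])
    qed
    also have "\<dots> = b (FO V) (\<Sum>(f, g)\<leftarrow>fs. e V (f \<circ> (g \<circ> k))) p"
      by (rule lin_on_sum_pairs[OF us us sU bl(1)[OF p], where g = "\<lambda>f g. e V (f \<circ> (g \<circ> k))", symmetric]) (rule e_in[OF gk(2)])
    also have "(\<Sum>(f, g)\<leftarrow>fs. e V (f \<circ> (g \<circ> k))) = e V (\<Sum>(f, g)\<leftarrow>fs. f \<circ> (g \<circ> k))"
      by (rule lin_on_sum_pairs[OF vs_f us hom_subspace[OF hdm_P V] e_lin[OF V], where g = "\<lambda>f g. f \<circ> (g \<circ> k)", symmetric]) (rule gk(2))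
    also have "(\<Sum>(f, g)\<leftarrow>fs. f \<circ> (g \<circ> k)) = k"
    proof
      fix p
      have "(\<Sum>(f, g)\<leftarrow>fs. f \<circ> (g \<circ> k)) p = (\<Sum>(f, g)\<leftarrow>fs. f (g (k p)))" by (simp add: sum_pairs_fun)
      also have "\<dots> = k p" by (rule fs(2)[OF hom_val[OF V k], symmetric])
      finally show "(\<Sum>(f, g)\<leftarrow>fs. f \<circ> (g \<circ> k)) p = k p" .
    qed
    finally show ?thesis .
  qed
  show "iso_arr HC.Cat (GO (FO V)) V (marr_of (GO (FO V)) V (em V))"
    by (rule HC.iso_arr_genI[OF _ _ eh h GO_span[OF U subspace_span_self[OF sU]] subspace_span_self[OF hdm_facts(2)[OF V]]])
      (use V hdm_GO[OF U] 1 2 in \<open>auto simp: FO_car\<close>)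
qed

text \<open>
  The unit \<open>U \<rightarrow> Hom(P, U \<otimes>\<^sub>A P)\<close> sends \<open>u\<close> to \<open>u \<otimes> _\<close>.  A morphism out of \<open>P\<close> is the average of a sum of rank one
  maps \<open>\<psi>(_) (u \<otimes> p)\<close>, and the average of such a map is \<open>u a \<otimes> _\<close>, where \<open>a\<close> is the average of \<open>\<psi>(_) p\<close>.
  This yields the inverse.
\<close>

lemma rank1_post:
  assumes \<phi>: "\<phi> \<in> lin_maps (hdcar V) (hdcar V')" and y: "y \<in> hdcar V"
  shows "rank1 X \<psi> (\<phi> y) = \<phi> \<circ> rank1 X \<psi> y"
  using lin_onD(2)[OF lin_mapsD(1)[OF \<phi>] y] lin_maps_0[OF \<phi>] by (auto simp: rank1_def fun_eq_iff)

lemma avg_rank1_lin: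
  assumes V: "hdm V" and \<psi>: "lin uscale (*) \<psi>"
  shows "lin_on uscale fscale (hdcar V) (\<lambda>y. avg P V (rank1 (hdcar P) \<psi> y))"
proof (rule lin_onI)
  note P = hdm_P and sV = hdm_facts(2)[OF V]
  note r = rank1_lin_maps[OF P_sub sV \<psi>]
  show "avg P V (rank1 (hdcar P) \<psi> (x + y)) = avg P V (rank1 (hdcar P) \<psi> x) + avg P V (rank1 (hdcar P) \<psi> y)"
    if "x \<in> hdcar V" "y \<in> hdcar V" for x y
  proof -
    have "rank1 (hdcar P) \<psi> (x + y) = rank1 (hdcar P) \<psi> x + rank1 (hdcar P) \<psi> y"
      by (auto simp: rank1_def fun_eq_iff algebra_simps)
    then show ?thesis using avg_add[OF P V r[OF that(1)] r[OF that(2)]] by (simp only:)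
  qed
  fix c y assume y: "y \<in> hdcar V"
  have id: "fscale c (id_map (hdcar V)) \<in> hom V V" by (rule fv.subspace_scale[OF hom_subspace[OF V V] hom_id[OF V]])
  have "c *\<^sub>u y = fscale c (id_map (hdcar V)) y" using y by (simp add: fscale_apply)
  then have "rank1 (hdcar P) \<psi> (c *\<^sub>u y) = fscale c (id_map (hdcar V)) \<circ> rank1 (hdcar P) \<psi> y"
    using rank1_post[OF homD(1)[OF id] y] by (simp only:)
  then have "avg P V (rank1 (hdcar P) \<psi> (c *\<^sub>u y)) = fscale c (id_map (hdcar V)) \<circ> avg P V (rank1 (hdcar P) \<psi> y)"
    using avg_post[OF P V r[OF y] V id] by (simp only:)
  also have "\<dots> = fscale c (avg P V (rank1 (hdcar P) \<psi> y))"
    using hom_val[OF V avg_hom[OF P V r[OF y]]] by (simp add: fun_eq_iff fscale_apply)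
  finally show "avg P V (rank1 (hdcar P) \<psi> (c *\<^sub>u y)) = fscale c (avg P V (rank1 (hdcar P) \<psi> y))" .
qed

definition nm :: "('k, 'k univ \<Rightarrow> 'k univ) rmod \<Rightarrow> 'k univ \<Rightarrow> 'k univ"
  where "nm U u = (if u \<in> rcar U then e (GO U) (\<beta> U u) else 0)"

lemma \<beta>_lin:
  assumes U: "rm U"
  shows "lin_on uscale fscale (rcar U) (\<beta> U)"
proof (rule lin_onI)
  show "\<beta> U (x + y) = \<beta> U x + \<beta> U y" if "x \<in> rcar U" "y \<in> rcar U" for x y
  proof
    show "\<beta> U (x + y) p = (\<beta> U x + \<beta> U y) p" for p
      using lin_onD(1)[OF b_lin(1)[OF U] that] by (cases "p \<in> hdcar P") (simp_all add: \<beta>_def)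
  qed
  show "\<beta> U (c *\<^sub>u x) = fscale c (\<beta> U x)" if "x \<in> rcar U" for c x
  proof
    show "\<beta> U (c *\<^sub>u x) p = fscale c (\<beta> U x) p" for p
    proof (cases "p \<in> hdcar P")
      case True then show ?thesis using lin_onD(2)[OF b_lin(1)[OF U True] that] by (simp only: \<beta>_def fscale_apply if_True)
    next
      case False then show ?thesis by (simp only: \<beta>_def fscale_apply if_False uv.scale_zero_right)
    qed
  qed
qed

lemma \<beta>_act:
  assumes U: "rm U" and u: "u \<in> rcar U" and a: "a \<in> hom P P"
  shows "\<beta> U (ract U u a) = \<beta> U u \<circ> a"
proof
  fix p show "\<beta> U (ract U u a) p = (\<beta> U u \<circ> a) p"
  proof (cases "p \<in> hdcar P")
    case True then show ?thesis using b_lin(3)[OF U u a True] homD(3)[OF a True] by (simp add: \<beta>_def)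
  next
    case False
    have "(\<beta> U u \<circ> a) p = 0" unfolding comp_apply homD(6)[OF a False] by (rule lin_maps_0[OF homD(1)[OF \<beta>_hom[OF U u]]])
    then show ?thesis using False by (simp only: \<beta>_def if_False)
  qed
qed

lemma nm:
  assumes U: "rm U"
  shows "u \<in> rcar U \<Longrightarrow> nm U u = e (GO U) (\<beta> U u)"
    and "nm U \<in> r_hom A U (FO (GO U))"
    and "iso_arr MC.Cat U (FO (GO U)) (marr_of U (FO (GO U)) (nm U))"
proof -
  note us = vs_u and P = hdm_P and G = hdm_GO[OF U] and sU = rm_sub[OF U] and be = \<beta>_hom[OF U]
  note U' = right_moduleD[OF U, unfolded A_sel]
  show ne: "nm U u = e (GO U) (\<beta> U u)" if "u \<in> rcar U" for u using that by (simp add: nm_def)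
  have "ulin (rcar U) (nm U)"
    by (rule lin_on_cong[OF sU us ne lin_comp[OF \<beta>_lin[OF U] e_lin[OF G]]]) (use be in blast)+
  then have nl: "nm U \<in> lin_maps (rcar U) (rcar (FO (GO U)))" using ne e_in[OF be] by (auto simp: lin_maps_def nm_def)
  show nh: "nm U \<in> r_hom A U (FO (GO U))"
    by (rule r_homI[OF nl]) (simp add: ne U'(2) \<beta>_act[OF U] FO_act[OF G be])
  obtain ys where "dual_sys uscale (hdcar P) ys" by (rule dual_system[OF us P_fd])
  note ys = dual_sysD[OF this]
  let ?r = "\<lambda>\<psi> p. avg P P (rank1 (hdcar P) \<psi> p)"
  have r: "?r \<psi> p \<in> hom P P" if "lin uscale (*) \<psi>" "p \<in> hdcar P" for \<psi> p
    by (rule avg_hom[OF P P rank1_lin_maps[OF P_sub P_sub that]])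
  define \<gamma> where "\<gamma> \<psi> = bal_lift U (\<lambda>u p. ract U u (?r \<psi> p))" for \<psi>
  have bal: "balanced U (\<lambda>u p. ract U u (?r \<psi> p))" if \<psi>: "lin uscale (*) \<psi>" for \<psi>
  proof (rule balancedI)
    show "ulin (rcar U) (\<lambda>u. ract U u (?r \<psi> p))" if "p \<in> hdcar P" for p by (rule U'(3)[OF r[OF \<psi> that]])
    fix u assume u: "u \<in> rcar U"
    show "ulin (hdcar P) (\<lambda>p. ract U u (?r \<psi> p))"
      by (rule lin_comp[OF avg_rank1_lin[OF P \<psi>] U'(4)[OF u]]) (use r[OF \<psi>] in blast)
    fix a p assume a: "a \<in> hom P P" and p: "p \<in> hdcar P"
    have "?r \<psi> (a p) = a \<circ> ?r \<psi> p"
      unfolding rank1_post[OF homD(1)[OF a] p] by (rule avg_post[OF P P rank1_lin_maps[OF P_sub P_sub \<psi> p] P a])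
    then show "ract U (ract U u a) (?r \<psi> p) = ract U u (?r \<psi> (a p))" using U'(5)[OF u a r[OF \<psi> p]] by simp
  qed
  have \<gamma>b: "\<gamma> \<psi> (b U u p) = ract U u (?r \<psi> p)" if "lin uscale (*) \<psi>" "u \<in> rcar U" "p \<in> hdcar P" for \<psi> u p
    unfolding \<gamma>_def by (rule bal_lift_b[OF U bal[OF that(1)] that(2,3)])
  have \<gamma>: "\<gamma> \<psi> \<in> lin_maps (hdcar (GO U)) (rcar U)" if "lin uscale (*) \<psi>" for \<psi>
    unfolding \<gamma>_def by (rule bal_lift_lin_maps[OF U bal[OF that] sU]) (use U'(2) r[OF that] in blast)
  have key: "\<beta> U (\<gamma> \<psi> y) = avg P (GO U) (rank1 (hdcar P) \<psi> y)" if \<psi>: "lin uscale (*) \<psi>" and y: "y \<in> hdcar (GO U)" for \<psi> y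
  proof -
    let ?B = "{b U u p |u p. u \<in> rcar U \<and> p \<in> hdcar P}"
    have B: "hdcar (GO U) = uv.span ?B" by (rule GO_span[OF U subspace_span_self[OF sU]])
    show ?thesis
    proof (rule lin_on_eq_on_span[OF us vs_f, where S = ?B and f = "\<lambda>y. \<beta> U (\<gamma> \<psi> y)" and g = "\<lambda>y. avg P (GO U) (rank1 (hdcar P) \<psi> y)"])
      show "lin_on uscale fscale (uv.span ?B) (\<lambda>y. \<beta> U (\<gamma> \<psi> y))" unfolding B[symmetric]
        by (rule lin_comp[OF lin_mapsD(1)[OF \<gamma>[OF \<psi>]] \<beta>_lin[OF U]]) (use lin_mapsD(2)[OF \<gamma>[OF \<psi>]] in blast)
      show "lin_on uscale fscale (uv.span ?B) (\<lambda>y. avg P (GO U) (rank1 (hdcar P) \<psi> y))" unfolding B[symmetric]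
        by (rule avg_rank1_lin[OF G \<psi>])
      show "y \<in> uv.span ?B" using y unfolding B .
      fix y assume "y \<in> ?B"
      then obtain u p where y: "u \<in> rcar U" "p \<in> hdcar P" "y = b U u p" by blast
      then have "y = \<beta> U u p" by (simp add: \<beta>_def)
      then have "rank1 (hdcar P) \<psi> y = \<beta> U u \<circ> rank1 (hdcar P) \<psi> p" using rank1_post[OF homD(1)[OF be[OF y(1)]] y(2)] by simp
      then have "avg P (GO U) (rank1 (hdcar P) \<psi> y) = \<beta> U u \<circ> ?r \<psi> p"
        using avg_post[OF P P rank1_lin_maps[OF P_sub P_sub \<psi> y(2)] G be[OF y(1)]] by simp
      then show "\<beta> U (\<gamma> \<psi> y) = avg P (GO U) (rank1 (hdcar P) \<psi> y)"
        unfolding y(3) \<gamma>b[OF \<psi> y(1,2)] \<beta>_act[OF U y(1) r[OF \<psi> y(2)]] by (rule sym)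
    qed
  qed
  define g where "g F = (\<Sum>(y, \<psi>)\<leftarrow>ys. \<gamma> \<psi> (F y))" for F
  have m: "\<gamma> \<psi> (F y) \<in> rcar U" if "(y, \<psi>) \<in> set ys" "F \<in> hom P (GO U)" for y \<psi> F
    using lin_mapsD(2)[OF \<gamma> homD(3)[OF that(2)]] ys(1)[OF that(1)] by blast
  have gU: "g F \<in> rcar U" if "F \<in> hom P (GO U)" for F
    unfolding g_def by (rule subspace_sum_pairs[OF us sU m[OF _ that]])
  have gl: "lin_on fscale uscale (hom P (GO U)) g"
    unfolding g_def
  proof (rule lin_sum_list[OF us])
    fix q assume q: "q \<in> set ys"
    have q': "fst q \<in> hdcar P" "lin uscale (*) (snd q)" using ys(1)[of "fst q" "snd q"] q by auto
    have "lin_on fscale uscale (hom P (GO U)) (\<lambda>F. \<gamma> (snd q) (F (fst q)))"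
      by (rule lin_comp[OF _ lin_mapsD(1)[OF \<gamma>[OF q'(2)]]]) (use homD(3) q'(1) in \<open>auto simp: lin_on_def fscale_apply\<close>)
    then show "lin_on fscale uscale (hom P (GO U)) (\<lambda>F. case q of (y, \<psi>) \<Rightarrow> \<gamma> \<psi> (F y))" by (simp add: case_prod_unfold)
  qed
  note ni = hom_lift_lin_maps[OF G gl gU]
  have sum: "f = (\<Sum>(y, \<psi>)\<leftarrow>ys. avg P V (rank1 (hdcar P) \<psi> (f y)))" if V: "hdm V" and f: "f \<in> hom P V" for V f
  proof -
    have "f = (\<Sum>(y, \<psi>)\<leftarrow>ys. rank1 (hdcar P) \<psi> (f y))"
      by (rule lin_maps_decomp[OF homD(1)[OF f] P_sub]) (use ys in auto)
    then have "avg P V f = avg P V (\<Sum>(y, \<psi>)\<leftarrow>ys. rank1 (hdcar P) \<psi> (f y))" by (rule arg_cong)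
    also have "\<dots> = (\<Sum>(y, \<psi>)\<leftarrow>ys. avg P V (rank1 (hdcar P) \<psi> (f y)))"
      by (rule avg_sum(1)[OF P V, where f = "\<lambda>y \<psi>. rank1 (hdcar P) \<psi> (f y)"])
        (use rank1_lin_maps[OF P_sub hdm_facts(2)[OF V] _ homD(3)[OF f]] ys(1) in blast)
    finally show ?thesis unfolding avg_id[OF P V homD(1)[OF f] f] .
  qed
  have 1: "hom_lift (GO U) g (nm U u) = u" if u: "u \<in> rcar U" for u
  proof -
    have "hom_lift (GO U) g (nm U u) = (\<Sum>(y, \<psi>)\<leftarrow>ys. \<gamma> \<psi> (\<beta> U u y))"
      unfolding ne[OF u] hom_lift_e[OF G be[OF u]] g_def ..
    also have "\<dots> = (\<Sum>(y, \<psi>)\<leftarrow>ys. ract U u (?r \<psi> y))"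
    proof (rule sum_pairs_cong)
      fix y \<psi> assume "(y, \<psi>) \<in> set ys"
      then have "y \<in> hdcar P" "lin uscale (*) \<psi>" using ys(1) by blast+
      then show "\<gamma> \<psi> (\<beta> U u y) = ract U u (?r \<psi> y)" using \<gamma>b u by (simp add: \<beta>_def)
    qed
    also have "\<dots> = ract U u (\<Sum>(y, \<psi>)\<leftarrow>ys. ?r \<psi> y)"
      by (rule lin_on_sum_pairs[OF vs_f us hom_subspace[OF P P] U'(4)[OF u], where g = "\<lambda>y \<psi>. ?r \<psi> y", symmetric])
        (use r ys(1) in blast)
    also have "(\<Sum>(y, \<psi>)\<leftarrow>ys. ?r \<psi> y) = (\<Sum>(y, \<psi>)\<leftarrow>ys. ?r \<psi> (id_map (hdcar P) y))"
      by (rule sum_pairs_cong) (use ys(1) in force)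
    also have "\<dots> = id_map (hdcar P)" by (rule sum[OF P hom_id[OF P], symmetric])
    finally show ?thesis unfolding U'(6)[OF u] .
  qed
  have 2: "nm U (hom_lift (GO U) g (e (GO U) F)) = e (GO U) F" if F: "F \<in> hom P (GO U)" for F
  proof -
    have "\<beta> U (g F) = (\<Sum>(y, \<psi>)\<leftarrow>ys. \<beta> U (\<gamma> \<psi> (F y)))"
      unfolding g_def by (rule lin_on_sum_pairs[OF us vs_f sU \<beta>_lin[OF U] m[OF _ F]])
    also have "\<dots> = (\<Sum>(y, \<psi>)\<leftarrow>ys. avg P (GO U) (rank1 (hdcar P) \<psi> (F y)))"
    proof (rule sum_pairs_cong)
      fix y \<psi> assume "(y, \<psi>) \<in> set ys"
      then show "\<beta> U (\<gamma> \<psi> (F y)) = avg P (GO U) (rank1 (hdcar P) \<psi> (F y))" by (intro key homD(3)[OF F]) (use ys(1) in blast)+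
    qed
    also have "\<dots> = F" by (rule sum[OF G F, symmetric])
    finally show ?thesis unfolding hom_lift_e[OF G F] ne[OF gU[OF F]] by (rule arg_cong)
  qed
  show "iso_arr MC.Cat U (FO (GO U)) (marr_of U (FO (GO U)) (nm U))"
    by (rule MC.iso_arr_genI[OF _ _ nh ni subspace_span_self[OF sU] subspace_span_self[OF FO_sub[OF G]]])
      (use U rm_FO[OF G] 1 2 in \<open>auto simp: FO_car\<close>)
qed

section \<open>The equivalence\<close>

lemma r_comp: "\<lbrakk>a \<in> r_hom A U U'; a' \<in> r_hom A U' U''; rm U'\<rbrakk> \<Longrightarrow> a' \<circ> a \<in> lin_maps (rcar U) (rcar U'')"
  by (rule lin_maps_comp[OF r_homD(1) r_homD(1) rm_sub])

lemma h_comp: "\<lbrakk>a \<in> hom V V'; a' \<in> hom V' V''; hdm V'\<rbrakk> \<Longrightarrow> a' \<circ> a \<in> lin_maps (hdcar V) (hdcar V'')"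
  by (rule lin_maps_comp[OF homD(1) homD(1) hdm_facts(2)])

lemma map_hom:
  assumes f: "f \<in> lin_maps X X'"
  shows "\<lbrakk>g \<in> hom V V'; fd X; fd X'; hdm V; hdm V'\<rbrakk> \<Longrightarrow> tensor_map X (hdcar V) f g \<in> hom (HX X V) (HX X' V')"
    and "\<lbrakk>k \<in> r_hom A U U'; fd X; fd X'; rm U; rm U'\<rbrakk> \<Longrightarrow> tensor_map X (rcar U) f k \<in> r_hom A (RX X U) (RX X' U')"
  using HC.tensor_map_hm[OF _ _ _ _ f] MC.tensor_map_hm[OF _ _ _ _ f] by simp_all

lemma assoc_hom:
  assumes "fd X" "fd Y"
  shows "hdm V \<Longrightarrow> assoc_map X Y (hdcar V) \<in> hom (HX (tensor_sp X Y) V) (HX X (HX Y V))"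
    and "rm U \<Longrightarrow> assoc_map X Y (rcar U) \<in> r_hom A (RX (tensor_sp X Y) U) (RX X (RX Y U))"
  using HC.assoc_map_hm[OF assms] MC.assoc_map_hm[OF assms] by simp_all

lemma lunit_hom:
  shows "hdm V \<Longrightarrow> lunit_map (hdcar V) \<in> hom (HX unit_sp V) V"
    and "rm U \<Longrightarrow> lunit_map (rcar U) \<in> r_hom A (RX unit_sp U) U"
  using HC.lunit_map_hm MC.lunit_map_hm by simp_all

lemma id_lin: "fd X \<Longrightarrow> id_map X \<in> lin_maps X X"
  by (rule id_map_lin_maps[OF fd_usub])

lemma fobj_F: "fobj (Hom_ftor H D P) = FO"
  by (simp add: Hom_ftor_def)

lemma F_ftor: "is_ftor HC.Cat MC.Cat (Hom_ftor H D P)"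
proof -
  have "Fm V V (id_map (hdcar V)) = id_map (rcar (FO V))" if V: "hdm V" for V
    by (rule lin_maps_eqI[OF r_homD(1)[OF Fm_hom[OF V V hom_id[OF V]]] id_lin[OF right_moduleD(1)[OF rm_FO[OF V]]] subspace_span_self[OF FO_sub[OF V]]])
      (auto simp: FO_car Fm_e[OF V] lin_maps_id(2)[OF homD(1)])
  moreover have "Fm V V'' (g \<circ> f) = Fm V' V'' g \<circ> Fm V V' f"
    if V: "hdm V" "hdm V'" "hdm V''" and f: "f \<in> hom V V'" and g: "g \<in> hom V' V''" for V V' V'' f g
    by (rule lin_maps_eqI[OF r_homD(1)[OF Fm_hom[OF V(1,3) hom_compose[OF V f g]]] r_comp[OF Fm_hom[OF V(1,2) f] Fm_hom[OF V(2,3) g] rm_FO[OF V(2)]]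
          subspace_span_self[OF FO_sub[OF V(1)]]])
      (auto simp: FO_car Fm_e[OF V(1)] Fm_e[OF V(2)] hom_compose[OF hdm_P V(1,2) _ f] comp_assoc)
  ultimately show ?thesis unfolding is_ftor_def fobj_F by (auto simp: homset_vmc farr_F rm_FO Fm_hom)
qed

lemma tm_\<beta>:
  assumes X: "fd X" and U: "rm U" and x: "x \<in> X" "u \<in> rcar U"
  shows "tm X U \<circ> \<beta> (RX X U) (x \<otimes> u) = (\<lambda>p. x \<otimes> \<beta> U u p)"
proof
  fix p show "(tm X U \<circ> \<beta> (RX X U) (x \<otimes> u)) p = x \<otimes> \<beta> U u p"
    using tm(1)[OF X U x] lin_maps_0[OF homD(1)[OF tm(2)[OF X U]]]
    by (cases "p \<in> hdcar P") (simp_all only: \<beta>_def comp_apply if_True if_False simp_thms kron_right(3))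
qed

text \<open>
  The module structure of \<open>Hom(P, _)\<close> is the inverse of \<open>x \<otimes> k \<mapsto> (p \<mapsto> x \<otimes> k p)\<close>.  This map is an isomorphism
  because it is the mate of \<open>t\<close>, that is, the composite
  \<open>X \<otimes> F V \<rightarrow> F G (X \<otimes> F V) \<rightarrow> F (X \<otimes> G F V) \<rightarrow> F (X \<otimes> V)\<close> of the unit, \<open>t\<close> and the counit.
\<close>

definition s_inv :: "'k univ set \<Rightarrow> ('k, 'h) hdmod \<Rightarrow> 'k univ \<Rightarrow> 'k univ"
  where "s_inv X V = Fm (HX X (GO (FO V))) (HX X V) (tensor_map X (hdcar (GO (FO V))) (id_map X) (em V)) \<circ>
    (Fm (GO (RX X (FO V))) (HX X (GO (FO V))) (tm X (FO V)) \<circ> nm (RX X (FO V)))"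

lemma s_inv:
  assumes X: "fd X" and V: "hdm V"
  shows "x \<in> X \<Longrightarrow> k \<in> hom P V \<Longrightarrow> s_inv X V (x \<otimes> e V k) = e (HX X V) (\<lambda>p. x \<otimes> k p)"
    and "iso_arr MC.Cat (RX X (FO V)) (FO (HX X V)) (marr_of (RX X (FO V)) (FO (HX X V)) (s_inv X V))"
proof -
  note F = rm_FO[OF V] and R = rm_RX[OF X rm_FO[OF V]] and G = hdm_GO[OF rm_FO[OF V]] and i = id_lin[OF X]
  note GR = hdm_GO[OF R] and XG = hdm_hd_tensor[OF X G] and t = tm(2)[OF X F] and eh = em(2)[OF V]
  have iX: "marr_of X X (id_map X) = Id Vec X" by simp
  have "iso_arr HC.Cat (HX X (GO (FO V))) (HX X V) (marr_of (HX X (GO (FO V))) (HX X V) (tensor_map X (hdcar (GO (FO V))) (id_map X) (em V)))"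
    using iso_arr_marr[OF HC.module_category_Cat _ em(3)[OF V], of X] X V G by simp
  from iso_arr_ftor[OF F_ftor this]
  have i1: "iso_arr MC.Cat (FO (HX X (GO (FO V)))) (FO (HX X V)) (marr_of (FO (HX X (GO (FO V)))) (FO (HX X V))
      (Fm (HX X (GO (FO V))) (HX X V) (tensor_map X (hdcar (GO (FO V))) (id_map X) (em V))))"
    using XG hdm_hd_tensor[OF X V] by (simp add: farr_F fobj_F)
  from iso_arr_ftor[OF F_ftor tm(3)[OF X F]]
  have i2: "iso_arr MC.Cat (FO (GO (RX X (FO V)))) (FO (HX X (GO (FO V)))) (marr_of (FO (GO (RX X (FO V)))) (FO (HX X (GO (FO V))))
      (Fm (GO (RX X (FO V))) (HX X (GO (FO V))) (tm X (FO V))))"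
    using XG GR by (simp add: farr_F fobj_F)
  show "iso_arr MC.Cat (RX X (FO V)) (FO (HX X V)) (marr_of (RX X (FO V)) (FO (HX X V)) (s_inv X V))"
    using iso_arr_comp[OF MC.category_Cat iso_arr_comp[OF MC.category_Cat nm(3)[OF R] i2] i1] by (simp add: s_inv_def)
  assume x: "x \<in> X" and k: "k \<in> hom P V"
  note xk = RX_in[OF x e_in[OF k]] and \<beta>k = \<beta>_hom[OF F e_in[OF k]]
  have t\<beta>: "tm X (FO V) \<circ> \<beta> (RX X (FO V)) (x \<otimes> e V k) = (\<lambda>p. x \<otimes> \<beta> (FO V) (e V k) p)" by (rule tm_\<beta>[OF X F x e_in[OF k]])
  have "tensor_map X (hdcar (GO (FO V))) (id_map X) (em V) \<circ> (\<lambda>p. x \<otimes> \<beta> (FO V) (e V k) p) = (\<lambda>p. x \<otimes> k p)"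
  proof
    fix p
    have "em V (\<beta> (FO V) (e V k) p) = k p"
      using em(1)[OF V k] homD(6)[OF k] lin_maps_0[OF homD(1)[OF eh]] by (cases "p \<in> hdcar P") (simp_all only: \<beta>_def if_True if_False simp_thms)
    then show "(tensor_map X (hdcar (GO (FO V))) (id_map X) (em V) \<circ> (\<lambda>p. x \<otimes> \<beta> (FO V) (e V k) p)) p = x \<otimes> k p"
      using tensor_map_pure[OF X hdm_facts(1)[OF G] i homD(1)[OF eh] x hom_val[OF G \<beta>k]] x by simp
  qed
  then show "s_inv X V (x \<otimes> e V k) = e (HX X V) (\<lambda>p. x \<otimes> k p)"
    unfolding s_inv_def comp_apply nm(1)[OF R xk] Fm_e[OF GR \<beta>_hom[OF R xk]] t\<beta> Fm_e[OF XG pt_hom[OF X G x \<beta>k]] by (rule arg_cong)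
qed

definition sm :: "'k univ set \<Rightarrow> ('k, 'h) hdmod \<Rightarrow> 'k univ \<Rightarrow> 'k univ"
  where "sm X V = (SOME s. s \<in> r_hom A (FO (HX X V)) (RX X (FO V)) \<and>
    s \<circ> s_inv X V = id_map (rcar (RX X (FO V))) \<and> s_inv X V \<circ> s = id_map (rcar (FO (HX X V))))"

lemma sm:
  assumes X: "fd X" and V: "hdm V"
  shows "iso_arr MC.Cat (FO (HX X V)) (RX X (FO V)) (marr_of (FO (HX X V)) (RX X (FO V)) (sm X V))"
    and "sm X V \<in> r_hom A (FO (HX X V)) (RX X (FO V))"
    and "x \<in> X \<Longrightarrow> k \<in> hom P V \<Longrightarrow> sm X V (e (HX X V) (\<lambda>p. x \<otimes> k p)) = x \<otimes> e V k"
    and "X = uv.span Z \<Longrightarrow> rcar (FO (HX X V)) = uv.span {e (HX X V) (\<lambda>p. x \<otimes> k p) |x k. x \<in> Z \<and> k \<in> hom P V}"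
proof -
  note si = s_inv[OF X V]
  have ex: "\<exists>s. s \<in> r_hom A (FO (HX X V)) (RX X (FO V)) \<and>
    s \<circ> s_inv X V = id_map (rcar (RX X (FO V))) \<and> s_inv X V \<circ> s = id_map (rcar (FO (HX X V)))"
    using si(2) by (clarsimp simp: iso_arr_def homset_vmc) blast
  note s = someI_ex[OF ex, folded sm_def]
  have sh: "s_inv X V \<in> r_hom A (RX X (FO V)) (FO (HX X V))" and ob: "rm (RX X (FO V))" "rm (FO (HX X V))"
    using si(2) by (auto simp: iso_arr_def homset_vmc)
  show s1: "sm X V \<in> r_hom A (FO (HX X V)) (RX X (FO V))" using s by blast
  show "iso_arr MC.Cat (FO (HX X V)) (RX X (FO V)) (marr_of (FO (HX X V)) (RX X (FO V)) (sm X V))"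
    by (rule MC.iso_arrI[OF _ _ s1 r_homD(1)[OF sh]]) (use s ob in auto)
  show "sm X V (e (HX X V) (\<lambda>p. x \<otimes> k p)) = x \<otimes> e V k" if x: "x \<in> X" and k: "k \<in> hom P V" for x k
    using fun_cong[OF conjunct1[OF conjunct2[OF s]], of "x \<otimes> e V k"] RX_in[OF x e_in[OF k]] si(1)[OF x k] by simp
  assume Z: "X = uv.span Z"
  have ZX: "Z \<subseteq> X" unfolding Z by (rule uv.span_superset)
  have "s_inv X V (sm X V y) = y" if "y \<in> rcar (FO (HX X V))" for y
    using fun_cong[OF conjunct2[OF conjunct2[OF s]], of y] that by simp
  then have "s_inv X V ` rcar (RX X (FO V)) = rcar (FO (HX X V))"
    using lin_mapsD(2)[OF r_homD(1)[OF sh]] lin_mapsD(2)[OF r_homD(1)[OF s1]] by (force simp: image_iff)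
  moreover have "rcar (RX X (FO V)) = uv.span {x \<otimes> u |x u. x \<in> Z \<and> u \<in> rcar (FO V)}" by (rule RX_span[OF Z rm_FO[OF V]])
  ultimately have "rcar (FO (HX X V)) = uv.span (s_inv X V ` {x \<otimes> u |x u. x \<in> Z \<and> u \<in> rcar (FO V)})"
    using lin_image_span[OF r_homD(1)[OF sh]] by simp
  also have "s_inv X V ` {x \<otimes> u |x u. x \<in> Z \<and> u \<in> rcar (FO V)} = {e (HX X V) (\<lambda>p. x \<otimes> k p) |x k. x \<in> Z \<and> k \<in> hom P V}"
    using si(1) ZX unfolding FO_car by (force simp: image_iff)
  finally show "rcar (FO (HX X V)) = uv.span {e (HX X V) (\<lambda>p. x \<otimes> k p) |x k. x \<in> Z \<and> k \<in> hom P V}" .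
qed

text \<open>
  Every identity required of an equivalence of module categories is now checked on the generators \<open>x \<otimes> k\<close> of
  \<open>Hom(P, X \<otimes> V)\<close>, the generators \<open>u \<otimes> p\<close> of \<open>U \<otimes>\<^sub>A P\<close>, and pure tensors.
\<close>

lemmas objs = hdm_hd_tensor hdm_GO rm_FO rm_RX fin_dim_tensor_sp fin_dim_unit_sp
lemmas homs = Fm_hom Gm(2) sm(2) tm(2) em(2) nm(2) map_hom assoc_hom lunit_hom id_lin

lemma F_natural:
  assumes X: "fd X" "fd X'" and f: "f \<in> lin_maps X X'" and V: "hdm V" "hdm V'" and g: "g \<in> hom V V'"
  shows "sm X' V' \<circ> Fm (HX X V) (HX X' V') (tensor_map X (hdcar V) f g) =
    tensor_map X (rcar (FO V)) f (Fm V V' g) \<circ> sm X V"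
proof (rule lin_maps_eqI[OF r_comp r_comp sm(4)[OF X(1) V(1) subspace_span_self[OF fd_usub[OF X(1)]]]])
  note G = Fm_hom[OF V g] and T = hdm_hd_tensor[OF X(1) V(1)] hdm_hd_tensor[OF X(2) V(2)]
  note rF = rm_FO[OF V(1)] rm_FO[OF V(2)]
  fix y assume "y \<in> {e (HX X V) (\<lambda>p. x \<otimes> k p) |x k. x \<in> X \<and> k \<in> hom P V}"
  then obtain x k where x: "x \<in> X" and k: "k \<in> hom P V" and y: "y = e (HX X V) (\<lambda>p. x \<otimes> k p)" by blast
  have fx: "f x \<in> X'" by (rule lin_mapsD(2)[OF f x])
  have gk: "g \<circ> k \<in> hom P V'" by (rule hom_compose[OF hdm_P V k g])
  have "tensor_map X (hdcar V) f g \<circ> (\<lambda>p. x \<otimes> k p) = (\<lambda>p. f x \<otimes> (g \<circ> k) p)"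
    using tensor_map_pure[OF X(1) hdm_facts(1)[OF V(1)] f homD(1)[OF g] x hom_val[OF V(1) k]] by (simp add: fun_eq_iff)
  moreover have "tensor_map X (rcar (FO V)) f (Fm V V' g) (x \<otimes> e V k) = f x \<otimes> e V' (g \<circ> k)"
    using tensor_map_pure[OF X(1) right_moduleD(1)[OF rF(1)] f r_homD(1)[OF G] x e_in[OF k]] Fm_e[OF V(1) k] by simp
  ultimately show "(sm X' V' \<circ> Fm (HX X V) (HX X' V') (tensor_map X (hdcar V) f g)) y =
      (tensor_map X (rcar (FO V)) f (Fm V V' g) \<circ> sm X V) y"
    unfolding y comp_apply Fm_e[OF T(1) pt_hom[OF X(1) V(1) x k]] sm(3)[OF X(1) V(1) x k]
    using sm(3)[OF X(2) V(2) fx gk] unfolding comp_def by (simp only:)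
qed (rule objs homs assms)+

lemma F_assoc:
  assumes X: "fd X" and Y: "fd Y" and V: "hdm V"
  shows "tensor_map X (rcar (FO (HX Y V))) (id_map X) (sm Y V) \<circ>
      (sm X (HX Y V) \<circ> Fm (HX (tensor_sp X Y) V) (HX X (HX Y V)) (assoc_map X Y (hdcar V))) =
    assoc_map X Y (rcar (FO V)) \<circ> sm (tensor_sp X Y) V"
proof -
  note XY = fin_dim_tensor_sp[OF X Y] and YV = hdm_hd_tensor[OF Y V] and i = id_lin[OF X]
  note T = hdm_hd_tensor[OF XY V] hdm_hd_tensor[OF X YV] and rF = rm_FO[OF V] rm_FO[OF YV]
  note a = assoc_hom(1)[OF X Y V] and s = sm(2)[OF Y V]
  show ?thesis
  proof (rule lin_maps_eqI[OF lin_maps_comp[OF r_comp r_homD(1) rm_sub] r_comp sm(4)[OF XY V tensor_sp_span]])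
    fix z assume "z \<in> {e (HX (tensor_sp X Y) V) (\<lambda>p. t \<otimes> k p) |t k. t \<in> {x \<otimes> y |x y. x \<in> X \<and> y \<in> Y} \<and> k \<in> hom P V}"
    then obtain x y k where x: "x \<in> X" "y \<in> Y" and k: "k \<in> hom P V" and z: "z = e (HX (tensor_sp X Y) V) (\<lambda>p. (x \<otimes> y) \<otimes> k p)" by blast
    note xy = pure_in[OF x] and yk = pt_hom[OF Y V x(2) k]
    have 1: "assoc_map X Y (hdcar V) \<circ> (\<lambda>p. (x \<otimes> y) \<otimes> k p) = (\<lambda>p. x \<otimes> (y \<otimes> k p))"
      using assoc_map_pure[OF X Y hdm_facts(1)[OF V] x hom_val[OF V k]] by (simp add: fun_eq_iff)
    have 2: "tensor_map X (rcar (FO (HX Y V))) (id_map X) (sm Y V) (x \<otimes> e (HX Y V) (\<lambda>p. y \<otimes> k p)) = x \<otimes> (y \<otimes> e V k)"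
      using tensor_map_pure[OF X right_moduleD(1)[OF rF(2)] i r_homD(1)[OF s] x(1) e_in[OF yk]] sm(3)[OF Y V x(2) k] x(1) by simp
    show "(tensor_map X (rcar (FO (HX Y V))) (id_map X) (sm Y V) \<circ>
        (sm X (HX Y V) \<circ> Fm (HX (tensor_sp X Y) V) (HX X (HX Y V)) (assoc_map X Y (hdcar V)))) z =
      (assoc_map X Y (rcar (FO V)) \<circ> sm (tensor_sp X Y) V) z"
      unfolding z comp_apply Fm_e[OF T(1) pt_hom[OF XY V xy k]] 1 sm(3)[OF X YV x(1) yk] sm(3)[OF XY V xy k] 2
        assoc_map_pure[OF X Y right_moduleD(1)[OF rF(1)] x e_in[OF k]] ..
  qed (rule objs homs assms)+
qed

lemma F_unit:
  assumes V: "hdm V"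
  shows "lunit_map (rcar (FO V)) \<circ> sm unit_sp V = Fm (HX unit_sp V) V (lunit_map (hdcar V))"
proof (rule lin_maps_eqI[OF r_comp r_homD(1) sm(4)[OF fin_dim_unit_sp V subspace_span_self[OF fd_usub[OF fin_dim_unit_sp]]]])
  note I = fin_dim_unit_sp and T = hdm_hd_tensor[OF fin_dim_unit_sp V] and F = rm_FO[OF V]
  fix z assume "z \<in> {e (HX unit_sp V) (\<lambda>p. c \<otimes> k p) |c k. c \<in> unit_sp \<and> k \<in> hom P V}"
  then obtain c k where c: "c \<in> unit_sp" and k: "k \<in> hom P V" and z: "z = e (HX unit_sp V) (\<lambda>p. c \<otimes> k p)" by blast
  have "lunit_map (hdcar V) \<circ> (\<lambda>p. c \<otimes> k p) = fscale (c 0) k"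
    using lunit_map_pure[OF hdm_facts(1)[OF V] c hom_val[OF V k]] unfolding comp_def fscale_def by (simp only:)
  then show "(lunit_map (rcar (FO V)) \<circ> sm unit_sp V) z = Fm (HX unit_sp V) V (lunit_map (hdcar V)) z"
    unfolding z comp_apply Fm_e[OF T pt_hom[OF I V c k]] sm(3)[OF I V c k]
    using lunit_map_pure[OF right_moduleD(1)[OF F] c e_in[OF k]] lin_onD(2)[OF e_lin[OF V] k] by (simp only:)
qed (rule objs homs assms)+

lemma G_natural:
  assumes X: "fd X" "fd X'" and f: "f \<in> lin_maps X X'" and U: "rm U" "rm U'" and g: "g \<in> r_hom A U U'"
  shows "tm X' U' \<circ> Gm (RX X U) (RX X' U') (tensor_map X (rcar U) f g) =
    tensor_map X (hdcar (GO U)) f (Gm U U' g) \<circ> tm X U"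
proof (rule lin_maps_eqI[OF h_comp h_comp GO_RX_span[OF X(1) subspace_span_self[OF fd_usub[OF X(1)]] U(1)]])
  note R = rm_RX[OF X(1) U(1)] rm_RX[OF X(2) U(2)] and m = map_hom(2)[OF f g X U] and G = hdm_GO[OF U(1)] hdm_GO[OF U(2)]
  note gm = Gm(2)[OF U g]
  fix z assume "z \<in> {b (RX X U) (x \<otimes> u) p |x u p. x \<in> X \<and> u \<in> rcar U \<and> p \<in> hdcar P}"
  then obtain x u p where x: "x \<in> X" "u \<in> rcar U" "p \<in> hdcar P" and z: "z = b (RX X U) (x \<otimes> u) p" by blast
  have x': "f x \<in> X'" "g u \<in> rcar U'" using lin_mapsD(2)[OF f x(1)] lin_mapsD(2)[OF r_homD(1)[OF g] x(2)] by auto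
  show "(tm X' U' \<circ> Gm (RX X U) (RX X' U') (tensor_map X (rcar U) f g)) z =
      (tensor_map X (hdcar (GO U)) f (Gm U U' g) \<circ> tm X U) z"
    unfolding z comp_apply Gm(1)[OF R m RX_in[OF x(1,2)] x(3)] tensor_map_pure[OF X(1) right_moduleD(1)[OF U(1)] f r_homD(1)[OF g] x(1,2)]
      tm(1)[OF X(2) U(2) x' x(3)] tm(1)[OF X(1) U(1) x]
      tensor_map_pure[OF X(1) hdm_facts(1)[OF G(1)] f homD(1)[OF gm] x(1) b_in[OF U(1) x(2,3)]] Gm(1)[OF U g x(2,3)] ..
qed (rule objs homs assms)+

lemma G_assoc:
  assumes X: "fd X" and Y: "fd Y" and U: "rm U"
  shows "tensor_map X (hdcar (GO (RX Y U))) (id_map X) (tm Y U) \<circ>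
      (tm X (RX Y U) \<circ> Gm (RX (tensor_sp X Y) U) (RX X (RX Y U)) (assoc_map X Y (rcar U))) =
    assoc_map X Y (hdcar (GO U)) \<circ> tm (tensor_sp X Y) U"
proof -
  note XY = fin_dim_tensor_sp[OF X Y] and YU = rm_RX[OF Y U] and i = id_lin[OF X]
  note R = rm_RX[OF XY U] rm_RX[OF X YU] and G = hdm_GO[OF U] hdm_GO[OF YU] and a = assoc_hom(2)[OF X Y U] and t = tm(2)[OF Y U]
  show ?thesis
  proof (rule lin_maps_eqI[OF lin_maps_comp[OF h_comp homD(1) hdm_facts(2)] h_comp GO_RX_span[OF XY tensor_sp_span U]])
    fix z assume "z \<in> {b (RX (tensor_sp X Y) U) (s \<otimes> u) p |s u p. s \<in> {x \<otimes> y |x y. x \<in> X \<and> y \<in> Y} \<and> u \<in> rcar U \<and> p \<in> hdcar P}"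
    then obtain x y u p where x: "x \<in> X" "y \<in> Y" and u: "u \<in> rcar U" "p \<in> hdcar P" and z: "z = b (RX (tensor_sp X Y) U) ((x \<otimes> y) \<otimes> u) p" by blast
    note xy = pure_in[OF x] and yu = RX_in[OF x(2) u(1)]
    have 2: "tensor_map X (hdcar (GO (RX Y U))) (id_map X) (tm Y U) (x \<otimes> b (RX Y U) (y \<otimes> u) p) = x \<otimes> (y \<otimes> b U u p)"
      using tensor_map_pure[OF X hdm_facts(1)[OF G(2)] i homD(1)[OF t] x(1) b_in[OF YU yu u(2)]] tm(1)[OF Y U x(2) u] x(1) by simp
    show "(tensor_map X (hdcar (GO (RX Y U))) (id_map X) (tm Y U) \<circ>
        (tm X (RX Y U) \<circ> Gm (RX (tensor_sp X Y) U) (RX X (RX Y U)) (assoc_map X Y (rcar U)))) z =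
      (assoc_map X Y (hdcar (GO U)) \<circ> tm (tensor_sp X Y) U) z"
      unfolding z comp_apply Gm(1)[OF R a RX_in[OF xy u(1)] u(2)] assoc_map_pure[OF X Y right_moduleD(1)[OF U] x u(1)]
        tm(1)[OF X YU x(1) yu u(2)] 2 tm(1)[OF XY U xy u] assoc_map_pure[OF X Y hdm_facts(1)[OF G(1)] x b_in[OF U u]] ..
  qed (rule objs homs assms)+
qed

lemma G_unit:
  assumes U: "rm U"
  shows "lunit_map (hdcar (GO U)) \<circ> tm unit_sp U = Gm (RX unit_sp U) U (lunit_map (rcar U))"
proof (rule lin_maps_eqI[OF h_comp homD(1) GO_RX_span[OF fin_dim_unit_sp subspace_span_self[OF fd_usub[OF fin_dim_unit_sp]] U]])
  note I = fin_dim_unit_sp and R = rm_RX[OF fin_dim_unit_sp U] and G = hdm_GO[OF U] and l = lunit_hom(2)[OF U]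
  fix z assume "z \<in> {b (RX unit_sp U) (c \<otimes> u) p |c u p. c \<in> unit_sp \<and> u \<in> rcar U \<and> p \<in> hdcar P}"
  then obtain c u p where c: "c \<in> unit_sp" "u \<in> rcar U" "p \<in> hdcar P" and z: "z = b (RX unit_sp U) (c \<otimes> u) p" by blast
  show "(lunit_map (hdcar (GO U)) \<circ> tm unit_sp U) z = Gm (RX unit_sp U) U (lunit_map (rcar U)) z"
    unfolding z comp_apply tm(1)[OF I U c] Gm(1)[OF R U l RX_in[OF c(1,2)] c(3)]
      lunit_map_pure[OF right_moduleD(1)[OF U] c(1,2)] lunit_map_pure[OF hdm_facts(1)[OF G] c(1) b_in[OF U c(2,3)]]
    by (rule lin_onD(2)[OF b_lin(1)[OF U c(3)] c(2), symmetric])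
qed (rule objs homs assms)+

lemma counit_natural:
  assumes V: "hdm V" "hdm V'" and f: "f \<in> hom V V'"
  shows "em V' \<circ> Gm (FO V) (FO V') (Fm V V' f) = f \<circ> em V"
proof (rule lin_maps_eqI[OF h_comp h_comp GO_span[OF rm_FO[OF V(1)] subspace_span_self[OF FO_sub[OF V(1)]]]])
  note F = rm_FO[OF V(1)] rm_FO[OF V(2)] and m = Fm_hom[OF V f]
  fix z assume "z \<in> {b (FO V) u p |u p. u \<in> rcar (FO V) \<and> p \<in> hdcar P}"
  then obtain k p where k: "k \<in> hom P V" "p \<in> hdcar P" "z = b (FO V) (e V k) p" unfolding FO_car by blast
  show "(em V' \<circ> Gm (FO V) (FO V') (Fm V V' f)) z = (f \<circ> em V) z"
    unfolding k(3) comp_apply Gm(1)[OF F m e_in[OF k(1)] k(2)] Fm_e[OF V(1) k(1)] em(1)[OF V(1) k(1,2)]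
      em(1)[OF V(2) hom_compose[OF hdm_P V k(1) f] k(2)] ..
qed (rule objs homs assms)+

lemma counit_module:
  assumes X: "fd X" and V: "hdm V"
  shows "id_map (hdcar (HX X V)) \<circ> em (HX X V) =
    tensor_map X (hdcar (GO (FO V))) (id_map X) (em V) \<circ> (tm X (FO V) \<circ> Gm (FO (HX X V)) (RX X (FO V)) (sm X V))"
proof -
  note T = hdm_hd_tensor[OF X V] and i = id_lin[OF X] and F = rm_FO[OF V] and sX = subspace_span_self[OF fd_usub[OF X]]
  note FT = rm_FO[OF T] and R = rm_RX[OF X F] and G = hdm_GO[OF F] and s = sm(2)[OF X V]
  show ?thesis unfolding lin_maps_id(2)[OF homD(1)[OF em(2)[OF T]]]
  proof (rule lin_maps_eqI[OF homD(1)[OF em(2)[OF T]] lin_maps_comp[OF h_comp homD(1) hdm_facts(2)] GO_span[OF FT sm(4)[OF X V sX]]])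
    fix z assume "z \<in> {b (FO (HX X V)) u p |u p. u \<in> {e (HX X V) (\<lambda>p. x \<otimes> k p) |x k. x \<in> X \<and> k \<in> hom P V} \<and> p \<in> hdcar P}"
    then obtain x k p where x: "x \<in> X" and k: "k \<in> hom P V" "p \<in> hdcar P" and z: "z = b (FO (HX X V)) (e (HX X V) (\<lambda>p. x \<otimes> k p)) p" by blast
    note pt = pt_hom[OF X V x k(1)]
    have 1: "tensor_map X (hdcar (GO (FO V))) (id_map X) (em V) (x \<otimes> b (FO V) (e V k) p) = x \<otimes> k p"
      using tensor_map_pure[OF X hdm_facts(1)[OF G] i homD(1)[OF em(2)[OF V]] x b_in[OF F e_in[OF k(1)] k(2)]] em(1)[OF V k] x by simp
    show "em (HX X V) z = (tensor_map X (hdcar (GO (FO V))) (id_map X) (em V) \<circ> (tm X (FO V) \<circ> Gm (FO (HX X V)) (RX X (FO V)) (sm X V))) z"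
      unfolding z comp_apply em(1)[OF T pt k(2)] Gm(1)[OF FT R s e_in[OF pt] k(2)] sm(3)[OF X V x k(1)] tm(1)[OF X F x e_in[OF k(1)] k(2)] 1 ..
  qed (rule objs homs assms)+
qed

lemma unit_natural:
  assumes U: "rm U" "rm U'" and f: "f \<in> r_hom A U U'"
  shows "nm U' \<circ> f = Fm (GO U) (GO U') (Gm U U' f) \<circ> nm U"
proof (rule lin_maps_eqI[OF r_comp r_comp subspace_span_self[OF rm_sub[OF U(1)]]])
  note G = hdm_GO[OF U(1)] hdm_GO[OF U(2)] and g = Gm(2)[OF U f]
  fix u assume u: "u \<in> rcar U"
  have fu: "f u \<in> rcar U'" by (rule lin_mapsD(2)[OF r_homD(1)[OF f] u])
  have "Gm U U' f \<circ> \<beta> U u = \<beta> U' (f u)"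
  proof
    fix p show "(Gm U U' f \<circ> \<beta> U u) p = \<beta> U' (f u) p"
      using Gm(1)[OF U f u] lin_maps_0[OF homD(1)[OF g]] by (cases "p \<in> hdcar P") (simp_all add: \<beta>_def)
  qed
  then show "(nm U' \<circ> f) u = (Fm (GO U) (GO U') (Gm U U' f) \<circ> nm U) u"
    unfolding comp_apply nm(1)[OF U(2) fu] nm(1)[OF U(1) u] Fm_e[OF G(1) \<beta>_hom[OF U(1) u]] by (simp only:)
qed (rule objs homs assms)+

lemma unit_module:
  assumes X: "fd X" and U: "rm U"
  shows "(sm X (GO U) \<circ> Fm (GO (RX X U)) (HX X (GO U)) (tm X U)) \<circ> nm (RX X U) =
    tensor_map X (rcar U) (id_map X) (nm U) \<circ> id_map (rcar (RX X U))"
proof -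
  note R = rm_RX[OF X U] and G = hdm_GO[OF U] and i = id_lin[OF X] and sX = subspace_span_self[OF fd_usub[OF X]]
  note GR = hdm_GO[OF R] and F = rm_FO[OF G] and T = hdm_hd_tensor[OF X G] and n = nm(2)[OF U] and t = tm(2)[OF X U]
  note m = map_hom(2)[OF i n X X U F]
  show ?thesis unfolding lin_maps_id(1)[OF r_homD(1)[OF m]]
  proof (rule lin_maps_eqI[OF lin_maps_comp[OF r_homD(1)[OF nm(2)[OF R]] r_comp FO_sub[OF GR]] r_homD(1)[OF m] RX_span[OF sX U]])
    fix z assume "z \<in> {x \<otimes> u |x u. x \<in> X \<and> u \<in> rcar U}"
    then obtain x u where x: "x \<in> X" "u \<in> rcar U" and z: "z = x \<otimes> u" by blast
    note xu = RX_in[OF x]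
    show "((sm X (GO U) \<circ> Fm (GO (RX X U)) (HX X (GO U)) (tm X U)) \<circ> nm (RX X U)) z = tensor_map X (rcar U) (id_map X) (nm U) z"
      unfolding z comp_apply nm(1)[OF R xu] Fm_e[OF GR \<beta>_hom[OF R xu]] tm_\<beta>[OF X U x] sm(3)[OF X G x(1) \<beta>_hom[OF U x(2)]]
        tensor_map_pure[OF X right_moduleD(1)[OF U] i r_homD(1)[OF n] x] id_map_apply[OF x(1)] nm(1)[OF U x(2)] ..
  qed (rule objs homs assms)+
qed

lemma F_module_ftor: "module_ftor Vec HC.Cat MC.Cat (Hom_ftor H D P) (\<lambda>X V. marr_of (FO (HX X V)) (RX X (FO V)) (sm X V))"
  unfolding module_ftor_def fobj_F
  by (auto simp: F_ftor homset_vmc homset_Vec farr_F F_natural F_assoc F_unit hdm_hd_tensor map_hom assoc_hom lunit_hom fin_dim_tensor_sp fin_dim_unit_sp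
      intro: sm(1))

lemma G_module_ftor: "module_ftor Vec MC.Cat HC.Cat (Tensor_ftor H D A P) (\<lambda>X U. marr_of (GO (RX X U)) (HX X (GO U)) (tm X U))"
proof -
  have ob: "fobj (Tensor_ftor H D A P) = GO" by (simp add: Tensor_ftor_def)
  have idr: "id_map (rcar U) \<in> r_hom A U U" if "rm U" for U using MC.hm_id that by simp
  have cr: "g \<circ> f \<in> r_hom A U U''" if "rm U" "rm U'" "rm U''" "f \<in> r_hom A U U'" "g \<in> r_hom A U' U''" for U U' U'' f g
    using MC.hm_comp that by simp
  have Gid: "Gm U U (id_map (rcar U)) = id_map (hdcar (GO U))" if U: "rm U" for U
    by (rule lin_maps_eqI[OF homD(1)[OF Gm(2)[OF U U idr[OF U]]] id_lin[OF GO_fd[OF U]] GO_span[OF U subspace_span_self[OF rm_sub[OF U]]]])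
      (auto simp: Gm(1)[OF U U idr[OF U]] b_in[OF U])
  have Gcomp: "Gm U U'' (g \<circ> f) = Gm U' U'' g \<circ> Gm U U' f"
    if U: "rm U" "rm U'" "rm U''" and f: "f \<in> r_hom A U U'" and g: "g \<in> r_hom A U' U''" for U U' U'' f g
    by (rule lin_maps_eqI[OF homD(1)[OF Gm(2)[OF U(1,3) cr[OF U f g]]] h_comp[OF Gm(2)[OF U(1,2) f] Gm(2)[OF U(2,3) g] hdm_GO[OF U(2)]]
          GO_span[OF U(1) subspace_span_self[OF rm_sub[OF U(1)]]]])
      (auto simp: Gm(1)[OF U(1,3) cr[OF U f g]] Gm(1)[OF U(1,2) f] Gm(1)[OF U(2,3) g] lin_mapsD(2)[OF r_homD(1)[OF f]])
  show ?thesis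
    unfolding module_ftor_def is_ftor_def ob
    by (auto simp: homset_vmc homset_Vec Gm(3) Gid Gcomp idr cr G_natural G_assoc G_unit rm_RX hdm_GO map_hom assoc_hom lunit_hom fin_dim_tensor_sp fin_dim_unit_sp
          Gm(2) intro: tm(3))
qed

theorem hom_tensor_equivalence: "module_category_equivalence Vec (HD_cat H R D) (Mod_cat A) (Hom_ftor H D P) (Tensor_ftor H D A P)"
proof -
  let ?s = "\<lambda>X V. marr_of (FO (HX X V)) (RX X (FO V)) (sm X V)" and ?t = "\<lambda>X U. marr_of (GO (RX X U)) (HX X (GO U)) (tm X U)"
  have ob: "fobj (Hom_ftor H D P) = FO" "fobj (Tensor_ftor H D A P) = GO" by (simp_all add: Hom_ftor_def Tensor_ftor_def)
  have "module_natural_iso Vec HC.Cat HC.Cat (comp_ftor (Tensor_ftor H D A P) (Hom_ftor H D P))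
      (comp_struct HC.Cat (Tensor_ftor H D A P) ?t (Hom_ftor H D P) ?s) id_ftor (id_struct HC.Cat) (\<lambda>V. marr_of (GO (FO V)) V (em V))"
    unfolding module_natural_iso_def natural_iso_def comp_ftor_def id_ftor_def comp_struct_def id_struct_def ftor.simps ob
    by (auto simp: homset_vmc farr_F Gm(3) rm_FO rm_RX hdm_hd_tensor Fm_hom sm(2) counit_natural counit_module intro: em(3))
  moreover have "module_natural_iso Vec MC.Cat MC.Cat id_ftor (id_struct MC.Cat) (comp_ftor (Hom_ftor H D P) (Tensor_ftor H D A P))
      (comp_struct MC.Cat (Hom_ftor H D P) ?s (Tensor_ftor H D A P) ?t) (\<lambda>U. marr_of U (FO (GO U)) (nm U))"
    unfolding module_natural_iso_def natural_iso_def comp_ftor_def id_ftor_def comp_struct_def id_struct_def ftor.simps ob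
    by (auto simp: homset_vmc farr_F Gm(3) rm_FO rm_RX hdm_hd_tensor hdm_GO unit_natural unit_module intro: nm(3))
  ultimately show ?thesis
    unfolding module_category_equivalence_def HD_cat_def Mod_cat_def
    using HC.module_category_Cat MC.module_category_Cat F_module_ftor G_module_ftor by blast
qed

end

theorem proposition5p2:
  fixes H :: "('k::field, 'h::ring_1) hopf"
    and R :: "'k univ"
    and D :: "'h set"
    and W :: "('k, 'w::ab_group_add) comod"
  assumes "fin_dim_hopf_algebra H"
    and "quasitriangular H R"
    and "semisimple_algebra (hopf_alg H)"
    and "cosemisimple H"
    and "minimal_adjoint_stable_subcoalgebra H R D"
    and "fin_dim_left_comodule H R D W"
    and "\<exists>w::'w. w \<noteq> 0"
  shows "semisimple_algebra (End_alg H D (free_hd H D W)) \<and>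
    module_category_equivalence Vec (HD_cat H R D) (Mod_cat (End_alg H D (free_hd H D W)))
      (Hom_ftor H D (free_hd H D W))
      (Tensor_ftor H D (End_alg H D (free_hd H D W)) (free_hd H D W))"
proof -
  interpret qt_hopf H R by unfold_locales (rule assms)+
  obtain Lam where Lam: "\<And>h. h * Lam = hs (\<epsilon> h) Lam" "\<And>h. Lam * h = hs (\<epsilon> h) Lam" "\<epsilon> Lam = 1"
    using integral_exists[OF assms(3)] by blast
  obtain lam where lam: "hlin (*) lam" "lam 1 = 1" "\<And>h. cop h (\<lambda>x y. hs (lam y) x) = hs (lam h) 1"
    "\<And>h. cop h (\<lambda>x y. hs (lam x) y) = hs (lam h) 1"
    using cointegral_exists[OF assms(4)] by blast
  interpret hd_free H R lam Lam D W
    by unfold_locales (fact assms lam Lam)+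
  show ?thesis using A_semisimple hom_tensor_equivalence by blast
qed

end
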